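(* Let $W$ satisfy Assumption (A1) with $0<\|W\|_\infty<2b$ small enough, and suppose $W=e^{i\alpha}V$ with $V:\mathbb{R}^3\to\mathbb{R}$, $V\ge0$, and $\alpha\in\pm(0,\frac\pi2)$. For $\varepsilon>0$ let $H_\varepsilon:=H_0+\varepsilon W$. Then there exists $\varepsilon_0>0$ such that for any $0<\varepsilon\le\varepsilon_0$ there is no accumulation of discrete eigenvalues of $H_\varepsilon$ near $2bq$, for $q\in\mathbb{N}$ (that is, $2bq$ is not an accumulation point of $\sigma_{\rm disc}(H_\varepsilon)$).
   Context: Fix $b>0$ and $\mathbf{A}(x)=(-\tfrac{b x_2}{2},\tfrac{b x_1}{2},0)$ for $x=(x_1,x_2,x_3)\in\mathbb{R}^3$; write $X_\perp=(x_1,x_2)$. $H_0:=(-i\nabla-\mathbf{A})^2-b$ is the self-adjoint magnetic Schrödinger operator in $L^2(\mathbb{R}^3)$ (defined by closing its quadratic form on $C_0^\infty(\mathbb{R}^3)$). $\mathbb{N}=\{0,1,2,\dots\}$. Assumption (A1): $W\in L^\infty(\mathbb{R}^3,\mathbb{C})$, $W(x)=\mathcal{O}(F(X_\perp)G(x_3))$ for $x=(X_\perp,x_3)\in\mathbb{R}^3$, where $F\in(L^{p/2}\cap L^\infty)(\mathbb{R}^2)$ takes values in $(0,\infty)$ for some $p\ge2$, and $G:\mathbb{R}\to(0,\infty)$ satisfies $G(x_3)=\mathcal{O}(\langle x_3\rangle^{-m})$ with $m>3$, $\langle y\rangle:=\sqrt{1+|y|^2}$. $H_\varepsilon$ is defined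 on $\mathrm{Dom}(H_0)$, $W$ acting by multiplication. $\sigma_{\rm disc}(M)$ is the set of discrete eigenvalues of $M$: isolated points of $\sigma(M)$ of finite algebraic multiplicity (rank of the Riesz projection). *)

theory Defs
  imports "HOL-Probability.Probability" "HOL-Complex_Analysis.Complex_Analysis"
begin

section \<open>The Hilbert space\<close>

text \<open>
  Elements of the space of square integrable functions are represented by Borel measurable
  functions, identified when they agree almost everywhere.
\<close>

type_synonym wavefn = "real^3 \<Rightarrow> complex"

definition L2 :: "wavefn set" where
  "L2 = {f \<in> borel_measurable lborel. integrable lborel (\<lambda>x. (cmod (f x))\<^sup>2)}"

definition l2_inner :: "wavefn \<Rightarrow> wavefn \<Rightarrow> complex" where
  "l2_inner f g = (LINT x|lborel. f x * cnj (g x))"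

definition l2_norm :: "wavefn \<Rightarrow> real" where
  "l2_norm f = sqrt (LINT x|lborel. (cmod (f x))\<^sup>2)"


section \<open>Unbounded operators and discrete spectrum\<close>

text \<open>
  An operator is given by its graph, a set of pairs \<open>(u, f)\<close> meaning that \<open>u\<close> is in the domain
  and is mapped to \<open>f\<close>.  All graphs used below are closed under almost everywhere equality in
  both components.
\<close>

type_synonym operator = "(wavefn \<times> wavefn) set"

text \<open>The operator minus \<open>z\<close> is a bijection from its domain onto the space (surjectivity is the
  first conjunct, injectivity follows from the bound), with bounded inverse.\<close>

definition resolvent_set :: "operator \<Rightarrow> complex set" where
  "resolvent_set M = {z.
     (\<forall>f\<in>L2. \<exists>u. (u, \<lambda>x. f x + z * u x) \<in> M) \<and>
     (\<exists>C. \<forall>(u, g)\<in>M. l2_norm u \<le> C * l2_norm (\<lambda>x. g x - z * u x))}"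

definition spectrum :: "operator \<Rightarrow> complex set" where
  "spectrum M = - resolvent_set M"

text \<open>A representative of the preimage of \<open>f\<close> under the operator minus \<open>z\<close>; for \<open>z\<close> in the
  resolvent set it is unique up to almost everywhere equality.\<close>

definition resolvent :: "operator \<Rightarrow> complex \<Rightarrow> wavefn \<Rightarrow> wavefn" where
  "resolvent M z f = (SOME u. (u, \<lambda>x. f x + z * u x) \<in> M)"

text \<open>\<open>h\<close> is the image of \<open>f\<close> under the Riesz projection, i.e. \<open>-1/(2\<pi>i)\<close> times the integral of
  \<open>resolvent M z f\<close> over the circle with centre \<open>\<mu>\<close> and radius \<open>r\<close>.  The vector-valued integral
  is understood weakly.\<close>

definition riesz_image :: "operator \<Rightarrow> complex \<Rightarrow> real \<Rightarrow> wavefn \<Rightarrow> wavefn \<Rightarrow> bool" where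
  "riesz_image M \<mu> r f h \<longleftrightarrow> h \<in> L2 \<and>
     (\<forall>g\<in>L2. l2_inner h g =
        - (1 / (2 * of_real pi * \<i>)) *
          contour_integral (circlepath \<mu> r) (\<lambda>z. l2_inner (resolvent M z f) g))"

definition riesz_finite_rank :: "operator \<Rightarrow> complex \<Rightarrow> real \<Rightarrow> bool" where
  "riesz_finite_rank M \<mu> r \<longleftrightarrow>
     (\<exists>B. finite B \<and> B \<subseteq> L2 \<and>
       (\<forall>f\<in>L2. \<exists>c. riesz_image M \<mu> r f (\<lambda>x. \<Sum>e\<in>B. c e * e x)))"

text \<open>The Riesz projection does not depend on the radius of a circle that isolates \<open>\<mu>\<close> from the
  rest of the spectrum.\<close>

definition discrete_spectrum :: "operator \<Rightarrow> complex set" where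
  "discrete_spectrum M =
     {\<mu>. \<exists>r>0. spectrum M \<inter> cball \<mu> r = {\<mu>} \<and> riesz_finite_rank M \<mu> r}"


section \<open>The magnetic operator\<close>

definition partial :: "3 \<Rightarrow> wavefn \<Rightarrow> wavefn" where
  "partial j u = (\<lambda>x. frechet_derivative u (at x) (axis j 1))"

definition smooth :: "wavefn \<Rightarrow> bool" where
  "smooth u \<longleftrightarrow> (\<forall>js x. foldr partial js u differentiable (at x))"

definition test_functions :: "wavefn set" where
  "test_functions = {u. smooth u \<and> compact (closure {x. u x \<noteq> 0})}"

definition vector_potential :: "real \<Rightarrow> real^3 \<Rightarrow> real^3" where
  "vector_potential b x = vector [- (b * x$2) / 2, b * x$1 / 2, 0]"

text \<open>The components of \<open>-i\<nabla> - A\<close>.\<close>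

definition magnetic_derivative :: "real \<Rightarrow> 3 \<Rightarrow> wavefn \<Rightarrow> wavefn" where
  "magnetic_derivative b j u =
     (\<lambda>x. - \<i> * partial j u x - of_real (vector_potential b x $ j) * u x)"

definition magnetic_form :: "real \<Rightarrow> wavefn \<Rightarrow> wavefn \<Rightarrow> complex" where
  "magnetic_form b u v =
     (\<Sum>j\<in>UNIV. l2_inner (magnetic_derivative b j u) (magnetic_derivative b j v))
       - of_real b * l2_inner u v"

text \<open>Convergence with respect to the form: \<open>s\<close> converges to \<open>u\<close> in the Hilbert space and is a
  Cauchy sequence for the quadratic form.\<close>

definition form_converges :: "real \<Rightarrow> (nat \<Rightarrow> wavefn) \<Rightarrow> wavefn \<Rightarrow> bool" where
  "form_converges b s u \<longleftrightarrow>
     (\<forall>n. s n \<in> test_functions) \<and> u \<in> L2 \<and>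
     (\<lambda>n. l2_norm (\<lambda>x. s n x - u x)) \<longlonglongrightarrow> 0 \<and>
     (\<forall>e>0. \<exists>N. \<forall>m\<ge>N. \<forall>n\<ge>N.
        cmod (magnetic_form b (\<lambda>x. s m x - s n x) (\<lambda>x. s m x - s n x)) < e)"

definition closed_form_domain :: "real \<Rightarrow> wavefn set" where
  "closed_form_domain b = {u. \<exists>s. form_converges b s u}"

definition closed_magnetic_form :: "real \<Rightarrow> wavefn \<Rightarrow> wavefn \<Rightarrow> complex" where
  "closed_magnetic_form b u v =
     (THE l. \<forall>s t. form_converges b s u \<longrightarrow> form_converges b t v \<longrightarrow>
        (\<lambda>n. magnetic_form b (s n) (t n)) \<longlonglongrightarrow> l)"

text \<open>The operator associated with the closed form by the representation theorem.\<close>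

definition H0 :: "real \<Rightarrow> operator" where
  "H0 b = {(u, f). u \<in> closed_form_domain b \<and> f \<in> L2 \<and>
     (\<forall>v\<in>closed_form_domain b. closed_magnetic_form b u v = l2_inner f v)}"

definition H_eps :: "real \<Rightarrow> wavefn \<Rightarrow> real \<Rightarrow> operator" where
  "H_eps b W \<epsilon> = {(u, \<lambda>x. f x + of_real \<epsilon> * W x * u x) | u f. (u, f) \<in> H0 b}"


section \<open>The potential\<close>

definition Linf_norm :: "('a::euclidean_space \<Rightarrow> 'b::real_normed_vector) \<Rightarrow> ereal" where
  "Linf_norm f = esssup lborel (\<lambda>x. ereal (norm (f x)))"

definition Linf :: "('a::euclidean_space \<Rightarrow> 'b::real_normed_vector) set" where
  "Linf = {f \<in> borel_measurable lborel. Linf_norm f < \<infinity>}"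

definition perp :: "real^3 \<Rightarrow> real^2" where
  "perp x = vector [x$1, x$2]"

definition japanese_bracket :: "real \<Rightarrow> real" where
  "japanese_bracket y = sqrt (1 + \<bar>y\<bar>\<^sup>2)"

text \<open>Both \<open>O\<close>-conditions are global bounds; the one on the class \<open>W\<close> is meant almost
  everywhere.\<close>

definition assumption_A1 :: "wavefn \<Rightarrow> bool" where
  "assumption_A1 W \<longleftrightarrow> W \<in> Linf \<and>
     (\<exists>(F :: real^2 \<Rightarrow> real) (G :: real \<Rightarrow> real) p m.
        p \<ge> 2 \<and> F \<in> Linf \<and> integrable lborel (\<lambda>y. \<bar>F y\<bar> powr (p / 2)) \<and> (\<forall>y. F y > 0) \<and>
        m > 3 \<and> (\<forall>t. G t > 0) \<and> (\<exists>C. \<forall>t. G t \<le> C * japanese_bracket t powr (- m)) \<and>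
        (\<exists>C. AE x in lborel. cmod (W x) \<le> C * (F (perp x) * G (x$3))))"

end

theory Submission
  imports Defs "HOL-Computational_Algebra.Polynomial" "HOL-Real_Asymp.Real_Asymp"
begin

text \<open>With \<open>a = (- \<i> \<partial>\<^sub>1 - A\<^sub>1) + \<i> (- \<i> \<partial>\<^sub>2 - A\<^sub>2)\<close> the magnetic operator is \<open>a\<^sup>* a - \<partial>\<^sub>3\<^sup>2\<close>, and on a piece of
  the space where \<open>a\<^sup>* a\<close> is close to \<open>\<tau>\<close> its resolvent at \<open>z\<close> is convolution in \<open>x\<^sub>3\<close> with
  \<open>\<i> / (2 * k) * exp (\<i> * k * \<bar>t\<bar>)\<close>, where \<open>k\<^sup>2 = z - \<tau>\<close> and \<open>Im k > 0\<close>.  The singular part \<open>\<i> / (2 * k)\<close>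
  of this kernel has nonnegative real part, and the remainder is at most \<open>\<bar>t\<bar> / 2\<close>, which the decay of the
  potential makes integrable because of \<open>m > 3\<close>.  Hence the real part of the weighted free resolvent is
  bounded from below uniformly in \<open>z\<close> and \<open>\<tau>\<close>.  As the phase of the potential has positive real part \<open>cos \<alpha>\<close>,
  this gives for small \<open>\<epsilon>\<close> an a priori bound for the inverse of the perturbed operator minus \<open>z\<close> that is locally
  uniform in \<open>z\<close> outside \<open>[0, \<infinity>)\<close>; such a bound excludes isolated points of the spectrum there.
  The points of \<open>[0, \<infinity>)\<close> all belong to the spectrum, by approximate eigenfunctions in the lowest Landau
  level that are moved to infinity along \<open>x\<^sub>3\<close>, and are therefore not isolated either.  So the discrete
  spectrum is empty for small \<open>\<epsilon>\<close>.

  The decomposition with respect to \<open>a\<^sup>* a\<close> is made by Bernstein polynomials in the bounded operator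
  \<open>B = (1 + a\<^sup>* a)\<^sup>-\<^sup>1\<close>.\<close>

section \<open>Closed subspaces of real Hilbert spaces\<close>

text \<open>The kernel of the resolvent along \<open>x_3\<close> depends through \<open>k\<close> on
  the value of \<open>a* a\<close>, so the estimate has to be made on pieces where this value is
  nearly constant. The substitute for a spectral measure is as follows: Bernstein polynomials form a
  partition of unity, they are positive on [0, 1] where the spectrum of \<open>B\<close> lies, each
  has an explicit square root (\<open>slice\<close>), and their variance identity says that
  \<open>B\<close> acts on slice \<open>k\<close> as \<open>k / n\<close> up to an error whose
  squares sum to at most \<open>1 / n\<close>. Slices with \<open>k / n\<close> near 0, where
  \<open>a* a\<close> is large, are harmless for vectors in the domain of \<open>a\<close>. The
  threshold for \<epsilon> must not depend on the distance of \<open>z\<close> to the real axis. The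
  source is therefore split into a weighted part, estimated with a constant independent of
  \<open>z\<close>, and a residual, for which a crude bound with \<open>1 / |Im z|\<close> is
  enough. The free resolvent along \<open>x_3\<close> is an integral over the translation group.
  Every invariance that it needs then reduces to invariance under translations and complex
  multiples.\<close>

lemma closed_subspace_projection:
  fixes S :: "'a::{real_inner, complete_space} set"
  assumes S: "subspace S" "closed S"
  shows "\<exists>p\<in>S. \<forall>w\<in>S. inner (x - p) w = 0"
proof -
  have ne: "S \<noteq> {}" using subspace_0[OF S(1)] by auto
  define d where "d = infdist x S"
  have d0: "d \<ge> 0" unfolding d_def by (rule infdist_nonneg)
  have d_le: "d \<le> norm (x - w)" if "w \<in> S" for w
    unfolding d_def using infdist_le[OF that, of x] by (simp add: dist_norm)
  have "\<exists>w\<in>S. norm (x - w) < d + 1 / Suc n" for n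
  proof -
    have "(INF a\<in>S. dist x a) < d + 1 / Suc n"
      using ne by (simp add: d_def infdist_def)
    moreover have "bdd_below (dist x ` S)" by (rule bdd_belowI2[where m=0]) simp
    ultimately show ?thesis using cINF_less_iff[of S "dist x" "d + 1 / Suc n"] ne
      by (auto simp: dist_norm)
  qed
  then obtain s where s: "\<And>n. s n \<in> S" "\<And>n. norm (x - s n) < d + 1 / Suc n" by metis
  \<comment> \<open>Parallelogram law: the midpoint of \<open>s m\<close> and \<open>s n\<close>
    lies in \<open>S\<close>, so its distance to \<open>x\<close> is at least \<open>d\<close>. This
    makes the minimizing sequence Cauchy.\<close>
  have par: "(norm (s m - s n))\<^sup>2 \<le> 2 * (norm (x - s m))\<^sup>2 + 2 * (norm (x - s n))\<^sup>2 - 4 * d\<^sup>2" for m n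
  proof -
    have mid: "(1/2) *\<^sub>R (s m + s n) \<in> S"
      using s S(1) by (simp add: subspace_add subspace_mul)
    have "d\<^sup>2 \<le> (norm (x - (1/2) *\<^sub>R (s m + s n)))\<^sup>2"
      using d_le[OF mid] d0 by (intro power_mono) auto
    moreover have "(norm (s m - s n))\<^sup>2 + 4 * (norm (x - (1/2) *\<^sub>R (s m + s n)))\<^sup>2
        = 2 * (norm (x - s m))\<^sup>2 + 2 * (norm (x - s n))\<^sup>2"
      by (simp add: power2_norm_eq_inner inner_diff_left inner_diff_right inner_add_left
        inner_add_right inner_commute algebra_simps)
    ultimately show ?thesis by simp
  qed
  have lim: "(\<lambda>n. norm (x - s n)) \<longlonglongrightarrow> d"
  proof (rule tendsto_sandwich[of "\<lambda>_. d" _ _ "\<lambda>n. d + 1 / Suc n"])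
    have "(\<lambda>n. d + inverse (real (Suc n))) \<longlonglongrightarrow> d + 0"
      by (intro tendsto_add tendsto_const LIMSEQ_inverse_real_of_nat)
    then show "(\<lambda>n. d + 1 / real (Suc n)) \<longlonglongrightarrow> d" by (simp add: inverse_eq_divide)
  qed (auto intro!: eventuallyI d_le s(1) less_imp_le[OF s(2)] simp del: of_nat_Suc)
  have "Cauchy s"
  proof (rule CauchyI)
    fix e :: real assume e: "e > 0"
    have "(\<lambda>n. (norm (x - s n))\<^sup>2) \<longlonglongrightarrow> d\<^sup>2" by (intro tendsto_power lim)
    then have "\<forall>\<^sub>F n in sequentially. dist ((norm (x - s n))\<^sup>2) (d\<^sup>2) < e\<^sup>2 / 4"
      using e by (intro tendstoD) auto
    then obtain N where N: "\<And>n. n \<ge> N \<Longrightarrow> dist ((norm (x - s n))\<^sup>2) (d\<^sup>2) < e\<^sup>2 / 4"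
      by (auto simp: eventually_sequentially)
    have "norm (s m - s n) < e" if mn: "m \<ge> N" "n \<ge> N" for m n
    proof -
      have "(norm (s m - s n))\<^sup>2 < e\<^sup>2"
        using par[of m n] N[OF mn(1)] N[OF mn(2)] by (simp add: dist_real_def abs_if split: if_splits)
      then show ?thesis using e by (simp add: power_less_imp_less_base)
    qed
    then show "\<exists>M. \<forall>m\<ge>M. \<forall>n\<ge>M. norm (s m - s n) < e" by blast
  qed
  then obtain p where p: "s \<longlonglongrightarrow> p" by (meson Cauchy_convergent_iff convergent_def)
  have pS: "p \<in> S" using S(2) s(1) p by (rule closed_sequentially)
  have "norm (x - p) = d"
    using lim tendsto_norm[OF tendsto_diff[OF tendsto_const[of x] p]] LIMSEQ_unique by blast
  have "inner (x - p) w = 0" if w: "w \<in> S" for w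
  proof (rule ccontr)
    assume nz: "inner (x - p) w \<noteq> 0"
    then have "w \<noteq> 0" by auto
    \<comment> \<open>This \<open>t\<close> minimizes the distance from \<open>x\<close> to the line
      \<open>p + t w\<close>; the gain over \<open>p\<close> is the squared inner product divided by
      \<open>inner w w\<close>.\<close>
    define t where "t = inner (x - p) w / inner w w"
    have "p + t *\<^sub>R w \<in> S" using S(1) pS w by (simp add: subspace_add subspace_mul)
    then have "(norm (x - p))\<^sup>2 \<le> (norm (x - (p + t *\<^sub>R w)))\<^sup>2"
      using d_le \<open>norm (x - p) = d\<close> d0 by (intro power_mono) auto
    also have "\<dots> = (norm (x - p))\<^sup>2 - 2 * t * inner (x - p) w + t * t * inner w w"
      by (simp add: power2_norm_eq_inner inner_diff_left inner_diff_right inner_add_left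
        inner_add_right inner_commute algebra_simps)
    also have "\<dots> = (norm (x - p))\<^sup>2 - (inner (x - p) w)\<^sup>2 / inner w w"
      using \<open>w \<noteq> 0\<close> by (simp add: t_def power2_eq_square field_simps)
    finally have "(inner (x - p) w)\<^sup>2 / inner w w \<le> 0" by simp
    moreover have "(inner (x - p) w)\<^sup>2 / inner w w > 0" using nz \<open>w \<noteq> 0\<close> by simp
    ultimately show False by simp
  qed
  then show ?thesis using pS by blast
qed

text \<open>The remainder of the projection of \<open>x\<close> is orthogonal to \<open>S\<close>,
  hence to \<open>x\<close>. Later this recognizes integrals as members of a closed graph: pairing
  with an orthogonal vector leaves a scalar integral that vanishes.\<close>

lemma closed_subspace_double_complement:
  fixes S :: "'a::{real_inner, complete_space} set"
  assumes S: "subspace S" "closed S" and x: "\<And>y. (\<And>w. w \<in> S \<Longrightarrow> inner y w = 0) \<Longrightarrow> inner y x = 0"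
  shows "x \<in> S"
proof -
  obtain p where p: "p \<in> S" "\<And>w. w \<in> S \<Longrightarrow> inner (x - p) w = 0"
    using closed_subspace_projection[OF S, of x] by blast
  have "inner (x - p) x = 0" using x p(2) by blast
  then have "inner (x - p) (x - p) = 0" using p by (simp add: inner_diff_right)
  then show ?thesis using p(1) by simp
qed

section \<open>The resolvent of a closed graph\<close>

text \<open>If \<open>G\<close> is the graph of a closed operator \<open>a\<close>, then \<open>B = (1 + a\<^sup>* a)\<^sup>-\<^sup>1\<close> and \<open>K = a B\<close>: the
  pair \<open>(B x, K x)\<close> is the projection of \<open>(x, 0)\<close> to \<open>G\<close>.\<close>

locale closed_graph =
  fixes G :: "('a::{real_inner, complete_space} \<times> 'b::{real_inner, complete_space}) set"
  assumes subspace_G: "subspace G" and closed_G: "closed G"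
begin

definition proj :: "'a \<Rightarrow> 'a \<times> 'b" where
  "proj x = (SOME p. p \<in> G \<and> (\<forall>w\<in>G. inner ((x, 0) - p) w = 0))"

definition B :: "'a \<Rightarrow> 'a" where "B x = fst (proj x)"
definition K :: "'a \<Rightarrow> 'b" where "K x = snd (proj x)"

lemma proj: "proj x \<in> G" "w \<in> G \<Longrightarrow> inner ((x, 0) - proj x) w = 0"
proof -
  have "\<exists>p. p \<in> G \<and> (\<forall>w\<in>G. inner ((x, 0) - p) w = 0)"
    using closed_subspace_projection[OF subspace_G closed_G] by blast
  from someI_ex[OF this, folded proj_def]
  show "proj x \<in> G" "w \<in> G \<Longrightarrow> inner ((x, 0) - proj x) w = 0" by blast+
qed

lemma BK_in: "(B x, K x) \<in> G"
  using proj(1) by (simp add: B_def K_def)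

text \<open>Weak form of \<open>(1 + a* a) (B x) = x\<close> with \<open>K x = a (B x)\<close>: the
  remainder of the projection of \<open>(x, 0)\<close> is orthogonal to the graph.\<close>

lemma BK_eq: "(w, w') \<in> G \<Longrightarrow> inner (K x) w' + inner (B x) w = inner x w"
  using proj(2)[of "(w, w')" x] by (simp add: B_def K_def inner_prod_def inner_diff_left)

text \<open>The difference of two solutions of the weak equation lies in the graph and can be tested
  against itself. Linearity and commutation of \<open>B\<close> and \<open>K\<close> are obtained by
  exhibiting a candidate here.\<close>

lemma BK_unique:
  assumes "(u, k) \<in> G" "\<And>w w'. (w, w') \<in> G \<Longrightarrow> inner k w' + inner u w = inner x w"
  shows "B x = u" "K x = k"
proof -
  have d: "(B x - u, K x - k) \<in> G"
    using subspace_diff[OF subspace_G BK_in assms(1)] by simp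
  have "inner (K x - k) (K x - k) + inner (B x - u) (B x - u) = 0"
    using BK_eq[OF d, of x] assms(2)[OF d] by (simp add: inner_diff_left)
  then have "inner (K x - k) (K x - k) = 0 \<and> inner (B x - u) (B x - u) = 0"
    using inner_ge_zero[of "K x - k"] inner_ge_zero[of "B x - u"] by linarith
  then show "B x = u" "K x = k" by simp_all
qed

lemma linear_B: "linear B" and linear_K: "linear K"
proof -
  have "inner (K x + K y) w' + inner (B x + B y) w = inner (x + y) w" if "(w, w') \<in> G" for x y w w'
    using BK_eq[OF that, of x] BK_eq[OF that, of y] by (simp add: inner_add_left)
  then have "B (x + y) = B x + B y \<and> K (x + y) = K x + K y" for x y
    using subspace_add[OF subspace_G BK_in[of x] BK_in[of y]]
      BK_unique[of "B x + B y" "K x + K y" "x + y"] by simp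
  moreover have "inner (c *\<^sub>R K x) w' + inner (c *\<^sub>R B x) w = inner (c *\<^sub>R x) w" if "(w, w') \<in> G" for c x w w'
    using BK_eq[OF that, of x] by (simp flip: distrib_left)
  then have "B (c *\<^sub>R x) = c *\<^sub>R B x \<and> K (c *\<^sub>R x) = c *\<^sub>R K x" for c x
    using subspace_scale[OF subspace_G BK_in[of x], of c]
      BK_unique[of "c *\<^sub>R B x" "c *\<^sub>R K x" "c *\<^sub>R x"] by simp
  ultimately show "linear B" "linear K" by (auto intro!: linearI)
qed

text \<open>Testing the weak equation of \<open>x\<close> with the pair of \<open>y\<close> gives
  \<open>K* K = B - B^2\<close>. Hence \<open>B\<close> is symmetric with \<open>B^2 <= B\<close>,
  and \<open>K\<close> can serve as a square root of \<open>B (1 - B)\<close> in the odd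
  slices.\<close>

lemma inner_K: "inner (K x) (K y) = inner x (B y) - inner (B x) (B y)"
  using BK_eq[OF BK_in[of y], of x] by simp

lemma B_sym: "inner (B x) y = inner x (B y)"
  using inner_K[of x y] inner_K[of y x] by (simp add: inner_commute)

lemma norm_B: "norm (B x) \<le> norm x"
proof -
  have "norm (B x) * norm (B x) \<le> inner x (B x)"
    using inner_K[of x x] inner_ge_zero[of "K x"] by (simp add: norm_eq_sqrt_inner)
  also have "\<dots> \<le> norm x * norm (B x)" by (rule norm_cauchy_schwarz)
  finally show ?thesis by (cases "B x = 0") auto
qed

text \<open>Unlike \<open>norm_K\<close>, this makes \<open>K x\<close> small when
  \<open>B x\<close> is small; it is what controls large values of \<open>a* a\<close>.\<close>

lemma norm_K_squared: "(norm (K x))\<^sup>2 \<le> norm x * norm (B x)"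
proof -
  have "(norm (K x))\<^sup>2 \<le> inner x (B x)"
    using inner_K[of x x] inner_ge_zero[of "B x"] by (simp add: power2_norm_eq_inner)
  also have "\<dots> \<le> norm x * norm (B x)" by (rule norm_cauchy_schwarz)
  finally show ?thesis .
qed

lemma norm_K: "norm (K x) \<le> norm x"
proof -
  have "(norm (K x))\<^sup>2 \<le> (norm x)\<^sup>2"
    using norm_K_squared[of x] mult_left_mono[OF norm_B[of x], of "norm x"]
    by (simp add: power2_eq_square)
  then show ?thesis by (rule power2_le_imp_le) simp
qed

lemma bounded_linear_B: "bounded_linear B"
  using linear_B norm_B by (auto intro!: bounded_linear_intro[where K=1] simp: linear_add linear_scale)

lemma bounded_linear_K: "bounded_linear K"
  using linear_K norm_K by (auto intro!: bounded_linear_intro[where K=1] simp: linear_add linear_scale)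

text \<open>\<open>(T (B x), U (K x))\<close> lies in the graph and solves the weak equation for
  \<open>T x\<close>: move \<open>T\<close> and \<open>U\<close> to their adjoints, which map the
  graph into itself as well.\<close>

lemma BK_commute:
  assumes "\<And>w w'. (w, w') \<in> G \<Longrightarrow> (T w, U w') \<in> G"
    and "\<And>w w'. (w, w') \<in> G \<Longrightarrow> (T' w, U' w') \<in> G"
    and "\<And>x y. inner (T x) y = inner x (T' y)" "\<And>x y. inner (U x) y = inner x (U' y)"
  shows "B (T x) = T (B x)" "K (T x) = U (K x)"
  using BK_unique[of "T (B x)" "U (K x)" "T x"] assms BK_in BK_eq by auto

section \<open>Polynomials in B and Bernstein polynomials\<close>

text \<open>Horner's scheme: \<open>pCons a p\<close> becomes \<open>a + B p(B)\<close>, so that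
  identities follow by induction over the polynomial.\<close>

definition polyB :: "real poly \<Rightarrow> 'a \<Rightarrow> 'a" where
  "polyB p = fold_coeffs (\<lambda>a f x. a *\<^sub>R x + B (f x)) p (\<lambda>x. 0)"

lemma B_0 [simp]: "B 0 = 0" by (rule linear_0[OF linear_B])

lemma polyB_0 [simp]: "polyB 0 x = 0"
  by (simp add: polyB_def)

lemma polyB_pCons [simp]: "polyB (pCons a p) x = a *\<^sub>R x + B (polyB p x)"
  by (cases "p = 0 \<and> a = 0") (auto simp: polyB_def)

lemmas B_simps = linear_add[OF linear_B] linear_scale[OF linear_B] linear_diff[OF linear_B]

lemma polyB_add: "polyB (p + q) x = polyB p x + polyB q x"
  by (induction p q rule: poly_induct2) (auto simp: B_simps algebra_simps)

lemma polyB_smult: "polyB (smult c p) x = c *\<^sub>R polyB p x"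
  by (induction p) (auto simp: B_simps algebra_simps)

lemma polyB_sum: "polyB (\<Sum>i\<in>I. p i) x = (\<Sum>i\<in>I. polyB (p i) x)"
  by (induction I rule: infinite_finite_induct) (auto simp: polyB_add)

lemma polyB_B: "polyB p (B x) = B (polyB p x)"
  by (induction p) (auto simp: B_simps)

lemma linear_polyB: "linear (polyB p)"
  by (induction p) (auto intro!: linearI simp: linear_add linear_scale B_simps algebra_simps)

lemma polyB_mult: "polyB (p * q) x = polyB p (polyB q x)"
  by (induction p) (auto simp: polyB_add polyB_smult polyB_B)

lemma polyB_sym: "inner (polyB p x) y = inner x (polyB p y)"
  by (induction p arbitrary: x y) (auto simp: inner_add_left inner_add_right B_sym polyB_B)

lemma inner_K_poly: "inner (K x) (K y) = inner (polyB [:0, 1, -1:] x) y"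
proof -
  have "inner (polyB [:0, 1, -1:] x) y = inner (B x) y - inner (B (B x)) y"
    by (simp add: B_simps inner_diff_left linear_neg[OF linear_B] inner_add_left)
  then show ?thesis by (simp add: inner_K B_sym)
qed

text \<open>A formal polynomial instead of a function, so that it can be evaluated at
  \<open>B\<close>; scalar identities are imported through \<open>poly_bern\<close>.\<close>

definition bern :: "nat \<Rightarrow> nat \<Rightarrow> real poly" where
  "bern n k = smult (of_nat (n choose k)) ([:0, 1:] ^ k * [:1, -1:] ^ (n - k))"

lemma poly_bern: "poly (bern n k) t = Bernstein n k t"
  by (simp add: bern_def Bernstein_def)

lemma sum_bern: "(\<Sum>k\<le>n. bern n k) = 1"
  by (subst poly_eq_poly_eq_iff[symmetric]) (simp add: fun_eq_iff poly_sum poly_bern)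

text \<open>The variance \<open>t (1 - t) / n\<close> of a binomial mean. As an identity of formal
  polynomials it holds for \<open>B\<close> as well as for numbers.\<close>

lemma sum_bern_variance:
  assumes n: "n > 0"
  shows "(\<Sum>k\<le>n. bern n k * [:- (k / n), 1:]\<^sup>2) = smult (1 / n) [:0, 1, -1:]"
proof (subst poly_eq_poly_eq_iff[symmetric], rule ext)
  fix t :: real
  \<comment> \<open>Splits the square into the moments \<open>1\<close>, \<open>k\<close> and
    \<open>k (k - 1)\<close>, whose Bernstein sums are known.\<close>
  have 1: "(t - k / n)\<^sup>2 * c = t\<^sup>2 * c - (2 * t / n) * (k * c) + (1 / n\<^sup>2) * (k * (k - 1) * c + k * c)" for k c :: real
    using n by (simp add: power2_eq_square field_simps)
  have "poly (\<Sum>k\<le>n. bern n k * [:- (k / n), 1:]\<^sup>2) t = (\<Sum>k\<le>n. (t - k / n)\<^sup>2 * Bernstein n k t)"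
    by (simp add: poly_sum poly_bern power2_eq_square algebra_simps)
  also have "\<dots> = t\<^sup>2 * (\<Sum>k\<le>n. Bernstein n k t) - (2 * t / n) * (\<Sum>k\<le>n. k * Bernstein n k t)
     + (1 / n\<^sup>2) * ((\<Sum>k\<le>n. k * (real k - 1) * Bernstein n k t) + (\<Sum>k\<le>n. k * Bernstein n k t))"
    by (simp only: 1 sum.distrib sum_subtractf flip: sum_distrib_left)
  also have "\<dots> = t * (1 - t) / n"
    unfolding sum_Bernstein sum_k_Bernstein sum_kk_Bernstein
    using n by (simp add: power2_eq_square field_simps)
  finally show "poly (\<Sum>k\<le>n. bern n k * [:- (k / n), 1:]\<^sup>2) t = poly (smult (1 / n) [:0, 1, -1:]) t"
    using n by (simp add: field_simps)
qed

end

section \<open>Approximate spectral slices of B\<close>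

locale closed_endo_graph = closed_graph G for G :: "('a::{real_inner, complete_space} \<times> 'a) set"
begin

text \<open>\<open>slice (2 * N) k\<close> is a square root of the positive operator \<open>polyB (bern (2 * N) k)\<close>; for odd
  \<open>k\<close> it uses that \<open>K\<^sup>* K = B (1 - B)\<close>.\<close>

definition slice :: "nat \<Rightarrow> nat \<Rightarrow> 'a \<Rightarrow> 'a" where
  "slice n k x = sqrt (n choose k) *\<^sub>R
     (if even k then polyB ([:0, 1:] ^ (k div 2) * [:1, -1:] ^ ((n - k) div 2)) x
      else K (polyB ([:0, 1:] ^ (k div 2) * [:1, -1:] ^ ((n - k) div 2)) x))"

lemma linear_slice: "linear (slice n k)"
  using linear_polyB linear_K
  by (auto intro!: linearI simp: slice_def linear_add linear_scale algebra_simps)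

lemmas slice_simps = linear_add[OF linear_slice] linear_scale[OF linear_slice] linear_diff[OF linear_slice]

lemma inner_slice:
  assumes n: "even n" "k \<le> n"
  shows "inner (slice n k x) (slice n k y) = inner (polyB (bern n k) x) y"
proof -
  define p :: "real poly" where "p = [:0, 1:] ^ (k div 2) * [:1, -1:] ^ ((n - k) div 2)"
  have X: "[:0, 1, -1:] = [:0, 1:] * ([:1, -1:] :: real poly)" by simp
  have "(if even k then inner (polyB p x) (polyB p y) else inner (K (polyB p x)) (K (polyB p y)))
      = inner (polyB ([:0, 1:] ^ k * [:1, -1:] ^ (n - k)) x) y"
  proof (cases "even k")
    case True
    then have "2 * (k div 2) = k" "2 * ((n - k) div 2) = n - k" using n by auto
    then have "p * p = [:0, 1:] ^ k * [:1, -1:] ^ (n - k)"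
      by (simp add: p_def mult_ac flip: power_add mult_2)
    then show ?thesis using True by (simp add: polyB_sym flip: polyB_mult)
  next
    \<comment> \<open>As \<open>n\<close> is even, \<open>n - k\<close> is odd too. Halving both
      exponents loses one factor \<open>X (1 - X)\<close>, which \<open>K* K\<close>
      supplies.\<close>
    case False
    then have "odd (n - k)" using n by simp
    with False have e: "Suc (2 * (k div 2)) = k" "Suc (2 * ((n - k) div 2)) = n - k"
      using odd_two_times_div_two_succ[of k] odd_two_times_div_two_succ[of "n - k"]
      by (simp_all del: odd_two_times_div_two_succ)
    have "p * ([:0, 1, -1:] * p) = [:0, 1:] ^ Suc (2 * (k div 2)) * [:1, -1:] ^ Suc (2 * ((n - k) div 2))"
      unfolding X p_def by (simp only: mult_2 power_add power_Suc mult_ac)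
    then have "p * ([:0, 1, -1:] * p) = [:0, 1:] ^ k * [:1, -1:] ^ (n - k)" by (simp only: e)
    then show ?thesis using False
      by (simp only: inner_K_poly polyB_sym flip: polyB_mult) (simp add: polyB_sym mult_ac)
  qed
  moreover have "inner (slice n k x) (slice n k y) = (n choose k) *
      (if even k then inner (polyB p x) (polyB p y) else inner (K (polyB p x)) (K (polyB p y)))"
    using real_sqrt_mult_self[of "real (n choose k)"]
    by (simp add: slice_def flip: p_def mult.assoc)
  ultimately show ?thesis by (simp add: bern_def polyB_smult)
qed

text \<open>The Bernstein polynomials sum to 1, so the slices act like a Parseval frame.\<close>

lemma sum_inner_slice:
  assumes n: "even n"
  shows "(\<Sum>k\<le>n. inner (slice n k x) (slice n k y)) = inner x y"
proof -
  have "(\<Sum>k\<le>n. inner (slice n k x) (slice n k y)) = inner (polyB (\<Sum>k\<le>n. bern n k) x) y"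
    using n by (simp add: inner_slice polyB_sum inner_sum_left)
  then show ?thesis by (simp add: sum_bern one_pCons)
qed

text \<open>The sense in which slice \<open>k\<close> localizes \<open>B\<close> near
  \<open>k / n\<close>. Polynomials in \<open>B\<close> commute, so the sum is the variance identity
  evaluated at \<open>B\<close>, and \<open>B (1 - B)\<close> is \<open>K* K\<close>.\<close>

lemma slice_variance:
  assumes n: "even n" "n > 0"
  shows "(\<Sum>k\<le>n. (norm (slice n k (B x - (k / n) *\<^sub>R x)))\<^sup>2) \<le> (norm x)\<^sup>2 / n"
proof -
  have "(norm (slice n k (B x - (k / n) *\<^sub>R x)))\<^sup>2
      = inner (polyB (bern n k * [:- (k / n), 1:]\<^sup>2) x) x" if "k \<le> n" for k
  proof -
    have e: "B x - (k / n) *\<^sub>R x = polyB [:- (k / n), 1:] x" by (simp add: B_simps)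
    have "(norm (slice n k (B x - (k / n) *\<^sub>R x)))\<^sup>2
        = inner (polyB (bern n k) (polyB [:- (k / n), 1:] x)) (polyB [:- (k / n), 1:] x)"
      unfolding power2_norm_eq_inner e using n that by (intro inner_slice)
    also have "\<dots> = inner (polyB ([:- (k / n), 1:] * (bern n k * [:- (k / n), 1:])) x) x"
      by (simp only: polyB_mult polyB_sym)
    finally show ?thesis by (simp only: power2_eq_square mult_ac)
  qed
  then have "(\<Sum>k\<le>n. (norm (slice n k (B x - (k / n) *\<^sub>R x)))\<^sup>2) = inner (polyB (smult (1 / n) [:0, 1, -1:]) x) x"
    unfolding sum_bern_variance[OF n(2), symmetric] polyB_sum inner_sum_left by (intro sum.cong refl) simp
  also have "\<dots> = (norm (K x))\<^sup>2 / n"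
    by (simp only: polyB_smult inner_scaleR_left power2_norm_eq_inner inner_K_poly) simp
  also have "\<dots> \<le> (norm x)\<^sup>2 / n"
    using norm_K[of x] by (intro divide_right_mono power_mono) auto
  finally show ?thesis .
qed

lemma L2_set_slice: "even n \<Longrightarrow> L2_set (\<lambda>k. norm (slice n k x)) {..n} = norm x"
  using sum_inner_slice[of n x x] by (simp add: L2_set_def power2_norm_eq_inner norm_eq_sqrt_inner)

lemma L2_set_slice_variance:
  "even n \<Longrightarrow> n > 0 \<Longrightarrow> L2_set (\<lambda>k. norm (slice n k (B x - (k / n) *\<^sub>R x))) {..n} \<le> norm x / sqrt n"
  using slice_variance[of n x]
  by (auto simp: L2_set_def real_sqrt_divide dest: real_sqrt_le_mono)

lemma L2_set_subset: "finite A \<Longrightarrow> S \<subseteq> A \<Longrightarrow> L2_set f S \<le> L2_set f A"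
  unfolding L2_set_def by (intro real_sqrt_le_mono sum_mono2) auto

lemma sum_mult_le_L2_set:
  fixes f g :: "nat \<Rightarrow> real"
  assumes "S \<subseteq> {..n}" "\<And>k. 0 \<le> f k" "\<And>k. 0 \<le> g k"
  shows "(\<Sum>k\<in>S. f k * g k) \<le> L2_set f {..n} * L2_set g {..n}"
proof -
  have "(\<Sum>k\<in>S. f k * g k) \<le> (\<Sum>k\<in>{..n}. \<bar>f k\<bar> * \<bar>g k\<bar>)"
    using assms by (simp, intro sum_mono2) auto
  also have "\<dots> \<le> L2_set f {..n} * L2_set g {..n}" by (rule L2_set_mult_ineq)
  finally show ?thesis .
qed

text \<open>The part of \<open>v\<close> at small values of \<open>B\<close>, i.e. at large values of \<open>a\<^sup>* a\<close>, is small for \<open>v\<close> in the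
  domain of \<open>a\<close>.\<close>

lemma slice_low:
  assumes v: "(v, p) \<in> G" and n: "even n" "n > 0" and S: "S \<subseteq> {..n}" "\<And>k. k \<in> S \<Longrightarrow> k / n \<le> \<beta>"
    and \<beta>: "0 \<le> \<beta>" and e: "e = \<beta> + 1 / sqrt n"
  shows "(\<Sum>k\<in>S. (norm (slice n k v))\<^sup>2) \<le> norm v * norm p * sqrt e + (norm v)\<^sup>2 * e"
proof -
  \<comment> \<open>Substitute for a spectral projection of \<open>v\<close> to small values of
    \<open>B\<close>; the sum to be bounded is \<open>inner y v\<close>.\<close>
  define y where "y = (\<Sum>k\<in>S. polyB (bern n k) v)"
  have fS: "finite S" using S(1) finite_subset by blast
  have y: "inner y w = (\<Sum>k\<in>S. inner (slice n k v) (slice n k w))" for w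
    unfolding y_def inner_sum_left using S(1) n by (intro sum.cong refl) (auto simp: inner_slice)
  have "(norm y)\<^sup>2 \<le> norm v * norm y"
  proof -
    have "(norm y)\<^sup>2 = (\<Sum>k\<in>S. inner (slice n k v) (slice n k y))" by (simp add: power2_norm_eq_inner y)
    also have "\<dots> \<le> (\<Sum>k\<in>S. norm (slice n k v) * norm (slice n k y))"
      by (intro sum_mono norm_cauchy_schwarz)
    also have "\<dots> \<le> norm v * norm y"
      using sum_mult_le_L2_set[OF S(1), of "\<lambda>k. norm (slice n k v)" "\<lambda>k. norm (slice n k y)"] n
      by (simp add: L2_set_slice)
    finally show ?thesis .
  qed
  then have ny: "norm y \<le> norm v" by (cases "y = 0") (auto simp: power2_eq_square)
  have By: "inner (B y) w \<le> norm v * e * norm w" for w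
  proof -
    have "inner (B y) w = (\<Sum>k\<in>S. inner (slice n k (B v)) (slice n k w))"
      unfolding y_def linear_sum[OF linear_B] inner_sum_left
      using S(1) n by (intro sum.cong refl) (auto simp: inner_slice polyB_B)
    \<comment> \<open>On slice \<open>k\<close> replace \<open>B\<close> by \<open>k / n\<close>,
      which is at most \<beta>; the variance error adds \<open>1 / sqrt n\<close>.\<close>
    also have "\<dots> = (\<Sum>k\<in>S. (k / n) * inner (slice n k v) (slice n k w)
        + inner (slice n k (B v - (k / n) *\<^sub>R v)) (slice n k w))"
      by (intro sum.cong refl) (simp add: slice_simps inner_diff_left)
    also have "\<dots> \<le> (\<Sum>k\<in>S. \<beta> * (norm (slice n k v) * norm (slice n k w))
        + norm (slice n k (B v - (k / n) *\<^sub>R v)) * norm (slice n k w))"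
    proof (intro sum_mono add_mono norm_cauchy_schwarz)
      fix k assume k: "k \<in> S"
      have "(k / n) * inner (slice n k v) (slice n k w) \<le> (k / n) * (norm (slice n k v) * norm (slice n k w))"
        by (intro mult_left_mono norm_cauchy_schwarz) auto
      also have "\<dots> \<le> \<beta> * (norm (slice n k v) * norm (slice n k w))"
        using S(2)[OF k] by (intro mult_right_mono) auto
      finally show "(k / n) * inner (slice n k v) (slice n k w) \<le> \<beta> * (norm (slice n k v) * norm (slice n k w))" .
    qed
    also have "\<dots> = \<beta> * (\<Sum>k\<in>S. norm (slice n k v) * norm (slice n k w))
        + (\<Sum>k\<in>S. norm (slice n k (B v - (k / n) *\<^sub>R v)) * norm (slice n k w))"
      by (simp add: sum.distrib sum_distrib_left)
    also have "\<dots> \<le> \<beta> * (norm v * norm w) + norm v / sqrt n * norm w"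
    proof (intro add_mono mult_left_mono)
      show "(\<Sum>k\<in>S. norm (slice n k v) * norm (slice n k w)) \<le> norm v * norm w"
        using sum_mult_le_L2_set[OF S(1), of "\<lambda>k. norm (slice n k v)" "\<lambda>k. norm (slice n k w)"] n
        by (simp add: L2_set_slice)
      have "(\<Sum>k\<in>S. norm (slice n k (B v - (k / n) *\<^sub>R v)) * norm (slice n k w))
         \<le> L2_set (\<lambda>k. norm (slice n k (B v - (k / n) *\<^sub>R v))) {..n} * L2_set (\<lambda>k. norm (slice n k w)) {..n}"
        by (intro sum_mult_le_L2_set S(1)) auto
      also have "\<dots> \<le> norm v / sqrt n * norm w"
        using n by (intro mult_mono L2_set_slice_variance) (auto simp: L2_set_slice)
      finally show "(\<Sum>k\<in>S. norm (slice n k (B v - (k / n) *\<^sub>R v)) * norm (slice n k w)) \<le> norm v / sqrt n * norm w" .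
    qed (use \<beta> in auto)
    finally show ?thesis by (simp add: e algebra_simps)
  qed
  have e0: "e \<ge> 0" using \<beta> e by simp
  have nBy: "norm (B y) \<le> norm v * e"
    using By[of "B y"] e0 by (cases "B y = 0") (auto simp: power2_eq_square simp flip: power2_norm_eq_inner)
  have "(norm (K y))\<^sup>2 \<le> (norm v)\<^sup>2 * e"
  proof -
    have "(norm (K y))\<^sup>2 \<le> norm y * norm (B y)" by (rule norm_K_squared)
    also have "\<dots> \<le> norm v * (norm v * e)" by (intro mult_mono ny nBy) auto
    finally show ?thesis by (simp add: power2_eq_square)
  qed
  then have nKy: "norm (K y) \<le> norm v * sqrt e"
    using real_sqrt_le_mono by (fastforce simp: real_sqrt_mult)
  \<comment> \<open>The domain of \<open>a\<close> enters here: the weak equation expresses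
    \<open>inner y v\<close> through \<open>K y\<close> and \<open>B y\<close>, whose norms are of
    order \<open>sqrt e\<close> and \<open>e\<close>.\<close>
  have "(\<Sum>k\<in>S. (norm (slice n k v))\<^sup>2) = inner y v" by (simp add: y power2_norm_eq_inner)
  also have "\<dots> = inner (K y) p + inner (B y) v" using BK_eq[OF v, of y] by simp
  also have "\<dots> \<le> norm (K y) * norm p + norm (B y) * norm v"
    by (intro add_mono norm_cauchy_schwarz)
  also have "\<dots> \<le> norm v * sqrt e * norm p + norm v * e * norm v"
    by (intro add_mono mult_right_mono nKy nBy) auto
  finally show ?thesis by (simp add: power2_eq_square mult_ac)
qed

text \<open>\<open>E\<close> is only known to be linear and to commute with \<open>B\<close> and
  \<open>K\<close> on \<open>CO\<close>, so the induction over the polynomial carries membership in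
  \<open>CO\<close> along.\<close>

lemma slice_commute:
  assumes CO: "subspace CO" "\<And>x. B x \<in> CO" and w: "w \<in> CO"
    and E: "\<And>x y. x \<in> CO \<Longrightarrow> y \<in> CO \<Longrightarrow> E (x + y) = E x + E y"
      "\<And>c x. x \<in> CO \<Longrightarrow> E (c *\<^sub>R x) = c *\<^sub>R E x"
      "\<And>x. x \<in> CO \<Longrightarrow> B (E x) = E (B x)" "\<And>x. x \<in> CO \<Longrightarrow> K (E x) = E (K x)"
      "\<And>x. K x \<in> CO"
  shows "slice n k (E w) = E (slice n k w)"
proof -
  have 0: "E 0 = 0" using E(2)[of 0 0] subspace_0[OF CO(1)] by simp
  have "polyB p w \<in> CO \<and> polyB p (E w) = E (polyB p w)" for p
  proof (induction p)
    case 0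
    then show ?case using subspace_0[OF CO(1)] \<open>E 0 = 0\<close> by simp
  next
    case (pCons a p)
    then show ?case using w subspace_add[OF CO(1)] subspace_scale[OF CO(1)] CO(2) E by simp
  qed
  then show ?thesis using E subspace_scale[OF CO(1)] by (simp add: slice_def)
qed

text \<open>If \<open>B\<close> were the number \<beta>, \<open>eq\<close> would read
  \<open>v = E \<beta> g\<close> and \<open>kernel\<close> would bound \<open>- inner g v\<close>.
  On slice \<open>k\<close> this holds with \<open>\<beta> = k / n\<close> up to the variance error,
  which costs powers of \<open>1 / b\<close> on slices with \<open>k / n >= b\<close>. Hence the
  order of limits: \<open>n\<close> to infinity at fixed \<open>b\<close> removes the error, then
  \<open>b\<close> to 0 removes the slices below \<open>b\<close>, which \<open>slice_low\<close>
  controls.\<close>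

theorem slice_transfer:
  fixes E :: "real \<Rightarrow> 'a \<Rightarrow> 'a"
  assumes M: "M \<ge> 0" and C: "C \<ge> 0"
    and CO: "subspace CO" "\<And>x. B x \<in> CO" "\<And>x. K x \<in> CO"
    and E_add: "\<And>\<beta> x y. 0 < \<beta> \<Longrightarrow> \<beta> \<le> 1 \<Longrightarrow> x \<in> CO \<Longrightarrow> y \<in> CO \<Longrightarrow> E \<beta> (x + y) = E \<beta> x + E \<beta> y"
    and E_scale: "\<And>\<beta> c x. 0 < \<beta> \<Longrightarrow> \<beta> \<le> 1 \<Longrightarrow> x \<in> CO \<Longrightarrow> E \<beta> (c *\<^sub>R x) = c *\<^sub>R E \<beta> x"
    and E_norm: "\<And>\<beta> x. 0 < \<beta> \<Longrightarrow> \<beta> \<le> 1 \<Longrightarrow> x \<in> CO \<Longrightarrow> norm (E \<beta> x) \<le> M * norm x"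
    and E_B: "\<And>\<beta> x. 0 < \<beta> \<Longrightarrow> \<beta> \<le> 1 \<Longrightarrow> x \<in> CO \<Longrightarrow> B (E \<beta> x) = E \<beta> (B x)"
    and E_K: "\<And>\<beta> x. 0 < \<beta> \<Longrightarrow> \<beta> \<le> 1 \<Longrightarrow> x \<in> CO \<Longrightarrow> K (E \<beta> x) = E \<beta> (K x)"
    and h: "linear h" "\<And>x. B (h x) = h (B x)" "\<And>x. K (h x) = h (K x)"
    and kernel: "\<And>\<beta> y. 0 < \<beta> \<Longrightarrow> \<beta> \<le> 1 \<Longrightarrow> h y \<in> CO \<Longrightarrow> - inner (h y) (E \<beta> (h y)) \<le> C * (norm y)\<^sup>2"
    and v: "v \<in> CO" "(v, p) \<in> G" and g: "g = h \<psi> + f"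
    and eq: "\<And>\<beta>. 0 < \<beta> \<Longrightarrow> \<beta> \<le> 1 \<Longrightarrow> B v = E \<beta> (B g + (1 / \<beta>) *\<^sub>R (B v - \<beta> *\<^sub>R v))"
  shows "- inner g v \<le> C * (norm \<psi>)\<^sup>2 + M * (2 * norm (h \<psi>) * norm f + (norm f)\<^sup>2)"
proof -
  let ?R = "C * (norm \<psi>)\<^sup>2 + M * (2 * norm (h \<psi>) * norm f + (norm f)\<^sup>2)"
  have h_slice: "slice n k (h w) = h (slice n k w)" for n k w
    using h linear_add[OF h(1)] linear_scale[OF h(1)]
    by (intro slice_commute[where CO=UNIV]) auto
  \<comment> \<open>For \<open>k > 0\<close> a factor \<open>B\<close> or \<open>K\<close> can be
    put in front, and both map into \<open>CO\<close>. The slice \<open>k = 0\<close> lies below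
    every \<open>b > 0\<close> and is never treated this way.\<close>
  have slice_CO: "slice n k w \<in> CO" if "k > 0" for n k w
  proof (cases "even k")
    case True
    then have "k div 2 \<noteq> 0" using that by (auto elim!: evenE)
    then obtain j where "k div 2 = Suc j" using not0_implies_Suc by blast
    then have "polyB ([:0, 1:] ^ (k div 2) * [:1, -1:] ^ ((n - k) div 2)) w
        = B (polyB ([:0, 1:] ^ j * [:1, -1:] ^ ((n - k) div 2)) w)"
      by (simp add: polyB_mult B_simps polyB_smult)
    then show ?thesis using True CO by (simp add: slice_def subspace_scale)
  qed (use CO in \<open>simp add: slice_def subspace_scale\<close>)
  have bound: "- inner g v \<le> ?R + ((M + 1) * (2 / b\<^sup>2)) * (norm g * (norm v + norm g) / sqrt (2 * N))
      + norm g * sqrt (norm v * norm p * sqrt (b + 1 / sqrt (2 * N)) + (norm v)\<^sup>2 * (b + 1 / sqrt (2 * N)))"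
    if b: "0 < b" "b \<le> 1" and N: "N > 0" for b :: real and N :: nat
  proof -
    define n where "n = 2 * N"
    have n: "even n" "n > 0" using N by (auto simp: n_def)
    define M' where "M' = (M + 1) * (2 / b\<^sup>2)"
    define S where "S = {k. k \<le> n \<and> k / n < b}"
    define H where "H = {k. k \<le> n \<and> b \<le> k / n}"
    define x where "x k = slice n k (B v - (k / n) *\<^sub>R v)" for k
    define y where "y k = slice n k (B g - (k / n) *\<^sub>R g)" for k
    have SH: "{..n} = S \<union> H" "S \<inter> H = {}" "finite S" "finite H" "S \<subseteq> {..n}" "H \<subseteq> {..n}"
      by (auto simp: S_def H_def)
    have high: "- inner (slice n k g) (slice n k v) \<le>
        C * (norm (slice n k \<psi>))\<^sup>2 + M * (2 * (norm (slice n k (h \<psi>)) * norm (slice n k f))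
        + (norm (slice n k f))\<^sup>2) + M' * (norm (slice n k g) * (norm (x k) + norm (y k)))"
      if k: "k \<in> H" for k
    proof -
      \<comment> \<open>The kernel parameter is adapted to the slice.\<close>
      define \<beta> where "\<beta> = k / n"
      have \<beta>: "b \<le> \<beta>" "0 < \<beta>" "\<beta> \<le> 1"
        using k b n by (auto simp: H_def \<beta>_def)
      then have "k > 0" by (auto simp: \<beta>_def intro: gr0I)
      note CO_simps = slice_CO[OF \<open>k > 0\<close>] subspace_add[OF CO(1)] subspace_scale[OF CO(1)]
        subspace_diff[OF CO(1)] CO v
      note E_simps = E_add[OF \<beta>(2,3)] E_scale[OF \<beta>(2,3)]
      have "slice n k (B v) = E \<beta> (slice n k (B g + (1 / \<beta>) *\<^sub>R (B v - \<beta> *\<^sub>R v)))"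
        by (subst (1) eq[OF \<beta>(2,3)], rule slice_commute[where CO=CO])
          (use \<beta> CO v E_B E_K E_add E_scale in \<open>simp_all add: subspace_add subspace_scale subspace_diff\<close>)
      also have "slice n k (B g + (1 / \<beta>) *\<^sub>R (B v - \<beta> *\<^sub>R v))
          = \<beta> *\<^sub>R slice n k g + (y k + (1 / \<beta>) *\<^sub>R x k)"
        by (simp add: x_def y_def \<beta>_def slice_simps algebra_simps)
      also have "E \<beta> \<dots> = \<beta> *\<^sub>R E \<beta> (slice n k g) + (E \<beta> (y k) + (1 / \<beta>) *\<^sub>R E \<beta> (x k))"
        unfolding x_def y_def by (simp add: E_simps CO_simps)
      finally have *: "\<beta> *\<^sub>R slice n k v
          = \<beta> *\<^sub>R E \<beta> (slice n k g) + (E \<beta> (y k) + (1 / \<beta>) *\<^sub>R E \<beta> (x k) - x k)"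
        by (simp add: x_def \<beta>_def slice_simps algebra_simps)
      \<comment> \<open>Collects the variance errors. One factor \<open>1 / \<beta>\<close> stems
        from dividing the equation by \<beta>, a second one is already in \<open>eq\<close>;
        together they cost \<open>1 / b^2\<close>.\<close>
      define r where "r = (1 / \<beta>) *\<^sub>R (E \<beta> (y k) + (1 / \<beta>) *\<^sub>R E \<beta> (x k) - x k)"
      have "\<beta> *\<^sub>R slice n k v = \<beta> *\<^sub>R (E \<beta> (slice n k g) + r)"
        using * \<beta> by (simp add: r_def scaleR_add_right)
      then have Lv: "slice n k v = E \<beta> (slice n k g) + r" using \<beta> by simp
      have nE: "norm (E \<beta> (x k)) \<le> M * norm (x k)" "norm (E \<beta> (y k)) \<le> M * norm (y k)"
        using E_norm \<beta> CO_simps unfolding x_def y_def by blast+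
      have ib: "1 / \<beta> \<le> 1 / b\<^sup>2" "1 / \<beta> * (1 / \<beta>) \<le> 1 / b\<^sup>2"
      proof -
        have "b\<^sup>2 \<le> b" using b by (simp add: power2_eq_square)
        then show "1 / \<beta> \<le> 1 / b\<^sup>2" using \<beta> b by (intro divide_left_mono) auto
        show "1 / \<beta> * (1 / \<beta>) \<le> 1 / b\<^sup>2" using \<beta> b
          by (simp add: field_simps power2_eq_square mult_mono)
      qed
      have "norm r \<le> M' * (norm (x k) + norm (y k))"
      proof -
        have "norm r \<le> (1 / \<beta>) * (norm (E \<beta> (y k)) + (1 / \<beta>) * norm (E \<beta> (x k)) + norm (x k))"
          unfolding r_def norm_scaleR using \<beta>
          by (intro mult_mono order_trans[OF norm_triangle_ineq4] add_mono order_trans[OF norm_triangle_ineq]) auto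
        also have "\<dots> \<le> (1 / \<beta>) * (M * norm (y k) + (1 / \<beta>) * (M * norm (x k)) + norm (x k))"
          using \<beta> nE by (intro mult_left_mono add_mono) auto
        also have "\<dots> = (1 / \<beta>) * (M * norm (y k)) + (1 / \<beta> * (1 / \<beta>)) * (M * norm (x k)) + (1 / \<beta>) * norm (x k)"
          by (simp add: algebra_simps)
        also have "\<dots> \<le> (1 / b\<^sup>2) * (M * norm (y k)) + (1 / b\<^sup>2) * (M * norm (x k)) + (1 / b\<^sup>2) * norm (x k)"
          using ib M by (intro add_mono mult_right_mono) auto
        also have "\<dots> \<le> (1 / b\<^sup>2) * (2 * ((M + 1) * (norm (x k) + norm (y k))))"
          using M by (simp only: distrib_left[symmetric], intro mult_left_mono) (auto simp: algebra_simps)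
        also have "\<dots> = M' * (norm (x k) + norm (y k))" using b by (simp add: M'_def field_simps)
        finally show ?thesis .
      qed
      then have 1: "- inner (slice n k g) r \<le> M' * (norm (slice n k g) * (norm (x k) + norm (y k)))"
        using norm_cauchy_schwarz[of "- slice n k g" r] mult_left_mono[of "norm r" _ "norm (slice n k g)"]
        by (fastforce simp: mult_ac)
      define a where "a = h (slice n k \<psi>)"
      define d where "d = slice n k f"
      have a: "a \<in> CO" "a = slice n k (h \<psi>)" using CO_simps by (auto simp: a_def simp flip: h_slice)
      have d: "d \<in> CO" using CO_simps by (auto simp: d_def)
      have gad: "slice n k g = a + d" by (simp add: g slice_simps a d_def)
      \<comment> \<open>Only the term quadratic in \<open>a\<close> uses the kernel bound and its
        constant \<open>C\<close>; every term with the residual \<open>d\<close> is bounded crudely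
        through \<open>M\<close>.\<close>
      have "- inner (slice n k g) (E \<beta> (slice n k g))
          = - inner a (E \<beta> a) + inner (- a) (E \<beta> d) + inner (- d) (E \<beta> a) + inner (- d) (E \<beta> d)"
        using a d by (simp add: gad E_simps inner_add_left inner_add_right)
      also have "\<dots> \<le> C * (norm (slice n k \<psi>))\<^sup>2 + norm a * (M * norm d) + norm d * (M * norm a) + norm d * (M * norm d)"
        using a d \<beta> E_norm kernel[of \<beta> "slice n k \<psi>"]
        by (intro add_mono order_trans[OF norm_cauchy_schwarz]) (auto intro!: mult_left_mono simp: a_def)
      finally have "- inner (slice n k g) (E \<beta> (slice n k g))
         \<le> C * (norm (slice n k \<psi>))\<^sup>2 + M * (2 * (norm a * norm d) + (norm d)\<^sup>2)"
        by (simp add: algebra_simps power2_eq_square)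
      then show ?thesis using 1 unfolding a(2) d_def by (simp add: Lv inner_add_right)
    qed
    have s1: "(\<Sum>k\<in>H. norm (slice n k u) * norm (slice n k w)) \<le> norm u * norm w" for u w
      using sum_mult_le_L2_set[OF SH(6), of "\<lambda>k. norm (slice n k u)" "\<lambda>k. norm (slice n k w)"] n
      by (simp add: L2_set_slice)
    have s2: "(\<Sum>k\<in>H. norm (slice n k g) * norm (slice n k (B w - (k / n) *\<^sub>R w))) \<le> norm g * (norm w / sqrt n)" for w
    proof -
      have "(\<Sum>k\<in>H. norm (slice n k g) * norm (slice n k (B w - (k / n) *\<^sub>R w)))
         \<le> L2_set (\<lambda>k. norm (slice n k g)) {..n} * L2_set (\<lambda>k. norm (slice n k (B w - (k / n) *\<^sub>R w))) {..n}"
        by (intro sum_mult_le_L2_set SH) auto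
      also have "\<dots> \<le> norm g * (norm w / sqrt n)"
        using n by (intro mult_mono L2_set_slice_variance) (auto simp: L2_set_slice)
      finally show ?thesis .
    qed
    have "(\<Sum>k\<in>H. - inner (slice n k g) (slice n k v)) \<le>
        (\<Sum>k\<in>H. C * (norm (slice n k \<psi>))\<^sup>2 + M * (2 * (norm (slice n k (h \<psi>)) * norm (slice n k f))
        + (norm (slice n k f))\<^sup>2) + M' * (norm (slice n k g) * (norm (x k) + norm (y k))))"
      by (intro sum_mono high)
    also have "\<dots> = C * (\<Sum>k\<in>H. norm (slice n k \<psi>) * norm (slice n k \<psi>))
       + M * (2 * (\<Sum>k\<in>H. norm (slice n k (h \<psi>)) * norm (slice n k f))
         + (\<Sum>k\<in>H. norm (slice n k f) * norm (slice n k f)))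
       + M' * ((\<Sum>k\<in>H. norm (slice n k g) * norm (x k)) + (\<Sum>k\<in>H. norm (slice n k g) * norm (y k)))"
      by (simp add: sum.distrib sum_distrib_left distrib_left power2_eq_square)
    also have "\<dots> \<le> C * (norm \<psi> * norm \<psi>) + M * (2 * (norm (h \<psi>) * norm f) + norm f * norm f)
        + M' * (norm g * (norm v / sqrt n) + norm g * (norm g / sqrt n))"
      unfolding x_def y_def using C M by (intro add_mono mult_left_mono s1 s2) (auto simp: M'_def)
    finally have hi: "(\<Sum>k\<in>H. - inner (slice n k g) (slice n k v)) \<le> ?R + M' * (norm g * (norm v + norm g) / sqrt n)"
      by (simp add: power2_eq_square algebra_simps add_divide_distrib)
    have "(\<Sum>k\<in>S. - inner (slice n k g) (slice n k v)) \<le> (\<Sum>k\<in>S. \<bar>norm (slice n k g)\<bar> * \<bar>norm (slice n k v)\<bar>)"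
    proof (rule sum_mono)
      fix k
      show "- inner (slice n k g) (slice n k v) \<le> \<bar>norm (slice n k g)\<bar> * \<bar>norm (slice n k v)\<bar>"
        using norm_cauchy_schwarz[of "- slice n k g" "slice n k v"] by simp
    qed
    also have "\<dots> \<le> L2_set (\<lambda>k. norm (slice n k g)) S * L2_set (\<lambda>k. norm (slice n k v)) S"
      by (rule L2_set_mult_ineq)
    also have "\<dots> \<le> norm g * sqrt (norm v * norm p * sqrt (b + 1 / sqrt n) + (norm v)\<^sup>2 * (b + 1 / sqrt n))"
    proof (intro mult_mono)
      show "L2_set (\<lambda>k. norm (slice n k g)) S \<le> norm g"
        using L2_set_subset[OF _ SH(5), of "\<lambda>k. norm (slice n k g)"] n by (simp add: L2_set_slice)
      show "L2_set (\<lambda>k. norm (slice n k v)) S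
          \<le> sqrt (norm v * norm p * sqrt (b + 1 / sqrt n) + (norm v)\<^sup>2 * (b + 1 / sqrt n))"
        unfolding L2_set_def using b
        by (intro real_sqrt_le_mono slice_low[OF v(2) n SH(5), where \<beta>=b]) (auto simp: S_def)
    qed auto
    finally have "(\<Sum>k\<in>S. - inner (slice n k g) (slice n k v))
        \<le> norm g * sqrt (norm v * norm p * sqrt (b + 1 / sqrt n) + (norm v)\<^sup>2 * (b + 1 / sqrt n))" .
    moreover have "- inner g v = (\<Sum>k\<in>S. - inner (slice n k g) (slice n k v)) + (\<Sum>k\<in>H. - inner (slice n k g) (slice n k v))"
      using sum.union_disjoint[OF SH(3,4,2), of "\<lambda>k. - inner (slice n k g) (slice n k v)"]
      by (simp add: sum_inner_slice[OF n(1), of g v, symmetric] sum_negf SH(1))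
    ultimately show ?thesis using hi by (simp add: n_def M'_def)
  qed
  have lim1: "- inner g v \<le> ?R + norm g * sqrt (norm v * norm p * sqrt b + (norm v)\<^sup>2 * b)"
    if b: "0 < b" "b \<le> 1" for b :: real
  proof (rule tendsto_lowerbound[OF _ _ sequentially_bot])
    have i: "(\<lambda>N. 1 / sqrt (2 * real N)) \<longlonglongrightarrow> 0" by real_asymp
    have "(\<lambda>N. ?R + ((M + 1) * (2 / b\<^sup>2)) * (norm g * (norm v + norm g) * (1 / sqrt (2 * real N)))
      + norm g * sqrt (norm v * norm p * sqrt (b + 1 / sqrt (2 * real N)) + (norm v)\<^sup>2 * (b + 1 / sqrt (2 * real N))))
      \<longlonglongrightarrow> ?R + ((M + 1) * (2 / b\<^sup>2)) * (norm g * (norm v + norm g) * 0)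
      + norm g * sqrt (norm v * norm p * sqrt (b + 0) + (norm v)\<^sup>2 * (b + 0))"
      by (intro tendsto_intros i)
    then show "(\<lambda>N. ?R + ((M + 1) * (2 / b\<^sup>2)) * (norm g * (norm v + norm g) / sqrt (2 * real N))
      + norm g * sqrt (norm v * norm p * sqrt (b + 1 / sqrt (2 * real N)) + (norm v)\<^sup>2 * (b + 1 / sqrt (2 * real N))))
      \<longlonglongrightarrow> ?R + norm g * sqrt (norm v * norm p * sqrt b + (norm v)\<^sup>2 * b)" by simp
    show "\<forall>\<^sub>F N in sequentially. - inner g v \<le> ?R + ((M + 1) * (2 / b\<^sup>2)) * (norm g * (norm v + norm g) / sqrt (2 * real N))
      + norm g * sqrt (norm v * norm p * sqrt (b + 1 / sqrt (2 * real N)) + (norm v)\<^sup>2 * (b + 1 / sqrt (2 * real N)))"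
      using eventually_gt_at_top[of 0] by eventually_elim (use bound[OF b] in auto)
  qed
  show ?thesis
  proof (rule tendsto_lowerbound[OF _ _ sequentially_bot])
    have i: "(\<lambda>N. 1 / real (Suc N)) \<longlonglongrightarrow> 0" by real_asymp
    have "(\<lambda>N. ?R + norm g * sqrt (norm v * norm p * sqrt (1 / real (Suc N)) + (norm v)\<^sup>2 * (1 / real (Suc N))))
      \<longlonglongrightarrow> ?R + norm g * sqrt (norm v * norm p * sqrt 0 + (norm v)\<^sup>2 * 0)"
      by (intro tendsto_intros i)
    then show "(\<lambda>N. ?R + norm g * sqrt (norm v * norm p * sqrt (1 / real (Suc N)) + (norm v)\<^sup>2 * (1 / real (Suc N)))) \<longlonglongrightarrow> ?R"
      by simp
    show "\<forall>\<^sub>F N in sequentially. - inner g v \<le> ?R + norm g * sqrt (norm v * norm p * sqrt (1 / real (Suc N)) + (norm v)\<^sup>2 * (1 / real (Suc N)))"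
      by (intro eventuallyI lim1) auto
  qed
qed

end

section \<open>The Hilbert space as a type\<close>

lemma L2_iff: "f \<in> L2 \<longleftrightarrow> f \<in> borel_measurable borel \<and> integrable lborel (\<lambda>x. (cmod (f x))\<^sup>2)"
  by (simp add: L2_def)

lemma L2_measurable [measurable_dest]: "f \<in> L2 \<Longrightarrow> f \<in> borel_measurable borel"
  by (simp add: L2_iff)

lemma L2_bound:
  assumes [measurable]: "f \<in> borel_measurable borel" and g: "integrable lborel g"
    and le: "AE x in lborel. (cmod (f x))\<^sup>2 \<le> g x"
  shows "f \<in> L2"
proof -
  have "integrable lborel (\<lambda>x. (cmod (f x))\<^sup>2)"
    by (rule Bochner_Integration.integrable_bound[OF g]) (use le in \<open>auto elim!: eventually_mono\<close>)
  then show ?thesis by (simp add: L2_iff)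
qed

lemma L2_add: "f \<in> L2 \<Longrightarrow> g \<in> L2 \<Longrightarrow> (\<lambda>x. f x + g x) \<in> L2"
proof (rule L2_bound[where g = "\<lambda>x. 2 * (cmod (f x))\<^sup>2 + 2 * (cmod (g x))\<^sup>2"])
  have "(cmod (a + b))\<^sup>2 \<le> 2 * (cmod a)\<^sup>2 + 2 * (cmod b)\<^sup>2" for a b
  proof -
    have "(cmod (a + b))\<^sup>2 \<le> (cmod a + cmod b)\<^sup>2" by (intro power_mono norm_triangle_ineq) auto
    also have "\<dots> \<le> 2 * (cmod a)\<^sup>2 + 2 * (cmod b)\<^sup>2" using sum_squares_bound[of "cmod a" "cmod b"] by (simp add: power2_sum)
    finally show ?thesis .
  qed
  then show "AE x in lborel. (cmod (f x + g x))\<^sup>2 \<le> 2 * (cmod (f x))\<^sup>2 + 2 * (cmod (g x))\<^sup>2" by auto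
qed (auto simp: L2_iff)

lemma L2_mult_bounded:
  assumes [measurable]: "h \<in> borel_measurable borel" and h: "AE x in lborel. cmod (h x) \<le> C" and f: "f \<in> L2"
  shows "(\<lambda>x. h x * f x) \<in> L2"
proof (rule L2_bound[where g = "\<lambda>x. C\<^sup>2 * (cmod (f x))\<^sup>2"])
  show "AE x in lborel. (cmod (h x * f x))\<^sup>2 \<le> C\<^sup>2 * (cmod (f x))\<^sup>2"
    using h by eventually_elim (auto simp: norm_mult power_mult_distrib intro!: mult_right_mono power_mono)
qed (use f in \<open>auto simp: L2_iff\<close>)

lemma L2_scale: "f \<in> L2 \<Longrightarrow> (\<lambda>x. c * f x) \<in> L2"
  by (rule L2_mult_bounded[where C = "cmod c"]) auto

lemma L2_uminus: "f \<in> L2 \<Longrightarrow> (\<lambda>x. - f x) \<in> L2"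
  using L2_scale[of f "-1"] by simp

lemma L2_diff: "f \<in> L2 \<Longrightarrow> g \<in> L2 \<Longrightarrow> (\<lambda>x. f x - g x) \<in> L2"
  using L2_add[of f "\<lambda>x. - g x"] L2_uminus[of g] by simp

lemma L2_zero: "(\<lambda>x. 0) \<in> L2"
  by (simp add: L2_iff)

lemma borel_measurable_cnj [measurable]: "cnj \<in> borel_measurable borel"
  by (intro borel_measurable_continuous_onI continuous_intros)

lemma integrable_inner_L2:
  assumes "f \<in> L2" "g \<in> L2"
  shows "integrable lborel (\<lambda>x. f x * cnj (g x))"
proof (rule Bochner_Integration.integrable_bound)
  show "integrable lborel (\<lambda>x. (cmod (f x))\<^sup>2 + (cmod (g x))\<^sup>2)" using assms by (auto simp: L2_iff)
  have "cmod a * cmod b \<le> (cmod a)\<^sup>2 + (cmod b)\<^sup>2" for a b :: complex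
  proof -
    have "0 \<le> cmod a * cmod b" by simp
    with sum_squares_bound[of "cmod a" "cmod b"] show ?thesis by linarith
  qed
  then show "AE x in lborel. norm (f x * cnj (g x)) \<le> norm ((cmod (f x))\<^sup>2 + (cmod (g x))\<^sup>2)"
    by (auto simp: norm_mult)
qed (use assms in measurable)

definition l2_rel :: "wavefn \<Rightarrow> wavefn \<Rightarrow> bool" where
  "l2_rel f g \<longleftrightarrow> f \<in> L2 \<and> g \<in> L2 \<and> (AE x in lborel. f x = g x)"

quotient_type l2 = wavefn / partial: l2_rel
proof (rule part_equivpI)
  show "\<exists>x. l2_rel x x" using L2_zero by (auto simp: l2_rel_def)
  show "symp l2_rel" by (auto simp: symp_def l2_rel_def)
  show "transp l2_rel" by (auto simp: transp_def l2_rel_def elim: AE_mp)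
qed

abbreviation cls :: "wavefn \<Rightarrow> l2" where "cls \<equiv> abs_l2"
abbreviation rep :: "l2 \<Rightarrow> wavefn" where "rep \<equiv> rep_l2"

lemma rep_L2 [simp]: "rep u \<in> L2"
  using Quotient3_rep_reflp[OF Quotient3_l2] by (auto simp: l2_rel_def)

lemma cls_rep [simp]: "cls (rep u) = u"
  using Quotient3_abs_rep[OF Quotient3_l2] .

lemma cls_eq_iff: "f \<in> L2 \<Longrightarrow> g \<in> L2 \<Longrightarrow> cls f = cls g \<longleftrightarrow> (AE x in lborel. f x = g x)"
  using Quotient3_rel[OF Quotient3_l2, of f g] by (auto simp: l2_rel_def)

lemma rep_cls: "f \<in> L2 \<Longrightarrow> AE x in lborel. rep (cls f) x = f x"
  using cls_eq_iff[of "rep (cls f)" f] by simp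

lemma l2_cases: obtains f where "f \<in> L2" "u = cls f"
  using that[of "rep u"] by simp

text \<open>The abstract part works in real Hilbert spaces, so the inner product is the real part of
  the complex one. The complex structure is kept as the operators \<open>cscale\<close>, and
  \<open>l2_inner_cls\<close> recovers the complex inner product with the help of
  \<open>cscale \<i>\<close>.\<close>

instantiation l2 :: real_inner
begin

lift_definition zero_l2 :: l2 is "\<lambda>x. 0" by (simp add: l2_rel_def L2_zero)
lift_definition plus_l2 :: "l2 \<Rightarrow> l2 \<Rightarrow> l2" is "\<lambda>f g x. f x + g x"
  by (auto simp: l2_rel_def L2_add)
lift_definition minus_l2 :: "l2 \<Rightarrow> l2 \<Rightarrow> l2" is "\<lambda>f g x. f x - g x"
  by (auto simp: l2_rel_def L2_diff)
lift_definition uminus_l2 :: "l2 \<Rightarrow> l2" is "\<lambda>f x. - f x"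
  by (auto simp: l2_rel_def L2_uminus)
lift_definition scaleR_l2 :: "real \<Rightarrow> l2 \<Rightarrow> l2" is "\<lambda>c f x. of_real c * f x"
  by (auto simp: l2_rel_def L2_scale)
lift_definition inner_l2 :: "l2 \<Rightarrow> l2 \<Rightarrow> real" is "\<lambda>f g. Re (l2_inner f g)"
proof -
  fix f f' g g' assume "l2_rel f f'" "l2_rel g g'"
  then have L: "f \<in> L2" "f' \<in> L2" "g \<in> L2" "g' \<in> L2"
    and ae: "AE x in lborel. f x = f' x" "AE x in lborel. g x = g' x" by (auto simp: l2_rel_def)
  have "l2_inner f g = l2_inner f' g'" unfolding l2_inner_def
  proof (rule integral_cong_AE)
    show "AE x in lborel. f x * cnj (g x) = f' x * cnj (g' x)"
      using ae by eventually_elim simp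
  qed (use integrable_inner_L2[OF L(1,3)] integrable_inner_L2[OF L(2,4)] in auto)
  then show "Re (l2_inner f g) = Re (l2_inner f' g')" by simp
qed

definition norm_l2 :: "l2 \<Rightarrow> real" where "norm_l2 u = sqrt (inner u u)"
definition dist_l2 :: "l2 \<Rightarrow> l2 \<Rightarrow> real" where "dist_l2 u v = norm (u - v)"
definition sgn_l2 :: "l2 \<Rightarrow> l2" where "sgn_l2 u = inverse (norm u) *\<^sub>R u"
definition uniformity_l2 :: "(l2 \<times> l2) filter" where
  "uniformity_l2 = (INF e\<in>{0<..}. principal {(x, y). dist x y < e})"
definition open_l2 :: "l2 set \<Rightarrow> bool" where
  "open_l2 U = (\<forall>x\<in>U. eventually (\<lambda>(x', y). x' = x \<longrightarrow> y \<in> U) uniformity)"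

instance
proof
  fix u v w :: l2 and a c :: real
  show "u + v + w = u + (v + w)" by transfer (auto simp: l2_rel_def L2_add add.assoc)
  show "u + v = v + u" by transfer (auto simp: l2_rel_def L2_add add.commute)
  show "0 + u = u" by transfer (auto simp: l2_rel_def)
  show "- u + u = 0" by transfer (auto simp: l2_rel_def L2_zero)
  show "u - v = u + - v" by transfer (auto simp: l2_rel_def L2_diff)
  show "a *\<^sub>R (u + v) = a *\<^sub>R u + a *\<^sub>R v" by transfer (auto simp: l2_rel_def L2_add L2_scale distrib_left)
  show "(a + c) *\<^sub>R u = a *\<^sub>R u + c *\<^sub>R u" by transfer (auto simp: l2_rel_def L2_add L2_scale distrib_right)
  show "a *\<^sub>R c *\<^sub>R u = (a * c) *\<^sub>R u" by transfer (auto simp: l2_rel_def L2_scale mult.assoc)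
  show "1 *\<^sub>R u = u" by transfer (auto simp: l2_rel_def)
  show "dist u v = norm (u - v)" by (rule dist_l2_def)
  show "sgn u = inverse (norm u) *\<^sub>R u" by (rule sgn_l2_def)
  show "uniformity = (INF e\<in>{0<..}. principal {(x :: l2, y). dist x y < e})" by (rule uniformity_l2_def)
  show "open U = (\<forall>x\<in>U. eventually (\<lambda>(x', y). x' = x \<longrightarrow> y \<in> U) uniformity)" for U :: "l2 set" by (rule open_l2_def)
  show "norm u = sqrt (inner u u)" by (rule norm_l2_def)
  show "inner u v = inner v u"
  proof transfer
    fix f g
    have "cnj (l2_inner g f) = (LINT x|lborel. cnj (g x * cnj (f x)))"
      unfolding l2_inner_def by (rule Bochner_Integration.integral_cnj[symmetric])
    then have "l2_inner f g = cnj (l2_inner g f)"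
      by (simp add: l2_inner_def mult.commute)
    then show "Re (l2_inner f g) = Re (l2_inner g f)" by simp
  qed
  show "inner (u + v) w = inner u w + inner v w"
    by transfer (auto simp: l2_rel_def l2_inner_def distrib_right integrable_inner_L2)
  show "inner (a *\<^sub>R u) v = a * inner u v"
    by transfer (auto simp: l2_rel_def l2_inner_def mult.assoc)
  have eq: "Re (l2_inner f f) = (LINT x|lborel. (cmod (f x))\<^sup>2)" for f
  proof -
    have "l2_inner f f = of_real (LINT x|lborel. (cmod (f x))\<^sup>2)"
      by (simp add: l2_inner_def complex_norm_square[symmetric] flip: integral_complex_of_real)
    then show ?thesis by simp
  qed
  show "0 \<le> inner u u"
    by transfer (auto simp: eq)
  show "(inner u u = 0) = (u = 0)"
    by transfer (auto simp: eq L2_iff l2_rel_def integral_nonneg_eq_0_iff_AE)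
qed

end

lemma cls_add: "f \<in> L2 \<Longrightarrow> g \<in> L2 \<Longrightarrow> cls f + cls g = cls (\<lambda>x. f x + g x)"
  by (rule plus_l2.abs_eq) (auto simp: l2_rel_def)
lemma cls_diff: "f \<in> L2 \<Longrightarrow> g \<in> L2 \<Longrightarrow> cls f - cls g = cls (\<lambda>x. f x - g x)"
  by (rule minus_l2.abs_eq) (auto simp: l2_rel_def)
lemma cls_uminus: "f \<in> L2 \<Longrightarrow> - cls f = cls (\<lambda>x. - f x)"
  by (rule uminus_l2.abs_eq) (auto simp: l2_rel_def)
lemma cls_scaleR: "f \<in> L2 \<Longrightarrow> c *\<^sub>R cls f = cls (\<lambda>x. of_real c * f x)"
  by (rule scaleR_l2.abs_eq) (auto simp: l2_rel_def)
lemma cls_inner: "f \<in> L2 \<Longrightarrow> g \<in> L2 \<Longrightarrow> inner (cls f) (cls g) = Re (l2_inner f g)"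
  by (rule inner_l2.abs_eq) (auto simp: l2_rel_def)
lemma cls_zero: "cls (\<lambda>x. 0) = 0"
  by (simp add: zero_l2_def)

lemma l2_inner_self: "l2_inner f f = of_real (LINT x|lborel. (cmod (f x))\<^sup>2)"
  by (simp add: l2_inner_def complex_norm_square[symmetric] flip: integral_complex_of_real)

lemma norm_cls: "f \<in> L2 \<Longrightarrow> norm (cls f) = l2_norm f"
  by (simp add: norm_l2_def cls_inner l2_inner_self l2_norm_def)

lemma norm_cls_squared: "f \<in> L2 \<Longrightarrow> (norm (cls f))\<^sup>2 = (LINT x|lborel. (cmod (f x))\<^sup>2)"
  by (simp add: norm_cls l2_norm_def)

lemma norm_cls_nn:
  "f \<in> L2 \<Longrightarrow> ennreal ((norm (cls f))\<^sup>2) = (\<integral>\<^sup>+x. ennreal ((cmod (f x))\<^sup>2) \<partial>lborel)"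
  by (subst nn_integral_eq_integral) (auto simp: norm_cls_squared L2_iff)

lift_definition cscale :: "complex \<Rightarrow> l2 \<Rightarrow> l2" is "\<lambda>c f x. c * f x"
  by (auto simp: l2_rel_def L2_scale)

lemma cls_cscale: "f \<in> L2 \<Longrightarrow> cscale c (cls f) = cls (\<lambda>x. c * f x)"
  by (rule cscale.abs_eq) (auto simp: l2_rel_def)

lemma cscale_add: "cscale c (u + v) = cscale c u + cscale c v"
  by transfer (auto simp: l2_rel_def L2_add L2_scale distrib_left)
lemma cscale_add_left: "cscale (c + d) u = cscale c u + cscale d u"
  by transfer (auto simp: l2_rel_def L2_add L2_scale distrib_right)
lemma cscale_cscale: "cscale c (cscale d u) = cscale (c * d) u"
  by transfer (auto simp: l2_rel_def L2_scale mult.assoc)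
lemma cscale_of_real: "cscale (of_real r) u = r *\<^sub>R u"
  by transfer (auto simp: l2_rel_def L2_scale)
lemma cscale_scaleR: "cscale c (r *\<^sub>R u) = r *\<^sub>R cscale c u" "cscale (r *\<^sub>R c) u = r *\<^sub>R cscale c u"
  by (simp_all add: cscale_cscale mult.commute scaleR_conv_of_real flip: cscale_of_real)
lemma inner_cscale: "inner (cscale c u) v = inner u (cscale (cnj c) v)"
  by transfer (simp add: l2_inner_def mult_ac)
lemma cscale_1 [simp]: "cscale 1 u = u" using cscale_of_real[of 1] by simp

lemma norm_cscale: "norm (cscale c u) = cmod c * norm u"
proof -
  have "inner (cscale c u) (cscale c u) = (cmod c)\<^sup>2 * inner u u"
    by (simp add: inner_cscale cscale_cscale complex_norm_square[symmetric] mult.commute[of "cnj c"] cscale_of_real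
        del: of_real_power)
  then show ?thesis by (simp add: norm_eq_sqrt_inner real_sqrt_mult)
qed

lemma bounded_bilinear_cscale: "bounded_bilinear cscale"
proof
  show "\<exists>K. \<forall>a b. norm (cscale a b) \<le> norm a * norm b * K"
    by (rule exI[of _ 1]) (simp add: norm_cscale)
qed (simp_all add: cscale_add cscale_add_left cscale_scaleR)

lemma inner_cscale_expand: "inner (cscale c u) v = Re c * inner u v + Im c * inner (cscale \<i> u) v"
proof -
  have "c = of_real (Re c) + of_real (Im c) * \<i>" by (simp add: complex_eq_iff)
  then have "cscale c u = Re c *\<^sub>R u + Im c *\<^sub>R cscale \<i> u"
    by (metis cscale_add_left cscale_cscale cscale_of_real)
  then show ?thesis by (simp add: inner_add_left)
qed

lemma l2_inner_cls:
  assumes "f \<in> L2" "g \<in> L2"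
  shows "l2_inner f g = Complex (inner (cls f) (cls g)) (- inner (cscale \<i> (cls f)) (cls g))"
  using assms by (simp add: cls_cscale cls_inner L2_scale complex_eq_iff) (simp add: l2_inner_def mult.assoc)

text \<open>A rapidly converging subsequence converges almost everywhere, and Fatou's lemma identifies its
  pointwise limit.\<close>

instance l2 :: complete_space
proof
  fix X :: "nat \<Rightarrow> l2" assume X: "Cauchy X"
  have "\<exists>N. \<forall>m\<ge>N. \<forall>n\<ge>N. norm (X m - X n) < (1/2) ^ i" for i
    using CauchyD[OF X, of "(1/2) ^ i"] by simp
  then obtain N where N: "\<And>i m n. m \<ge> N i \<Longrightarrow> n \<ge> N i \<Longrightarrow> norm (X m - X n) < (1/2) ^ i" by metis
  \<comment> \<open>The sum with \<open>Suc\<close> makes \<open>r\<close> strictly increasing and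
    keeps it above \<open>N i\<close>.\<close>
  define r where "r i = (\<Sum>j\<le>i. Suc (N j))" for i
  have r_mono: "strict_mono r" by (rule strict_monoI_Suc) (simp add: r_def)
  have rN: "r i \<ge> N i" for i
    using member_le_sum[of i "{..i}" "\<lambda>j. Suc (N j)"] by (simp add: r_def)
  have close: "norm (X (r n) - X (r i)) < (1/2) ^ i" if "n \<ge> i" for n i
    using N[of i "r n" "r i"] rN[of i] strict_mono_leD[OF r_mono that] by simp
  define f where "f i = rep (X (r i))" for i
  have f [simp]: "f i \<in> L2" for i by (simp add: f_def)
  have [measurable]: "f i \<in> borel_measurable borel" for i using L2_measurable[OF f] .
  have nn: "(\<integral>\<^sup>+x. ennreal ((cmod (f n x - f i x))\<^sup>2) \<partial>lborel) \<le> ennreal ((1/4) ^ i)" if "n \<ge> i" for n i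
  proof -
    have "X (r n) - X (r i) = cls (\<lambda>x. f n x - f i x)" by (simp add: f_def flip: cls_diff)
    then have "(\<integral>\<^sup>+x. ennreal ((cmod (f n x - f i x))\<^sup>2) \<partial>lborel) = ennreal ((norm (X (r n) - X (r i)))\<^sup>2)"
      using norm_cls_nn[of "\<lambda>x. f n x - f i x"] by (simp add: L2_diff)
    also have "\<dots> \<le> ennreal (((1/2) ^ i)\<^sup>2)"
      using close[OF that] by (intro ennreal_leI power_mono) auto
    also have "((1/2) ^ i)\<^sup>2 = ((1/4) ^ i :: real)" by (simp add: power_mult_distrib[symmetric] power2_eq_square)
    finally show ?thesis .
  qed
  \<comment> \<open>The weights \<open>2 ^ i\<close> against the bounds \<open>(1/4) ^ i\<close>
    still leave a convergent series. Where the weighted sum is finite, the increments are of order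
    \<open>2 ^ (- i / 2)\<close>, hence summable.\<close>
  have "(\<integral>\<^sup>+x. (\<Sum>i. ennreal (2 ^ i) * ennreal ((cmod (f (Suc i) x - f i x))\<^sup>2)) \<partial>lborel)
      = (\<Sum>i. ennreal (2 ^ i) * (\<integral>\<^sup>+x. ennreal ((cmod (f (Suc i) x - f i x))\<^sup>2) \<partial>lborel))"
    by (subst nn_integral_suminf) (auto simp: nn_integral_cmult)
  also have "\<dots> \<le> (\<Sum>i. ennreal (2 ^ i) * ennreal ((1/4) ^ i))"
    by (intro suminf_le mult_left_mono nn) auto
  also have "\<dots> = (\<Sum>i. ennreal ((1/2) ^ i))"
    by (intro suminf_cong) (simp add: power_mult_distrib[symmetric] flip: ennreal_mult)
  also have "\<dots> < \<infinity>" by (subst suminf_ennreal2) (auto simp: summable_geometric)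
  finally have "AE x in lborel. (\<Sum>i. ennreal (2 ^ i) * ennreal ((cmod (f (Suc i) x - f i x))\<^sup>2)) \<noteq> \<infinity>"
    by (intro nn_integral_PInf_AE) auto
  then have conv: "AE x in lborel. convergent (\<lambda>i. f i x)"
  proof eventually_elim
    fix x assume fin: "(\<Sum>i. ennreal (2 ^ i) * ennreal ((cmod (f (Suc i) x - f i x))\<^sup>2)) \<noteq> \<infinity>"
    define S where "S = (\<Sum>i. ennreal (2 ^ i) * ennreal ((cmod (f (Suc i) x - f i x))\<^sup>2))"
    obtain s where s: "S = ennreal s" "s \<ge> 0" using fin unfolding S_def[symmetric] by (cases S) auto
    have "norm (f (Suc i) x - f i x) \<le> sqrt s * (sqrt (1/2)) ^ i" for i
    proof -
      have "ennreal (2 ^ i) * ennreal ((cmod (f (Suc i) x - f i x))\<^sup>2) \<le> S"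
        unfolding S_def using sum_le_suminf[of "\<lambda>i. ennreal (2 ^ i) * ennreal ((cmod (f (Suc i) x - f i x))\<^sup>2)" "{i}"]
        by simp
      then have "2 ^ i * (cmod (f (Suc i) x - f i x))\<^sup>2 \<le> s" using s by (simp flip: ennreal_mult)
      then have "(cmod (f (Suc i) x - f i x))\<^sup>2 \<le> s * (1/2) ^ i" by (simp add: field_simps power_one_over)
      then have "cmod (f (Suc i) x - f i x) \<le> sqrt (s * (1/2) ^ i)" by (rule real_le_rsqrt)
      then show ?thesis by (simp add: real_sqrt_mult real_sqrt_power)
    qed
    moreover have "summable (\<lambda>i. sqrt s * (sqrt (1/2)) ^ i)"
      by (intro summable_mult summable_geometric) (simp add: real_sqrt_divide)
    ultimately have "summable (\<lambda>i. f (Suc i) x - f i x)"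
      by (rule summable_comparison_test'[rotated]) 
    then have "convergent (\<lambda>n. (\<Sum>i<n. f (Suc i) x - f i x) + f 0 x)"
      by (intro convergent_add convergent_const) (simp add: summable_iff_convergent)
    then show "convergent (\<lambda>i. f i x)" by (simp add: sum_lessThan_telescope[of "\<lambda>i. f i x"])
  qed
  define F where "F x = lim (\<lambda>i. f i x)" for x
  have [measurable]: "F \<in> borel_measurable borel"
    unfolding F_def by (intro borel_measurable_lim_metric) simp
  have lim: "AE x in lborel. (\<lambda>i. f i x) \<longlonglongrightarrow> F x"
    using conv by eventually_elim (simp add: F_def convergent_LIMSEQ_iff)
  have Fi: "(\<integral>\<^sup>+x. ennreal ((cmod (F x - f i x))\<^sup>2) \<partial>lborel) \<le> ennreal ((1/4) ^ i)" for i
  proof -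
    have "(\<integral>\<^sup>+x. ennreal ((cmod (F x - f i x))\<^sup>2) \<partial>lborel)
        = (\<integral>\<^sup>+x. liminf (\<lambda>n. ennreal ((cmod (f n x - f i x))\<^sup>2)) \<partial>lborel)"
    proof (rule nn_integral_cong_AE, use lim in eventually_elim)
      fix x assume "(\<lambda>i. f i x) \<longlonglongrightarrow> F x"
      then have "(\<lambda>n. ennreal ((cmod (f n x - f i x))\<^sup>2)) \<longlonglongrightarrow> ennreal ((cmod (F x - f i x))\<^sup>2)"
        by (intro tendsto_intros)
      then show "ennreal ((cmod (F x - f i x))\<^sup>2) = liminf (\<lambda>n. ennreal ((cmod (f n x - f i x))\<^sup>2))"
        by (intro lim_imp_Liminf[symmetric]) auto
    qed
    also have "\<dots> \<le> liminf (\<lambda>n. \<integral>\<^sup>+x. ennreal ((cmod (f n x - f i x))\<^sup>2) \<partial>lborel)"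
      by (rule nn_integral_liminf) simp
    also have "\<dots> \<le> ennreal ((1/4) ^ i)"
      by (intro Liminf_le eventually_mono[OF eventually_ge_at_top[of i]] nn sequentially_bot)
    finally show ?thesis .
  qed
  have dL2: "(\<lambda>x. F x - f i x) \<in> L2" for i
    using Fi[of i] by (auto simp: L2_iff intro!: integrableI_bounded elim: le_less_trans[OF _ ennreal_less_top])
  have FL2: "F \<in> L2" using L2_add[OF dL2 f, of 0 0] by simp
  have "norm (cls F - X (r i)) \<le> (1/2) ^ i" for i
  proof -
    have "cls F - X (r i) = cls (\<lambda>x. F x - f i x)" using FL2 by (simp add: f_def flip: cls_diff)
    then have "ennreal ((norm (cls F - X (r i)))\<^sup>2) \<le> ennreal ((1/4) ^ i)"
      using Fi[of i] norm_cls_nn[OF dL2] by simp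
    then have "(norm (cls F - X (r i)))\<^sup>2 \<le> ((1/2) ^ i)\<^sup>2"
      by (simp add: power_mult_distrib[symmetric] power2_eq_square)
    then show ?thesis by (rule power2_le_imp_le) simp
  qed
  then have "(\<lambda>i. norm (X (r i) - cls F)) \<longlonglongrightarrow> 0"
    by (intro tendsto_sandwich[OF _ _ tendsto_const LIMSEQ_power_zero[of "1/2 :: real"]])
      (auto simp: norm_minus_commute)
  then have "(X \<circ> r) \<longlonglongrightarrow> cls F"
    by (subst LIM_zero_iff[symmetric]) (simp add: o_def tendsto_norm_zero_iff)
  then have "X \<longlonglongrightarrow> cls F" using Cauchy_converges_subseq[OF X r_mono] by blast
  then show "convergent X" by (auto simp: convergent_def)
qed

section \<open>Translations and the one-dimensional free resolvent\<close>

instance l2 :: banach ..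

lemma AE_lborel_shift:
  fixes y :: "'a::euclidean_space"
  assumes "AE x in lborel. P x"
  shows "AE x in lborel. P (x + y)"
proof -
  have "AE x in distr lborel borel ((+) y). P x" unfolding lborel_distr_plus by (rule assms)
  from AE_distrD[OF _ this] show ?thesis by (simp add: add.commute)
qed

lemma integrable_lborel_shift:
  fixes y :: "'a::euclidean_space" and f :: "'a \<Rightarrow> 'b::{banach, second_countable_topology}"
  assumes "integrable lborel f"
  shows "integrable lborel (\<lambda>x. f (x + y))"
proof -
  have "integrable (distr lborel borel ((+) y)) f" using assms by (simp add: lborel_distr_plus)
  from integrable_distr[OF _ this] show ?thesis by (simp add: add.commute)
qed

lemma integral_lborel_shift:
  fixes y :: "'a::euclidean_space" and f :: "'a \<Rightarrow> 'b::{banach, second_countable_topology}"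
  assumes [measurable]: "f \<in> borel_measurable borel"
  shows "(LINT x|lborel. f (x + y)) = (LINT x|lborel. f x)"
proof -
  have "(LINT x|lborel. f x) = (LINT x|distr lborel borel ((+) y). f x)" by (simp add: lborel_distr_plus)
  also have "\<dots> = (LINT x|lborel. f (x + y))" by (subst integral_distr) (auto simp: add.commute)
  finally show ?thesis by simp
qed

lemma L2_shift: "f \<in> L2 \<Longrightarrow> (\<lambda>x. f (x + y)) \<in> L2"
  using integrable_lborel_shift[of "\<lambda>x. (cmod (f x))\<^sup>2" y] by (auto simp: L2_iff)

lift_definition translate :: "real^3 \<Rightarrow> l2 \<Rightarrow> l2" is "\<lambda>y f x. f (x + y)"
  by (simp add: l2_rel_def L2_shift AE_lborel_shift[where P = "\<lambda>x. _ x = _ x"])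

lemma cls_shift: "f \<in> L2 \<Longrightarrow> translate y (cls f) = cls (\<lambda>x. f (x + y))"
  by (rule translate.abs_eq) (auto simp: l2_rel_def)

lemma shift_add: "translate y (u + v) = translate y u + translate y v"
  by transfer (auto simp: l2_rel_def L2_add L2_shift)
lemma shift_cscale: "translate y (cscale c u) = cscale c (translate y u)"
  by transfer (auto simp: l2_rel_def L2_scale L2_shift)
lemma shift_scaleR: "translate y (c *\<^sub>R u) = c *\<^sub>R translate y u"
  by (simp add: shift_cscale flip: cscale_of_real)
lemma shift_shift: "translate y (translate z u) = translate (y + z) u"
  by transfer (auto simp: l2_rel_def L2_shift add.assoc)
lemma shift_0 [simp]: "translate 0 u = u"
  by transfer (auto simp: l2_rel_def)

lemma inner_shift_shift: "inner (translate y u) (translate y v) = inner u v"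
proof (cases u rule: l2_cases, cases v rule: l2_cases)
  fix f g assume fg: "f \<in> L2" "u = cls f" "g \<in> L2" "v = cls g"
  then have [measurable]: "f \<in> borel_measurable borel" "g \<in> borel_measurable borel" by auto
  show ?thesis using fg integral_lborel_shift[of "\<lambda>x. f x * cnj (g x)" y]
    by (simp add: cls_shift cls_inner L2_shift) (simp add: l2_inner_def)
qed

lemma inner_shift: "inner (translate y u) v = inner u (translate (- y) v)"
  using inner_shift_shift[of y u "translate (- y) v"] by (simp add: shift_shift)

lemma norm_shift [simp]: "norm (translate y u) = norm u"
  by (simp add: norm_eq_sqrt_inner inner_shift_shift)

lemma bounded_linear_shift: "bounded_linear (translate y)"
  by (rule bounded_linear_intro[where K = 1]) (auto simp: shift_add shift_scaleR)

lemma shift_zero [simp]: "translate y 0 = 0"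
  by (rule linear_0) (auto intro: bounded_linear.linear bounded_linear_shift)

lemma shift_diff: "translate y (u - v) = translate y u - translate y v"
  by (rule linear_diff) (auto intro: bounded_linear.linear bounded_linear_shift)

abbreviation translate3 :: "real \<Rightarrow> l2 \<Rightarrow> l2" where "translate3 t \<equiv> translate (t *\<^sub>R axis 3 1)"

lemma shift3_shift3: "translate3 s (translate3 t u) = translate3 (s + t) u"
  by (simp add: shift_shift scaleR_add_left)

section \<open>Strong continuity and Laplace transforms of translations\<close>

text \<open>Strong continuity along \<open>x_3\<close> is built into a subspace instead of being
  shown for every vector: it is closed, and it contains the test functions and with them the
  components of both closed graphs below.\<close>

definition CO :: "l2 set" where "CO = {u. continuous_on UNIV (\<lambda>t. translate3 t u)}"

lemma COI:
  assumes "((\<lambda>t. translate3 t u) \<longlongrightarrow> u) (at 0)"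
  shows "u \<in> CO"
  unfolding CO_def mem_Collect_eq continuous_on_def
proof (intro ballI)
  fix t :: real
  have "((\<lambda>h. translate3 t (translate3 h u)) \<longlongrightarrow> translate3 t u) (at 0)"
    by (intro bounded_linear.tendsto[OF bounded_linear_shift] assms)
  then have "((\<lambda>h. translate3 (t + h) u) \<longlongrightarrow> translate3 t u) (at 0)" by (simp add: shift3_shift3)
  then show "((\<lambda>t. translate3 t u) \<longlongrightarrow> translate3 t u) (at t within UNIV)"
    by (rule LIM_offset_zero_cancel)
qed

lemma continuous_on_shift3: "u \<in> CO \<Longrightarrow> continuous_on A f \<Longrightarrow> continuous_on A (\<lambda>t. translate3 (f t) u)"
  unfolding CO_def mem_Collect_eq by (rule continuous_on_compose2[of UNIV "\<lambda>t. translate3 t u"]) auto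

lemma subspace_CO: "subspace CO"
  by (auto simp: subspace_def CO_def shift_add shift_scaleR shift_zero intro!: continuous_intros)

lemma closed_CO: "closed CO"
  unfolding closed_sequential_limits
proof (intro allI impI COI)
  fix w u assume w: "(\<forall>n. w n \<in> CO) \<and> w \<longlonglongrightarrow> u"
  show "((\<lambda>t. translate3 t u) \<longlongrightarrow> u) (at 0)"
  proof (rule tendstoI)
    fix e :: real assume e: "e > 0"
    then obtain n where n: "norm (w n - u) < e / 3"
      using w LIMSEQ_D[of w u "e / 3"] by auto
    have "continuous_on UNIV (\<lambda>t. translate3 t (w n))" using w by (simp add: CO_def)
    then have "((\<lambda>t. translate3 t (w n)) \<longlongrightarrow> translate3 0 (w n)) (at 0)"
      unfolding continuous_on_def by blast
    then have "\<forall>\<^sub>F t in at 0. dist (translate3 t (w n)) (translate3 0 (w n)) < e / 3"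
      using e by (intro tendstoD) auto
    then show "\<forall>\<^sub>F t in at 0. dist (translate3 t u) u < e"
    proof eventually_elim
      case (elim t)
      have "translate3 t u - u = translate3 t (u - w n) + (translate3 t (w n) - w n) + (w n - u)"
        by (simp add: shift_diff)
      then have "norm (translate3 t u - u) \<le> norm (u - w n) + norm (translate3 t (w n) - w n) + norm (w n - u)"
        using norm_triangle_ineq[of "translate3 t (u - w n) + (translate3 t (w n) - w n)" "w n - u"]
          norm_triangle_ineq[of "translate3 t (u - w n)" "translate3 t (w n) - w n"] by simp
      then show ?case using n elim by (simp add: dist_norm norm_minus_commute)
    qed
  qed
qed

lemma CO_bounded_linear:
  assumes "bounded_linear T" "\<And>t. T (translate3 t u) = translate3 t (T u)" "u \<in> CO"
  shows "T u \<in> CO"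
  using bounded_linear.continuous_on[OF assms(1), of UNIV "\<lambda>t. translate3 t u"] assms(2,3)
  by (simp add: CO_def)

lemma bounded_linear_cscale: "bounded_linear (cscale c)"
  by (rule bounded_bilinear.bounded_linear_right[OF bounded_bilinear_cscale])

lemma cscale_diff: "cscale c (u - v) = cscale c u - cscale c v"
  by (rule bounded_bilinear.diff_right[OF bounded_bilinear_cscale])

lemma CO_cscale: "u \<in> CO \<Longrightarrow> cscale c u \<in> CO"
  by (rule CO_bounded_linear[OF bounded_linear_cscale]) (auto simp: shift_cscale)

definition orbit :: "real \<Rightarrow> complex \<Rightarrow> l2 \<Rightarrow> real \<Rightarrow> l2" where
  "orbit s k u t = cscale (exp (\<i> * k * of_real t)) (translate3 (s * t) u)"

lemma continuous_on_orbit: "u \<in> CO \<Longrightarrow> continuous_on A (orbit s k u)"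
  unfolding orbit_def
  by (intro bounded_bilinear.continuous_on[OF bounded_bilinear_cscale] continuous_on_shift3 continuous_intros)

lemma orbit_integrable: "u \<in> CO \<Longrightarrow> orbit s k u integrable_on {a..b}"
  by (intro integrable_continuous_interval continuous_on_orbit)

lemma norm_orbit: "norm (orbit s k u t) = exp (- Im k * t) * norm u"
  by (simp add: orbit_def norm_cscale norm_exp_eq_Re)

text \<open>The Laplace transform of the translations in direction \<open>s\<close>, that is
  \<open>- (\<i> k + s d/dx_3)^(-1)\<close>. Integer end points suffice for the improper integral
  because the integrand decays like \<open>exp (- Im k * t)\<close>.\<close>

definition S :: "real \<Rightarrow> complex \<Rightarrow> l2 \<Rightarrow> l2" where
  "S s k u = lim (\<lambda>n. integral {0..real n} (orbit s k u))"

lemma integral_exp_minus: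
  fixes \<eta> a b c :: real
  assumes "\<eta> > 0" "a \<le> b"
  shows "((\<lambda>t. exp (- \<eta> * t) * c) has_integral (exp (- \<eta> * a) - exp (- \<eta> * b)) / \<eta> * c) {a..b}"
proof (rule has_integral_mult_left)
  have "((\<lambda>t. exp (- \<eta> * t)) has_integral (- exp (- \<eta> * b) / \<eta> - (- exp (- \<eta> * a) / \<eta>))) {a..b}"
    using assms by (intro fundamental_theorem_of_calculus[where f = "\<lambda>t. - exp (- \<eta> * t) / \<eta>"])
      (auto intro!: derivative_eq_intros simp: has_real_derivative_iff_has_vector_derivative[symmetric])
  then show "((\<lambda>t. exp (- \<eta> * t)) has_integral (exp (- \<eta> * a) - exp (- \<eta> * b)) / \<eta>) {a..b}"
    by (simp add: diff_divide_distrib)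
qed

lemma norm_integral_orbit:
  assumes "u \<in> CO" "Im k > 0" "a \<le> b"
  shows "norm (integral {a..b} (orbit s k u)) \<le> exp (- Im k * a) / Im k * norm u"
proof -
  have "norm (integral {a..b} (orbit s k u)) \<le> integral {a..b} (\<lambda>t. exp (- Im k * t) * norm u)"
    using integral_exp_minus[OF assms(2,3), of "norm u"] assms(1)
    by (intro integral_norm_bound_integral orbit_integrable) (auto simp: norm_orbit)
  also have "\<dots> = (exp (- Im k * a) - exp (- Im k * b)) / Im k * norm u"
    using integral_exp_minus[OF assms(2,3), of "norm u"] by (rule integral_unique)
  also have "\<dots> \<le> exp (- Im k * a) / Im k * norm u"
    using assms by (intro mult_right_mono divide_right_mono) auto
  finally show ?thesis .
qed

lemma S_lim:
  assumes u: "u \<in> CO" and k: "Im k > 0"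
  shows "(\<lambda>n. integral {0..real n} (orbit s k u)) \<longlonglongrightarrow> S s k u"
proof -
  have d: "norm (integral {0..real m} (orbit s k u) - integral {0..real n} (orbit s k u))
     \<le> exp (- Im k * n) / Im k * norm u" if "n \<le> m" for m n :: nat
  proof -
    have "integral {0..real n} (orbit s k u) + integral {real n..real m} (orbit s k u)
        = integral {0..real m} (orbit s k u)"
      using that by (intro Henstock_Kurzweil_Integration.integral_combine orbit_integrable u) auto
    then have "integral {0..real m} (orbit s k u) - integral {0..real n} (orbit s k u)
        = integral {real n..real m} (orbit s k u)" by (simp add: algebra_simps)
    then show ?thesis using norm_integral_orbit[OF u k, of n m] that by simp
  qed
  have "(\<lambda>n. exp (- Im k * real n) / Im k * norm u) \<longlonglongrightarrow> 0 / Im k * norm u"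
  proof (intro tendsto_intros)
    have "filterlim (\<lambda>n. - (Im k * real n)) at_bot sequentially"
      unfolding filterlim_uminus_at_top[symmetric]
      using k by (intro filterlim_tendsto_pos_mult_at_top[OF tendsto_const] filterlim_real_sequentially) auto
    then show "(\<lambda>n. exp (- Im k * real n)) \<longlonglongrightarrow> 0"
      using filterlim_compose[OF exp_at_bot] by auto
  qed (use k in auto)
  then have lim0: "(\<lambda>n. exp (- Im k * real n) / Im k * norm u) \<longlonglongrightarrow> 0" by simp
  have "Cauchy (\<lambda>n. integral {0..real n} (orbit s k u))"
  proof (rule CauchyI')
    fix e :: real assume "e > 0"
    then obtain M where M: "\<And>n. n \<ge> M \<Longrightarrow> exp (- Im k * real n) / Im k * norm u < e"
      using order_tendstoD(2)[OF lim0] by (auto simp: eventually_sequentially)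
    have "dist (integral {0..real m} (orbit s k u)) (integral {0..real n} (orbit s k u)) < e"
      if "m \<ge> M" "n > m" for m n
      using d[of m n] M[of m] that by (simp add: dist_norm norm_minus_commute)
    then show "\<exists>M. \<forall>m\<ge>M. \<forall>n>m. dist (integral {0..real m} (orbit s k u)) (integral {0..real n} (orbit s k u)) < e"
      by blast
  qed
  then show ?thesis unfolding S_def using Cauchy_convergent_iff convergent_LIMSEQ_iff by blast
qed

lemma S_norm: "u \<in> CO \<Longrightarrow> Im k > 0 \<Longrightarrow> norm (S s k u) \<le> norm u / Im k"
proof -
  assume a: "u \<in> CO" "Im k > 0"
  show ?thesis
    using norm_integral_orbit[OF a, of 0]
    by (intro tendsto_upperbound[OF tendsto_norm[OF S_lim[OF a]]]) auto
qed

lemma orbit_add: "orbit s k (u + v) t = orbit s k u t + orbit s k v t"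
  by (simp add: orbit_def shift_add cscale_add)

lemma S_add:
  assumes "u \<in> CO" "v \<in> CO" "Im k > 0"
  shows "S s k (u + v) = S s k u + S s k v"
proof (rule LIMSEQ_unique[OF S_lim])
  show "u + v \<in> CO" using assms subspace_add[OF subspace_CO] by blast
  have "integral {0..real n} (orbit s k (u + v))
      = integral {0..real n} (orbit s k u) + integral {0..real n} (orbit s k v)" for n
    unfolding orbit_add using assms
    by (intro Henstock_Kurzweil_Integration.integral_add orbit_integrable)
  then show "(\<lambda>n. integral {0..real n} (orbit s k (u + v))) \<longlonglongrightarrow> S s k u + S s k v"
    using assms by (auto intro!: tendsto_add S_lim)
qed (fact assms)

text \<open>A bounded operator passes under the integral and the limit. Through
  \<open>E_bounded_linear\<close> this makes \<open>E k\<close> commute with \<open>B\<close>,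
  \<open>K\<close> and translations.\<close>

lemma S_bounded_linear:
  assumes T: "bounded_linear T" "\<And>c t. T (cscale c (translate3 t u)) = cscale c (translate3 t (T u))"
    and u: "u \<in> CO" and k: "Im k > 0"
  shows "T (S s k u) = S s k (T u)"
proof (rule LIMSEQ_unique)
  have Tu: "T u \<in> CO" using CO_bounded_linear[OF T(1) _ u] T(2)[of 1] by simp
  have "T (integral {0..real n} (orbit s k u)) = integral {0..real n} (orbit s k (T u))" for n
    using integral_linear[OF orbit_integrable[OF u] T(1), of 0 n s k] T(2)
    by (simp add: o_def orbit_def[abs_def])
  then show "(\<lambda>n. integral {0..real n} (orbit s k (T u))) \<longlonglongrightarrow> T (S s k u)"
    using bounded_linear.tendsto[OF T(1) S_lim[OF u k, of s]] by simp
  show "(\<lambda>n. integral {0..real n} (orbit s k (T u))) \<longlonglongrightarrow> S s k (T u)"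
    by (rule S_lim[OF Tu k])
qed

lemma S_cscale: "u \<in> CO \<Longrightarrow> Im k > 0 \<Longrightarrow> S s k (cscale c u) = cscale c (S s k u)"
  by (rule S_bounded_linear[OF bounded_linear_cscale, symmetric]) (simp_all add: shift_cscale cscale_cscale mult_ac)

lemma S_scaleR: "u \<in> CO \<Longrightarrow> Im k > 0 \<Longrightarrow> S s k (c *\<^sub>R u) = c *\<^sub>R S s k u"
  by (simp add: S_cscale flip: cscale_of_real)

lemma S_inner:
  assumes u: "u \<in> CO" and k: "Im k > 0"
  shows "(\<lambda>n. integral {0..real n} (\<lambda>t. inner (orbit s k u t) w)) \<longlonglongrightarrow> inner (S s k u) w"
  using bounded_linear.tendsto[OF bounded_linear_inner_left S_lim[OF u k]]
    integral_linear[OF orbit_integrable[OF u] bounded_linear_inner_left]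
  by (simp add: o_def)

text \<open>The adjoint of a translation is the opposite translation, and the conjugate of
  \<open>exp (\<i> k t)\<close> is \<open>exp (\<i> k' t)\<close> with \<open>k' = - cnj k\<close>,
  which lies in the upper half plane again.\<close>

lemma S_adjoint:
  assumes u: "u \<in> CO" and w: "w \<in> CO" and k: "Im k > 0"
  shows "inner (S s k u) w = inner u (S (- s) (- cnj k) w)"
proof (rule LIMSEQ_unique[OF S_inner[OF u k]])
  have "inner (orbit s k u t) w = inner (orbit (- s) (- cnj k) w t) u" for t
    by (subst inner_commute) (simp add: orbit_def inner_cscale inner_shift shift_cscale exp_cnj inner_commute[of w])
  then show "(\<lambda>n. integral {0..real n} (\<lambda>t. inner (orbit s k u t) w)) \<longlonglongrightarrow> inner u (S (- s) (- cnj k) w)"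
    using S_inner[OF w, of "- cnj k" "- s" u] k by (simp add: inner_commute)
qed

text \<open>This is how \<open>S\<close> preserves closed subspaces of products.\<close>

lemma S_relation:
  assumes "u1 \<in> CO" "u2 \<in> CO" "u3 \<in> CO" and k: "Im k > 0"
    and 0: "\<And>c t. inner (cscale c (translate3 t u1)) y1 + inner (cscale c (translate3 t u2)) y2
      + inner (cscale c (translate3 t u3)) y3 = 0"
  shows "inner (S s k u1) y1 + inner (S s k u2) y2 + inner (S s k u3) y3 = 0"
proof (rule LIMSEQ_unique)
  show "(\<lambda>n. integral {0..real n} (\<lambda>t. inner (orbit s k u1 t) y1) + integral {0..real n} (\<lambda>t. inner (orbit s k u2 t) y2)
      + integral {0..real n} (\<lambda>t. inner (orbit s k u3 t) y3))
      \<longlonglongrightarrow> inner (S s k u1) y1 + inner (S s k u2) y2 + inner (S s k u3) y3"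
    using assms by (intro tendsto_add S_inner)
  have i: "(\<lambda>t. inner (orbit s k u t) y) integrable_on {0..a}" if "u \<in> CO" for u y a
    by (intro integrable_continuous_interval continuous_intros continuous_on_orbit that)
  have "integral {0..real n} (\<lambda>t. inner (orbit s k u1 t) y1) + integral {0..real n} (\<lambda>t. inner (orbit s k u2 t) y2)
      + integral {0..real n} (\<lambda>t. inner (orbit s k u3 t) y3) = 0" for n
  proof -
    have "integral {0..real n} (\<lambda>t. inner (orbit s k u1 t) y1 + inner (orbit s k u2 t) y2 + inner (orbit s k u3 t) y3) = 0"
      using 0 by (simp add: orbit_def)
    then show ?thesis
      using assms by (simp add: Henstock_Kurzweil_Integration.integral_add Henstock_Kurzweil_Integration.integrable_add i)
  qed
  then show "(\<lambda>n. integral {0..real n} (\<lambda>t. inner (orbit s k u1 t) y1) + integral {0..real n} (\<lambda>t. inner (orbit s k u2 t) y2)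
      + integral {0..real n} (\<lambda>t. inner (orbit s k u3 t) y3)) \<longlonglongrightarrow> 0" by simp
qed

text \<open>\<open>u\<close> is in the domain of the generator of the translations along
  \<open>x_3\<close>; membership in \<open>CO\<close> makes the Laplace transforms of
  \<open>u\<close> and \<open>q\<close> converge.\<close>

definition has_d3 :: "l2 \<Rightarrow> l2 \<Rightarrow> bool" where
  "has_d3 u q \<longleftrightarrow> u \<in> CO \<and> q \<in> CO \<and> ((\<lambda>t. translate3 t u) has_vector_derivative q) (at 0)"

lemma has_d3_at:
  assumes "has_d3 u q"
  shows "((\<lambda>t. translate3 t u) has_vector_derivative translate3 t q) (at t within A)"
proof -
  have "((\<lambda>h. translate3 h u) has_vector_derivative q) (at (t - t))" using assms by (simp add: has_d3_def)
  moreover have "((\<lambda>x. x - t) has_vector_derivative 1) (at t)"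
    by (auto intro!: derivative_eq_intros)
  ultimately have "(((\<lambda>h. translate3 h u) \<circ> (\<lambda>x. x - t)) has_vector_derivative 1 *\<^sub>R q) (at t)"
    by (intro vector_diff_chain_at)
  from bounded_linear.has_vector_derivative[OF bounded_linear_shift this]
  have "((\<lambda>x. translate3 t (translate3 (x - t) u)) has_vector_derivative translate3 t q) (at t)"
    by (simp add: o_def)
  then have "((\<lambda>x. translate3 x u) has_vector_derivative translate3 t q) (at t)" by (simp add: shift3_shift3)
  then show ?thesis by (rule has_vector_derivative_at_within)
qed

text \<open>The derivative of the orbit of \<open>u\<close> is \<open>\<i> k\<close> times this
  orbit plus the orbit of \<open>s q\<close>. Integrate it from 0 to \<open>n\<close>; the boundary
  term at \<open>n\<close> decays.\<close>

lemma S_derivative: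
  assumes q: "has_d3 u q" and k: "Im k > 0"
  shows "S s k (s *\<^sub>R q) = - u - cscale (\<i> * k) (S s k u)"
proof -
  have u: "u \<in> CO" and q': "q \<in> CO" using q by (auto simp: has_d3_def)
  have sq: "s *\<^sub>R q \<in> CO" by (intro subspace_scale subspace_CO q')
  have I: "integral {0..real n} (orbit s k (s *\<^sub>R q))
      = orbit s k u n - u - cscale (\<i> * k) (integral {0..real n} (orbit s k u))" for n
  proof -
    have "((\<lambda>t. cscale (\<i> * k) (orbit s k u t) + orbit s k (s *\<^sub>R q) t) has_integral
        (orbit s k u n - orbit s k u 0)) {0..real n}"
    proof (rule fundamental_theorem_of_calculus)
      fix t assume "t \<in> {0..real n}"
      have "((\<lambda>t. exp (\<i> * k * of_real t)) has_vector_derivative \<i> * k * exp (\<i> * k * of_real t)) (at t within {0..real n})"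
        by (auto intro!: derivative_eq_intros has_vector_derivative_real_field)
      moreover have "((\<lambda>t. translate3 (s * t) u) has_vector_derivative s *\<^sub>R translate3 (s * t) q) (at t within {0..real n})"
        using vector_diff_chain_within[of "\<lambda>t. s * t" s t "{0..real n}" "\<lambda>t. translate3 t u" "translate3 (s * t) q"]
          has_d3_at[OF q] DERIV_cmult_Id[of s t "{0..real n}"]
        by (auto simp: o_def has_real_derivative_iff_has_vector_derivative)
      ultimately show "(orbit s k u has_vector_derivative cscale (\<i> * k) (orbit s k u t) + orbit s k (s *\<^sub>R q) t)
         (at t within {0..real n})"
        unfolding orbit_def[abs_def]
        using bounded_bilinear.has_vector_derivative[OF bounded_bilinear_cscale]
        by (fastforce simp: cscale_cscale shift_scaleR add.commute)
    qed simp
    moreover have "((\<lambda>t. cscale (\<i> * k) (orbit s k u t) + orbit s k (s *\<^sub>R q) t) has_integral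
        cscale (\<i> * k) (integral {0..real n} (orbit s k u)) + integral {0..real n} (orbit s k (s *\<^sub>R q))) {0..real n}"
      using has_integral_linear[OF integrable_integral[OF orbit_integrable[OF u]] bounded_linear_cscale]
      by (intro has_integral_add integrable_integral orbit_integrable sq) (simp add: o_def)
    ultimately have "orbit s k u n - orbit s k u 0 = cscale (\<i> * k) (integral {0..real n} (orbit s k u))
        + integral {0..real n} (orbit s k (s *\<^sub>R q))" by (rule has_integral_unique)
    then show ?thesis by (simp add: orbit_def[of s k u 0] algebra_simps)
  qed
  have "(\<lambda>n. norm (orbit s k u (real n))) \<longlonglongrightarrow> 0"
  proof -
    have "filterlim (\<lambda>n. - (Im k * real n)) at_bot sequentially"
      unfolding filterlim_uminus_at_top[symmetric]
      using k by (intro filterlim_tendsto_pos_mult_at_top[OF tendsto_const] filterlim_real_sequentially) auto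
    then have "(\<lambda>n. exp (- Im k * real n) * norm u) \<longlonglongrightarrow> 0 * norm u"
      using filterlim_compose[OF exp_at_bot] by (intro tendsto_mult tendsto_const) auto
    then show ?thesis by (simp add: norm_orbit)
  qed
  then have "(\<lambda>n. orbit s k u n - u - cscale (\<i> * k) (integral {0..real n} (orbit s k u)))
      \<longlonglongrightarrow> 0 - u - cscale (\<i> * k) (S s k u)"
    using u k by (intro tendsto_diff tendsto_const bounded_linear.tendsto[OF bounded_linear_cscale] S_lim)
      (simp_all add: tendsto_norm_zero_iff)
  then show ?thesis using LIMSEQ_unique[OF S_lim[OF sq k, of s]] unfolding I by simp
qed

text \<open>Accretivity of the resolvent of a contraction semigroup, without use of the generator.
  Translating \<open>x = S s k u\<close> by \<open>s r\<close> yields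
  \<open>exp (\<sigma> r)\<close> times the tail \<open>x - I r\<close> of the integral.
  Translations are isometric, so \<open>x - I r\<close> is no longer than \<open>x\<close>, and
  therefore \<open>inner x (I r) >= 0\<close>. Dividing by \<open>r\<close> and letting
  \<open>r\<close> tend to 0 replaces \<open>I r\<close> by \<open>u\<close>.\<close>

lemma S_positive:
  assumes u: "u \<in> CO" and \<sigma>: "\<sigma> > 0"
  shows "inner (S s (\<i> * of_real \<sigma>) u) u \<ge> 0"
proof -
  define k where "k = \<i> * of_real \<sigma>"
  have k: "Im k > 0" "Re k = 0" using \<sigma> by (auto simp: k_def)
  define x where "x = S s k u"
  define I where "I r = integral {0..r} (orbit s k u)" for r
  have step: "orbit s k (translate3 (s * r) u) t = exp (\<sigma> * r) *\<^sub>R orbit s k u (r + t)" for r t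
  proof -
    have "exp (\<i> * k * of_real t) = of_real (exp (\<sigma> * r)) * exp (\<i> * k * of_real (r + t))"
      by (simp add: k_def exp_of_real[symmetric] algebra_simps flip: exp_add mult.assoc)
    then show ?thesis
      by (simp add: orbit_def shift3_shift3 cscale_cscale algebra_simps flip: cscale_of_real)
  qed
  have shifted: "translate3 (s * r) x = exp (\<sigma> * r) *\<^sub>R (x - I r)" if r: "r \<ge> 0" for r
  proof -
    have ru: "translate3 (s * r) u \<in> CO"
      by (rule CO_bounded_linear[OF bounded_linear_shift _ u]) (simp add: shift_shift add.commute)
    have "translate3 (s * r) x = S s k (translate3 (s * r) u)" unfolding x_def
      by (rule S_bounded_linear[OF bounded_linear_shift _ u k(1)]) (simp add: shift_cscale shift_shift add.commute)
    have "integral {0..real n} (orbit s k (translate3 (s * r) u))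
        = exp (\<sigma> * r) *\<^sub>R (integral {0..real n} (orbit s k u) + integral {real n..real n + r} (orbit s k u) - I r)" for n
    proof -
      have "integral {0..real n} (orbit s k (translate3 (s * r) u)) = exp (\<sigma> * r) *\<^sub>R integral {0..real n} (orbit s k u \<circ> (+) r)"
        by (simp add: step[abs_def] o_def)
      also have "integral {0..real n} (orbit s k u \<circ> (+) r) = integral {r..real n + r} (orbit s k u)"
        by (simp add: integral_shift_Icc_real)
      also have "\<dots> = integral {0..real n + r} (orbit s k u) - I r"
        using Henstock_Kurzweil_Integration.integral_combine[of 0 r "real n + r" "orbit s k u"] r orbit_integrable[OF u]
        by (simp add: I_def algebra_simps)
      also have "integral {0..real n + r} (orbit s k u)
          = integral {0..real n} (orbit s k u) + integral {real n..real n + r} (orbit s k u)"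
        using Henstock_Kurzweil_Integration.integral_combine[of 0 "real n" "real n + r" "orbit s k u"] r orbit_integrable[OF u]
        by simp
      finally show ?thesis .
    qed
    moreover have "(\<lambda>n. integral {real n..real n + r} (orbit s k u)) \<longlonglongrightarrow> 0"
    proof (rule tendsto_norm_zero_cancel, rule tendsto_sandwich[OF _ _ tendsto_const])
      have "filterlim (\<lambda>n. - (Im k * real n)) at_bot sequentially"
        unfolding filterlim_uminus_at_top[symmetric]
        using k by (intro filterlim_tendsto_pos_mult_at_top[OF tendsto_const] filterlim_real_sequentially) auto
      then have "(\<lambda>n. exp (- Im k * real n) / Im k * norm u) \<longlonglongrightarrow> 0 / Im k * norm u"
        using filterlim_compose[OF exp_at_bot] k by (intro tendsto_intros) auto
      then show "(\<lambda>n. exp (- Im k * real n) / Im k * norm u) \<longlonglongrightarrow> 0" by simp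
    qed (use norm_integral_orbit[OF u k(1)] r in auto)
    ultimately have "(\<lambda>n. integral {0..real n} (orbit s k (translate3 (s * r) u))) \<longlonglongrightarrow> exp (\<sigma> * r) *\<^sub>R (x + 0 - I r)"
      unfolding x_def by (simp only:) (intro tendsto_intros S_lim[OF u k(1)])
    then show ?thesis
      using LIMSEQ_unique[OF S_lim[OF ru k(1), of s]] \<open>translate3 (s * r) x = _\<close> by auto
  qed
  have nonneg: "inner x (I r) \<ge> 0" if r: "r \<ge> 0" for r
  proof -
    have "norm x = exp (\<sigma> * r) * norm (x - I r)"
      using shifted[OF r] norm_shift[of "(s * r) *\<^sub>R axis 3 1" x] by simp
    then have "norm (x - I r) = exp (- (\<sigma> * r)) * norm x" by (simp add: exp_minus)
    also have "\<dots> \<le> norm x" using \<sigma> r by (intro mult_left_le_one_le) auto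
    finally have "(norm (x - I r))\<^sup>2 \<le> (norm x)\<^sup>2" by (intro power_mono) auto
    then have "2 * inner x (I r) \<ge> inner (I r) (I r)"
      by (simp add: power2_norm_eq_inner inner_diff_left inner_diff_right inner_commute)
    then show ?thesis using inner_ge_zero[of "I r"] by linarith
  qed
  have "(I has_vector_derivative u) (at 0 within {0..1})"
    using integral_has_vector_derivative[OF continuous_on_orbit[OF u, of "{0..1}" s k], of 0]
    by (simp add: I_def[abs_def] orbit_def)
  from bounded_linear.has_vector_derivative[OF bounded_linear_inner_right this, of x]
  have "((\<lambda>r. inner x (I r)) has_field_derivative inner x u) (at 0 within {0..1})"
    by (simp add: has_real_derivative_iff_has_vector_derivative)
  then have "((\<lambda>r. inner x (I r) / r) \<longlongrightarrow> inner x u) (at_right 0)"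
    by (simp add: has_field_derivative_iff I_def at_within_Icc_at_right)
  then have "inner x u \<ge> 0"
    by (rule tendsto_lowerbound)
      (auto intro!: eventually_mono[OF eventually_at_right_less[of 0]] divide_nonneg_nonneg nonneg)
  then show ?thesis by (simp add: x_def k_def)
qed

text \<open>\<open>E k\<close> is convolution with \<open>\<i> / (2 * k) * exp (\<i> * k * \<bar>t\<bar>)\<close>, the inverse of \<open>- (d/dx\<^sub>3)\<^sup>2 - k\<^sup>2\<close>, and
  \<open>E1 k\<close> is its derivative.\<close>

definition E :: "complex \<Rightarrow> l2 \<Rightarrow> l2" where
  "E k u = cscale (\<i> / (2 * k)) (S 1 k u + S (- 1) k u)"

definition E1 :: "complex \<Rightarrow> l2 \<Rightarrow> l2" where
  "E1 k u = (1 / 2) *\<^sub>R (S 1 k u - S (- 1) k u)"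

lemma E_add: "u \<in> CO \<Longrightarrow> v \<in> CO \<Longrightarrow> Im k > 0 \<Longrightarrow> E k (u + v) = E k u + E k v"
  by (simp add: E_def S_add cscale_add algebra_simps)

lemma E_cscale: "u \<in> CO \<Longrightarrow> Im k > 0 \<Longrightarrow> E k (cscale c u) = cscale c (E k u)"
  by (simp add: E_def S_cscale cscale_add cscale_cscale mult_ac)

lemma E_scaleR: "u \<in> CO \<Longrightarrow> Im k > 0 \<Longrightarrow> E k (c *\<^sub>R u) = c *\<^sub>R E k u"
  by (simp add: E_cscale flip: cscale_of_real)

lemma E_bounded_linear:
  assumes "bounded_linear T" "\<And>c u. T (cscale c u) = cscale c (T u)" "\<And>t u. T (translate3 t u) = translate3 t (T u)"
    "u \<in> CO" "Im k > 0"
  shows "T (E k u) = E k (T u)"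
  using S_bounded_linear[of T u k] assms by (simp add: E_def linear_add[OF bounded_linear.linear[OF assms(1)]])

lemma E_norm:
  assumes u: "u \<in> CO" and k: "Im k > 0"
  shows "norm (E k u) \<le> norm u / (cmod k * Im k)"
proof -
  have "norm (S 1 k u + S (- 1) k u) \<le> norm u / Im k + norm u / Im k"
    by (rule order_trans[OF norm_triangle_ineq]) (intro add_mono S_norm u k)
  then have "norm (E k u) \<le> 1 / (2 * cmod k) * (norm u / Im k + norm u / Im k)"
    unfolding E_def norm_cscale by (intro mult_mono) (auto simp: norm_divide norm_mult)
  also have "\<dots> = norm u / (cmod k * Im k)" by simp
  finally show ?thesis .
qed

lemma E1_norm:
  assumes u: "u \<in> CO" and k: "Im k > 0"
  shows "norm (E1 k u) \<le> norm u / Im k"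
proof -
  have "norm (S 1 k u - S (- 1) k u) \<le> norm u / Im k + norm u / Im k"
    by (rule order_trans[OF norm_triangle_ineq4]) (intro add_mono S_norm u k)
  then show ?thesis unfolding E1_def by (simp add: mult.commute)
qed

lemma E_adjoint:
  assumes "u \<in> CO" "w \<in> CO" "Im k > 0"
  shows "inner (E k u) w = inner u (E (- cnj k) w)"
  using assms S_adjoint[of u "cscale (- (\<i> / (2 * cnj k))) w" k] CO_cscale[of w]
  by (simp add: E_def inner_cscale inner_add_left inner_add_right S_cscale cscale_add) 

lemma E1_adjoint:
  assumes "u \<in> CO" "w \<in> CO" "Im k > 0"
  shows "inner (E1 k u) w = - inner u (E1 (- cnj k) w)"
  using assms S_adjoint[of u w k] by (simp add: E1_def inner_diff_left inner_diff_right field_simps)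

lemma S_derivative_signs:
  assumes "has_d3 u q" "Im k > 0"
  shows "S 1 k q = - u - cscale (\<i> * k) (S 1 k u)" "S (- 1) k q = u + cscale (\<i> * k) (S (- 1) k u)"
proof -
  have q: "q \<in> CO" using assms by (simp add: has_d3_def)
  show "S 1 k q = - u - cscale (\<i> * k) (S 1 k u)" using S_derivative[OF assms, of 1] by simp
  have "- S (- 1) k q = - u - cscale (\<i> * k) (S (- 1) k u)"
    using S_derivative[OF assms, of "-1"] S_scaleR[OF q assms(2), of "-1" "-1"] by simp
  then show "S (- 1) k q = u + cscale (\<i> * k) (S (- 1) k u)" by (simp add: minus_equation_iff algebra_simps)
qed

lemma E_derivative:
  assumes "has_d3 u q" "Im k > 0"
  shows "E k q = E1 k u"
proof -
  have "k \<noteq> 0" using assms by auto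
  have "E k q = cscale (\<i> / (2 * k)) (cscale (\<i> * k) (S (- 1) k u - S 1 k u))"
    unfolding E_def S_derivative_signs[OF assms] by (simp add: cscale_diff algebra_simps)
  also have "\<dots> = cscale (of_real (- 1 / 2)) (S (- 1) k u - S 1 k u)"
    using \<open>k \<noteq> 0\<close> by (simp add: cscale_cscale)
  finally show ?thesis unfolding cscale_of_real E1_def by (simp add: algebra_simps)
qed

text \<open>With \<open>E_derivative\<close> this says that \<open>E k\<close> inverts
  \<open>- (d/dx_3)^2 - k^2\<close>. The derivative stays inside \<open>E1\<close>, so that no
  domain question arises for \<open>E k u\<close>.\<close>

lemma E1_derivative:
  assumes "has_d3 u q" "Im k > 0"
  shows "E1 k q = - u - cscale (k\<^sup>2) (E k u)"
proof -
  have "k \<noteq> 0" using assms by auto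
  then have "cscale (k\<^sup>2) (E k u) = cscale (of_real (1 / 2)) (cscale (\<i> * k) (S 1 k u + S (- 1) k u))"
    by (simp add: E_def cscale_cscale power2_eq_square mult_ac)
  then show ?thesis unfolding E1_def S_derivative_signs[OF assms] cscale_of_real
    by (simp add: cscale_add algebra_simps flip: scaleR_add_left)
qed

section \<open>Multiplication operators\<close>

lemma borel_measurable_vec_nth [measurable]: "(\<lambda>x::real^'n. x $ i) \<in> borel_measurable borel"
  by (intro borel_measurable_continuous_onI continuous_intros)

definition mulf :: "(real^3 \<Rightarrow> complex) \<Rightarrow> l2 \<Rightarrow> l2" where
  "mulf h u = cls (\<lambda>x. h x * rep u x)"

locale bounded_multiplier =
  fixes h :: "real^3 \<Rightarrow> complex" and C :: real
  assumes meas [measurable]: "h \<in> borel_measurable borel" and bound: "AE x in lborel. cmod (h x) \<le> C"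
begin

lemma L2: "f \<in> L2 \<Longrightarrow> (\<lambda>x. h x * f x) \<in> L2"
  by (rule L2_mult_bounded[OF meas bound])

lemma cls: "f \<in> L2 \<Longrightarrow> mulf h (cls f) = cls (\<lambda>x. h x * f x)"
  unfolding mulf_def by (subst cls_eq_iff) (auto simp: L2 dest!: rep_cls elim!: eventually_mono)

lemma add: "mulf h (u + v) = mulf h u + mulf h v"
proof -
  have "u + v = cls (\<lambda>x. rep u x + rep v x)" by (simp flip: cls_add)
  then have "mulf h (u + v) = cls (\<lambda>x. h x * rep u x + h x * rep v x)"
    by (simp add: cls L2_add distrib_left)
  then show ?thesis by (simp add: mulf_def L2 flip: cls_add)
qed

lemma cscale: "mulf h (cscale c u) = cscale c (mulf h u)"
proof -
  have "cscale c u = cls (\<lambda>x. c * rep u x)" by (simp flip: cls_cscale)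
  then have "mulf h (cscale c u) = cls (\<lambda>x. c * (h x * rep u x))"
    by (simp add: cls L2_scale mult.left_commute)
  also have "\<dots> = cscale c (mulf h u)" by (simp add: mulf_def cls_cscale L2)
  finally show ?thesis .
qed

lemma scaleR: "mulf h (c *\<^sub>R u) = c *\<^sub>R mulf h u"
  by (simp add: cscale flip: cscale_of_real)

lemma linear: "linear (mulf h)"
  by (intro linearI add scaleR)

lemma inner:
  assumes real: "\<And>x. cnj (h x) = h x"
  shows "inner (mulf h u) v = inner u (mulf h v)"
proof (cases u rule: l2_cases, cases v rule: l2_cases)
  fix f g assume "f \<in> L2" "u = abs_l2 f" "g \<in> L2" "v = abs_l2 g"
  then show ?thesis by (simp add: cls cls_inner L2) (simp add: l2_inner_def real mult_ac)
qed

lemma norm_le: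
  assumes "C \<ge> 0"
  shows "norm (mulf h u) \<le> C * norm u"
proof (cases u rule: l2_cases)
  fix f assume f: "f \<in> L2" "u = abs_l2 f"
  have "(norm (mulf h u))\<^sup>2 = (LINT x|lborel. (cmod (h x * f x))\<^sup>2)"
    using f by (simp add: cls norm_cls_squared L2)
  also have "\<dots> \<le> (LINT x|lborel. C\<^sup>2 * (cmod (f x))\<^sup>2)"
  proof (rule integral_mono_AE)
    show "AE x in lborel. (cmod (h x * f x))\<^sup>2 \<le> C\<^sup>2 * (cmod (f x))\<^sup>2"
      using bound by eventually_elim (auto simp: norm_mult power_mult_distrib intro!: mult_right_mono power_mono)
  qed (use f L2[OF f(1)] in \<open>auto simp: L2_iff\<close>)
  also have "\<dots> = (C * norm u)\<^sup>2" using f by (simp add: power_mult_distrib norm_cls_squared)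
  finally show ?thesis by (rule power2_le_imp_le) (use assms in auto)
qed

lemma bounded_linear: "C \<ge> 0 \<Longrightarrow> bounded_linear (mulf h)"
  using norm_le by (intro bounded_linear_intro[where K = C] add scaleR) (simp add: mult.commute)

end

section \<open>The weighted estimate for the one-dimensional resolvent\<close>

lemma nn_integral_lborel_shift:
  fixes y :: "'a::euclidean_space"
  assumes [measurable]: "f \<in> borel_measurable borel"
  shows "(\<integral>\<^sup>+x. f (x + y) \<partial>lborel) = (\<integral>\<^sup>+x. f x \<partial>lborel)"
proof -
  have "(\<integral>\<^sup>+x. f x \<partial>lborel) = (\<integral>\<^sup>+x. f x \<partial>distr lborel borel ((+) y))" by (simp only: lborel_distr_plus)
  also have "\<dots> = (\<integral>\<^sup>+x. f (x + y) \<partial>lborel)" by (subst nn_integral_distr) (auto simp: add.commute)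
  finally show ?thesis by simp
qed

text \<open>The factor \<open>|t|\<close> is the distance of the two points along
  \<open>x_3\<close>, and \<open>|a - b| <= 2 sqrt (1 + a^2) sqrt (1 + b^2)\<close> distributes it
  over the two weights. The inequality of the geometric and arithmetic means then separates the
  points, and by Fubini the integral over \<open>t\<close> only sees the one-dimensional
  weight.\<close>

lemma weighted_autocorrelation:
  fixes w :: "real \<Rightarrow> real"
  assumes f: "f \<in> L2" and [measurable]: "w \<in> borel_measurable borel" and w: "\<And>y. w y \<ge> 0" and s: "s = 1 \<or> s = - 1"
  shows "(\<integral>\<^sup>+t. \<integral>\<^sup>+x. ennreal (\<bar>t\<bar> * (w ((x + (s * t) *\<^sub>R axis 3 1) $ 3) * cmod (f (x + (s * t) *\<^sub>R axis 3 1))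
      * (w (x $ 3) * cmod (f x)))) \<partial>lborel \<partial>lborel)
    \<le> 2 * (\<integral>\<^sup>+y. ennreal ((1 + y\<^sup>2) * (w y)\<^sup>2) \<partial>lborel) * (\<integral>\<^sup>+x. ennreal ((cmod (f x))\<^sup>2) \<partial>lborel)"
proof -
  have [measurable]: "f \<in> borel_measurable borel" using f by auto
  define V where "V y = ennreal ((1 + y\<^sup>2) * (w y)\<^sup>2)" for y
  have [measurable]: "V \<in> borel_measurable borel" unfolding V_def by measurable
  define F where "F x = ennreal ((cmod (f x))\<^sup>2)" for x
  have [measurable]: "F \<in> borel_measurable borel" unfolding F_def by measurable
  define J where "J = (\<integral>\<^sup>+y. V y \<partial>lborel)"
  have le: "ennreal (\<bar>t\<bar> * (w ((x + (s * t) *\<^sub>R axis 3 1) $ 3) * cmod (f (x + (s * t) *\<^sub>R axis 3 1)) * (w (x $ 3) * cmod (f x))))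
      \<le> V (x $ 3) * F (x + (s * t) *\<^sub>R axis 3 1) + V (x $ 3 + s * t) * F x" for x t
  proof -
    define a b q where "a = x $ 3 + s * t" and "b = x $ 3" and "q = (\<lambda>y::real. sqrt (1 + y\<^sup>2))"
    define A B where "A = cmod (f (x + (s * t) *\<^sub>R axis 3 1))" and "B = cmod (f x)"
    have q: "q y \<ge> 1" "\<bar>y\<bar> \<le> q y" "(q y)\<^sup>2 = 1 + y\<^sup>2" for y
      unfolding q_def by (auto intro!: real_le_rsqrt)
    have "\<bar>t\<bar> = \<bar>a - b\<bar>" using s by (auto simp: a_def b_def)
    also have "\<dots> \<le> q a + q b" using q(2)[of a] q(2)[of b] by linarith
    also have "\<dots> \<le> 2 * (q a * q b)"
    proof -
      have "1 * q b \<le> q a * q b" "q a * 1 \<le> q a * q b"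
        using q(1)[of a] q(1)[of b] by (intro mult_mono; simp)+
      then show ?thesis by simp
    qed
    finally have t: "\<bar>t\<bar> \<le> 2 * (q a * q b)" .
    have "\<bar>t\<bar> * (w a * A * (w b * B)) \<le> 2 * (q a * q b) * (w a * A * (w b * B))"
      using w by (intro mult_right_mono t) (auto simp: A_def B_def)
    also have "\<dots> = 2 * (q b * w b * A) * (q a * w a * B)" by (simp add: mult_ac)
    also have "\<dots> \<le> (q b * w b * A)\<^sup>2 + (q a * w a * B)\<^sup>2" by (rule sum_squares_bound)
    also have "\<dots> = (1 + b\<^sup>2) * (w b)\<^sup>2 * A\<^sup>2 + (1 + a\<^sup>2) * (w a)\<^sup>2 * B\<^sup>2"
      by (simp add: power_mult_distrib q)
    finally show ?thesis
      by (simp add: V_def F_def ennreal_mult'[symmetric] ennreal_plus[symmetric] a_def b_def A_def B_def axis_def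
          del: ennreal_plus)
  qed
  have tt: "(\<integral>\<^sup>+t. V (y + c * t) \<partial>lborel) = J" if "c = 1 \<or> c = -1" for c y
    using nn_integral_real_affine[of V c y] that unfolding J_def by auto
  have "(\<integral>\<^sup>+t. \<integral>\<^sup>+x. ennreal (\<bar>t\<bar> * (w ((x + (s * t) *\<^sub>R axis 3 1) $ 3) * cmod (f (x + (s * t) *\<^sub>R axis 3 1))
      * (w (x $ 3) * cmod (f x)))) \<partial>lborel \<partial>lborel)
    \<le> (\<integral>\<^sup>+t. \<integral>\<^sup>+x. (V (x $ 3) * F (x + (s * t) *\<^sub>R axis 3 1) + V (x $ 3 + s * t) * F x) \<partial>lborel \<partial>lborel)"
    by (intro nn_integral_mono le)
  also have "\<dots> = (\<integral>\<^sup>+t. \<integral>\<^sup>+x. (V (x $ 3 + (- s) * t) + V (x $ 3 + s * t)) * F x \<partial>lborel \<partial>lborel)"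
  proof (rule nn_integral_cong)
    fix t :: real
    have "(\<integral>\<^sup>+x. V (x $ 3) * F (x + (s * t) *\<^sub>R axis 3 1) \<partial>lborel)
        = (\<integral>\<^sup>+x. V (x $ 3 + (- s) * t) * F x \<partial>lborel)"
      using nn_integral_lborel_shift[of "\<lambda>x. V (x $ 3 + (- s) * t) * F x" "(s * t) *\<^sub>R axis 3 1"]
      by (simp add: axis_def)
    then show "(\<integral>\<^sup>+x. (V (x $ 3) * F (x + (s * t) *\<^sub>R axis 3 1) + V (x $ 3 + s * t) * F x) \<partial>lborel)
       = (\<integral>\<^sup>+x. (V (x $ 3 + (- s) * t) + V (x $ 3 + s * t)) * F x \<partial>lborel)"
      by (simp add: nn_integral_add distrib_right)
  qed
  also have "\<dots> = (\<integral>\<^sup>+x. \<integral>\<^sup>+t. (V (x $ 3 + (- s) * t) + V (x $ 3 + s * t)) * F x \<partial>lborel \<partial>lborel)"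
    by (rule lborel_pair.Fubini') measurable
  also have "\<dots> = (\<integral>\<^sup>+x. (J + J) * F x \<partial>lborel)"
  proof (rule nn_integral_cong)
    fix x :: "real^3"
    have "(\<integral>\<^sup>+t. (V (x $ 3 + (- s) * t) + V (x $ 3 + s * t)) * F x \<partial>lborel)
       = (\<integral>\<^sup>+t. (V (x $ 3 + (- s) * t) + V (x $ 3 + s * t)) \<partial>lborel) * F x"
      by (rule nn_integral_multc) measurable
    also have "(\<integral>\<^sup>+t. (V (x $ 3 + (- s) * t) + V (x $ 3 + s * t)) \<partial>lborel) = J + J"
      by (subst nn_integral_add) (use s tt[of "- s" "x $ 3"] tt[of s "x $ 3"] in auto)
    finally show "(\<integral>\<^sup>+t. (V (x $ 3 + (- s) * t) + V (x $ 3 + s * t)) * F x \<partial>lborel) = (J + J) * F x" .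
  qed
  also have "\<dots> = 2 * J * (\<integral>\<^sup>+x. F x \<partial>lborel)"
    by (subst nn_integral_cmult) (auto simp: mult_2)
  finally show ?thesis by (simp add: J_def V_def F_def)
qed

text \<open>The derivative of \<open>exp\<close> has modulus at most 1 on the closed left half
  plane, which is convex.\<close>

lemma cmod_exp_diff_le:
  assumes "Re a \<le> 0" "Re b \<le> 0"
  shows "cmod (exp a - exp b) \<le> cmod (a - b)"
proof -
  have "cmod (exp a - exp b) \<le> 1 * cmod (a - b)"
    by (rule field_differentiable_bound[of "{z. Re z \<le> 0}" exp exp])
      (use assms in \<open>auto intro!: derivative_eq_intros simp: convex_halfspace_Re_le\<close>)
  then show ?thesis by simp
qed

lemma abs_integral_le_nn:
  fixes F :: "real \<Rightarrow> real"
  assumes F: "continuous_on {0..a} F" and le: "(\<integral>\<^sup>+t. indicator {0..a} t * ennreal \<bar>F t\<bar> \<partial>lborel) \<le> ennreal K" and K: "K \<ge> 0"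
  shows "\<bar>integral {0..a} F\<bar> \<le> K"
proof -
  have i: "set_integrable lborel {0..a} F" by (rule borel_integrable_atLeastAtMost'[OF F])
  have "ennreal \<bar>integral {0..a} F\<bar> = ennreal (norm (LINT t|lborel. indicator {0..a} t *\<^sub>R F t))"
    using set_borel_integral_eq_integral(2)[OF i] by (simp add: set_lebesgue_integral_def)
  also have "\<dots> \<le> (\<integral>\<^sup>+t. ennreal (norm (indicator {0..a} t *\<^sub>R F t)) \<partial>lborel)"
    using i by (intro integral_norm_bound_ennreal) (simp add: set_integrable_def)
  also have "\<dots> = (\<integral>\<^sup>+t. indicator {0..a} t * ennreal \<bar>F t\<bar> \<partial>lborel)"
    by (intro nn_integral_cong) (auto simp: indicator_def)
  also note le
  finally show ?thesis using K by simp
qed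

text \<open>The comparison is with \<open>k0 = \<i> |k|\<close> in the exponent and not with the
  constant kernel \<open>c = \<i> / (2 k)\<close>: the kernel \<open>c exp (- |k| |t|)\<close>
  belongs to a bounded operator, \<open>c\<close> times a positive symmetric one, and
  \<open>Re c >= 0\<close>. In the difference, \<open>|k - k0| <= 2 |k|\<close> cancels the
  denominator of \<open>c\<close> and leaves at most \<open>|t|\<close>, uniformly in
  \<open>k\<close>. Each of the two directions contributes \<open>2 J\<close>.\<close>

lemma kernel_estimate:
  fixes w :: "real \<Rightarrow> real"
  assumes [measurable]: "w \<in> borel_measurable borel" and w: "\<And>y. w y \<ge> 0" "\<And>y. w y \<le> 1"
    and J: "(\<integral>\<^sup>+y. ennreal ((1 + y\<^sup>2) * (w y)\<^sup>2) \<partial>lborel) \<le> ennreal J" "J \<ge> 0"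
    and k: "Im k > 0" and CO: "mulf (\<lambda>x. of_real (w (x $ 3))) y \<in> CO"
  shows "- inner (mulf (\<lambda>x. of_real (w (x $ 3))) y) (E k (mulf (\<lambda>x. of_real (w (x $ 3))) y)) \<le> 4 * J * (norm y)\<^sup>2"
proof -
  define h where "h = (\<lambda>x::real^3. complex_of_real (w (x $ 3)))"
  interpret bounded_multiplier h 1
    by unfold_locales (use w in \<open>auto simp: h_def\<close>)
  define u where "u = mulf h y"
  have u: "u \<in> CO" using CO by (simp add: u_def h_def)
  define f where "f = rep y"
  have f: "f \<in> L2" "abs_l2 f = y" by (auto simp: f_def)
  have [measurable]: "f \<in> borel_measurable borel" using f by auto
  have uf: "u = abs_l2 (\<lambda>x. h x * f x)" "(\<lambda>x. h x * f x) \<in> L2" using cls[OF f(1)] L2[OF f(1)] f(2) by (auto simp: u_def)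
  define \<sigma> where "\<sigma> = cmod k"
  have \<sigma>: "\<sigma> > 0" using k by (auto simp: \<sigma>_def)
  define k0 where "k0 = \<i> * complex_of_real \<sigma>"
  have k0: "Im k0 > 0" using \<sigma> by (simp add: k0_def)
  define c where "c = \<i> / (2 * k)"
  have c: "cmod c = 1 / (2 * \<sigma>)" "Re c \<ge> 0"
    using k by (auto simp: c_def \<sigma>_def norm_divide norm_mult Re_divide)
  have near: "inner (cscale c (S s k u - S s k0 u)) u \<ge> - (2 * J * (norm y)\<^sup>2)" if s: "s = 1 \<or> s = -1" for s
  proof -
    define G where "G t = inner (orbit s k u t) (cscale (cnj c) u) - inner (orbit s k0 u t) (cscale (cnj c) u)" for t
    have G: "continuous_on A G" for A
      unfolding G_def by (intro continuous_intros continuous_on_orbit u)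
    have Gle: "ennreal \<bar>G t\<bar> \<le> (\<integral>\<^sup>+x. ennreal (\<bar>t\<bar> * (w ((x + (s * t) *\<^sub>R axis 3 1) $ 3) * cmod (f (x + (s * t) *\<^sub>R axis 3 1))
      * (w (x $ 3) * cmod (f x)))) \<partial>lborel)" if t: "t \<ge> 0" for t
    proof -
      define d where "d = c * (exp (\<i> * k * of_real t) - exp (\<i> * k0 * of_real t))"
      have "cmod (exp (\<i> * k * of_real t) - exp (\<i> * k0 * of_real t)) \<le> cmod (\<i> * k * of_real t - \<i> * k0 * of_real t)"
        using k k0 t by (intro cmod_exp_diff_le) auto
      also have "\<dots> = cmod (k - k0) * t" using t by (simp add: norm_mult flip: right_diff_distrib left_diff_distrib)
      also have "\<dots> \<le> (\<sigma> + \<sigma>) * t"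
        using t by (intro mult_right_mono order_trans[OF norm_triangle_ineq4]) (auto simp: \<sigma>_def k0_def norm_mult)
      finally have "cmod d \<le> 1 / (2 * \<sigma>) * ((\<sigma> + \<sigma>) * t)"
        unfolding d_def norm_mult c using \<sigma> by (intro mult_left_mono) auto
      then have d: "cmod d \<le> t" using \<sigma> by simp
      let ?p = "\<lambda>x. h x * f x"
      have "G t = inner (cscale d (translate3 (s * t) u)) u"
      proof -
        have "G t = inner (cscale c (orbit s k u t - orbit s k0 u t)) u"
          by (simp add: G_def inner_cscale inner_diff_left)
        also have "cscale c (orbit s k u t - orbit s k0 u t) = cscale d (translate3 (s * t) u)"
          by (simp add: orbit_def d_def cscale_cscale right_diff_distrib cscale_diff
              bounded_bilinear.diff_left[OF bounded_bilinear_cscale])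
        finally show ?thesis .
      qed
      also have "\<dots> = Re (LINT x|lborel. d * ?p (x + (s * t) *\<^sub>R axis 3 1) * cnj (?p x))"
        using uf by (simp add: cls_shift cls_cscale cls_inner L2_shift[OF uf(2)] L2_scale) (simp add: l2_inner_def)
      finally have "\<bar>G t\<bar> \<le> norm (LINT x|lborel. d * ?p (x + (s * t) *\<^sub>R axis 3 1) * cnj (?p x))"
        using abs_Re_le_cmod by simp
      then have "ennreal \<bar>G t\<bar> \<le> ennreal (norm (LINT x|lborel. d * ?p (x + (s * t) *\<^sub>R axis 3 1) * cnj (?p x)))"
        by (rule ennreal_leI)
      also have "\<dots> \<le> (\<integral>\<^sup>+x. ennreal (norm (d * ?p (x + (s * t) *\<^sub>R axis 3 1) * cnj (?p x))) \<partial>lborel)"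
        using integrable_inner_L2[OF L2_scale[OF L2_shift[OF uf(2)]] uf(2)]
        by (intro integral_norm_bound_ennreal)
      also have "\<dots> \<le> (\<integral>\<^sup>+x. ennreal (\<bar>t\<bar> * (w ((x + (s * t) *\<^sub>R axis 3 1) $ 3) * cmod (f (x + (s * t) *\<^sub>R axis 3 1))
          * (w (x $ 3) * cmod (f x)))) \<partial>lborel)"
      proof (intro nn_integral_mono ennreal_leI)
        fix x :: "real^3"
        have "norm (d * ?p (x + (s * t) *\<^sub>R axis 3 1) * cnj (?p x)) = cmod d *
          (w ((x + (s * t) *\<^sub>R axis 3 1) $ 3) * cmod (f (x + (s * t) *\<^sub>R axis 3 1)) * (w (x $ 3) * cmod (f x)))"
          using w by (simp add: norm_mult h_def mult_ac)
        also have "\<dots> \<le> \<bar>t\<bar> *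
          (w ((x + (s * t) *\<^sub>R axis 3 1) $ 3) * cmod (f (x + (s * t) *\<^sub>R axis 3 1)) * (w (x $ 3) * cmod (f x)))"
          using d t w by (intro mult_right_mono mult_nonneg_nonneg) auto
        finally show "norm (d * ?p (x + (s * t) *\<^sub>R axis 3 1) * cnj (?p x)) \<le> \<bar>t\<bar> *
          (w ((x + (s * t) *\<^sub>R axis 3 1) $ 3) * cmod (f (x + (s * t) *\<^sub>R axis 3 1)) * (w (x $ 3) * cmod (f x)))" .
      qed
      finally show ?thesis .
    qed
    have I: "\<bar>integral {0..real n} G\<bar> \<le> 2 * J * (norm y)\<^sup>2" for n
    proof (rule abs_integral_le_nn[OF G])
      have "(\<integral>\<^sup>+t. indicator {0..real n} t * ennreal \<bar>G t\<bar> \<partial>lborel)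
        \<le> (\<integral>\<^sup>+t. \<integral>\<^sup>+x. ennreal (\<bar>t\<bar> * (w ((x + (s * t) *\<^sub>R axis 3 1) $ 3) * cmod (f (x + (s * t) *\<^sub>R axis 3 1))
      * (w (x $ 3) * cmod (f x)))) \<partial>lborel \<partial>lborel)"
        using Gle by (intro nn_integral_mono) (auto simp: indicator_def)
      also have "\<dots> \<le> 2 * (\<integral>\<^sup>+y. ennreal ((1 + y\<^sup>2) * (w y)\<^sup>2) \<partial>lborel) * (\<integral>\<^sup>+x. ennreal ((cmod (f x))\<^sup>2) \<partial>lborel)"
        by (rule weighted_autocorrelation[OF f(1) _ w(1) s]) measurable
      also have "\<dots> \<le> 2 * ennreal J * ennreal ((norm y)\<^sup>2)"
        using J(1) norm_cls_nn[OF f(1)] f(2) by (intro mult_mono) auto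
      also have "\<dots> = ennreal (2 * J * (norm y)\<^sup>2)"
        using J(2) by (simp add: ennreal_mult' flip: ennreal_numeral)
      finally show "(\<integral>\<^sup>+t. indicator {0..real n} t * ennreal \<bar>G t\<bar> \<partial>lborel) \<le> ennreal (2 * J * (norm y)\<^sup>2)" .
    qed (use J in auto)
    have i: "(\<lambda>t. inner (orbit s k u t) v) integrable_on {0..a}" for k v a
      by (intro integrable_continuous_interval continuous_intros continuous_on_orbit u)
    have "(\<lambda>n. integral {0..real n} G) \<longlonglongrightarrow> inner (S s k u) (cscale (cnj c) u) - inner (S s k0 u) (cscale (cnj c) u)"
      using tendsto_diff[OF S_inner[OF u k] S_inner[OF u k0]]
      by (simp add: G_def[abs_def] Henstock_Kurzweil_Integration.integral_diff i)
    then have "inner (S s k u) (cscale (cnj c) u) - inner (S s k0 u) (cscale (cnj c) u) \<ge> - (2 * J * (norm y)\<^sup>2)"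
      by (rule tendsto_lowerbound) (use I in \<open>auto simp: abs_le_iff intro!: eventuallyI, smt (verit)\<close>)
    then show ?thesis by (simp add: inner_cscale inner_diff_left)
  qed
  define Z where "Z = S 1 k0 u + S (- 1) k0 u"
  \<comment> \<open>\<open>k0\<close> is fixed by the map from \<open>k\<close> to
    \<open>- cnj k\<close>, so the two directions are adjoint to each other and \<open>Z\<close> is
    symmetric. Then the pairing of \<open>cscale \<i> Z\<close> with \<open>u\<close> vanishes, and
    only \<open>Re c\<close> counts.\<close>
  have "k0 = - cnj k0" by (simp add: k0_def)
  then have sym: "inner (S 1 k0 u) v = inner u (S (- 1) k0 v)" "inner (S (- 1) k0 u) v = inner u (S 1 k0 v)" if "v \<in> CO" for v
    using S_adjoint[OF u that k0] by (metis minus_minus)+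
  have iu: "cscale \<i> u \<in> CO" by (rule CO_cscale[OF u])
  have "inner (cscale \<i> Z) u = inner (S 1 k0 (cscale \<i> u)) u + inner (S (- 1) k0 (cscale \<i> u)) u"
    by (simp add: Z_def S_cscale u k0 cscale_add inner_add_left)
  also have "\<dots> = inner (cscale \<i> u) Z"
    using sym(1)[OF iu] sym(2)[OF iu] by (simp add: Z_def inner_add_right inner_commute add.commute)
  also have "\<dots> = - inner (cscale \<i> Z) u"
    using inner_cscale[of \<i> u Z] inner_commute[of u "cscale \<i> Z"]
    by (simp add: bounded_bilinear.minus_left[OF bounded_bilinear_cscale])
  finally have "inner (cscale \<i> Z) u = 0" by simp
  moreover have "inner Z u \<ge> 0"
    unfolding Z_def inner_add_left k0_def using S_positive[OF u \<sigma>] by simp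
  ultimately have far: "inner (cscale c Z) u \<ge> 0"
    using c(2) by (simp add: inner_cscale_expand[of c])
  have "E k u = cscale c (S 1 k u - S 1 k0 u) + cscale c (S (- 1) k u - S (- 1) k0 u) + cscale c Z"
  proof -
    have "S 1 k u + S (- 1) k u = (S 1 k u - S 1 k0 u) + (S (- 1) k u - S (- 1) k0 u) + Z" by (simp add: Z_def)
    then show ?thesis unfolding E_def c_def[symmetric] by (simp only: cscale_add)
  qed
  then have "inner (E k u) u \<ge> - (4 * J * (norm y)\<^sup>2)"
    using near[of 1] near[of "-1"] far by (simp add: inner_add_left)
  then show ?thesis by (simp add: u_def h_def inner_commute)
qed

text \<open>The integrand is \<open><y>^(2 - m)\<close>, integrable because \<open>m > 3\<close>; it
  is dominated by 1 on [-1, 1] and by \<open>|y|^(2 - m)\<close> outside.\<close>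

lemma weight_integral:
  fixes m :: real
  assumes m: "m > 3"
  shows "(\<integral>\<^sup>+y. ennreal ((1 + y\<^sup>2) * ((1 + y\<^sup>2) powr (- m / 4))\<^sup>2) \<partial>lborel) < \<infinity>"
proof -
  define r where "r = 2 - m"
  have r: "r < -1" using m by (simp add: r_def)
  have p: "(1 + y\<^sup>2) * ((1 + y\<^sup>2) powr (- m / 4))\<^sup>2 = (1 + y\<^sup>2) powr (r / 2)" for y :: real
  proof -
    have pos: "1 + y\<^sup>2 > 0" by (simp add: add_pos_nonneg)
    have "(1 + y\<^sup>2) * ((1 + y\<^sup>2) powr (- m / 4))\<^sup>2 = (1 + y\<^sup>2) * (1 + y\<^sup>2) powr (- m / 2)"
      using pos by (simp add: power2_eq_square flip: powr_add)
    then show ?thesis using pos by (simp add: r_def diff_divide_distrib powr_mult_base)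
  qed
  have tail: "(\<integral>\<^sup>+y. indicator {1..} y * ennreal (y powr r) \<partial>lborel) < \<infinity>"
    using nn_integral_has_integral_lebesgue[OF _ has_integral_powr_to_inf[OF r, of 1]]
    by (simp add: ennreal_mult' ennreal_indicator mult.commute)
  have "(\<integral>\<^sup>+y. ennreal ((1 + y\<^sup>2) * ((1 + y\<^sup>2) powr (- m / 4))\<^sup>2) \<partial>lborel)
    \<le> (\<integral>\<^sup>+y. indicator {-1..1} y + indicator {1..} y * ennreal (y powr r) + indicator {1..} (- y) * ennreal ((- y) powr r) \<partial>lborel)"
  proof (rule nn_integral_mono)
    fix y :: real
    have 1: "(1 + y\<^sup>2) powr (r / 2) \<le> 1"
      using r powr_mono[of "r / 2" 0 "1 + y\<^sup>2"] by (simp split: if_splits)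
    have 2: "(1 + y\<^sup>2) powr (r / 2) \<le> \<bar>y\<bar> powr r" if "\<bar>y\<bar> \<ge> 1"
    proof -
      have "\<bar>y\<bar> powr 2 = y\<^sup>2" using that by (simp add: powr_numeral)
      then have "(y\<^sup>2) powr (r / 2) = \<bar>y\<bar> powr r"
        using powr_powr[of "\<bar>y\<bar>" 2 "r / 2"] by simp
      moreover have "(1 + y\<^sup>2) powr (r / 2) \<le> (y\<^sup>2) powr (r / 2)"
        using r that by (intro powr_mono2') auto
      ultimately show ?thesis by simp
    qed
    consider "\<bar>y\<bar> \<le> 1" | "y > 1" | "y < - 1" by linarith
    then show "ennreal ((1 + y\<^sup>2) * ((1 + y\<^sup>2) powr (- m / 4))\<^sup>2)
      \<le> indicator {-1..1} y + indicator {1..} y * ennreal (y powr r) + indicator {1..} (- y) * ennreal ((- y) powr r)"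
    proof cases
      case 1
      then have "indicator {-1..1} y = (1 :: ennreal)" by (auto simp: indicator_def)
      moreover have "ennreal ((1 + y\<^sup>2) powr (r / 2)) \<le> 1" using \<open>(1 + y\<^sup>2) powr (r / 2) \<le> 1\<close> by simp
      ultimately show ?thesis unfolding p by (simp add: add.assoc add_increasing2)
    qed (use 2 in \<open>unfold p, auto simp: indicator_def intro!: ennreal_leI\<close>)
  qed
  also have "\<dots> = (\<integral>\<^sup>+y. indicator {-1..1::real} y \<partial>lborel) + (\<integral>\<^sup>+y. indicator {1..} y * ennreal (y powr r) \<partial>lborel)
     + (\<integral>\<^sup>+y. indicator {1..} (- y) * ennreal ((- y) powr r) \<partial>lborel)"
    by (simp add: nn_integral_add)
  also have "(\<integral>\<^sup>+y. indicator {1..} (- y) * ennreal ((- y) powr r) \<partial>lborel) = (\<integral>\<^sup>+y. indicator {1..} y * ennreal (y powr r) \<partial>lborel)"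
    using nn_integral_real_affine[of "\<lambda>y. indicator {1..} y * ennreal (y powr r)" "-1" 0] by simp
  also have "(\<integral>\<^sup>+y. indicator {-1..1::real} y \<partial>lborel) + (\<integral>\<^sup>+y. indicator {1..} y * ennreal (y powr r) \<partial>lborel)
      + (\<integral>\<^sup>+y. indicator {1..} y * ennreal (y powr r) \<partial>lborel) < \<infinity>"
    using tail by (simp add: emeasure_lborel_Icc_eq ennreal_add_eq_top less_top)
  finally show ?thesis .
qed

section \<open>Smooth functions\<close>

lemma partial_eq: "(u has_derivative D) (at x) \<Longrightarrow> partial j u x = D (axis j 1)"
  unfolding partial_def by (simp add: frechet_derivative_at[symmetric])

lemma differentiable_frechet: "u differentiable (at x) \<Longrightarrow> (u has_derivative frechet_derivative u (at x)) (at x)"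
  by (simp add: frechet_derivative_works)

text \<open>Coinduction: iterated derivatives never leave the class. Later smoothness proofs only
  have to exhibit a class of differentiable functions that is closed under
  \<open>partial\<close>.\<close>

lemma smooth_coinduct:
  assumes step: "\<And>v. v \<in> A \<Longrightarrow> (\<forall>x. v differentiable (at x)) \<and> (\<forall>j. partial j v \<in> A)" and u: "u \<in> A"
  shows "smooth u"
proof -
  have "foldr partial js u \<in> A" for js by (induction js) (use u step in auto)
  then show ?thesis using step by (simp add: smooth_def)
qed

lemma smooth_differentiable: "smooth u \<Longrightarrow> u differentiable (at x)"
  unfolding smooth_def by (drule spec[of _ "[]"]) simp

lemma smooth_partial: "smooth u \<Longrightarrow> smooth (partial j u)"
proof -
  assume u: "smooth u"
  have "foldr partial js (partial j u) = foldr partial (js @ [j]) u" for js by simp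
  then show ?thesis using u unfolding smooth_def by metis
qed

lemma smooth_continuous: "smooth u \<Longrightarrow> continuous_on A u"
  by (intro continuous_at_imp_continuous_on ballI differentiable_imp_continuous_within smooth_differentiable)

lemma smoothI_partial: "(\<And>x. u differentiable (at x)) \<Longrightarrow> (\<And>j. smooth (partial j u)) \<Longrightarrow> smooth u"
  by (rule smooth_coinduct[of "insert u (Collect smooth)"])
    (auto simp: smooth_differentiable smooth_partial)

lemma partial_const: "partial j (\<lambda>x. c) = (\<lambda>x. 0)"
  by (rule ext, subst partial_eq[OF has_derivative_const]) simp

lemma partial_add:
  assumes "\<And>x. u differentiable (at x)" "\<And>x. v differentiable (at x)"
  shows "partial j (\<lambda>x. u x + v x) = (\<lambda>x. partial j u x + partial j v x)"
  by (rule ext, subst partial_eq[OF has_derivative_add[OF differentiable_frechet differentiable_frechet]])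
    (auto simp: assms partial_def)

lemma partial_mult:
  assumes "\<And>x. u differentiable (at x)" "\<And>x. v differentiable (at x)"
  shows "partial j (\<lambda>x. u x * v x) = (\<lambda>x. u x * partial j v x + partial j u x * v x)"
  by (rule ext, subst partial_eq[OF has_derivative_mult[OF differentiable_frechet differentiable_frechet]])
    (auto simp: assms partial_def)

lemma partial_shift:
  assumes "\<And>x. u differentiable (at x)"
  shows "partial j (\<lambda>x. u (x + y)) = (\<lambda>x. partial j u (x + y))"
proof
  fix x
  have "((\<lambda>x. x + y) has_derivative (\<lambda>h. h)) (at x)" by (auto intro!: derivative_eq_intros)
  from has_derivative_compose[OF this differentiable_frechet[OF assms]]
  show "partial j (\<lambda>x. u (x + y)) x = partial j u (x + y)" by (subst partial_eq) (auto simp: partial_def)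
qed

lemma smooth_const: "smooth (\<lambda>x. c)"
  by (rule smooth_coinduct[of "range (\<lambda>c x. c)"]) (auto simp: partial_const)

lemma smooth_add:
  assumes "smooth u" "smooth v"
  shows "smooth (\<lambda>x. u x + v x)"
proof (rule smooth_coinduct[of "{\<lambda>x. u x + v x | u v. smooth u \<and> smooth v}"])
  fix w assume "w \<in> {\<lambda>x. u x + v x | u v. smooth u \<and> smooth v}"
  then obtain u v where "w = (\<lambda>x. u x + v x)" "smooth u" "smooth v" by auto
  then show "(\<forall>x. w differentiable (at x)) \<and> (\<forall>j. partial j w \<in> {\<lambda>x. u x + v x | u v. smooth u \<and> smooth v})"
    using smooth_partial by (auto simp: smooth_differentiable partial_add intro!: differentiable_add)
qed (use assms in auto)

text \<open>The Leibniz rule turns a product into a sum of products; closure under addition makes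
  the class invariant under \<open>partial\<close>.\<close>

inductive_set products :: "wavefn set" where
  base: "smooth u \<Longrightarrow> smooth v \<Longrightarrow> (\<lambda>x. u x * v x) \<in> products"
| add: "f \<in> products \<Longrightarrow> g \<in> products \<Longrightarrow> (\<lambda>x. f x + g x) \<in> products"

lemma products_step: "w \<in> products \<Longrightarrow> (\<forall>x. w differentiable (at x)) \<and> (\<forall>j. partial j w \<in> products)"
proof (induction rule: products.induct)
  case (base u v)
  then show ?case
    by (auto simp: smooth_differentiable partial_mult smooth_partial intro!: differentiable_mult products.intros)
next
  case (add f g)
  then show ?case by (auto simp: partial_add intro!: products.intros differentiable_add)
qed

lemma smooth_mult: "smooth u \<Longrightarrow> smooth v \<Longrightarrow> smooth (\<lambda>x. u x * v x)"
  by (rule smooth_coinduct[OF products_step products.base])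

lemma smooth_cmult: "smooth u \<Longrightarrow> smooth (\<lambda>x. c * u x)"
  by (intro smooth_mult smooth_const)

lemma smooth_shift:
  assumes "smooth u"
  shows "smooth (\<lambda>x. u (x + y))"
proof (rule smooth_coinduct[of "{\<lambda>x. u (x + y) | u. smooth u}"])
  fix w assume "w \<in> {\<lambda>x. u (x + y) | u. smooth u}"
  then obtain u where u: "w = (\<lambda>x. u (x + y))" "smooth u" by auto
  have "(\<lambda>x. u (x + y)) differentiable (at x)" for x
    by (rule differentiable_compose[of u "\<lambda>x. x + y"]) (auto simp: u smooth_differentiable)
  then show "(\<forall>x. w differentiable (at x)) \<and> (\<forall>j. partial j w \<in> {\<lambda>x. u (x + y) | u. smooth u})"
    using u by (auto simp: partial_shift smooth_differentiable intro: smooth_partial)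
qed (use assms in auto)

lemma has_derivative_coord: "((\<lambda>x::real^3. complex_of_real (x $ i)) has_derivative (\<lambda>h. complex_of_real (h $ i))) (at x)"
  by (intro has_derivative_of_real bounded_linear.has_derivative[OF bounded_linear_vec_nth] has_derivative_ident)

lemma partial_coord: "partial j (\<lambda>x. of_real (x $ i)) = (\<lambda>x. if i = j then 1 else 0)"
  by (rule ext, subst partial_eq[OF has_derivative_coord]) (simp add: axis_def)

lemma differentiable_coord: "(\<lambda>x::real^3. complex_of_real (x $ i)) differentiable (at x)"
  using has_derivative_coord differentiableI by blast

lemma smooth_coord: "smooth (\<lambda>x. of_real (x $ i))"
  by (rule smoothI_partial) (auto simp: partial_coord smooth_const differentiable_coord)

text \<open>Made for families whose derivatives are smooth multiples of members of the family:
  exponentials, powers of a reciprocal, flat functions.\<close>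

inductive_set smooth_span :: "wavefn set \<Rightarrow> wavefn set" for A where
  base: "smooth q \<Longrightarrow> u \<in> A \<Longrightarrow> (\<lambda>x. q x * u x) \<in> smooth_span A"
| add: "f \<in> smooth_span A \<Longrightarrow> g \<in> smooth_span A \<Longrightarrow> (\<lambda>x. f x + g x) \<in> smooth_span A"

lemma smooth_span_mult: "f \<in> smooth_span A \<Longrightarrow> smooth q \<Longrightarrow> (\<lambda>x. q x * f x) \<in> smooth_span A"
proof (induction rule: smooth_span.induct)
  case (base p u)
  then show ?case using smooth_span.base[of "\<lambda>x. q x * p x" u A] by (simp add: smooth_mult mult.assoc)
qed (simp add: smooth_span.add distrib_left)

lemma smooth_span_smooth:
  assumes A: "\<And>u x. u \<in> A \<Longrightarrow> u differentiable (at x)" "\<And>u j. u \<in> A \<Longrightarrow> partial j u \<in> smooth_span A"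
    and u: "u \<in> A"
  shows "smooth u"
proof (rule smooth_coinduct[of "smooth_span A"])
  fix w assume "w \<in> smooth_span A"
  then show "(\<forall>x. w differentiable (at x)) \<and> (\<forall>j. partial j w \<in> smooth_span A)"
  proof (induction rule: smooth_span.induct)
    case (base q u)
    have "(\<lambda>x. q x * partial j u x) \<in> smooth_span A" for j
      using smooth_span_mult[OF A(2)] base by blast
    moreover have "(\<lambda>x. partial j q x * u x) \<in> smooth_span A" for j
      using smooth_span.base[OF smooth_partial] base by blast
    ultimately have "(\<lambda>x. q x * partial j u x + partial j q x * u x) \<in> smooth_span A" for j
      using smooth_span.add by blast
    with base show ?case
      by (auto simp: A(1) smooth_differentiable partial_mult intro!: differentiable_mult)
  next
    case (add f g)
    then show ?case by (auto simp: partial_add intro!: smooth_span.intros differentiable_add)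
  qed
next
  show "u \<in> smooth_span A" using smooth_span.base[OF smooth_const u, of 1] by simp
qed

lemma smooth_exp:
  assumes p: "smooth p"
  shows "smooth (\<lambda>x. exp (p x))" and "partial j (\<lambda>x. exp (p x)) = (\<lambda>x. partial j p x * exp (p x))"
proof -
  have d: "((\<lambda>x. exp (p x)) has_derivative (\<lambda>h. exp (p x) * frechet_derivative p (at x) h)) (at x)" for x
    using has_derivative_compose[OF differentiable_frechet[OF smooth_differentiable[OF p]] DERIV_exp[unfolded has_field_derivative_def]]
    by (simp add: has_field_derivative_def)
  show eq: "partial j (\<lambda>x. exp (p x)) = (\<lambda>x. partial j p x * exp (p x))" for j
    by (rule ext, subst partial_eq[OF d]) (simp add: partial_def)
  show "smooth (\<lambda>x. exp (p x))"
    using d by (intro smooth_span_smooth[of "{\<lambda>x. exp (p x)}"])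
      (auto simp: eq differentiable_def intro!: smooth_span.base smooth_partial p)
qed

lemma smooth_inverse:
  assumes f: "smooth f" and nz: "\<And>x. f x \<noteq> 0"
  shows "smooth (\<lambda>x. inverse (f x))"
\<comment> \<open>All powers are needed, as the derivative of one is a multiple of the next.\<close>
proof (rule smooth_span_smooth[of "range (\<lambda>n x. inverse (f x) ^ n)"])
  have d: "((\<lambda>x. inverse (f x) ^ n) has_derivative
      (\<lambda>h. - of_nat n * frechet_derivative f (at x) h * inverse (f x) ^ Suc n)) (at x)" for n x
  proof -
    have "((\<lambda>z. inverse z ^ n) has_field_derivative - of_nat n * inverse (f x) ^ Suc n) (at (f x))"
      using DERIV_power[OF DERIV_inverse[OF nz[of x]], of n] by (cases n) (simp_all add: algebra_simps)
    from has_derivative_compose[OF differentiable_frechet[OF smooth_differentiable[OF f]] this[unfolded has_field_derivative_def]]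
    show ?thesis by (simp add: mult_ac)
  qed
  fix u :: wavefn and x j assume "u \<in> range (\<lambda>n x. inverse (f x) ^ n)"
  then obtain n where u: "u = (\<lambda>x. inverse (f x) ^ n)" by auto
  show "u differentiable (at x)" using d by (auto simp: u differentiable_def)
  have "partial j u = (\<lambda>x. (- of_nat n * partial j f x) * inverse (f x) ^ Suc n)"
    unfolding u by (rule ext, subst partial_eq[OF d]) (simp add: partial_def)
  then show "partial j u \<in> smooth_span (range (\<lambda>n x. inverse (f x) ^ n))"
    by (simp only:) (rule smooth_span.base[OF smooth_cmult[OF smooth_partial[OF f]] rangeI])
next
  show "(\<lambda>x. inverse (f x)) \<in> range (\<lambda>n x. inverse (f x) ^ n)" by (rule range_eqI[of _ _ 1]) simp
qed

lemma smooth_weight: "smooth (\<lambda>x. of_real ((1 + (x $ 3)\<^sup>2) powr (- m / 4)))"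
  and partial_weight: "j \<noteq> 3 \<Longrightarrow> partial j (\<lambda>x. of_real ((1 + (x $ 3)\<^sup>2) powr (- m / 4))) = (\<lambda>x. 0)"
proof -
  \<comment> \<open>The logarithm of the weight. Its gradient is a rational function without poles,
    so smoothness reduces to \<open>smooth_exp\<close> and \<open>smooth_inverse\<close>.\<close>
  define p where "p = (\<lambda>x::real^3. complex_of_real (- (m / 4) * ln (1 + (x $ 3)\<^sup>2)))"
  have pos: "1 + (x $ 3)\<^sup>2 > 0" for x :: "real^3" by (simp add: add_pos_nonneg)
  have d: "(p has_derivative (\<lambda>h. complex_of_real (- (m / 4) * (2 * (x $ 3) * (h $ 3) * inverse (1 + (x $ 3)\<^sup>2))))) (at x)" for x
    unfolding p_def
  proof (rule has_derivative_of_real)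
    have "((\<lambda>y. - (m / 4) * ln (1 + y\<^sup>2)) has_field_derivative (- (m / 4) * (2 * (x $ 3) * inverse (1 + (x $ 3)\<^sup>2)))) (at (x $ 3))"
      using pos[of x] by (auto intro!: derivative_eq_intros simp: field_simps)
    from has_derivative_compose[OF bounded_linear.has_derivative[OF bounded_linear_vec_nth has_derivative_ident]
        this[unfolded has_field_derivative_def]]
    show "((\<lambda>x. - (m / 4) * ln (1 + (x $ 3)\<^sup>2)) has_derivative
        (\<lambda>h. - (m / 4) * (2 * (x $ 3) * (h $ 3) * inverse (1 + (x $ 3)\<^sup>2)))) (at x)"
      by (simp add: mult_ac)
  qed
  have pp: "partial j p = (\<lambda>x. if j = 3 then of_real (- m / 2) * (of_real (x $ 3) * inverse (1 + of_real (x $ 3) * of_real (x $ 3))) else 0)" for j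
    by (rule ext, subst partial_eq[OF d]) (simp add: axis_def power2_eq_square)
  have nz: "1 + complex_of_real (x $ 3) * complex_of_real (x $ 3) \<noteq> 0" for x :: "real^3"
    using pos[of x] by (metis of_real_1 of_real_add of_real_eq_0_iff of_real_mult order_less_irrefl power2_eq_square)
  have sp: "smooth p"
  proof (rule smoothI_partial)
    show "smooth (partial j p)" for j
    proof (cases "j = 3")
      case True
      show ?thesis unfolding pp if_P[OF True]
        by (intro smooth_cmult smooth_mult smooth_coord smooth_inverse smooth_add smooth_const nz)
    next
      case False
      show ?thesis unfolding pp if_not_P[OF False] by (rule smooth_const)
    qed
  qed (use d in \<open>auto simp: differentiable_def\<close>)
  have e: "(\<lambda>x. complex_of_real ((1 + (x $ 3)\<^sup>2) powr (- m / 4))) = (\<lambda>x. exp (p x))"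
  proof
    fix x :: "real^3"
    have "(1 + (x $ 3)\<^sup>2) powr (- m / 4) = exp (- (m / 4) * ln (1 + (x $ 3)\<^sup>2))"
      using pos[of x] by (simp add: powr_def)
    then show "complex_of_real ((1 + (x $ 3)\<^sup>2) powr (- m / 4)) = exp (p x)"
      by (simp add: p_def exp_of_real del: of_real_mult of_real_minus)
  qed
  show "smooth (\<lambda>x. of_real ((1 + (x $ 3)\<^sup>2) powr (- m / 4)))"
    unfolding e by (rule smooth_exp[OF sp])
  show "partial j (\<lambda>x. of_real ((1 + (x $ 3)\<^sup>2) powr (- m / 4))) = (\<lambda>x. 0)" if "j \<noteq> 3"
    unfolding e smooth_exp(2)[OF sp] pp using that by simp
qed

section \<open>Flat functions and bumps\<close>

text \<open>The classical function \<open>exp (- 1 / t)\<close> with the polynomial factors in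
  \<open>1 / t\<close> that differentiation produces: for \<open>s = 1 / t\<close> it maps
  \<open>p\<close> to \<open>s^2 (p - p')\<close>.\<close>

definition flat :: "real poly \<Rightarrow> real \<Rightarrow> real" where
  "flat p t = (if t > 0 then poly p (1 / t) * exp (- (1 / t)) else 0)"

lemma poly_exp_tendsto_0: "((\<lambda>s::real. poly p s * exp (- s)) \<longlongrightarrow> 0) at_top"
proof -
  have "((\<lambda>s::real. \<Sum>i\<le>degree p. coeff p i * (s ^ i / exp s)) \<longlongrightarrow> (\<Sum>i\<le>degree p. coeff p i * 0)) at_top"
    by (intro tendsto_sum tendsto_mult tendsto_const tendsto_power_div_exp_0)
  then show ?thesis by (simp add: poly_altdef sum_distrib_right exp_minus divide_inverse mult.assoc)
qed

lemma flat_tendsto_0: "(flat p \<longlongrightarrow> 0) (at_right 0)"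
proof (rule Lim_transform_eventually)
  show "((\<lambda>t. poly p (inverse t) * exp (- inverse t)) \<longlongrightarrow> 0) (at_right 0)"
    using filterlim_compose[OF poly_exp_tendsto_0 filterlim_inverse_at_top_right] .
  show "\<forall>\<^sub>F t in at_right 0. poly p (inverse t) * exp (- inverse t) = flat p t"
    using eventually_at_right_less[of 0] by eventually_elim (simp add: flat_def inverse_eq_divide)
qed

lemma flat_derivative: "(flat p has_field_derivative flat ([:0, 1:] ^ 2 * (p - pderiv p)) t) (at t)"
proof -
  consider "t > 0" | "t < 0" | "t = 0" by linarith
  then show ?thesis
  proof cases
    case 1
    have "((\<lambda>t. poly p (1 / t) * exp (- (1 / t))) has_field_derivative flat ([:0, 1:] ^ 2 * (p - pderiv p)) t) (at t)"
      using 1 by (auto intro!: derivative_eq_intros DERIV_chain2[OF poly_DERIV] simp: flat_def field_simps power2_eq_square)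
    then show ?thesis
      by (rule has_field_derivative_transform_within_open[of _ _ _ "{0<..}"]) (use 1 in \<open>auto simp: flat_def\<close>)
  next
    case 2
    have "((\<lambda>t. 0) has_field_derivative flat ([:0, 1:] ^ 2 * (p - pderiv p)) t) (at t)"
      using 2 by (simp add: flat_def)
    then show ?thesis
      by (rule has_field_derivative_transform_within_open[of _ _ _ "{..<0}"]) (use 2 in \<open>auto simp: flat_def\<close>)
  next
    case 3
    \<comment> \<open>\<open>flat p h / h\<close> is again flat, with polynomial \<open>X p\<close>,
      so the difference quotient at 0 falls under the limit already shown.\<close>
    have "((\<lambda>h. flat p h / h) \<longlongrightarrow> 0) (at_right 0)"
    proof (rule Lim_transform_eventually[OF flat_tendsto_0])
      show "\<forall>\<^sub>F t in at_right 0. flat ([:0, 1:] * p) t = flat p t / t"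
        using eventually_at_right_less[of 0] by eventually_elim (simp add: flat_def)
    qed
    moreover have "((\<lambda>h. flat p h / h) \<longlongrightarrow> 0) (at_left 0)"
    proof (rule Lim_transform_eventually[OF tendsto_const])
      show "\<forall>\<^sub>F t in at_left 0. 0 = flat p t / t"
        by (simp add: eventually_at_filter flat_def)
    qed
    ultimately have "((\<lambda>h. flat p h / h) \<longlongrightarrow> 0) (at 0)" by (simp add: filterlim_at_split)
    then show ?thesis using 3 by (simp add: has_field_derivative_iff flat_def)
  qed
qed

definition bump :: "real \<Rightarrow> real^3 \<Rightarrow> complex" where
  "bump R x = of_real (flat 1 (1 - (x \<bullet> x) / R\<^sup>2))"

lemma flat_compose_derivative:
  "((\<lambda>x::real^3. complex_of_real (flat p (1 - (x \<bullet> x) / R\<^sup>2))) has_derivative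
    (\<lambda>h. of_real (- 2 / R\<^sup>2 * (x \<bullet> h) * flat ([:0, 1:] ^ 2 * (p - pderiv p)) (1 - (x \<bullet> x) / R\<^sup>2)))) (at x)"
proof (rule has_derivative_of_real)
  have "((\<lambda>x. 1 - (x \<bullet> x) / R\<^sup>2) has_derivative (\<lambda>h. - 2 / R\<^sup>2 * (x \<bullet> h))) (at x)"
    unfolding divide_inverse by (auto intro!: derivative_eq_intros simp: inner_commute algebra_simps)
  from has_derivative_compose[OF this flat_derivative[unfolded has_field_derivative_def]]
  show "((\<lambda>x. flat p (1 - (x \<bullet> x) / R\<^sup>2)) has_derivative
      (\<lambda>h. - 2 / R\<^sup>2 * (x \<bullet> h) * flat ([:0, 1:] ^ 2 * (p - pderiv p)) (1 - (x \<bullet> x) / R\<^sup>2))) (at x)"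
    by (simp add: mult_ac)
qed

lemma partial_flat: "partial j (\<lambda>x. of_real (flat p (1 - (x \<bullet> x) / R\<^sup>2))) =
  (\<lambda>x. of_real (- 2 / R\<^sup>2) * of_real (x $ j) * of_real (flat ([:0, 1:] ^ 2 * (p - pderiv p)) (1 - (x \<bullet> x) / R\<^sup>2)))"
  by (rule ext, subst partial_eq[OF flat_compose_derivative]) (simp add: inner_axis)

lemma smooth_bump: "smooth (bump R)"
  unfolding bump_def
proof (rule smooth_span_smooth[of "range (\<lambda>p x. of_real (flat p (1 - (x \<bullet> x) / R\<^sup>2)))"])
  fix u :: wavefn and x j assume "u \<in> range (\<lambda>p x. of_real (flat p (1 - (x \<bullet> x) / R\<^sup>2)))"
  then obtain p where u: "u = (\<lambda>x. of_real (flat p (1 - (x \<bullet> x) / R\<^sup>2)))" by auto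
  show "u differentiable (at x)" unfolding u using flat_compose_derivative differentiableI by blast
  show "partial j u \<in> smooth_span (range (\<lambda>p x. of_real (flat p (1 - (x \<bullet> x) / R\<^sup>2))))"
    unfolding u partial_flat by (intro smooth_span.base[OF smooth_cmult[OF smooth_coord] rangeI])
qed auto

section \<open>Test functions\<close>

lemma test_iff: "u \<in> test_functions \<longleftrightarrow> smooth u \<and> bounded {x. u x \<noteq> 0}"
  by (simp add: test_functions_def compact_closure)

lemma test_smooth: "u \<in> test_functions \<Longrightarrow> smooth u"
  by (simp add: test_iff)

lemma test_diff_at: "u \<in> test_functions \<Longrightarrow> u differentiable (at x)"
  by (simp add: test_iff smooth_differentiable)

lemma test_add: "u \<in> test_functions \<Longrightarrow> v \<in> test_functions \<Longrightarrow> (\<lambda>x. u x + v x) \<in> test_functions"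
  by (auto simp: test_iff smooth_add intro: bounded_subset[of "{x. u x \<noteq> 0} \<union> {x. v x \<noteq> 0}"])

lemma test_mult: "smooth q \<Longrightarrow> u \<in> test_functions \<Longrightarrow> (\<lambda>x. q x * u x) \<in> test_functions"
  by (auto simp: test_iff smooth_mult intro: bounded_subset[of "{x. u x \<noteq> 0}"])

lemma test_cmult: "u \<in> test_functions \<Longrightarrow> (\<lambda>x. c * u x) \<in> test_functions"
  by (intro test_mult smooth_const)

lemma test_diff: "u \<in> test_functions \<Longrightarrow> v \<in> test_functions \<Longrightarrow> (\<lambda>x. u x - v x) \<in> test_functions"
  using test_add[of u "\<lambda>x. -1 * v x"] test_cmult[of v "-1"] by simp

lemma test_zero: "(\<lambda>x. 0) \<in> test_functions"
  by (simp add: test_iff smooth_const)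

lemma partial_eq_0_outside:
  assumes "x \<notin> closure {x. u x \<noteq> 0}"
  shows "partial j u x = 0"
proof -
  have "(u has_derivative (\<lambda>h. 0)) (at x)"
    by (rule has_derivative_transform_within_open[OF has_derivative_const[of 0], of "- closure {x. u x \<noteq> 0}"])
      (use assms closure_subset[of "{x. u x \<noteq> 0}"] in auto)
  then show ?thesis by (simp add: partial_eq)
qed

lemma test_partial:
  assumes "u \<in> test_functions"
  shows "partial j u \<in> test_functions"
proof -
  have "{x. partial j u x \<noteq> 0} \<subseteq> closure {x. u x \<noteq> 0}" using partial_eq_0_outside by blast
  then show ?thesis using assms
    by (auto simp: test_iff smooth_partial intro: bounded_subset[OF bounded_closure])
qed

lemma test_shift:
  assumes "u \<in> test_functions"
  shows "(\<lambda>x. u (x + y)) \<in> test_functions"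
proof -
  have "{x. u (x + y) \<noteq> 0} = (+) (- y) ` {x. u x \<noteq> 0}"
    by (auto simp: image_iff) (metis add.commute add_diff_cancel diff_conv_add_uminus)
  then show ?thesis using assms by (auto simp: test_iff smooth_shift intro: bounded_translation_minus)
qed

lemma test_support:
  assumes "u \<in> test_functions"
  obtains r where "r > 0" "\<And>x. norm x > r \<Longrightarrow> u x = 0"
  using assms unfolding test_iff bounded_pos by (metis (mono_tags) mem_Collect_eq not_le)

lemma test_bounded:
  assumes u: "u \<in> test_functions"
  obtains M where "M \<ge> 0" "\<And>x. cmod (u x) \<le> M"
proof -
  obtain r where r: "r > 0" "\<And>x. norm x > r \<Longrightarrow> u x = 0" using test_support[OF u] by blast
  have "compact (u ` cball 0 r)"
    by (intro compact_continuous_image smooth_continuous test_smooth u compact_cball)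
  then obtain M where M: "\<And>x. x \<in> cball 0 r \<Longrightarrow> cmod (u x) \<le> M"
    by (metis bounded_iff compact_imp_bounded imageI)
  have "cmod (u x) \<le> max M 0" for x
    using M[of x] r(2)[of x] by (cases "norm x \<le> r") auto
  then show ?thesis using that[of "max M 0"] by auto
qed

lemma L2_compact_support:
  assumes [measurable]: "f \<in> borel_measurable borel" and c: "\<And>x. cmod (f x) \<le> c" "\<And>x. norm x > r \<Longrightarrow> f x = 0"
  shows "f \<in> L2" "norm (cls f) \<le> c * sqrt (measure lborel (cball (0::real^3) r))"
proof -
  have c0: "c \<ge> 0" using c(1)[of 0] norm_ge_zero order_trans by blast
  have le: "(cmod (f x))\<^sup>2 \<le> c\<^sup>2 * indicator (cball 0 r) x" for x
    using c(1)[of x] c(2)[of x] c0 by (auto simp: indicator_def dist_norm intro!: power_mono)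
  have i: "integrable lborel (\<lambda>x::real^3. c\<^sup>2 * indicator (cball 0 r) x)"
    using emeasure_lborel_cball_finite[of "0::real^3" r] by (simp add: less_top)
  show L2: "f \<in> L2" by (rule L2_bound[OF _ i]) (use le in auto)
  have "(norm (cls f))\<^sup>2 \<le> (LINT x|lborel. c\<^sup>2 * indicator (cball (0::real^3) r) x)"
    unfolding norm_cls_squared[OF L2] using L2 i le by (intro integral_mono) (auto simp: L2_iff)
  also have "\<dots> = (c * sqrt (measure lborel (cball (0::real^3) r)))\<^sup>2"
    by (simp add: power_mult_distrib)
  finally show "norm (cls f) \<le> c * sqrt (measure lborel (cball (0::real^3) r))"
    by (rule power2_le_imp_le) (simp add: c0)
qed

lemma test_measurable: "u \<in> test_functions \<Longrightarrow> u \<in> borel_measurable borel"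
  by (intro borel_measurable_continuous_onI smooth_continuous test_smooth)

lemma test_L2 [simp]: "u \<in> test_functions \<Longrightarrow> u \<in> L2"
proof -
  assume u: "u \<in> test_functions"
  show ?thesis
    using test_bounded[OF u] test_support[OF u] L2_compact_support(1)[OF test_measurable[OF u]] by metis
qed

lemma smooth_line_derivative:
  assumes "smooth u"
  shows "((\<lambda>t. u (x + t *\<^sub>R axis j 1)) has_vector_derivative partial j u (x + t *\<^sub>R axis j 1)) (at t within A)"
proof -
  have "((\<lambda>t. x + t *\<^sub>R axis j (1::real)) has_derivative (\<lambda>h. h *\<^sub>R axis j 1)) (at t within A)"
    by (auto intro!: derivative_eq_intros)
  from has_derivative_compose[OF this differentiable_frechet[OF smooth_differentiable[OF assms]]]
  have "((\<lambda>t. u (x + t *\<^sub>R axis j 1)) has_derivative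
      (\<lambda>h. frechet_derivative u (at (x + t *\<^sub>R axis j 1)) (h *\<^sub>R axis j 1))) (at t within A)" .
  moreover have "linear (frechet_derivative u (at (x + t *\<^sub>R axis j 1)))"
    by (rule linear_frechet_derivative[OF smooth_differentiable[OF assms]])
  ultimately show ?thesis by (simp add: has_vector_derivative_def partial_def linear_scale)
qed

text \<open>A uniform second order bound suffices: for \<open>|t| <= 1\<close> the remainder
  vanishes outside a fixed ball, so its norm is at most the supremum times the root of the
  volume.\<close>

lemma test_taylor:
  assumes u: "u \<in> test_functions"
  obtains K where "K \<ge> 0" "\<And>t. \<bar>t\<bar> \<le> 1 \<Longrightarrow>
    norm (translate (t *\<^sub>R axis j 1) (cls u) - cls u - t *\<^sub>R cls (partial j u)) \<le> K * t\<^sup>2"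
proof -
  define v where "v = partial j u"
  have v: "v \<in> test_functions" unfolding v_def by (rule test_partial[OF u])
  obtain M where M: "M \<ge> 0" "\<And>x. cmod (partial j v x) \<le> M" using test_bounded[OF test_partial[OF v]] by blast
  obtain r1 where r1: "r1 > 0" "\<And>x. norm x > r1 \<Longrightarrow> u x = 0" using test_support[OF u] by blast
  obtain r2 where r2: "r2 > 0" "\<And>x. norm x > r2 \<Longrightarrow> v x = 0" using test_support[OF v] by blast
  \<comment> \<open>The margin 1 covers the supports of all translates by
    \<open>|t| <= 1\<close>.\<close>
  define r where "r = max r1 r2 + 1"
  define e where "e = (axis j 1 :: real^3)"
  \<comment> \<open>\<open>3 M\<close> is the linearization error \<open>2 M\<close> plus the linear
    term \<open>M\<close>.\<close>
  have v_le: "cmod (v (x + s *\<^sub>R e) - v x) \<le> 3 * M * \<bar>s\<bar>" for x s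
  proof -
    have "cmod (v (x + s *\<^sub>R e) - v (x + 0 *\<^sub>R e) - (s - 0) *\<^sub>R partial j v (x + 0 *\<^sub>R e)) \<le> norm (s - 0) * (2 * M)"
      using M(2)[of "x + _ *\<^sub>R e"] M(2)[of x]
      by (intro vector_differentiable_bound_linearization[where S = UNIV and f = "\<lambda>s. v (x + s *\<^sub>R e)" and f' = "\<lambda>s. partial j v (x + s *\<^sub>R e)"])
        (auto intro!: smooth_line_derivative[OF test_smooth[OF v], where j = j, folded e_def] order_trans[OF norm_triangle_ineq4] add_mono[of _ M _ M, simplified])
    moreover have "cmod (s *\<^sub>R partial j v x) \<le> \<bar>s\<bar> * M" using M by (simp add: mult_left_mono)
    ultimately show ?thesis
      using norm_triangle_sub[of "v (x + s *\<^sub>R e) - v x" "s *\<^sub>R partial j v x"] by (simp add: algebra_simps)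
  qed
  have u_le: "cmod (u (x + t *\<^sub>R e) - u x - t *\<^sub>R v x) \<le> 3 * M * t\<^sup>2" for x t
  proof -
    have "cmod (u (x + t *\<^sub>R e) - u (x + 0 *\<^sub>R e) - (t - 0) *\<^sub>R v (x + 0 *\<^sub>R e)) \<le> norm (t - 0) * (3 * M * \<bar>t\<bar>)"
    proof (rule vector_differentiable_bound_linearization[where S = "closed_segment 0 t" and f = "\<lambda>s. u (x + s *\<^sub>R e)" and f' = "\<lambda>s. v (x + s *\<^sub>R e)"])
      fix s assume s: "s \<in> closed_segment 0 t"
      then have "\<bar>s\<bar> \<le> \<bar>t\<bar>" by (auto simp: closed_segment_eq_real_ivl split: if_splits)
      then show "cmod (v (x + s *\<^sub>R e) - v (x + 0 *\<^sub>R e)) \<le> 3 * M * \<bar>t\<bar>"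
        using v_le[of x s] M(1) mult_left_mono[of "\<bar>s\<bar>" "\<bar>t\<bar>" "3 * M"] by simp
      show "((\<lambda>s. u (x + s *\<^sub>R e)) has_vector_derivative v (x + s *\<^sub>R e)) (at s within closed_segment 0 t)"
        unfolding v_def e_def by (rule smooth_line_derivative[OF test_smooth[OF u]])
    qed auto
    then show ?thesis by (simp add: power2_eq_square mult_ac)
  qed
  have "norm (translate (t *\<^sub>R e) (cls u) - cls u - t *\<^sub>R cls v)
      \<le> 3 * M * t\<^sup>2 * sqrt (measure lborel (cball (0::real^3) r))" if t: "\<bar>t\<bar> \<le> 1" for t
  proof -
    let ?g = "\<lambda>x. u (x + t *\<^sub>R e) - u x - of_real t * v x"
    have "translate (t *\<^sub>R e) (cls u) - cls u - t *\<^sub>R cls v = cls ?g"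
      using u v by (simp add: cls_shift cls_diff cls_scaleR L2_shift L2_diff L2_scale)
    moreover have "norm (cls ?g) \<le> 3 * M * t\<^sup>2 * sqrt (measure lborel (cball (0::real^3) r))"
    proof (rule L2_compact_support)
      show "?g \<in> borel_measurable borel"
        using L2_diff[OF L2_diff[OF L2_shift L2_scale[of v]]] u v by (auto simp: L2_shift L2_scale L2_diff intro!: L2_measurable)
      show "cmod (?g x) \<le> 3 * M * t\<^sup>2" for x using u_le[of x t] by (simp add: scaleR_conv_of_real)
      fix x :: "real^3" assume x: "norm x > r"
      have "norm (x + t *\<^sub>R e) \<ge> norm x - norm (t *\<^sub>R e)" using norm_triangle_ineq2[of x "- t *\<^sub>R e"] by simp
      then have "norm (x + t *\<^sub>R e) \<ge> norm x - 1" using t by (simp add: e_def)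
      then show "?g x = 0" using x r1(2) r2(2) by (simp add: r_def)
    qed
    ultimately show ?thesis by simp
  qed
  then show ?thesis using that[of "3 * M * sqrt (measure lborel (cball (0::real^3) r))"] M(1)
    by (simp add: e_def v_def mult_ac)
qed

lemma test_derivative:
  assumes u: "u \<in> test_functions"
  shows "((\<lambda>t. translate (t *\<^sub>R axis j 1) (cls u)) has_vector_derivative cls (partial j u)) (at 0)"
proof -
  obtain K where K: "K \<ge> 0" "\<And>t. \<bar>t\<bar> \<le> 1 \<Longrightarrow>
    norm (translate (t *\<^sub>R axis j 1) (cls u) - cls u - t *\<^sub>R cls (partial j u)) \<le> K * t\<^sup>2"
    using test_taylor[OF u] by blast
  have "((\<lambda>t. norm (translate (t *\<^sub>R axis j 1) (cls u) - cls u - t *\<^sub>R cls (partial j u)) / norm t) \<longlongrightarrow> 0) (at 0)"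
  proof (rule tendsto_sandwich[OF _ _ tendsto_const])
    have "((\<lambda>t::real. K * \<bar>t\<bar>) \<longlongrightarrow> K * \<bar>0\<bar>) (at 0)" by (intro tendsto_intros)
    then show "((\<lambda>t::real. K * \<bar>t\<bar>) \<longlongrightarrow> 0) (at 0)" by simp
    have "\<forall>\<^sub>F t in at 0. \<bar>t\<bar> \<le> (1::real)" by (auto simp: eventually_at intro!: exI[of _ 1])
    then show "\<forall>\<^sub>F t in at 0. norm (translate (t *\<^sub>R axis j 1) (cls u) - cls u - t *\<^sub>R cls (partial j u)) / norm t \<le> K * \<bar>t\<bar>"
    proof eventually_elim
      case (elim t)
      show ?case
      proof (cases "t = 0")
        case False
        then show ?thesis using K(2)[OF elim] by (simp add: divide_le_eq power2_eq_square mult.assoc)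
      qed simp
    qed
  qed auto
  then show ?thesis
    by (simp add: has_vector_derivative_def has_derivative_iff_norm bounded_linear_scaleR_left)
qed

lemma test_CO: "u \<in> test_functions \<Longrightarrow> cls u \<in> CO"
  using has_vector_derivative_continuous[OF test_derivative[of u 3]]
  by (intro COI) (simp add: isCont_def)

lemma test_has_d3: "u \<in> test_functions \<Longrightarrow> has_d3 (cls u) (cls (partial 3 u))"
  by (simp add: has_d3_def test_CO test_derivative test_partial)

text \<open>Both sides are the derivative at 0 of the pairing of a translate of \<open>u\<close>
  with \<open>v\<close>, on the right after moving the translation to \<open>v\<close>.\<close>

lemma integration_by_parts:
  assumes u: "u \<in> test_functions" and v: "v \<in> test_functions"
  shows "inner (cls (partial j u)) (cls v) = - inner (cls u) (cls (partial j v))"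
proof -
  have "((\<lambda>t. inner (translate (t *\<^sub>R axis j 1) (cls u)) (cls v)) has_vector_derivative inner (cls (partial j u)) (cls v)) (at 0)"
    by (intro bounded_linear.has_vector_derivative[OF bounded_linear_inner_left] test_derivative u)
  moreover have "((\<lambda>t. inner (translate (t *\<^sub>R axis j 1) (cls u)) (cls v)) has_vector_derivative - inner (cls u) (cls (partial j v))) (at 0)"
  proof -
    have "((\<lambda>t. translate (t *\<^sub>R axis j 1) (cls v)) has_vector_derivative cls (partial j v)) (at (- 0))"
      using test_derivative[OF v] by simp
    moreover have "(uminus has_vector_derivative (-1)) (at (0::real))"
      by (auto intro!: derivative_eq_intros)
    ultimately have "(((\<lambda>t. translate (t *\<^sub>R axis j 1) (cls v)) \<circ> uminus) has_vector_derivative (-1) *\<^sub>R cls (partial j v)) (at 0)"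
      by (intro vector_diff_chain_at)
    from bounded_linear.has_vector_derivative[OF bounded_linear_inner_right this, of "cls u"]
    show ?thesis by (simp add: o_def inner_shift)
  qed
  ultimately show ?thesis by (rule vector_derivative_unique_at)
qed

text \<open>Derivatives commute because translations do.\<close>

lemma partial_commute_weak:
  assumes u: "u \<in> test_functions" and v: "v \<in> test_functions"
  shows "inner (cls (partial i (partial j u))) (cls v) = inner (cls (partial j (partial i u))) (cls v)"
proof -
  have "((\<lambda>t. inner (translate (t *\<^sub>R axis j 1) (cls u)) (cls (partial i v))) has_vector_derivative
      inner (cls (partial j u)) (cls (partial i v))) (at 0)"
    by (intro bounded_linear.has_vector_derivative[OF bounded_linear_inner_left] test_derivative u)
  moreover have "inner (translate (t *\<^sub>R axis j 1) (cls u)) (cls (partial i v))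
      = - inner (translate (t *\<^sub>R axis j 1) (cls (partial i u))) (cls v)" for t
    using integration_by_parts[OF test_shift[OF u] v, of i "t *\<^sub>R axis j 1"]
    by (simp add: cls_shift u test_partial partial_shift test_diff_at)
  moreover have "((\<lambda>t. - inner (translate (t *\<^sub>R axis j 1) (cls (partial i u))) (cls v)) has_vector_derivative
      - inner (cls (partial j (partial i u))) (cls v)) (at 0)"
    by (intro has_vector_derivative_minus bounded_linear.has_vector_derivative[OF bounded_linear_inner_left]
        test_derivative test_partial u)
  ultimately have "inner (cls (partial j u)) (cls (partial i v)) = - inner (cls (partial j (partial i u))) (cls v)"
    using vector_derivative_unique_at by simp
  then show ?thesis
    using integration_by_parts[OF test_partial[OF u] v, of i j] by simp
qed

section \<open>The magnetic form\<close>

lemma subspace_closure_normed: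
  fixes S :: "'a::real_normed_vector set"
  assumes S: "subspace S"
  shows "subspace (closure S)"
  unfolding subspace_def
proof (intro conjI ballI allI)
  show "0 \<in> closure S" using subspace_0[OF S] closure_subset by blast
next
  fix x y assume "x \<in> closure S" "y \<in> closure S"
  then obtain f g where "\<forall>n. f n \<in> S" "f \<longlonglongrightarrow> x" "\<forall>n. g n \<in> S" "g \<longlonglongrightarrow> y" unfolding closure_sequential by blast
  then show "x + y \<in> closure S" unfolding closure_sequential
    by (intro exI[of _ "\<lambda>n. f n + g n"]) (auto intro: tendsto_add subspace_add[OF S])
next
  fix x and c :: real assume "x \<in> closure S"
  then obtain f where "\<forall>n. f n \<in> S" "f \<longlonglongrightarrow> x" unfolding closure_sequential by blast
  then show "c *\<^sub>R x \<in> closure S" unfolding closure_sequential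
    by (intro exI[of _ "\<lambda>n. c *\<^sub>R f n"]) (auto intro: tendsto_scaleR subspace_scale[OF S])
qed

lemma partial_cmult: "u \<in> test_functions \<Longrightarrow> partial j (\<lambda>x. c * u x) = (\<lambda>x. c * partial j u x)"
  by (subst partial_mult) (auto simp: test_diff_at partial_const)

lemma partial_add_test:
  "u \<in> test_functions \<Longrightarrow> v \<in> test_functions \<Longrightarrow> partial j (\<lambda>x. u x + v x) = (\<lambda>x. partial j u x + partial j v x)"
  by (rule partial_add) (auto simp: test_diff_at)

locale magnetic =
  fixes b :: real
begin

abbreviation D :: "3 \<Rightarrow> wavefn \<Rightarrow> wavefn" where "D \<equiv> magnetic_derivative b"

definition A :: "3 \<Rightarrow> real^3 \<Rightarrow> complex" where "A j x = of_real (vector_potential b x $ j)"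

lemma D_def: "D j u = (\<lambda>x. - \<i> * partial j u x - A j x * u x)"
  by (simp add: magnetic_derivative_def A_def)

lemma A_simps: "A 1 = (\<lambda>x. - of_real (b / 2) * of_real (x $ 2))" "A 2 = (\<lambda>x. of_real (b / 2) * of_real (x $ 1))"
  "A 3 = (\<lambda>x. 0)"
  by (auto simp: A_def vector_potential_def fun_eq_iff)

lemma smooth_A: "smooth (A j)"
proof -
  have "smooth (A 1)" "smooth (A 2)" "smooth (A 3)"
    unfolding A_simps by (intro smooth_cmult smooth_coord smooth_const)+
  then show ?thesis using exhaust_3[of j] by auto
qed

lemma partial_A: "partial 1 (A 2) = (\<lambda>x. of_real (b / 2))" "partial 2 (A 1) = (\<lambda>x. - of_real (b / 2))"
  unfolding A_simps by (subst partial_mult; simp add: differentiable_coord partial_const partial_coord)+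

lemma D_test: "u \<in> test_functions \<Longrightarrow> D j u \<in> test_functions"
  unfolding D_def by (intro test_diff test_cmult test_partial test_mult smooth_A)

lemma D_cmult: "u \<in> test_functions \<Longrightarrow> D j (\<lambda>x. c * u x) = (\<lambda>x. c * D j u x)"
  by (simp add: D_def partial_cmult algebra_simps)

lemma D_add: "u \<in> test_functions \<Longrightarrow> v \<in> test_functions \<Longrightarrow> D j (\<lambda>x. u x + v x) = (\<lambda>x. D j u x + D j v x)"
  by (simp add: D_def partial_add_test algebra_simps)

lemma D_sym:
  assumes u: "u \<in> test_functions" and v: "v \<in> test_functions"
  shows "inner (cls (D j u)) (cls v) = inner (cls u) (cls (D j v))"
proof -
  have e: "cls (D j w) = cscale (- \<i>) (cls (partial j w)) - cls (\<lambda>x. A j x * w x)" if "w \<in> test_functions" for w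
    unfolding D_def using that
    by (subst cls_cscale, simp add: test_partial, subst cls_diff)
      (simp_all add: L2_uminus L2_scale test_partial test_mult smooth_A)
  have "inner (cls (\<lambda>x. A j x * u x)) (cls v) = inner (cls u) (cls (\<lambda>x. A j x * v x))"
    using u v by (simp add: cls_inner test_mult smooth_A) (simp add: l2_inner_def A_def mult_ac)
  moreover have "inner (cscale (- \<i>) (cls (partial j u))) (cls v) = inner (cls u) (cscale (- \<i>) (cls (partial j v)))"
  proof -
    have "inner (cls (partial j u)) (cscale \<i> (cls v)) = - inner (cls u) (cscale \<i> (cls (partial j v)))"
      using integration_by_parts[OF u test_cmult[OF v, of \<i>], of j]
      by (simp add: cls_cscale v test_partial partial_cmult)
    then show ?thesis by (simp add: inner_cscale bounded_bilinear.minus_left[OF bounded_bilinear_cscale])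
  qed
  ultimately show ?thesis by (simp add: e u v inner_diff_left inner_diff_right)
qed

text \<open>The constant is the magnetic field: the two cross derivatives of the potential
  contribute \<open>b / 2\<close> each. The relation is paired with a test function because mixed
  partial derivatives have been shown to commute in this weak sense.\<close>

lemma commutator:
  assumes u: "u \<in> test_functions" and v: "v \<in> test_functions"
  shows "inner (cls u) (cls (\<lambda>x. \<i> * (D 1 (D 2 v) x - D 2 (D 1 v) x))) = - b * inner (cls u) (cls v)"
proof -
  let ?m = "\<lambda>x. partial 1 (partial 2 v) x - partial 2 (partial 1 v) x"
  have pD: "partial i (D j v) = (\<lambda>x. - \<i> * partial i (partial j v) x - (A j x * partial i v x + partial i (A j) x * v x))" for i j
  proof -
    have "partial i (D j v) = partial i (\<lambda>x. - \<i> * partial j v x + (- 1) * (A j x * v x))"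
      by (simp add: D_def)
    also have "\<dots> = (\<lambda>x. - \<i> * partial i (partial j v) x + (- 1) * partial i (\<lambda>x. A j x * v x) x)"
      using v by (simp only: partial_add_test partial_cmult test_cmult test_mult smooth_A test_partial)
    also have "partial i (\<lambda>x. A j x * v x) = (\<lambda>x. A j x * partial i v x + partial i (A j) x * v x)"
      using v by (intro partial_mult) (auto simp: test_diff_at smooth_differentiable smooth_A)
    finally show ?thesis by (simp add: fun_eq_iff algebra_simps)
  qed
  have e: "(\<lambda>x. \<i> * (D 1 (D 2 v) x - D 2 (D 1 v) x)) = (\<lambda>x. - \<i> * ?m x - of_real b * v x)"
    unfolding D_def[of _ "D _ v"] pD partial_A unfolding D_def
    by (auto simp: fun_eq_iff algebra_simps complex_eq_iff)
  have m: "inner (cls w) (cls ?m) = 0" if w: "w \<in> test_functions" for w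
    using partial_commute_weak[OF v w, of 1 2] v
    by (simp add: test_partial inner_diff_right inner_commute flip: cls_diff)
  have "cls (\<lambda>x. \<i> * (D 1 (D 2 v) x - D 2 (D 1 v) x)) = cscale (- \<i>) (cls ?m) - b *\<^sub>R cls v"
    unfolding e using v by (simp add: cls_cscale test_partial test_diff cls_scaleR cls_diff L2_scale L2_uminus)
  moreover have "inner (cls u) (cscale (- \<i>) (cls ?m)) = inner (cls (\<lambda>x. \<i> * u x)) (cls ?m)"
    using inner_cscale[of \<i> "cls u" "cls ?m"] u by (simp add: cls_cscale)
  ultimately show ?thesis
    using m[OF test_cmult[OF u, of \<i>]] by (simp add: inner_diff_right)
qed

text \<open>The Landau annihilation operator, with \<open>a'\<close> as formal adjoint; the sign of
  \<open>\<i>\<close> is the one for which the cross terms of \<open>|a u|^2\<close> produce the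
  term \<open>- b\<close> of the form.\<close>

definition a :: "wavefn \<Rightarrow> wavefn" where "a u = (\<lambda>x. D 1 u x + \<i> * D 2 u x)"
definition a' :: "wavefn \<Rightarrow> wavefn" where "a' u = (\<lambda>x. D 1 u x - \<i> * D 2 u x)"

lemma a_test: "u \<in> test_functions \<Longrightarrow> a u \<in> test_functions"
  unfolding a_def by (intro test_add test_cmult D_test)

lemma a_cmult: "u \<in> test_functions \<Longrightarrow> a (\<lambda>x. c * u x) = (\<lambda>x. c * a u x)"
  by (simp add: a_def D_cmult algebra_simps)
lemma a_add: "u \<in> test_functions \<Longrightarrow> v \<in> test_functions \<Longrightarrow> a (\<lambda>x. u x + v x) = (\<lambda>x. a u x + a v x)"
  by (simp add: a_def D_add algebra_simps)
lemma a_diff: "u \<in> test_functions \<Longrightarrow> v \<in> test_functions \<Longrightarrow> a (\<lambda>x. u x - v x) = (\<lambda>x. a u x - a v x)"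
  using a_add[of u "\<lambda>x. -1 * v x"] a_cmult[of v "-1"] test_cmult[of v "-1"] by simp
lemma partial_diff_test:
  "u \<in> test_functions \<Longrightarrow> v \<in> test_functions \<Longrightarrow> partial j (\<lambda>x. u x - v x) = (\<lambda>x. partial j u x - partial j v x)"
  using partial_add_test[of u "\<lambda>x. -1 * v x" j] partial_cmult[of v j "-1"] test_cmult[of v "-1"] by simp

lemma cls_a: "u \<in> test_functions \<Longrightarrow> cls (a u) = cls (D 1 u) + cscale \<i> (cls (D 2 u))"
  unfolding a_def by (simp add: cls_cscale cls_add D_test L2_scale)
lemma cls_a': "u \<in> test_functions \<Longrightarrow> cls (a' u) = cls (D 1 u) - cscale \<i> (cls (D 2 u))"
  unfolding a'_def by (simp add: cls_cscale cls_diff D_test L2_scale)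

lemma a_adjoint:
  assumes u: "u \<in> test_functions" and v: "v \<in> test_functions"
  shows "inner (cls (a u)) (cls v) = inner (cls u) (cls (a' v))"
proof -
  have "inner (cscale \<i> (cls (D 2 u))) (cls v) = inner (cls (D 2 (\<lambda>x. \<i> * u x))) (cls v)"
    using u by (simp add: cls_cscale D_test D_cmult)
  also have "\<dots> = inner (cscale \<i> (cls u)) (cls (D 2 v))"
    using u by (simp add: D_sym test_cmult v cls_cscale)
  also have "\<dots> = inner (cls u) (- cscale \<i> (cls (D 2 v)))"
    by (simp add: inner_cscale bounded_bilinear.minus_left[OF bounded_bilinear_cscale])
  finally show ?thesis
    using D_sym[OF u v, of 1] by (simp add: cls_a cls_a' u v inner_add_left inner_diff_right)
qed

definition form :: "wavefn \<Rightarrow> wavefn \<Rightarrow> real" where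
  "form u v = inner (cls (a u)) (cls (a v)) + inner (cls (partial 3 u)) (cls (partial 3 v))"

text \<open>The zeroth-order term \<open>- b\<close> of the form is the commutator of the first two components.\<close>

lemma Re_magnetic_form:
  assumes u: "u \<in> test_functions" and v: "v \<in> test_functions"
  shows "Re (magnetic_form b u v) = form u v"
proof -
  have c: "inner (cls (D 1 u)) (cscale \<i> (cls (D 2 v))) + inner (cscale \<i> (cls (D 2 u))) (cls (D 1 v)) = - b * inner (cls u) (cls v)"
  proof -
    have 1: "inner (cls (D 1 u)) (cscale \<i> (cls (D 2 v))) = inner (cls u) (cls (\<lambda>x. \<i> * D 1 (D 2 v) x))"
      using D_sym[OF u test_cmult[OF D_test[OF v]], of 1 \<i> 2] v by (simp add: cls_cscale D_test D_cmult)
    have "inner (cscale \<i> (cls (D 2 u))) (cls (D 1 v)) = - inner (cls (D 2 u)) (cls (\<lambda>x. \<i> * D 1 v x))"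
      using v by (simp add: inner_cscale bounded_bilinear.minus_left[OF bounded_bilinear_cscale] cls_cscale D_test)
    also have "\<dots> = - inner (cls u) (cls (\<lambda>x. \<i> * D 2 (D 1 v) x))"
      using D_sym[OF u test_cmult[OF D_test[OF v]], of 2 \<i> 1] v by (simp add: D_test D_cmult)
    finally have 2: "inner (cscale \<i> (cls (D 2 u))) (cls (D 1 v)) = - inner (cls u) (cls (\<lambda>x. \<i> * D 2 (D 1 v) x))" .
    have "cls (\<lambda>x. \<i> * (D 1 (D 2 v) x - D 2 (D 1 v) x)) = cls (\<lambda>x. \<i> * D 1 (D 2 v) x) - cls (\<lambda>x. \<i> * D 2 (D 1 v) x)"
      using v by (simp add: cls_diff test_cmult D_test right_diff_distrib)
    then show ?thesis using commutator[OF u v] by (simp add: 1 2 inner_diff_right)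
  qed
  have D3: "cls (D 3 w) = cscale (- \<i>) (cls (partial 3 w))" if "w \<in> test_functions" for w
    using that by (simp add: D_def A_simps cls_cscale test_partial)
  have "Re (magnetic_form b u v) = inner (cls (D 1 u)) (cls (D 1 v)) + inner (cls (D 2 u)) (cls (D 2 v))
      + inner (cls (D 3 u)) (cls (D 3 v)) - b * inner (cls u) (cls v)"
    using u v by (simp add: magnetic_form_def sum_3 cls_inner D_test)
  then show ?thesis
    using c u v by (simp add: form_def cls_a inner_add_left inner_add_right D3 inner_cscale cscale_cscale)
qed

lemma magnetic_form_i:
  assumes u: "u \<in> test_functions"
  shows "magnetic_form b (\<lambda>x. \<i> * u x) v = \<i> * magnetic_form b u v"
proof -
  have "l2_inner (\<lambda>x. \<i> * f x) g = \<i> * l2_inner f g" for f g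
    by (simp add: l2_inner_def mult.assoc)
  then show ?thesis using D_cmult[OF u, of _ \<i>]
    by (simp add: magnetic_form_def sum_distrib_left right_diff_distrib)
qed

text \<open>Complex linearity in the first argument recovers the imaginary part from the real part
  at \<open>\<i> u\<close>.\<close>

lemma magnetic_form_eq:
  assumes u: "u \<in> test_functions" and v: "v \<in> test_functions"
  shows "magnetic_form b u v = Complex (form u v) (- form (\<lambda>x. \<i> * u x) v)"
  using Re_magnetic_form[OF u v] Re_magnetic_form[OF test_cmult[OF u] v, of \<i>] magnetic_form_i[OF u, of v]
  by (simp add: complex_eq_iff)

lemma cmod_magnetic_form_self:
  assumes u: "u \<in> test_functions"
  shows "cmod (magnetic_form b u u) = (norm (cls (a u)))\<^sup>2 + (norm (cls (partial 3 u)))\<^sup>2"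
proof -
  have "Im (magnetic_form b u u) = 0" by (simp add: magnetic_form_def l2_inner_self)
  then have "cmod (magnetic_form b u u) = \<bar>Re (magnetic_form b u u)\<bar>" by (simp add: cmod_def)
  then show ?thesis by (simp add: Re_magnetic_form u form_def power2_norm_eq_inner)
qed

section \<open>Closed graphs of the form and of the annihilation operator\<close>

text \<open>A member is a vector of the form domain together with its two generalized derivatives,
  as limits along one sequence of test functions; by \<open>Gm_zero\<close> the vector determines
  them.\<close>

definition Gm :: "(l2 \<times> l2 \<times> l2) set" where
  "Gm = closure {(cls u, cls (a u), cls (partial 3 u)) | u. u \<in> test_functions}"

text \<open>The closure for \<open>a\<close> alone asks for no derivative in \<open>x_3\<close>. The
  operator \<open>B\<close> built from it commutes with translations along \<open>x_3\<close> and
  with multiplication by weights in \<open>x_3\<close>.\<close>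

definition Ga :: "(l2 \<times> l2) set" where
  "Ga = closure {(cls u, cls (a u)) | u. u \<in> test_functions}"

lemma closed_Gm: "closed Gm" and closed_Ga: "closed Ga"
  by (simp_all add: Gm_def Ga_def)

lemma subspace_Gm: "subspace Gm"
  unfolding Gm_def
proof (rule subspace_closure_normed, unfold subspace_def, intro conjI ballI allI)
  let ?S = "{(cls u, cls (a u), cls (partial 3 u)) | u. u \<in> test_functions}"
  show "0 \<in> ?S"
    using a_cmult[OF test_zero, of 0] test_zero
    by (auto simp: zero_prod_def cls_zero partial_const intro!: exI[of _ "\<lambda>x. 0"])
next
  let ?S = "{(cls u, cls (a u), cls (partial 3 u)) | u. u \<in> test_functions}"
  fix x y assume "x \<in> ?S" "y \<in> ?S"
  then obtain u v where uv: "u \<in> test_functions" "v \<in> test_functions"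
    "x = (cls u, cls (a u), cls (partial 3 u))" "y = (cls v, cls (a v), cls (partial 3 v))" by auto
  then have "x + y = (cls (\<lambda>x. u x + v x), cls (a (\<lambda>x. u x + v x)), cls (partial 3 (\<lambda>x. u x + v x)))"
    by (simp add: a_add partial_add_test cls_add a_test test_partial)
  then show "x + y \<in> ?S" using test_add uv by blast
next
  let ?S = "{(cls u, cls (a u), cls (partial 3 u)) | u. u \<in> test_functions}"
  fix x and c :: real assume "x \<in> ?S"
  then obtain u where u: "u \<in> test_functions" "x = (cls u, cls (a u), cls (partial 3 u))" by auto
  then have "c *\<^sub>R x = (cls (\<lambda>x. of_real c * u x), cls (a (\<lambda>x. of_real c * u x)), cls (partial 3 (\<lambda>x. of_real c * u x)))"
    by (simp add: a_cmult partial_cmult cls_scaleR a_test test_partial)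
  then show "c *\<^sub>R x \<in> ?S" using test_cmult u by blast
qed

lemma Ga_image: "Ga = closure ((\<lambda>(u, p, q). (u, p)) ` {(cls u, cls (a u), cls (partial 3 u)) | u. u \<in> test_functions})"
  unfolding Ga_def by (rule arg_cong[where f = closure]) force

lemma Gm_Ga: "(u, p, q) \<in> Gm \<Longrightarrow> (u, p) \<in> Ga"
proof -
  have "(\<lambda>(u, p, q). (u, p)) ` Gm \<subseteq> Ga"
    unfolding Gm_def Ga_image
    by (intro image_closure_subset closed_closure closure_subset) (auto simp: case_prod_unfold intro!: continuous_intros)
  then show "(u, p, q) \<in> Gm \<Longrightarrow> (u, p) \<in> Ga" by force
qed

lemma subspace_Ga: "subspace Ga"
  unfolding Ga_def
proof (rule subspace_closure_normed, unfold subspace_def, intro conjI ballI allI)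
  let ?S = "{(cls u, cls (a u)) | u. u \<in> test_functions}"
  show "0 \<in> ?S"
    using a_cmult[OF test_zero, of 0] test_zero
    by (auto simp: zero_prod_def cls_zero intro!: exI[of _ "\<lambda>x. 0"])
next
  let ?S = "{(cls u, cls (a u)) | u. u \<in> test_functions}"
  fix x y assume "x \<in> ?S" "y \<in> ?S"
  then obtain u v where uv: "u \<in> test_functions" "v \<in> test_functions"
    "x = (cls u, cls (a u))" "y = (cls v, cls (a v))" by auto
  then have "x + y = (cls (\<lambda>x. u x + v x), cls (a (\<lambda>x. u x + v x)))"
    by (simp add: a_add cls_add a_test)
  then show "x + y \<in> ?S" using test_add uv by blast
next
  let ?S = "{(cls u, cls (a u)) | u. u \<in> test_functions}"
  fix x and c :: real assume "x \<in> ?S"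
  then obtain u where u: "u \<in> test_functions" "x = (cls u, cls (a u))" by auto
  then have "c *\<^sub>R x = (cls (\<lambda>x. of_real c * u x), cls (a (\<lambda>x. of_real c * u x)))"
    by (simp add: a_cmult cls_scaleR a_test)
  then show "c *\<^sub>R x \<in> ?S" using test_cmult u by blast
qed

lemma Gm_bounded_linear:
  assumes "bounded_linear T"
    and "\<And>u. u \<in> test_functions \<Longrightarrow> (T (cls u), T (cls (a u)), T (cls (partial 3 u))) \<in> Gm"
    and "(u, p, q) \<in> Gm"
  shows "(T u, T p, T q) \<in> Gm"
proof -
  have "(\<lambda>(u, p, q). (T u, T p, T q)) ` Gm \<subseteq> Gm"
    unfolding Gm_def using assms(2)
    by (intro image_closure_subset closed_closure)
      (auto simp: case_prod_unfold Gm_def intro!: continuous_intros bounded_linear.continuous_on[OF assms(1)])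
  then show ?thesis using assms(3) by force
qed

lemma Ga_bounded_linear:
  assumes "bounded_linear T"
    and "\<And>u. u \<in> test_functions \<Longrightarrow> (T (cls u), T (cls (a u))) \<in> Ga"
    and "(u, p) \<in> Ga"
  shows "(T u, T p) \<in> Ga"
proof -
  have "(\<lambda>(u, p). (T u, T p)) ` Ga \<subseteq> Ga"
    unfolding Ga_def using assms(2)
    by (intro image_closure_subset closed_closure)
      (auto simp: case_prod_unfold Ga_def intro!: continuous_intros bounded_linear.continuous_on[OF assms(1)])
  then show ?thesis using assms(3) by force
qed

lemma test_in_Gm: "u \<in> test_functions \<Longrightarrow> (cls u, cls (a u), cls (partial 3 u)) \<in> Gm"
  unfolding Gm_def by (rule subsetD[OF closure_subset]) blast
lemma test_in_Ga: "u \<in> test_functions \<Longrightarrow> (cls u, cls (a u)) \<in> Ga"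
  unfolding Ga_def by (rule subsetD[OF closure_subset]) blast

lemma Gm_cscale: "(u, p, q) \<in> Gm \<Longrightarrow> (cscale c u, cscale c p, cscale c q) \<in> Gm"
  by (rule Gm_bounded_linear[OF bounded_linear_cscale])
    (use test_in_Gm[OF test_cmult, of _ c] in \<open>auto simp: cls_cscale a_test test_partial a_cmult partial_cmult\<close>)

lemma Ga_cscale: "(u, p) \<in> Ga \<Longrightarrow> (cscale c u, cscale c p) \<in> Ga"
  by (rule Ga_bounded_linear[OF bounded_linear_cscale])
    (use test_in_Ga[OF test_cmult, of _ c] in \<open>auto simp: cls_cscale a_test a_cmult\<close>)

lemma a_shift3: "u \<in> test_functions \<Longrightarrow> a (\<lambda>x. u (x + t *\<^sub>R axis 3 1)) = (\<lambda>x. a u (x + t *\<^sub>R axis 3 1))"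
  by (simp add: a_def D_def partial_shift test_diff_at A_simps fun_eq_iff axis_def)

lemma Gm_shift3: "(u, p, q) \<in> Gm \<Longrightarrow> (translate3 t u, translate3 t p, translate3 t q) \<in> Gm"
  by (rule Gm_bounded_linear[OF bounded_linear_shift])
    (use test_in_Gm[OF test_shift, of _ "t *\<^sub>R axis 3 1"] in
      \<open>auto simp: cls_shift a_test test_partial a_shift3 partial_shift test_diff_at\<close>)

lemma Ga_shift3: "(u, p) \<in> Ga \<Longrightarrow> (translate3 t u, translate3 t p) \<in> Ga"
  by (rule Ga_bounded_linear[OF bounded_linear_shift])
    (use test_in_Ga[OF test_shift, of _ "t *\<^sub>R axis 3 1"] in \<open>auto simp: cls_shift a_test a_shift3\<close>)

lemma a_mult:
  assumes "smooth h" "partial 1 h = (\<lambda>x. 0)" "partial 2 h = (\<lambda>x. 0)" "u \<in> test_functions"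
  shows "a (\<lambda>x. h x * u x) = (\<lambda>x. h x * a u x)"
  using assms by (simp add: a_def D_def partial_mult smooth_differentiable test_diff_at fun_eq_iff algebra_simps)

lemma Ga_CO:
  assumes "(u, p) \<in> Ga"
  shows "u \<in> CO" "p \<in> CO"
proof -
  have "Ga \<subseteq> CO \<times> CO"
    unfolding Ga_def by (rule closure_minimal) (auto intro: test_CO a_test closed_Times closed_CO)
  then show "u \<in> CO" "p \<in> CO" using assms by auto
qed

lemma Gm_CO:
  assumes "(u, p, q) \<in> Gm"
  shows "u \<in> CO" "p \<in> CO" "q \<in> CO"
proof -
  have "Gm \<subseteq> CO \<times> CO \<times> CO"
    unfolding Gm_def by (rule closure_minimal) (auto intro: test_CO a_test test_partial closed_Times closed_CO)
  then show "u \<in> CO" "p \<in> CO" "q \<in> CO" using assms by auto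
qed

lemma Gm_sequence:
  assumes "(u, p, q) \<in> Gm"
  obtains s where "\<And>n. s n \<in> test_functions" "(\<lambda>n. cls (s n)) \<longlonglongrightarrow> u" "(\<lambda>n. cls (a (s n))) \<longlonglongrightarrow> p"
    "(\<lambda>n. cls (partial 3 (s n))) \<longlonglongrightarrow> q"
proof -
  obtain x where x: "\<And>n. x n \<in> {(cls u, cls (a u), cls (partial 3 u)) | u. u \<in> test_functions}" "x \<longlonglongrightarrow> (u, p, q)"
    using assms unfolding Gm_def closure_sequential by blast
  then have "\<forall>n. \<exists>s. s \<in> test_functions \<and> x n = (cls s, cls (a s), cls (partial 3 s))" by blast
  then obtain s where s: "\<And>n. s n \<in> test_functions" "\<And>n. x n = (cls (s n), cls (a (s n)), cls (partial 3 (s n)))" by metis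
  show ?thesis
    using that[OF s(1)] tendsto_fst[OF x(2)] tendsto_fst[OF tendsto_snd[OF x(2)]] tendsto_snd[OF tendsto_snd[OF x(2)]]
    by (simp add: s(2))
qed

lemma Gm_limit:
  assumes "\<And>n. s n \<in> test_functions" "(\<lambda>n. cls (s n)) \<longlonglongrightarrow> u" "(\<lambda>n. cls (a (s n))) \<longlonglongrightarrow> p"
    "(\<lambda>n. cls (partial 3 (s n))) \<longlonglongrightarrow> q"
  shows "(u, p, q) \<in> Gm"
  by (rule closed_sequentially[OF closed_Gm, of "\<lambda>n. (cls (s n), cls (a (s n)), cls (partial 3 (s n)))"])
    (use assms in \<open>auto intro: test_in_Gm tendsto_Pair\<close>)

text \<open>The components are limits of test functions and orthogonal to all test functions.\<close>

lemma Gm_zero: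
  assumes "(0, p, q) \<in> Gm"
  shows "p = 0" "q = 0"
proof -
  obtain s where s: "\<And>n. s n \<in> test_functions" "(\<lambda>n. cls (s n)) \<longlonglongrightarrow> 0" "(\<lambda>n. cls (a (s n))) \<longlonglongrightarrow> p"
    "(\<lambda>n. cls (partial 3 (s n))) \<longlonglongrightarrow> q" using Gm_sequence[OF assms] by metis
  have z: "(\<lambda>n. inner (cls (s n)) w) \<longlonglongrightarrow> 0" for w
    using bounded_linear.tendsto[OF bounded_linear_inner_left s(2)] by simp
  have "inner p (cls w) = 0" "inner q (cls w) = 0" if w: "w \<in> test_functions" for w
  proof -
    show "inner p (cls w) = 0"
      using LIMSEQ_unique[OF bounded_linear.tendsto[OF bounded_linear_inner_left s(3), of "cls w"]]
        z[of "cls (a' w)"] by (simp add: a_adjoint s(1) w)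
    show "inner q (cls w) = 0"
      using LIMSEQ_unique[OF bounded_linear.tendsto[OF bounded_linear_inner_left s(4), of "cls w"]]
        tendsto_minus[OF z[of "cls (partial 3 w)"]] by (simp add: integration_by_parts s(1) w)
  qed
  then have "inner p p = 0" "inner q q = 0"
    using LIMSEQ_unique[OF bounded_linear.tendsto[OF bounded_linear_inner_right s(3), of p], of 0]
      LIMSEQ_unique[OF bounded_linear.tendsto[OF bounded_linear_inner_right s(4), of q], of 0]
    by (simp_all add: a_test test_partial s(1))
  then show "p = 0" "q = 0" by simp_all
qed

lemma Gm_unique: "(u, p, q) \<in> Gm \<Longrightarrow> (u, p', q') \<in> Gm \<Longrightarrow> p = p' \<and> q = q'"
  using Gm_zero[of "p - p'" "q - q'"] subspace_diff[OF subspace_Gm, of "(u, p, q)" "(u, p', q')"] by simp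

text \<open>On a difference of test functions the form is the sum of the squared norms of the two
  derivative components, so a Cauchy sequence for the form is one for which both converge.\<close>

lemma form_converges_iff:
  "form_converges b s u \<longleftrightarrow> (\<forall>n. s n \<in> test_functions) \<and> u \<in> L2 \<and> (\<lambda>n. cls (s n)) \<longlonglongrightarrow> cls u \<and>
    convergent (\<lambda>n. cls (a (s n))) \<and> convergent (\<lambda>n. cls (partial 3 (s n)))"
proof (cases "(\<forall>n. s n \<in> test_functions) \<and> u \<in> L2")
  case True
  then have s: "\<And>n. s n \<in> test_functions" and u: "u \<in> L2" by auto
  have 1: "(\<lambda>n. l2_norm (\<lambda>x. s n x - u x)) \<longlonglongrightarrow> 0 \<longleftrightarrow> (\<lambda>n. cls (s n)) \<longlonglongrightarrow> cls u"
  proof -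
    have "l2_norm (\<lambda>x. s n x - u x) = norm (cls (s n) - cls u)" for n
      using s u by (simp add: cls_diff norm_cls L2_diff)
    then show ?thesis by (simp only: tendsto_norm_zero_iff LIM_zero_iff)
  qed
  have d: "cmod (magnetic_form b (\<lambda>x. s m x - s n x) (\<lambda>x. s m x - s n x))
      = (norm (cls (a (s m)) - cls (a (s n))))\<^sup>2 + (norm (cls (partial 3 (s m)) - cls (partial 3 (s n))))\<^sup>2" for m n
    using s by (simp add: cmod_magnetic_form_self test_diff a_diff partial_diff_test cls_diff a_test test_partial)
  have "(\<forall>e>0. \<exists>N. \<forall>m\<ge>N. \<forall>n\<ge>N. cmod (magnetic_form b (\<lambda>x. s m x - s n x) (\<lambda>x. s m x - s n x)) < e)
    \<longleftrightarrow> Cauchy (\<lambda>n. cls (a (s n))) \<and> Cauchy (\<lambda>n. cls (partial 3 (s n)))" (is "?L \<longleftrightarrow> ?R")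
  proof
    assume L: ?L
    have "\<exists>N. \<forall>m\<ge>N. \<forall>n\<ge>N. norm (cls (a (s m)) - cls (a (s n))) < e \<and> norm (cls (partial 3 (s m)) - cls (partial 3 (s n))) < e"
      if e: "e > 0" for e
    proof -
      obtain N where N: "\<And>m n. m \<ge> N \<Longrightarrow> n \<ge> N \<Longrightarrow> cmod (magnetic_form b (\<lambda>x. s m x - s n x) (\<lambda>x. s m x - s n x)) < e\<^sup>2"
        using L e zero_less_power[of e 2] by metis
      have "norm (cls (a (s m)) - cls (a (s n))) < e \<and> norm (cls (partial 3 (s m)) - cls (partial 3 (s n))) < e"
        if "m \<ge> N" "n \<ge> N" for m n
      proof -
        have "(norm (cls (a (s m)) - cls (a (s n))))\<^sup>2 < e\<^sup>2" "(norm (cls (partial 3 (s m)) - cls (partial 3 (s n))))\<^sup>2 < e\<^sup>2"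
          using N[OF that] zero_le_power2[of "norm (cls (a (s m)) - cls (a (s n)))"]
            zero_le_power2[of "norm (cls (partial 3 (s m)) - cls (partial 3 (s n)))"] unfolding d by linarith+
        then show ?thesis using e power2_less_imp_less[of _ e] by auto
      qed
      then show ?thesis by blast
    qed
    then show ?R unfolding Cauchy_iff by meson
  next
    assume R: ?R
    show ?L
    proof (intro allI impI)
      fix e :: real assume e: "e > 0"
      define r where "r = sqrt (e / 2)"
      have r: "r > 0" "r\<^sup>2 = e / 2" using e by (auto simp: r_def)
      obtain N1 where N1: "\<And>m n. m \<ge> N1 \<Longrightarrow> n \<ge> N1 \<Longrightarrow> norm (cls (a (s m)) - cls (a (s n))) < r"
        using R r(1) unfolding Cauchy_iff by meson
      obtain N2 where N2: "\<And>m n. m \<ge> N2 \<Longrightarrow> n \<ge> N2 \<Longrightarrow> norm (cls (partial 3 (s m)) - cls (partial 3 (s n))) < r"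
        using R r(1) unfolding Cauchy_iff by meson
      have "cmod (magnetic_form b (\<lambda>x. s m x - s n x) (\<lambda>x. s m x - s n x)) < e" if "m \<ge> max N1 N2" "n \<ge> max N1 N2" for m n
      proof -
        have "(norm (cls (a (s m)) - cls (a (s n))))\<^sup>2 < r\<^sup>2" "(norm (cls (partial 3 (s m)) - cls (partial 3 (s n))))\<^sup>2 < r\<^sup>2"
          using N1[of m n] N2[of m n] that by (auto intro!: power_strict_mono)
        then show ?thesis unfolding d r(2) by simp
      qed
      then show "\<exists>N. \<forall>m\<ge>N. \<forall>n\<ge>N. cmod (magnetic_form b (\<lambda>x. s m x - s n x) (\<lambda>x. s m x - s n x)) < e" by blast
    qed
  qed
  then show ?thesis unfolding form_converges_def using True 1 by (simp add: Cauchy_convergent_iff)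
qed (auto simp: form_converges_def)

lemma form_converges_Gm:
  assumes "form_converges b s u" "(cls u, p, q) \<in> Gm"
  shows "(\<lambda>n. cls (a (s n))) \<longlonglongrightarrow> p" "(\<lambda>n. cls (partial 3 (s n))) \<longlonglongrightarrow> q"
proof -
  obtain p' q' where l: "(\<lambda>n. cls (a (s n))) \<longlonglongrightarrow> p'" "(\<lambda>n. cls (partial 3 (s n))) \<longlonglongrightarrow> q'"
    using assms(1) by (auto simp: form_converges_iff convergent_def)
  then have "(cls u, p', q') \<in> Gm" using assms(1) by (intro Gm_limit) (auto simp: form_converges_iff)
  then have "p = p'" "q = q'" using Gm_unique assms(2) by blast+
  then show "(\<lambda>n. cls (a (s n))) \<longlonglongrightarrow> p" "(\<lambda>n. cls (partial 3 (s n))) \<longlonglongrightarrow> q" using l by auto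
qed

lemma form_converges_exists: "u \<in> L2 \<Longrightarrow> (cls u, p, q) \<in> Gm \<Longrightarrow> \<exists>s. form_converges b s u"
  by (erule Gm_sequence) (auto simp: form_converges_iff convergent_def)

lemma closed_form_domain_iff: "u \<in> closed_form_domain b \<longleftrightarrow> u \<in> L2 \<and> (\<exists>p q. (cls u, p, q) \<in> Gm)"
proof
  assume "u \<in> closed_form_domain b"
  then obtain s where s: "form_converges b s u" by (auto simp: closed_form_domain_def)
  then obtain p q where "(\<lambda>n. cls (a (s n))) \<longlonglongrightarrow> p" "(\<lambda>n. cls (partial 3 (s n))) \<longlonglongrightarrow> q"
    by (auto simp: form_converges_iff convergent_def)
  then show "u \<in> L2 \<and> (\<exists>p q. (cls u, p, q) \<in> Gm)" 
    using s Gm_limit[of s "cls u" p q] by (auto simp: form_converges_iff)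
qed (use form_converges_exists in \<open>auto simp: closed_form_domain_def\<close>)

text \<open>Every form-convergent sequence has component limits fixed by \<open>Gm\<close>, and such
  sequences exist, so the description by \<open>THE\<close> has exactly one solution.\<close>

lemma closed_magnetic_form_eq:
  assumes u: "u \<in> L2" "(cls u, p, q) \<in> Gm" and v: "v \<in> L2" "(cls v, p', q') \<in> Gm"
  shows "closed_magnetic_form b u v = Complex (inner p p' + inner q q') (- (inner (cscale \<i> p) p' + inner (cscale \<i> q) q'))"
    (is "_ = ?l")
proof -
  have lim: "(\<lambda>n. magnetic_form b (s n) (t n)) \<longlonglongrightarrow> ?l" if s: "form_converges b s u" and t: "form_converges b t v" for s t
  proof -
    have test: "s n \<in> test_functions" "t n \<in> test_functions" for n using s t by (auto simp: form_converges_iff)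
    have e: "magnetic_form b (s n) (t n) = Complex (inner (cls (a (s n))) (cls (a (t n))) + inner (cls (partial 3 (s n))) (cls (partial 3 (t n))))
      (- (inner (cscale \<i> (cls (a (s n)))) (cls (a (t n))) + inner (cscale \<i> (cls (partial 3 (s n)))) (cls (partial 3 (t n)))))" for n
      using test by (simp add: magnetic_form_eq form_def a_cmult partial_cmult cls_cscale a_test test_partial)
    show ?thesis unfolding e
      using form_converges_Gm[OF s u(2)] form_converges_Gm[OF t v(2)]
      by (intro tendsto_Complex tendsto_add tendsto_minus tendsto_inner bounded_linear.tendsto[OF bounded_linear_cscale])
  qed
  obtain s t where st: "form_converges b s u" "form_converges b t v" using form_converges_exists u v by blast
  show ?thesis unfolding closed_magnetic_form_def
  proof (rule the_equality)
    show "\<forall>s t. form_converges b s u \<longrightarrow> form_converges b t v \<longrightarrow> (\<lambda>n. magnetic_form b (s n) (t n)) \<longlonglongrightarrow> ?l"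
      using lim by blast
    show "l = ?l" if "\<forall>s t. form_converges b s u \<longrightarrow> form_converges b t v \<longrightarrow> (\<lambda>n. magnetic_form b (s n) (t n)) \<longlonglongrightarrow> l" for l
      using that st lim LIMSEQ_unique by blast
  qed
qed

text \<open>Real parts suffice: \<open>Gm\<close> is closed under complex multiples, and testing
  with \<open>- \<i> w\<close> yields the imaginary part. From here on \<open>H0\<close> is the weak
  equation \<open>a* p - dq/dx_3 = f\<close> in a real Hilbert space.\<close>

lemma H0_iff:
  "(u, f) \<in> H0 b \<longleftrightarrow> u \<in> L2 \<and> f \<in> L2 \<and> (\<exists>p q. (cls u, p, q) \<in> Gm \<and>
     (\<forall>(w, p', q')\<in>Gm. inner p p' + inner q q' = inner (cls f) w))"
proof
  assume H: "(u, f) \<in> H0 b"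
  then obtain p q where u: "u \<in> L2" "(cls u, p, q) \<in> Gm" and f: "f \<in> L2"
    by (auto simp: H0_def closed_form_domain_iff)
  have "inner p p' + inner q q' = inner (cls f) w" if w: "(w, p', q') \<in> Gm" for w p' q'
  proof -
    have v: "rep w \<in> L2" "(cls (rep w), p', q') \<in> Gm" using w by auto
    then have "closed_magnetic_form b u (rep w) = l2_inner f (rep w)"
      using H by (auto simp: H0_def closed_form_domain_iff)
    then show ?thesis
      unfolding closed_magnetic_form_eq[OF u v] l2_inner_cls[OF f v(1)] by simp
  qed
  then show "u \<in> L2 \<and> f \<in> L2 \<and> (\<exists>p q. (cls u, p, q) \<in> Gm \<and> (\<forall>(w, p', q')\<in>Gm. inner p p' + inner q q' = inner (cls f) w))"
    using u f by blast
next
  assume "u \<in> L2 \<and> f \<in> L2 \<and> (\<exists>p q. (cls u, p, q) \<in> Gm \<and> (\<forall>(w, p', q')\<in>Gm. inner p p' + inner q q' = inner (cls f) w))"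
  then obtain p q where u: "u \<in> L2" "(cls u, p, q) \<in> Gm" and f: "f \<in> L2"
    and eq: "\<And>w p' q'. (w, p', q') \<in> Gm \<Longrightarrow> inner p p' + inner q q' = inner (cls f) w" by fast
  have "closed_magnetic_form b u v = l2_inner f v" if v: "v \<in> L2" "(cls v, p', q') \<in> Gm" for v p' q'
    using eq[OF v(2)] eq[OF Gm_cscale[OF v(2), of "- \<i>"]]
    unfolding closed_magnetic_form_eq[OF u v] l2_inner_cls[OF f v(1)] by (simp add: inner_cscale)
  then show "(u, f) \<in> H0 b"
    using u f by (auto simp: H0_def closed_form_domain_iff)
qed

end

section \<open>The weighted resolvent estimate\<close>

lemma E_diff: "u \<in> CO \<Longrightarrow> v \<in> CO \<Longrightarrow> Im k > 0 \<Longrightarrow> E k (u - v) = E k u - E k v"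
  using E_add[of u "- 1 *\<^sub>R v" k] E_scaleR[of v k "-1"] subspace_scale[OF subspace_CO, of v "-1"] by simp

lemma S_diff: "u \<in> CO \<Longrightarrow> v \<in> CO \<Longrightarrow> Im k > 0 \<Longrightarrow> S s k (u - v) = S s k u - S s k v"
  using S_add[of u "- 1 *\<^sub>R v" k] S_scaleR[of v k s "-1"] subspace_scale[OF subspace_CO, of v "-1"] by simp

lemma E1_diff: "u \<in> CO \<Longrightarrow> v \<in> CO \<Longrightarrow> Im k > 0 \<Longrightarrow> E1 k (u - v) = E1 k u - E1 k v"
  by (simp add: E1_def S_diff algebra_simps)

lemma E_CO:
  assumes u: "u \<in> CO" and k: "Im k > 0"
  shows "E k u \<in> CO"
proof (rule COI)
  have \<tau>u: "translate3 t u \<in> CO" for t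
    by (rule CO_bounded_linear[OF bounded_linear_shift _ u]) (simp add: shift_shift add.commute)
  have le: "norm (translate3 t (E k u) - E k u) \<le> norm (translate3 t u - u) / (cmod k * Im k)" for t
  proof -
    have "translate3 t (E k u) = E k (translate3 t u)"
      by (rule E_bounded_linear[OF bounded_linear_shift _ _ u k]) (simp_all add: shift_cscale shift_shift add.commute)
    then show ?thesis
      using E_norm[OF subspace_diff[OF subspace_CO \<tau>u u] k, of t] by (simp add: E_diff \<tau>u u k)
  qed
  have "continuous_on UNIV (\<lambda>t. translate3 t u)" using u by (simp add: CO_def)
  then have "((\<lambda>t. translate3 t u) \<longlongrightarrow> translate3 0 u) (at 0)" unfolding continuous_on_def by blast
  then have "((\<lambda>t. norm (translate3 t u - u) / (cmod k * Im k)) \<longlongrightarrow> norm (u - u) / (cmod k * Im k)) (at 0)"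
    using k by (intro tendsto_intros) auto
  then have "((\<lambda>t. norm (translate3 t (E k u) - E k u)) \<longlongrightarrow> 0) (at 0)"
    by (intro Lim_null_comparison[of "\<lambda>t. norm (translate3 t (E k u) - E k u)"
        "\<lambda>t. norm (translate3 t u - u) / (cmod k * Im k)"]) (simp_all add: le)
  then show "((\<lambda>t. translate3 t (E k u)) \<longlongrightarrow> E k u) (at 0)"
    by (simp only: tendsto_norm_zero_iff LIM_zero_iff)
qed

lemma E_tendsto:
  assumes x: "\<And>n. x n \<in> CO" and u: "u \<in> CO" and k: "Im k > 0" and lim: "x \<longlonglongrightarrow> u"
  shows "(\<lambda>n. E k (x n)) \<longlonglongrightarrow> E k u" "(\<lambda>n. E1 k (x n)) \<longlonglongrightarrow> E1 k u"
proof -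
  have l0: "(\<lambda>n. norm (x n - u)) \<longlonglongrightarrow> 0"
    using lim by (simp only: LIM_zero_iff tendsto_norm_zero_iff)
  have "(\<lambda>n. norm (x n - u) / (cmod k * Im k)) \<longlonglongrightarrow> 0 / (cmod k * Im k)"
    using k l0 by (intro tendsto_divide tendsto_const) auto
  then have "(\<lambda>n. norm (E k (x n) - E k u)) \<longlonglongrightarrow> 0"
    using E_norm[OF subspace_diff[OF subspace_CO x u] k]
    by (intro Lim_null_comparison[of "\<lambda>n. norm (E k (x n) - E k u)" "\<lambda>n. norm (x n - u) / (cmod k * Im k)"])
      (simp_all add: E_diff x u k)
  then show "(\<lambda>n. E k (x n)) \<longlonglongrightarrow> E k u"
    by (simp only: LIM_zero_iff tendsto_norm_zero_iff)
  have "(\<lambda>n. norm (x n - u) / Im k) \<longlonglongrightarrow> 0 / Im k"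
    using k l0 by (intro tendsto_divide tendsto_const) auto
  then have "(\<lambda>n. norm (E1 k (x n) - E1 k u)) \<longlonglongrightarrow> 0"
    using E1_norm[OF subspace_diff[OF subspace_CO x u] k]
    by (intro Lim_null_comparison[of "\<lambda>n. norm (E1 k (x n) - E1 k u)" "\<lambda>n. norm (x n - u) / Im k"])
      (simp_all add: E1_diff x u k)
  then show "(\<lambda>n. E1 k (x n)) \<longlonglongrightarrow> E1 k u"
    by (simp only: LIM_zero_iff tendsto_norm_zero_iff)
qed

lemma square_root_upper:
  fixes \<zeta> :: complex
  assumes "Im \<zeta> \<noteq> 0"
  obtains k where "k\<^sup>2 = \<zeta>" "Im k > 0"
proof -
  have "Im (csqrt \<zeta>) \<noteq> 0"
  proof
    assume 0: "Im (csqrt \<zeta>) = 0"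
    have "Im \<zeta> = Im ((csqrt \<zeta>)\<^sup>2)" by (simp only: power2_csqrt)
    also have "\<dots> = 0" using 0 by (simp add: power2_eq_square del: csqrt.simps)
    finally show False using assms by simp
  qed
  then consider "Im (csqrt \<zeta>) > 0" | "Im (csqrt \<zeta>) < 0" by linarith
  then show ?thesis
    using that[of "csqrt \<zeta>"] that[of "- csqrt \<zeta>"] by cases (simp_all del: csqrt.simps)
qed

context magnetic
begin

sublocale cg: closed_endo_graph Ga
  by unfold_locales (rule subspace_Ga closed_Ga)+

lemma B_CO: "cg.B x \<in> CO" and K_CO: "cg.K x \<in> CO"
  using Ga_CO[OF cg.BK_in] by blast+

lemma B_cscale: "cg.B (cscale c x) = cscale c (cg.B x)" and K_cscale: "cg.K (cscale c x) = cscale c (cg.K x)"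
  using cg.BK_commute[of "cscale c" "cscale c" "cscale (cnj c)" "cscale (cnj c)" x]
  by (auto intro: Ga_cscale inner_cscale)

lemma B_shift3: "cg.B (translate3 t x) = translate3 t (cg.B x)" and K_shift3: "cg.K (translate3 t x) = translate3 t (cg.K x)"
  using cg.BK_commute[of "translate3 t" "translate3 t" "translate3 (- t)" "translate3 (- t)" x]
    Ga_shift3[of _ _ t] Ga_shift3[of _ _ "- t"]
  by (auto simp: inner_shift)

lemma B_E: "x \<in> CO \<Longrightarrow> Im k > 0 \<Longrightarrow> cg.B (E k x) = E k (cg.B x)"
  by (rule E_bounded_linear) (auto simp: cg.bounded_linear_B B_cscale B_shift3)

lemma K_E: "x \<in> CO \<Longrightarrow> Im k > 0 \<Longrightarrow> cg.K (E k x) = E k (cg.K x)"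
  by (rule E_bounded_linear) (auto simp: cg.bounded_linear_K K_cscale K_shift3)

text \<open>\<open>S\<close> is a limit of integrals over members of \<open>Ga\<close>, which is
  invariant under translations along \<open>x_3\<close> and complex multiples; orthogonality to a
  fixed vector passes through the integral. The third slot of \<open>S_relation\<close> is filled
  with zeros.\<close>

lemma Ga_S:
  assumes "(u, p) \<in> Ga" "Im k > 0"
  shows "(S s k u, S s k p) \<in> Ga"
proof (rule closed_subspace_double_complement[OF subspace_Ga closed_Ga])
  fix y assume y: "\<And>w. w \<in> Ga \<Longrightarrow> inner y w = 0"
  have "inner (S s k u) (fst y) + inner (S s k p) (snd y) + inner (S s k 0) 0 = 0"
  proof (rule S_relation)
    fix c t
    have "(cscale c (translate3 t u), cscale c (translate3 t p)) \<in> Ga" by (intro Ga_cscale Ga_shift3 assms)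
    from y[OF this] show "inner (cscale c (translate3 t u)) (fst y) + inner (cscale c (translate3 t p)) (snd y)
        + inner (cscale c (translate3 t 0)) 0 = 0"
      by (simp add: inner_prod_def inner_commute)
  qed (use assms Ga_CO subspace_0[OF subspace_CO] in auto)
  then show "inner y (S s k u, S s k p) = 0" by (simp add: inner_prod_def inner_commute)
qed

lemma Ga_E: "(u, p) \<in> Ga \<Longrightarrow> Im k > 0 \<Longrightarrow> (E k u, E k p) \<in> Ga"
  unfolding E_def
  using Ga_cscale[of "S 1 k u + S (- 1) k u" "S 1 k p + S (- 1) k p"] subspace_add[OF subspace_Ga Ga_S Ga_S, of u p k u p k 1 "-1"]
  by simp

lemma Gm_S:
  assumes "(u, p, q) \<in> Gm" "Im k > 0"
  shows "(S s k u, S s k p, S s k q) \<in> Gm"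
proof (rule closed_subspace_double_complement[OF subspace_Gm closed_Gm])
  fix y assume y: "\<And>w. w \<in> Gm \<Longrightarrow> inner y w = 0"
  have "inner (S s k u) (fst y) + inner (S s k p) (fst (snd y)) + inner (S s k q) (snd (snd y)) = 0"
  proof (rule S_relation)
    fix c t
    have "(cscale c (translate3 t u), cscale c (translate3 t p), cscale c (translate3 t q)) \<in> Gm"
      by (intro Gm_cscale Gm_shift3 assms)
    from y[OF this] show "inner (cscale c (translate3 t u)) (fst y) + inner (cscale c (translate3 t p)) (fst (snd y))
        + inner (cscale c (translate3 t q)) (snd (snd y)) = 0"
      by (simp add: inner_prod_def inner_commute)
  qed (use assms Gm_CO in auto)
  then show "inner y (S s k u, S s k p, S s k q) = 0" by (simp add: inner_prod_def inner_commute)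
qed

lemma Gm_E: "(u, p, q) \<in> Gm \<Longrightarrow> Im k > 0 \<Longrightarrow> (E k u, E k p, E k q) \<in> Gm"
  unfolding E_def
  using Gm_cscale[of "S 1 k u + S (- 1) k u" "S 1 k p + S (- 1) k p" "S 1 k q + S (- 1) k q"]
    subspace_add[OF subspace_Gm Gm_S Gm_S, of u p q k u p q k 1 "-1"]
  by simp

lemma Ga_sequence:
  assumes "(u, p) \<in> Ga"
  obtains s where "\<And>n. s n \<in> test_functions" "(\<lambda>n. cls (s n)) \<longlonglongrightarrow> u" "(\<lambda>n. cls (a (s n))) \<longlonglongrightarrow> p"
proof -
  obtain x where x: "\<And>n. x n \<in> {(cls u, cls (a u)) | u. u \<in> test_functions}" "x \<longlonglongrightarrow> (u, p)"
    using assms unfolding Ga_def closure_sequential by blast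
  then have "\<forall>n. \<exists>s. s \<in> test_functions \<and> x n = (cls s, cls (a s))" by blast
  then obtain s where s: "\<And>n. s n \<in> test_functions" "\<And>n. x n = (cls (s n), cls (a (s n)))" by metis
  show ?thesis using that[OF s(1)] tendsto_fst[OF x(2)] tendsto_snd[OF x(2)] by (simp add: s(2))
qed

text \<open>\<open>E k\<close> supplies the derivative in \<open>x_3\<close> that \<open>Ga\<close>
  lacks, in the form of the bounded operator \<open>E1 k\<close>. Thus \<open>E k\<close> applied to
  \<open>B y\<close> is an admissible test vector in the weak equation.\<close>

lemma Ga_E_Gm:
  assumes up: "(u, p) \<in> Ga" and k: "Im k > 0"
  shows "(E k u, E k p, E1 k u) \<in> Gm"
proof -
  obtain s where s: "\<And>n. s n \<in> test_functions" "(\<lambda>n. cls (s n)) \<longlonglongrightarrow> u" "(\<lambda>n. cls (a (s n))) \<longlonglongrightarrow> p"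
    using Ga_sequence[OF up] by metis
  have "(E k (cls (s n)), E k (cls (a (s n))), E1 k (cls (s n))) \<in> Gm" for n
    using Gm_E[OF test_in_Gm[OF s(1)] k] E_derivative[OF test_has_d3[OF s(1)] k] by simp
  then show ?thesis
    by (rule closed_sequentially[OF closed_Gm])
      (auto intro!: tendsto_Pair E_tendsto s k Ga_CO[OF up] test_CO a_test)
qed

lemma Gm_E1:
  assumes "(u, p, q) \<in> Gm" and k: "Im k > 0"
  shows "E1 k q = - u - cscale (k\<^sup>2) (E k u)"
proof -
  obtain s where s: "\<And>n. s n \<in> test_functions" "(\<lambda>n. cls (s n)) \<longlonglongrightarrow> u" "(\<lambda>n. cls (a (s n))) \<longlonglongrightarrow> p"
    "(\<lambda>n. cls (partial 3 (s n))) \<longlonglongrightarrow> q" using Gm_sequence[OF assms(1)] by metis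
  note CO = Gm_CO[OF assms(1)]
  have "(\<lambda>n. E1 k (cls (partial 3 (s n)))) \<longlonglongrightarrow> E1 k q"
    by (rule E_tendsto(2)) (auto intro: s CO k test_CO test_partial)
  moreover have "(\<lambda>n. - cls (s n) - cscale (k\<^sup>2) (E k (cls (s n)))) \<longlonglongrightarrow> - u - cscale (k\<^sup>2) (E k u)"
    by (intro tendsto_diff tendsto_minus s bounded_linear.tendsto[OF bounded_linear_cscale] E_tendsto(1))
      (auto intro: s CO k test_CO)
  ultimately show ?thesis
    using LIMSEQ_unique by (simp add: E1_derivative[OF test_has_d3[OF s(1)] k])
qed

text \<open>The resolvent equation, smoothed by \<open>B\<close> and solved in the third direction.\<close>

lemma resolvent_identity:
  assumes v: "(v, p, q) \<in> Gm" and eq: "\<And>w p' q'. (w, p', q') \<in> Gm \<Longrightarrow> inner p p' + inner q q' = inner (g + cscale z v) w"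
    and k: "Im k > 0" "k\<^sup>2 = z + 1 - of_real (1 / \<beta>)" and \<beta>: "\<beta> > 0"
  shows "cg.B v = E k (cg.B g + (1 / \<beta>) *\<^sub>R (cg.B v - \<beta> *\<^sub>R v))"
proof -
  define k' where "k' = - cnj k"
  have k': "Im k' > 0" using k by (simp add: k'_def)
  have vCO: "v \<in> CO" "p \<in> CO" "q \<in> CO" using Gm_CO[OF v] by auto
  note CO_simps = vCO B_CO K_CO E_CO subspace_add[OF subspace_CO] subspace_diff[OF subspace_CO]
    subspace_scale[OF subspace_CO] CO_cscale k
  define Y where "Y = E k (cg.B v)"
  have Y: "Y = cg.B (E k v)" by (simp add: Y_def B_E vCO k)
  \<comment> \<open>\<open>X\<close> is the equation after application of \<open>B\<close> and
    \<open>E k\<close>, with \<open>a* a B = 1 - B\<close> and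
    \<open>- (d/dx_3)^2 E k = 1 + k^2 E k\<close> inserted. It lies in \<open>CO\<close>, so it may
    be paired with itself at the end.\<close>
  define X where "X = E k v - Y + cg.B v + cscale (k\<^sup>2) Y - E k (cg.B g) - cscale z Y"
  have XCO: "X \<in> CO" unfolding X_def Y_def by (intro CO_simps)
  have "inner X y = 0" if y: "y \<in> CO" for y
  proof -
    \<comment> \<open>The test vector smooths an arbitrary \<open>y\<close> by \<open>B\<close> and
      by the adjoint of \<open>E k\<close>; moving both to the other side puts them on
      \<open>v\<close> and \<open>g\<close>.\<close>
    have "(E k' (cg.B y), E k' (cg.K y), E1 k' (cg.B y)) \<in> Gm"
      by (rule Ga_E_Gm[OF cg.BK_in k'])
    from eq[OF this] have 0: "inner p (E k' (cg.K y)) + inner q (E1 k' (cg.B y)) = inner (g + cscale z v) (E k' (cg.B y))" .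
    have "inner p (E k' (cg.K y)) = inner (cg.K y) (E k p)"
      using E_adjoint[OF vCO(2) K_CO k(1), of y] by (simp add: k'_def inner_commute)
    also have "\<dots> = inner y (E k v) - inner (cg.B y) (E k v)"
      using cg.BK_eq[OF Ga_E[OF Gm_Ga[OF v] k(1)], of y] by simp
    also have "\<dots> = inner (E k v) y - inner Y y"
      unfolding Y cg.B_sym by (simp add: cg.B_sym inner_commute[of "E k v"])
    finally have 1: "inner p (E k' (cg.K y)) = inner (E k v) y - inner Y y" .
    have "inner q (E1 k' (cg.B y)) = - inner (E1 k q) (cg.B y)"
      using E1_adjoint[OF vCO(3) B_CO k(1), of y] by (simp add: k'_def)
    also have "\<dots> = inner (cg.B v + cscale (k\<^sup>2) Y) y"
    proof -
      have "- E1 k q = v + cscale (k\<^sup>2) (E k v)" by (simp add: Gm_E1[OF v k(1)])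
      then have "- inner (E1 k q) (cg.B y) = inner (v + cscale (k\<^sup>2) (E k v)) (cg.B y)"
        by (simp flip: inner_minus_left)
      also have "\<dots> = inner (cg.B (v + cscale (k\<^sup>2) (E k v))) y" by (rule cg.B_sym[symmetric])
      finally show ?thesis by (simp add: Y cg.B_simps B_cscale)
    qed
    finally have 2: "inner q (E1 k' (cg.B y)) = inner (cg.B v + cscale (k\<^sup>2) Y) y" .
    have "inner (g + cscale z v) (E k' (cg.B y)) = inner (cg.B (g + cscale z v)) (E k' y)"
      by (simp add: cg.B_sym B_E y k')
    also have "\<dots> = inner (E k (cg.B (g + cscale z v))) y"
      using E_adjoint[OF B_CO y k(1)] by (simp add: k'_def)
    also have "E k (cg.B (g + cscale z v)) = E k (cg.B g) + cscale z Y"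
      by (simp add: cg.B_simps B_cscale E_add E_cscale CO_simps Y_def)
    finally have 3: "inner (g + cscale z v) (E k' (cg.B y)) = inner (E k (cg.B g) + cscale z Y) y" .
    show ?thesis using 0 unfolding 1 2 3 X_def by (simp add: inner_add_left inner_diff_left)
  qed
  from this[OF XCO] have "X = 0" by simp
  then have "cg.B v = E k (cg.B g) + (cscale z Y + Y - cscale (k\<^sup>2) Y) - E k v"
    unfolding X_def by (simp add: algebra_simps)
  \<comment> \<open>The choice of \<open>k\<close>: \<open>B = \<beta>\<close> means
    \<open>a* a = 1 / \<beta> - 1\<close>, so \<open>k^2 = z - (1 / \<beta> - 1)\<close>, and the
    multiple \<open>1 / \<beta>\<close> of \<open>Y\<close> is left over.\<close>
  also have "cscale z Y + Y - cscale (k\<^sup>2) Y = cscale (of_real (1 / \<beta>)) Y"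
    unfolding k(2) using bounded_bilinear.diff_left[OF bounded_bilinear_cscale, of "z + 1" "of_real (1 / \<beta>)" Y]
    by (simp add: cscale_add_left)
  also have "E k (cg.B g) + cscale (of_real (1 / \<beta>)) Y - E k v
      = E k (cg.B g + (1 / \<beta>) *\<^sub>R (cg.B v - \<beta> *\<^sub>R v))"
  proof -
    have "(1 / \<beta>) *\<^sub>R (cg.B v - \<beta> *\<^sub>R v) = (1 / \<beta>) *\<^sub>R cg.B v - v" using \<beta> by (simp add: algebra_simps)
    then show ?thesis using cscale_of_real[of "1 / \<beta>" Y]
      by (simp add: E_add E_diff E_scaleR CO_simps Y_def)
  qed
  finally show ?thesis .
qed

section \<open>The weight in the third variable and the uniform estimate\<close>

text \<open>\<open><x_3>^(- m / 2)\<close>, the square root of the decay bound for \<open>W\<close>: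
  in the weighted resolvent one such factor stands on each side.\<close>

definition weight :: "real \<Rightarrow> real^3 \<Rightarrow> complex" where
  "weight m x = of_real ((1 + (x $ 3)\<^sup>2) powr (- m / 4))"

lemma weight_le: "m > 0 \<Longrightarrow> (1 + y\<^sup>2) powr (- m / 4) \<le> (1 :: real)" for y :: real
  using powr_mono[of "- m / 4" 0 "1 + y\<^sup>2"] by (simp split: if_splits)

lemma bounded_multiplier_weight: "m > 0 \<Longrightarrow> bounded_multiplier (weight m) 1"
  using weight_le[of m] smooth_continuous[OF smooth_weight[of m]]
  by unfold_locales (auto simp: weight_def intro!: borel_measurable_continuous_onI)

text \<open>The weight depends on \<open>x_3\<close> only and \<open>a\<close> differentiates in the
  other two variables, so they commute on test functions.\<close>

lemma Ga_weight:
  assumes m: "m > 0" and up: "(u, p) \<in> Ga"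
  shows "(mulf (weight m) u, mulf (weight m) p) \<in> Ga"
proof (rule Ga_bounded_linear[where T = "mulf (weight m)", OF _ _ up])
  interpret h: bounded_multiplier "weight m" 1 using m by (rule bounded_multiplier_weight)
  show "bounded_linear (mulf (weight m))" by (rule h.bounded_linear) simp
  have s: "smooth (weight m)" unfolding weight_def by (rule smooth_weight)
  have p: "partial 1 (weight m) = (\<lambda>x. 0)" "partial 2 (weight m) = (\<lambda>x. 0)"
    unfolding weight_def by (rule partial_weight, simp)+
  show "(mulf (weight m) (cls u), mulf (weight m) (cls (a u))) \<in> Ga" if u: "u \<in> test_functions" for u
    using test_in_Ga[OF test_mult[OF s u]] u by (simp add: h.cls a_mult[OF s p] a_test)
qed

lemma B_weight:
  assumes "m > 0"
  shows "cg.B (mulf (weight m) x) = mulf (weight m) (cg.B x)" "cg.K (mulf (weight m) x) = mulf (weight m) (cg.K x)"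
proof -
  interpret h: bounded_multiplier "weight m" 1 using assms by (rule bounded_multiplier_weight)
  have s: "inner (mulf (weight m) x) y = inner x (mulf (weight m) y)" for x y
    by (rule h.inner) (simp add: weight_def)
  show "cg.B (mulf (weight m) x) = mulf (weight m) (cg.B x)" "cg.K (mulf (weight m) x) = mulf (weight m) (cg.K x)"
    by (rule cg.BK_commute[of "mulf (weight m)" "mulf (weight m)" "mulf (weight m)" "mulf (weight m)"];
        intro Ga_weight assms s; assumption)+
qed

text \<open>\<open>C\<close> depends neither on \<open>z\<close> nor on the slice; the distance to
  the real axis enters only through terms with the residual \<open>f\<close>. This later allows one
  threshold for \<epsilon> at all non-real \<open>z\<close>.\<close>

theorem weighted_resolvent_estimate:
  assumes m: "m > 3"
  shows "\<exists>C\<ge>0. \<forall>z v p q g \<psi> f. Im z \<noteq> 0 \<longrightarrow> (v, p, q) \<in> Gm \<longrightarrow>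
    (\<forall>(w, p', q')\<in>Gm. inner p p' + inner q q' = inner (g + cscale z v) w) \<longrightarrow> g = mulf (weight m) \<psi> + f \<longrightarrow>
    - inner g v \<le> C * (norm \<psi>)\<^sup>2 + 2 / \<bar>Im z\<bar> * (2 * norm (mulf (weight m) \<psi>) * norm f + (norm f)\<^sup>2)"
proof -
  have m0: "m > 0" using m by simp
  interpret h: bounded_multiplier "weight m" 1 using m0 by (rule bounded_multiplier_weight)
  obtain J where J: "(\<integral>\<^sup>+y. ennreal ((1 + y\<^sup>2) * ((1 + y\<^sup>2) powr (- m / 4))\<^sup>2) \<partial>lborel) \<le> ennreal J" "J \<ge> 0"
    using weight_integral[OF m]
    by (cases "\<integral>\<^sup>+y. ennreal ((1 + y\<^sup>2) * ((1 + y\<^sup>2) powr (- m / 4))\<^sup>2) \<partial>lborel") auto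
  have w: "weight m = (\<lambda>x. of_real ((\<lambda>y. (1 + y\<^sup>2) powr (- m / 4)) (x $ 3)))" by (simp add: weight_def[abs_def])
  have ker: "- inner (mulf (weight m) y) (E k (mulf (weight m) y)) \<le> 4 * J * (norm y)\<^sup>2"
    if "Im k > 0" "mulf (weight m) y \<in> CO" for k y
    unfolding w by (rule kernel_estimate) (use J that weight_le[OF m0] in \<open>auto simp: w\<close>)
  show ?thesis
  proof (intro exI[of _ "4 * J"] conjI allI impI)
    fix z v p q g \<psi> f
    assume z: "Im z \<noteq> 0" and v: "(v, p, q) \<in> Gm" and g: "g = mulf (weight m) \<psi> + f"
      and eq: "\<forall>(w, p', q')\<in>Gm. inner p p' + inner q q' = inner (g + cscale z v) w"
    have "\<exists>k. k\<^sup>2 = z + 1 - of_real (1 / \<beta>) \<and> Im k > 0" for \<beta> :: real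
      by (rule square_root_upper[of "z + 1 - of_real (1 / \<beta>)"]) (use z in auto)
    then obtain k where k: "\<And>\<beta>::real. (k \<beta>)\<^sup>2 = z + 1 - of_real (1 / \<beta>)" "\<And>\<beta>. Im (k \<beta>) > 0" by metis
    \<comment> \<open>Source of \<open>M = 2 / |Im z|\<close>: for every real \<beta> the imaginary
      part of \<open>k^2\<close> is that of \<open>z\<close>, and its modulus is at most
      \<open>2 |k| Im k\<close>.\<close>
    have nk: "norm (E (k \<beta>) x) \<le> 2 / \<bar>Im z\<bar> * norm x" if x: "x \<in> CO" for \<beta> x
    proof -
      have "Im z = Im ((k \<beta>)\<^sup>2)" by (simp add: k)
      then have "\<bar>Im z\<bar> = 2 * (\<bar>Re (k \<beta>)\<bar> * Im (k \<beta>))" using k(2)[of \<beta>] by (simp add: power2_eq_square abs_mult)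
      also have "\<dots> \<le> 2 * (cmod (k \<beta>) * Im (k \<beta>))"
        using k(2)[of \<beta>] by (intro mult_left_mono mult_right_mono abs_Re_le_cmod) auto
      finally have le: "\<bar>Im z\<bar> / 2 \<le> cmod (k \<beta>) * Im (k \<beta>)" by simp
      have "norm (E (k \<beta>) x) \<le> norm x / (cmod (k \<beta>) * Im (k \<beta>))" by (rule E_norm[OF x k(2)])
      also have "\<dots> \<le> norm x / (\<bar>Im z\<bar> / 2)" using z le by (intro divide_left_mono) auto
      finally show ?thesis by (simp add: mult.commute)
    qed
    show "- inner g v \<le> 4 * J * (norm \<psi>)\<^sup>2 + 2 / \<bar>Im z\<bar> * (2 * norm (mulf (weight m) \<psi>) * norm f + (norm f)\<^sup>2)"
    proof (rule cg.slice_transfer[where E = "\<lambda>\<beta>. E (k \<beta>)" and CO = CO and h = "mulf (weight m)"])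
      show "cg.B v = E (k \<beta>) (cg.B g + (1 / \<beta>) *\<^sub>R (cg.B v - \<beta> *\<^sub>R v))" if "0 < \<beta>" for \<beta>
        by (rule resolvent_identity[OF v _ k(2) k(1) that]) (use eq in fast)
      show "(v, p) \<in> Ga" by (rule Gm_Ga[OF v])
      show "v \<in> CO" using Gm_CO[OF v] by blast
    qed (use J k nk g ker m0 in \<open>auto simp: E_add E_scaleR B_E K_E B_CO K_CO subspace_CO h.linear B_weight\<close>)
  qed (use J in auto)
qed

end

section \<open>A priori bounds for the perturbed operator\<close>

text \<open>The equation at \<open>\<mu>\<close> is solved by a fixed point of a contraction built from a nearby resolvent.\<close>

lemma resolvent_set_limit:
  fixes M :: operator
  assumes dom: "\<And>u g. (u, g) \<in> M \<Longrightarrow> u \<in> L2 \<and> g \<in> L2"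
    and diff: "\<And>u g v h. (u, g) \<in> M \<Longrightarrow> (v, h) \<in> M \<Longrightarrow> ((\<lambda>x. u x - v x), (\<lambda>x. g x - h x)) \<in> M"
    and ae: "\<And>u g h. (u, g) \<in> M \<Longrightarrow> h \<in> L2 \<Longrightarrow> AE x in lborel. g x = h x \<Longrightarrow> (u, h) \<in> M"
    and near: "\<And>z. z \<noteq> \<mu> \<Longrightarrow> dist z \<mu> < r \<Longrightarrow> z \<in> resolvent_set M"
    and bound: "\<And>z u g. dist z \<mu> < r \<Longrightarrow> (u, g) \<in> M \<Longrightarrow> l2_norm u \<le> C * l2_norm (\<lambda>x. g x - z * u x)"
    and r: "r > 0"
  shows "\<mu> \<in> resolvent_set M"
proof -
  define C' where "C' = max C 1"
  have C': "C' \<ge> 1" "C \<le> C'" by (auto simp: C'_def)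
  \<comment> \<open>With \<open>\<delta> C' <= 1 / 2\<close> the map below halves distances, and
    \<open>z = \<mu> + \<delta>\<close> stays in the disc where the bound holds.\<close>
  define \<delta> where "\<delta> = min (r / 2) (1 / (2 * C'))"
  have \<delta>: "\<delta> > 0" "\<delta> < r" "\<delta> * C' \<le> 1 / 2"
  proof -
    have "\<delta> * C' \<le> 1 / (2 * C') * C'" using C' by (intro mult_right_mono) (auto simp: \<delta>_def)
    then show "\<delta> * C' \<le> 1 / 2" using C' by simp
  qed (use r C' in \<open>auto simp: \<delta>_def min_def\<close>)
  define z where "z = \<mu> + of_real \<delta>"
  have z: "z \<noteq> \<mu>" "dist z \<mu> < r" using \<delta> by (auto simp: z_def dist_norm)
  have zM: "z \<in> resolvent_set M" by (rule near[OF z])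
  have surj: "\<exists>u. (u, \<lambda>x. f x + \<mu> * u x) \<in> M" if f: "f \<in> L2" for f
  proof -
    define rhs where "rhs x = rep (cls f + cscale (\<mu> - z) x)" for x
    have "\<exists>u. (u, \<lambda>y. rhs x y + z * u y) \<in> M" for x
      using zM by (simp add: resolvent_set_def rhs_def)
    then obtain U where U: "\<And>x. (U x, \<lambda>y. rhs x y + z * U x y) \<in> M" by metis
    have UL2: "U x \<in> L2" and rL2: "rhs x \<in> L2" for x using dom[OF U] by (auto simp: rhs_def)
    have lip: "dist (cls (U x)) (cls (U y)) \<le> 1/2 * dist x y" for x y
    proof -
      have "((\<lambda>t. U x t - U y t), (\<lambda>t. (rhs x t + z * U x t) - (rhs y t + z * U y t))) \<in> M" by (rule diff[OF U U])
      from bound[OF z(2) this]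
      have "l2_norm (\<lambda>t. U x t - U y t) \<le> C * l2_norm (\<lambda>t. rhs x t - rhs y t)"
        by (simp add: algebra_simps)
      then have "norm (cls (U x) - cls (U y)) \<le> C * norm (cls (rhs x) - cls (rhs y))"
        by (simp add: cls_diff norm_cls UL2 rL2 L2_diff)
      also have "cls (rhs x) - cls (rhs y) = cscale (\<mu> - z) (x - y)" by (simp add: rhs_def cscale_diff)
      also have "norm \<dots> = \<delta> * norm (x - y)" using \<delta> by (simp add: norm_cscale z_def)
      also have "C * (\<delta> * norm (x - y)) \<le> C' * (\<delta> * norm (x - y))" using C' \<delta> by (intro mult_right_mono) auto
      also have "\<dots> = (\<delta> * C') * norm (x - y)" by simp
      also have "\<dots> \<le> 1/2 * norm (x - y)" by (intro mult_right_mono \<delta>) auto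
      finally show ?thesis by (simp add: dist_norm)
    qed
    obtain x where x: "cls (U x) = x"
      using banach_fix_type[of "1/2" "\<lambda>x. cls (U x)"] lip by auto
    have "AE y in lborel. rhs x y + z * U x y = f y + \<mu> * U x y"
    proof -
      have "cls (rhs x) = cls (\<lambda>y. f y + (\<mu> - z) * U x y)"
      proof -
        have "cls (rhs x) = cls f + cscale (\<mu> - z) (cls (U x))" by (simp add: rhs_def x)
        also have "\<dots> = cls (\<lambda>y. f y + (\<mu> - z) * U x y)"
          using f by (simp add: cls_cscale cls_add UL2 L2_scale)
        finally show ?thesis .
      qed
      then have "AE y in lborel. rhs x y = f y + (\<mu> - z) * U x y"
        using f UL2 by (subst (asm) cls_eq_iff) (auto simp: rhs_def L2_add L2_scale)
      then show ?thesis by eventually_elim (simp add: algebra_simps)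
    qed
    then show ?thesis using ae[OF U[of x], of "\<lambda>y. f y + \<mu> * U x y"] f UL2 by (auto simp: L2_add L2_scale)
  qed
  moreover have "\<forall>(u, g)\<in>M. l2_norm u \<le> C * l2_norm (\<lambda>x. g x - \<mu> * u x)"
    using bound[of \<mu>] r by auto
  ultimately show ?thesis unfolding resolvent_set_def by blast
qed

section \<open>The perturbed operator and its quadratic identities\<close>

locale perturbed = magnetic +
  fixes W :: wavefn and \<alpha> m C1 \<epsilon> :: real
  assumes W_meas [measurable]: "W \<in> borel_measurable borel"
    and W_phase: "AE x in lborel. W x = exp (\<i> * of_real \<alpha>) * of_real (cmod (W x))"
    and W_decay: "AE x in lborel. cmod (W x) \<le> C1 * (1 + (x $ 3)\<^sup>2) powr (- m / 2)"
    and m: "m > 3" and C1: "C1 > 0" and \<alpha>: "cos \<alpha> > 0" and \<epsilon>: "\<epsilon> > 0"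
begin

abbreviation H :: operator where "H \<equiv> H_eps b W \<epsilon>"

lemma W_bounded: "AE x in lborel. cmod (W x) \<le> C1"
  using W_decay
proof eventually_elim
  case (elim x)
  have "(1 + (x $ 3)\<^sup>2) powr (- m / 2) \<le> 1"
    using weight_le[of "2 * m" "x $ 3"] m by simp
  then have "C1 * (1 + (x $ 3)\<^sup>2) powr (- m / 2) \<le> C1 * 1" using C1 by (intro mult_left_mono) auto
  then show ?case using elim by linarith
qed

lemma WL2: "u \<in> L2 \<Longrightarrow> (\<lambda>x. W x * u x) \<in> L2"
  by (rule L2_mult_bounded[OF W_meas W_bounded])

lemma H_iff: "(u, g) \<in> H \<longleftrightarrow> u \<in> L2 \<and> (u, \<lambda>x. g x - of_real \<epsilon> * W x * u x) \<in> H0 b"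
proof
  assume "(u, g) \<in> H"
  then obtain f where f: "g = (\<lambda>x. f x + of_real \<epsilon> * W x * u x)" "(u, f) \<in> H0 b" by (auto simp: H_eps_def)
  then show "u \<in> L2 \<and> (u, \<lambda>x. g x - of_real \<epsilon> * W x * u x) \<in> H0 b" using H0_iff by simp
next
  assume "u \<in> L2 \<and> (u, \<lambda>x. g x - of_real \<epsilon> * W x * u x) \<in> H0 b"
  then show "(u, g) \<in> H" unfolding H_eps_def
    by (auto intro!: exI[of _ "\<lambda>x. g x - of_real \<epsilon> * W x * u x"])
qed

lemma H_L2: "(u, g) \<in> H \<Longrightarrow> u \<in> L2 \<and> g \<in> L2"
proof -
  assume "(u, g) \<in> H"
  then have u: "u \<in> L2" and h: "(\<lambda>x. g x - of_real \<epsilon> * W x * u x) \<in> L2" by (auto simp: H_iff H0_iff)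
  show ?thesis using u L2_add[OF h L2_scale[OF WL2[OF u], of "of_real \<epsilon>"]] by (simp add: mult.assoc)
qed

lemma H_diff:
  assumes "(u, g) \<in> H" "(v, h) \<in> H"
  shows "((\<lambda>x. u x - v x), (\<lambda>x. g x - h x)) \<in> H"
proof -
  define f1 f2 where "f1 = (\<lambda>x. g x - of_real \<epsilon> * W x * u x)" and "f2 = (\<lambda>x. h x - of_real \<epsilon> * W x * v x)"
  obtain p q where 1: "u \<in> L2" "f1 \<in> L2" "(cls u, p, q) \<in> Gm" "\<And>w p' q'. (w, p', q') \<in> Gm \<Longrightarrow> inner p p' + inner q q' = inner (cls f1) w"
    using assms(1) unfolding H_iff H0_iff f1_def by fast
  obtain p2 q2 where 2: "v \<in> L2" "f2 \<in> L2" "(cls v, p2, q2) \<in> Gm" "\<And>w p' q'. (w, p', q') \<in> Gm \<Longrightarrow> inner p2 p' + inner q2 q' = inner (cls f2) w"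
    using assms(2) unfolding H_iff H0_iff f2_def by fast
  have "(cls u - cls v, p - p2, q - q2) \<in> Gm" using subspace_diff[OF subspace_Gm 1(3) 2(3)] by simp
  moreover have "inner (p - p2) p' + inner (q - q2) q' = inner (cls f1 - cls f2) w" if "(w, p', q') \<in> Gm" for w p' q'
    using 1(4)[OF that] 2(4)[OF that] by (simp add: inner_diff_left)
  ultimately have "((\<lambda>x. u x - v x), (\<lambda>x. f1 x - f2 x)) \<in> H0 b"
    unfolding H0_iff using 1(1,2) 2(1,2)
    by (intro conjI exI[of _ "p - p2"] exI[of _ "q - q2"]) (auto simp: L2_diff simp flip: cls_diff)
  then show ?thesis using 1 2 by (simp add: H_iff L2_diff f1_def f2_def algebra_simps)
qed

lemma H_ae:
  assumes "(u, g) \<in> H" "h \<in> L2" "AE x in lborel. g x = h x"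
  shows "(u, h) \<in> H"
proof -
  define f1 f2 where "f1 = (\<lambda>x. g x - of_real \<epsilon> * W x * u x)" and "f2 = (\<lambda>x. h x - of_real \<epsilon> * W x * u x)"
  have u: "u \<in> L2" "(u, f1) \<in> H0 b" using assms(1) by (auto simp: H_iff f1_def)
  have f2: "f2 \<in> L2" unfolding f2_def using L2_diff[OF assms(2) L2_scale[OF WL2[OF u(1)], of "of_real \<epsilon>"]] by (simp add: mult.assoc)
  have f1: "f1 \<in> L2" using u(2) by (simp add: H0_iff)
  have "cls f1 = cls f2" using assms(3) f1 f2 by (subst cls_eq_iff) (auto simp: f1_def f2_def)
  then have "(u, f2) \<in> H0 b" using u(2) f2 by (simp add: H0_iff)
  then show ?thesis using u by (simp add: H_iff f2_def)
qed

text \<open>The expectation of \<open>|W|\<close>. By the phase condition the expectation of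
  \<open>W\<close> is \<open>exp (\<i> \<alpha>)\<close> times this number, so one nonnegative
  quantity governs both real and imaginary part.\<close>

definition mass :: "wavefn \<Rightarrow> real" where "mass u = (LINT x|lborel. cmod (W x) * (cmod (u x))\<^sup>2)"

lemma integrable_mass: "u \<in> L2 \<Longrightarrow> integrable lborel (\<lambda>x. cmod (W x) * (cmod (u x))\<^sup>2)"
proof (rule Bochner_Integration.integrable_bound[of _ "\<lambda>x. C1 * (cmod (u x))\<^sup>2"])
  assume u: "u \<in> L2"
  then have [measurable]: "u \<in> borel_measurable borel" by auto
  show "integrable lborel (\<lambda>x. C1 * (cmod (u x))\<^sup>2)" using u by (simp add: L2_iff)
  show "(\<lambda>x. cmod (W x) * (cmod (u x))\<^sup>2) \<in> borel_measurable lborel" by measurable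
  show "AE x in lborel. norm (cmod (W x) * (cmod (u x))\<^sup>2) \<le> norm (C1 * (cmod (u x))\<^sup>2)"
    using W_bounded by eventually_elim (use C1 in \<open>auto simp: abs_mult intro!: mult_right_mono\<close>)
qed

lemma mass_nonneg: "mass u \<ge> 0"
  unfolding mass_def by (intro integral_nonneg_AE) auto

lemma mass_le: "u \<in> L2 \<Longrightarrow> mass u \<le> C1 * (norm (cls u))\<^sup>2"
proof -
  assume u: "u \<in> L2"
  have "mass u \<le> (LINT x|lborel. C1 * (cmod (u x))\<^sup>2)"
    unfolding mass_def
  proof (rule integral_mono_AE[OF integrable_mass[OF u]])
    show "AE x in lborel. cmod (W x) * (cmod (u x))\<^sup>2 \<le> C1 * (cmod (u x))\<^sup>2"
      using W_bounded by eventually_elim (auto intro: mult_right_mono)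
  qed (use u in \<open>auto simp: L2_iff\<close>)
  then show ?thesis by (simp add: norm_cls_squared u)
qed

lemma l2_inner_W: "u \<in> L2 \<Longrightarrow> l2_inner (\<lambda>x. W x * u x) u = exp (\<i> * of_real \<alpha>) * of_real (mass u)"
proof -
  assume u: "u \<in> L2"
  have "l2_inner (\<lambda>x. W x * u x) u = (LINT x|lborel. exp (\<i> * of_real \<alpha>) * of_real (cmod (W x) * (cmod (u x))\<^sup>2))"
    unfolding l2_inner_def
  proof (rule integral_cong_AE)
    show "AE x in lborel. W x * u x * cnj (u x) = exp (\<i> * of_real \<alpha>) * of_real (cmod (W x) * (cmod (u x))\<^sup>2)"
      using W_phase
    proof eventually_elim
      case (elim x)
      have "W x * u x * cnj (u x) = W x * of_real ((cmod (u x))\<^sup>2)"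
        by (simp add: mult.assoc complex_norm_square[symmetric] del: of_real_power)
      then show ?case using elim by (metis mult.assoc of_real_mult)
    qed
  qed (use L2_measurable[OF u] in measurable)
  then show ?thesis by (simp add: mass_def flip: integral_complex_of_real)
qed

text \<open>Moved to the right-hand side, the perturbation becomes the source
  \<open>- \<epsilon> W u = weight * \<psi> u\<close>, which is the form that the weighted estimate
  requires.\<close>

definition \<psi> :: "wavefn \<Rightarrow> wavefn" where
  "\<psi> u = (\<lambda>x. - of_real \<epsilon> * (W x / weight m x) * u x)"

lemma weight_nz: "weight m x \<noteq> 0" "cmod (weight m x) = (1 + (x $ 3)\<^sup>2) powr (- m / 4)"
proof -
  have "1 + (x $ 3)\<^sup>2 > 0" by (simp add: add_pos_nonneg)
  then show "weight m x \<noteq> 0" by (simp add: weight_def)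
qed (simp add: weight_def)

lemma weight_meas [measurable]: "weight m \<in> borel_measurable borel"
  using bounded_multiplier.meas[OF bounded_multiplier_weight] m by simp

lemma W_weight: "AE x in lborel. cmod (W x / weight m x) \<le> C1" "AE x in lborel. (cmod (W x / weight m x))\<^sup>2 \<le> C1 * cmod (W x)"
proof -
  have e: "(1 + (x $ 3)\<^sup>2) powr (- m / 2) = (cmod (weight m x))\<^sup>2" for x :: "real^3"
  proof -
    have "1 + (x $ 3)\<^sup>2 > 0" by (simp add: add_pos_nonneg)
    then show ?thesis by (simp add: weight_nz power2_eq_square flip: powr_add)
  qed
  have le1: "cmod (weight m x) \<le> 1" for x using weight_le[of m "x $ 3"] m by (simp add: weight_nz)
  have pos: "cmod (weight m x) > 0" for x using weight_nz(1)[of x] by simp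
  show "AE x in lborel. cmod (W x / weight m x) \<le> C1"
    using W_decay
  proof eventually_elim
    case (elim x)
    have "cmod (W x) \<le> C1 * (cmod (weight m x) * cmod (weight m x))" using elim unfolding e by (simp add: power2_eq_square)
    also have "\<dots> \<le> C1 * (1 * cmod (weight m x))" using C1 le1[of x] by (intro mult_left_mono mult_right_mono) auto
    finally show ?case using pos[of x] by (simp add: norm_divide divide_le_eq)
  qed
  show "AE x in lborel. (cmod (W x / weight m x))\<^sup>2 \<le> C1 * cmod (W x)"
    using W_decay
  proof eventually_elim
    case (elim x)
    have "cmod (W x) * cmod (W x) \<le> (C1 * (cmod (weight m x))\<^sup>2) * cmod (W x)"
      using elim unfolding e by (intro mult_right_mono) auto
    then show ?case using pos[of x] by (simp add: norm_divide power_divide divide_le_eq power2_eq_square mult_ac)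
  qed
qed

lemma \<psi>_L2: "u \<in> L2 \<Longrightarrow> \<psi> u \<in> L2"
proof -
  assume u: "u \<in> L2"
  have "(\<lambda>x. (W x / weight m x) * u x) \<in> L2"
    by (rule L2_mult_bounded[OF _ W_weight(1) u]) measurable
  from L2_scale[OF this, of "- of_real \<epsilon>"] show ?thesis by (simp add: \<psi>_def mult.assoc)
qed

text \<open>From \<open>|W / weight|^2 <= C1 |W|\<close>. The bound is quadratic in \<epsilon>,
  whereas the phase yields \<open>mass\<close> with a single factor \<epsilon>; this difference is
  what small \<epsilon> exploits.\<close>

lemma norm_\<psi>:
  assumes u: "u \<in> L2"
  shows "(norm (cls (\<psi> u)))\<^sup>2 \<le> \<epsilon>\<^sup>2 * C1 * mass u"
proof -
  have "(norm (cls (\<psi> u)))\<^sup>2 \<le> (LINT x|lborel. \<epsilon>\<^sup>2 * C1 * (cmod (W x) * (cmod (u x))\<^sup>2))"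
    unfolding norm_cls_squared[OF \<psi>_L2[OF u]]
  proof (rule integral_mono_AE)
    show "AE x in lborel. (cmod (\<psi> u x))\<^sup>2 \<le> \<epsilon>\<^sup>2 * C1 * (cmod (W x) * (cmod (u x))\<^sup>2)"
      using W_weight(2)
    proof eventually_elim
      case (elim x)
      have "(cmod (\<psi> u x))\<^sup>2 = \<epsilon>\<^sup>2 * ((cmod (W x / weight m x))\<^sup>2 * (cmod (u x))\<^sup>2)"
        by (simp only: \<psi>_def norm_mult norm_minus_cancel norm_of_real power_mult_distrib power2_abs mult.assoc)
      also have "\<dots> \<le> \<epsilon>\<^sup>2 * (C1 * cmod (W x) * (cmod (u x))\<^sup>2)"
        by (intro mult_left_mono mult_right_mono elim) auto
      finally show ?case by (simp add: mult_ac)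
    qed
  qed (use \<psi>_L2[OF u] integrable_mass[OF u] in \<open>auto simp: L2_iff\<close>)
  then show ?thesis by (simp add: mass_def)
qed

lemma weight_\<psi>: "u \<in> L2 \<Longrightarrow> mulf (weight m) (cls (\<psi> u)) = cls (\<lambda>x. - of_real \<epsilon> * (W x * u x))"
proof -
  assume u: "u \<in> L2"
  interpret h: bounded_multiplier "weight m" 1 using m by (intro bounded_multiplier_weight) simp
  have "(\<lambda>x. weight m x * \<psi> u x) = (\<lambda>x. - of_real \<epsilon> * (W x * u x))"
    using weight_nz by (auto simp: \<psi>_def fun_eq_iff)
  then show ?thesis by (simp add: h.cls \<psi>_L2 u)
qed

lemma norm_weight_\<psi>: "u \<in> L2 \<Longrightarrow> norm (mulf (weight m) (cls (\<psi> u))) \<le> norm (cls (\<psi> u))"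
proof -
  interpret h: bounded_multiplier "weight m" 1 using m by (intro bounded_multiplier_weight) simp
  show ?thesis using h.norm_le[of "cls (\<psi> u)"] by simp
qed

text \<open>The perturbation is made part of the source of a free equation. Testing with
  \<open>u\<close> and using that the form is nonnegative gives the bound with \<open>Re z\<close>;
  testing with \<open>\<i> u\<close> makes the form vanish and gives the bound with
  \<open>|Im z|\<close>.\<close>

lemma H_equation:
  assumes ug: "(u, g) \<in> H" and F: "F = cls (\<lambda>x. g x - z * u x)"
  obtains p q where "(cls u, p, q) \<in> Gm"
    "\<And>w p' q'. (w, p', q') \<in> Gm \<Longrightarrow> inner p p' + inner q q' = inner ((mulf (weight m) (cls (\<psi> u)) + F) + cscale z (cls u)) w"
    "inner (mulf (weight m) (cls (\<psi> u))) (cls u) = - \<epsilon> * cos \<alpha> * mass u"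
    "- Re z * (norm (cls u))\<^sup>2 + \<epsilon> * cos \<alpha> * mass u \<le> inner F (cls u)"
    "\<bar>Im z\<bar> * (norm (cls u))\<^sup>2 \<le> \<epsilon> * mass u + norm F * norm (cls u)"
proof -
  define v where "v = cls u"
  define f0 where "f0 = (\<lambda>x. g x - of_real \<epsilon> * W x * u x)"
  obtain p q where u: "u \<in> L2" "f0 \<in> L2" "(v, p, q) \<in> Gm"
    and eq: "\<And>w p' q'. (w, p', q') \<in> Gm \<Longrightarrow> inner p p' + inner q q' = inner (cls f0) w"
    using ug unfolding H_iff H0_iff f0_def v_def by fast
  have gL2: "g \<in> L2" using H_L2[OF ug] by blast
  define \<phi> where "\<phi> = mulf (weight m) (cls (\<psi> u))"
  have \<phi>: "\<phi> = cls (\<lambda>x. - of_real \<epsilon> * (W x * u x))" by (simp add: \<phi>_def weight_\<psi> u)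
  have f0: "cls f0 = (\<phi> + F) + cscale z v"
  proof -
    have "(\<phi> + F) + cscale z v = cls (\<lambda>x. (- of_real \<epsilon> * (W x * u x) + (g x - z * u x)) + z * u x)"
      unfolding \<phi> F v_def using u gL2 WL2[OF u(1)]
      by (subst cls_add, simp add: L2_scale L2_uminus, simp add: L2_diff L2_scale, subst cls_cscale, simp,
          subst cls_add) (simp_all add: L2_add L2_diff L2_scale L2_uminus)
    also have "\<dots> = cls f0" by (simp add: f0_def algebra_simps)
    finally show ?thesis by simp
  qed
  have \<phi>v: "l2_inner (\<lambda>x. - of_real \<epsilon> * (W x * u x)) u = - of_real \<epsilon> * (exp (\<i> * of_real \<alpha>) * of_real (mass u))"
  proof -
    have "l2_inner (\<lambda>x. - of_real \<epsilon> * (W x * u x)) u = - of_real \<epsilon> * l2_inner (\<lambda>x. W x * u x) u"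
      unfolding l2_inner_def integral_mult_right_zero[symmetric] by (simp add: mult_ac)
    then show ?thesis by (simp add: l2_inner_W u)
  qed
  have \<phi>L2: "(\<lambda>x. - of_real \<epsilon> * (W x * u x)) \<in> L2" using L2_scale[OF WL2[OF u(1)], of "- of_real \<epsilon>"] by simp
  have re: "inner \<phi> v = - \<epsilon> * cos \<alpha> * mass u"
    unfolding \<phi> v_def using \<phi>v by (subst cls_inner[OF \<phi>L2 u(1)]) (simp add: Re_exp)
  have im: "inner \<phi> (cscale \<i> v) = - \<epsilon> * sin \<alpha> * mass u"
  proof -
    have "inner \<phi> (cscale \<i> v) = - inner (cscale \<i> \<phi>) v"
      by (simp add: inner_cscale bounded_bilinear.minus_left[OF bounded_bilinear_cscale])
    also have "\<dots> = Im (l2_inner (\<lambda>x. - of_real \<epsilon> * (W x * u x)) u)"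
      unfolding \<phi> v_def by (subst l2_inner_cls[OF \<phi>L2 u(1)]) simp
    also have "\<dots> = - \<epsilon> * sin \<alpha> * mass u" unfolding \<phi>v by (simp add: Im_exp)
    finally show ?thesis .
  qed
  have zv: "inner (cscale z v) v = Re z * (norm v)\<^sup>2"
    and izv: "inner (cscale z v) (cscale \<i> v) = Im z * (norm v)\<^sup>2"
  proof -
    have i0: "inner (cscale \<i> x) x = 0" for x
    proof -
      have "inner (cscale \<i> x) x = inner x (- cscale \<i> x)"
        by (simp add: inner_cscale bounded_bilinear.minus_left[OF bounded_bilinear_cscale])
      then show ?thesis by (simp add: inner_commute)
    qed
    show "inner (cscale z v) v = Re z * (norm v)\<^sup>2"
      unfolding inner_cscale_expand[of z] by (simp add: i0 power2_norm_eq_inner)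
    have "inner (cscale \<i> v) (cscale \<i> v) = inner v v" by (simp add: inner_cscale cscale_cscale)
    then show "inner (cscale z v) (cscale \<i> v) = Im z * (norm v)\<^sup>2"
      unfolding inner_cscale_expand[of z] by (simp add: i0[of v] inner_commute[of v "cscale \<i> v"] power2_norm_eq_inner)
  qed
  have "0 \<le> inner p p + inner q q" by simp
  also have "\<dots> = inner \<phi> v + inner F v + Re z * (norm v)\<^sup>2"
    using eq[OF u(3)] by (simp add: f0 inner_add_left zv)
  finally have 4: "- Re z * (norm v)\<^sup>2 + \<epsilon> * cos \<alpha> * mass u \<le> inner F v" by (simp add: re)
  have "inner p (cscale \<i> p) + inner q (cscale \<i> q) = inner \<phi> (cscale \<i> v) + inner F (cscale \<i> v) + Im z * (norm v)\<^sup>2"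
    using eq[OF Gm_cscale[OF u(3), of \<i>]] by (simp add: f0 inner_add_left izv)
  moreover have "inner x (cscale \<i> x) = 0" for x
  proof -
    have "inner x (cscale \<i> x) = - inner (cscale \<i> x) x"
      by (simp add: inner_cscale bounded_bilinear.minus_left[OF bounded_bilinear_cscale])
    then show ?thesis by (simp add: inner_commute)
  qed
  ultimately have "Im z * (norm v)\<^sup>2 = \<epsilon> * sin \<alpha> * mass u - inner F (cscale \<i> v)" by (simp add: im)
  then have "\<bar>Im z\<bar> * (norm v)\<^sup>2 = \<bar>\<epsilon> * sin \<alpha> * mass u - inner F (cscale \<i> v)\<bar>"
    by (simp add: abs_mult flip: \<open>Im z * (norm v)\<^sup>2 = _\<close>)
  also have "\<dots> \<le> \<bar>\<epsilon> * sin \<alpha> * mass u\<bar> + \<bar>inner F (cscale \<i> v)\<bar>" by (rule abs_triangle_ineq4)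
  also have "\<dots> \<le> \<epsilon> * mass u + norm F * norm v"
  proof (rule add_mono)
    have "\<bar>\<epsilon> * sin \<alpha> * mass u\<bar> = \<bar>sin \<alpha>\<bar> * (\<epsilon> * mass u)" using \<epsilon> mass_nonneg[of u] by (simp add: abs_mult)
    also have "\<dots> \<le> 1 * (\<epsilon> * mass u)" using \<epsilon> mass_nonneg[of u] by (intro mult_right_mono) auto
    finally show "\<bar>\<epsilon> * sin \<alpha> * mass u\<bar> \<le> \<epsilon> * mass u" by simp
    show "\<bar>inner F (cscale \<i> v)\<bar> \<le> norm F * norm v"
      using Cauchy_Schwarz_ineq2[of F "cscale \<i> v"] by (simp add: norm_cscale)
  qed
  finally have 5: "\<bar>Im z\<bar> * (norm v)\<^sup>2 \<le> \<epsilon> * mass u + norm F * norm v" .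
  show ?thesis
  proof (rule that)
    show "(cls u, p, q) \<in> Gm" using u(3) by (simp add: v_def)
    show "inner p p' + inner q q' = inner ((mulf (weight m) (cls (\<psi> u)) + F) + cscale z (cls u)) w"
      if "(w, p', q') \<in> Gm" for w p' q' using eq[OF that] by (simp add: f0 \<phi>_def v_def)
  qed (use re 4 5 in \<open>simp_all add: \<phi>_def v_def\<close>)
qed

text \<open>For \<open>Re z < 0\<close> the form, the term with \<open>- Re z\<close> and the real
  part of the perturbation are all nonnegative, so nothing has to be absorbed.\<close>

lemma negative_bound:
  assumes "(u, g) \<in> H" "Re z \<le> - c" "c > 0"
  shows "l2_norm u \<le> (1 / c) * l2_norm (\<lambda>x. g x - z * u x)"
proof -
  have L: "u \<in> L2" "g \<in> L2" using H_L2[OF assms(1)] by auto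
  define F where "F = cls (\<lambda>x. g x - z * u x)"
  have "- Re z * (norm (cls u))\<^sup>2 + \<epsilon> * cos \<alpha> * mass u \<le> inner F (cls u)"
    by (rule H_equation[OF assms(1) F_def])
  moreover have "\<epsilon> * cos \<alpha> * mass u \<ge> 0" using \<epsilon> \<alpha> mass_nonneg[of u] by (intro mult_nonneg_nonneg) auto
  moreover have "c * (norm (cls u))\<^sup>2 \<le> - Re z * (norm (cls u))\<^sup>2" using assms by (intro mult_right_mono) auto
  ultimately have "c * (norm (cls u))\<^sup>2 \<le> norm F * norm (cls u)"
    using norm_cauchy_schwarz[of F "cls u"] by linarith
  then have "c * norm (cls u) \<le> norm F" by (cases "cls u = 0") (auto simp: power2_eq_square)
  then show ?thesis using assms(3) L by (simp add: F_def norm_cls L2_diff L2_scale field_simps)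
qed

text \<open>The left side of \<open>est\<close> is \<open>\<epsilon> cos \<alpha> mass\<close> up to
  \<open>inner F v\<close>, while the right side contains only
  \<open>\<epsilon>^2 C C1 mass\<close>; by \<open>small\<close>, half of the left side absorbs it.
  This bounds \<open>mass\<close> by a multiple of \<open>|v| |F|\<close>, and the imaginary part of
  the equation then bounds \<open>|Im z| |v|^2\<close>. The condition \<open>small\<close> does not
  involve \<open>c\<close>.\<close>

theorem nonreal_bound:
  assumes est: "C \<ge> 0" "\<And>z v p q g \<psi> f. Im z \<noteq> 0 \<Longrightarrow> (v, p, q) \<in> Gm \<Longrightarrow>
    (\<forall>(w, p', q')\<in>Gm. inner p p' + inner q q' = inner (g + cscale z v) w) \<Longrightarrow> g = mulf (weight m) \<psi> + f \<Longrightarrow>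
    - inner g v \<le> C * (norm \<psi>)\<^sup>2 + 2 / \<bar>Im z\<bar> * (2 * norm (mulf (weight m) \<psi>) * norm f + (norm f)\<^sup>2)"
    and small: "2 * \<epsilon> * C * C1 \<le> cos \<alpha>" and c: "c > 0"
  shows "\<exists>K. \<forall>z u g. \<bar>Im z\<bar> \<ge> c \<longrightarrow> (u, g) \<in> H \<longrightarrow> l2_norm u \<le> K * l2_norm (\<lambda>x. g x - z * u x)"
proof -
  \<comment> \<open>Half the coefficient of \<open>mass\<close>: the part that remains after
    absorption.\<close>
  define e where "e = \<epsilon> * cos \<alpha> / 2"
  have e: "e > 0" using \<epsilon> \<alpha> by (simp add: e_def)
  \<comment> \<open>The 1 accounts for \<open>inner F v\<close>, the rest for the terms of the
    estimate that contain \<open>F\<close>.\<close>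
  define N where "N = 1 + 2 / c * (2 * (\<epsilon> * C1) + 1)"
  have N: "N \<ge> 1" using \<epsilon> C1 c by (simp add: N_def)
  define K where "K = max 1 ((\<epsilon> * (2 * N / e) + 1) / c)"
  have "norm (cls u) \<le> K * norm F" if z: "\<bar>Im z\<bar> \<ge> c" and ug: "(u, g) \<in> H" and F: "F = cls (\<lambda>x. g x - z * u x)" for z u g F
  proof (cases "norm (cls u) \<le> norm F")
    case True
    then show ?thesis using mult_right_mono[of 1 K "norm F"] by (simp add: K_def)
  next
    case False
    \<comment> \<open>Now \<open>|F|^2\<close> can be replaced by \<open>|v| |F|\<close>, which
      gives all error terms the same shape.\<close>
    then have vF: "norm F \<le> norm (cls u)" "cls u \<noteq> 0" by auto
    define v where "v = cls u"
    have u: "u \<in> L2" using H_L2[OF ug] by blast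
    obtain p q where v: "(v, p, q) \<in> Gm" and
      eq: "\<And>w p' q'. (w, p', q') \<in> Gm \<Longrightarrow> inner p p' + inner q q' = inner ((mulf (weight m) (cls (\<psi> u)) + F) + cscale z v) w"
      and re: "inner (mulf (weight m) (cls (\<psi> u))) v = - \<epsilon> * cos \<alpha> * mass u"
      and im: "\<bar>Im z\<bar> * (norm v)\<^sup>2 \<le> \<epsilon> * mass u + norm F * norm v"
      using H_equation[OF ug F] unfolding v_def by metis
    let ?\<psi> = "cls (\<psi> u)"
    have n\<psi>: "norm ?\<psi> \<le> \<epsilon> * C1 * norm v"
    proof (rule power2_le_imp_le)
      have "(norm ?\<psi>)\<^sup>2 \<le> \<epsilon>\<^sup>2 * C1 * mass u" by (rule norm_\<psi>[OF u])
      also have "\<dots> \<le> \<epsilon>\<^sup>2 * C1 * (C1 * (norm v)\<^sup>2)"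
        using mass_le[OF u] C1 unfolding v_def by (intro mult_left_mono) auto
      finally show "(norm ?\<psi>)\<^sup>2 \<le> (\<epsilon> * C1 * norm v)\<^sup>2" by (simp add: power2_eq_square mult_ac)
    qed (use \<epsilon> C1 in auto)
    have "- inner (mulf (weight m) ?\<psi> + F) v \<le> C * (norm ?\<psi>)\<^sup>2
        + 2 / \<bar>Im z\<bar> * (2 * norm (mulf (weight m) ?\<psi>) * norm F + (norm F)\<^sup>2)"
      by (rule est(2)[OF _ v _ refl]) (use eq z c in auto)
    also have "\<dots> \<le> C * (\<epsilon>\<^sup>2 * C1 * mass u) + 2 / c * (2 * (\<epsilon> * C1 * norm v) * norm F + norm v * norm F)"
    proof (intro add_mono mult_mono mult_left_mono)
      show "(norm ?\<psi>)\<^sup>2 \<le> \<epsilon>\<^sup>2 * C1 * mass u" by (rule norm_\<psi>[OF u])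
      show "norm (mulf (weight m) ?\<psi>) \<le> \<epsilon> * C1 * norm v" using norm_weight_\<psi>[OF u] n\<psi> by linarith
      show "(norm F)\<^sup>2 \<le> norm v * norm F" using vF unfolding v_def power2_eq_square by (intro mult_right_mono) auto
      show "2 / \<bar>Im z\<bar> \<le> 2 / c" using z c by (intro divide_left_mono) auto
    qed (use est \<epsilon> C1 c in auto)
    also have "C * (\<epsilon>\<^sup>2 * C1 * mass u) \<le> e * mass u"
    proof -
      have "C * (\<epsilon>\<^sup>2 * C1 * mass u) = (\<epsilon> / 2) * (2 * \<epsilon> * C * C1) * mass u" by (simp add: power2_eq_square)
      also have "\<dots> \<le> (\<epsilon> / 2) * cos \<alpha> * mass u"
        using small \<epsilon> mass_nonneg[of u] by (intro mult_right_mono mult_left_mono) auto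
      finally show ?thesis by (simp add: e_def)
    qed
    finally have "- inner (mulf (weight m) ?\<psi> + F) v \<le> e * mass u + 2 / c * (2 * (\<epsilon> * C1) + 1) * (norm v * norm F)"
      by (simp add: algebra_simps)
    moreover have "- inner (mulf (weight m) ?\<psi> + F) v = 2 * e * mass u - inner F v"
      by (simp add: inner_add_left re e_def)
    ultimately have "e * mass u \<le> N * (norm v * norm F)"
      using norm_cauchy_schwarz[of F v] by (simp add: N_def algebra_simps)
    then have mass: "mass u \<le> N / e * (norm v * norm F)" using e by (simp add: field_simps)
    have "c * (norm v)\<^sup>2 \<le> \<bar>Im z\<bar> * (norm v)\<^sup>2" by (intro mult_right_mono z) auto
    also note im
    also have "\<epsilon> * mass u \<le> \<epsilon> * (N / e * (norm v * norm F))" using \<epsilon> mass by (intro mult_left_mono) auto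
    finally have "c * (norm v)\<^sup>2 \<le> (\<epsilon> * (N / e) + 1) * (norm v * norm F)" by (simp add: algebra_simps)
    also have "\<dots> \<le> (\<epsilon> * (2 * N / e) + 1) * (norm v * norm F)"
      using \<epsilon> N e by (intro mult_right_mono add_right_mono mult_left_mono divide_right_mono) auto
    finally have "norm v * (c * norm v) \<le> norm v * ((\<epsilon> * (2 * N / e) + 1) * norm F)"
      by (simp add: power2_eq_square mult_ac)
    then have "c * norm v \<le> (\<epsilon> * (2 * N / e) + 1) * norm F" using vF(2) by (simp add: v_def)
    then have "norm v \<le> (\<epsilon> * (2 * N / e) + 1) / c * norm F" using c by (simp add: field_simps)
    also have "\<dots> \<le> K * norm F" by (intro mult_right_mono) (auto simp: K_def)
    finally show ?thesis by (simp add: v_def)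
  qed
  then have "l2_norm u \<le> K * l2_norm (\<lambda>x. g x - z * u x)" if "\<bar>Im z\<bar> \<ge> c" "(u, g) \<in> H" for z u g
    using that H_L2[OF that(2)] by (fastforce simp: norm_cls[symmetric] L2_diff L2_scale)
  then show ?thesis by blast
qed

end

section \<open>Approximate eigenfunctions\<close>

lemma L2_dominated:
  assumes [measurable]: "\<And>n. f n \<in> borel_measurable borel" "F \<in> borel_measurable borel"
    and g: "integrable lborel (\<lambda>x. (g x)\<^sup>2)" and le: "\<And>n x. cmod (f n x) \<le> g x"
    and lim: "AE x in lborel. (\<lambda>n. f n x) \<longlonglongrightarrow> F x"
  shows "f n \<in> L2" "F \<in> L2" "(\<lambda>n. cls (f n)) \<longlonglongrightarrow> cls F"
proof -
  have sq: "(cmod (f n x))\<^sup>2 \<le> (g x)\<^sup>2" for n x using le[of n x] by (intro power_mono) auto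
  show fL2: "f n \<in> L2" for n by (rule L2_bound[OF _ g]) (use sq in auto)
  have Fle: "AE x in lborel. cmod (F x) \<le> g x"
    using lim
  proof eventually_elim
    case (elim x)
    show ?case by (rule tendsto_upperbound[OF tendsto_norm[OF elim]]) (use le in auto)
  qed
  show FL2: "F \<in> L2"
    by (rule L2_bound[OF _ g]) (use Fle in \<open>auto elim!: eventually_mono intro: power_mono\<close>)
  have "(\<lambda>n. LINT x|lborel. (cmod (f n x - F x))\<^sup>2) \<longlonglongrightarrow> (LINT x|(lborel :: (real^3) measure). (0::real))"
  proof (rule integral_dominated_convergence[where w = "\<lambda>x. 4 * (g x)\<^sup>2"])
    show "AE x in lborel. (\<lambda>n. (cmod (f n x - F x))\<^sup>2) \<longlonglongrightarrow> 0"
      using lim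
    proof eventually_elim
      case (elim x)
      have "(\<lambda>n. (cmod (f n x - F x))\<^sup>2) \<longlonglongrightarrow> (cmod (F x - F x))\<^sup>2" by (intro tendsto_intros elim)
      then show ?case by simp
    qed
    show "AE x in lborel. norm ((cmod (f n x - F x))\<^sup>2) \<le> 4 * (g x)\<^sup>2" for n
      using Fle
    proof eventually_elim
      case (elim x)
      have "cmod (f n x - F x) \<le> 2 * g x" using norm_triangle_ineq4[of "f n x" "F x"] elim le[of n x] by linarith
      then have "(cmod (f n x - F x))\<^sup>2 \<le> (2 * g x)\<^sup>2" by (intro power_mono) auto
      then show ?case by (simp add: power_mult_distrib)
    qed
  qed (use g in auto)
  then have "(\<lambda>n. (norm (cls (f n) - cls F))\<^sup>2) \<longlonglongrightarrow> 0"
    using fL2 FL2 by (simp add: cls_diff norm_cls_squared L2_diff)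
  then have "(\<lambda>n. norm (cls (f n) - cls F)) \<longlonglongrightarrow> 0"
    using tendsto_real_sqrt[of "\<lambda>n. (norm (cls (f n) - cls F))\<^sup>2" 0] by simp
  then show "(\<lambda>n. cls (f n)) \<longlonglongrightarrow> cls F" by (simp only: tendsto_norm_zero_iff LIM_zero_iff)
qed

section \<open>Gaussian majorants and cutoffs\<close>

lemma integrable_gaussian:
  assumes c: "c > 0"
  shows "integrable lborel (\<lambda>x::real^3. exp (- c * (x \<bullet> x)))"
proof (rule integrableI_bounded)
  define \<sigma> where "\<sigma> = 1 / sqrt (2 * c)"
  have \<sigma>: "\<sigma> > 0" "c = 1 / (2 * \<sigma>\<^sup>2)" using c by (auto simp: \<sigma>_def power_divide)
  have "integrable lborel (\<lambda>y::real. sqrt (2 * pi * \<sigma>\<^sup>2) * normal_density 0 \<sigma> y)"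
    by (intro integrable_mult_right integrable_normal_density \<sigma>)
  then have "integrable lborel (\<lambda>y::real. exp (- c * y\<^sup>2))"
    using \<sigma> by (simp add: normal_density_def)
  then have fin: "(\<integral>\<^sup>+y. ennreal (exp (- c * y\<^sup>2)) \<partial>lborel) < \<infinity>"
    by (simp add: nn_integral_eq_integral)
  have "(\<integral>\<^sup>+x. ennreal (norm (exp (- c * (x \<bullet> x)))) \<partial>(lborel :: (real^3) measure))
      = (\<integral>\<^sup>+x. (\<Prod>b\<in>Basis. ennreal (exp (- c * (x \<bullet> b)\<^sup>2))) \<partial>(lborel :: (real^3) measure))"
  proof (rule nn_integral_cong)
    fix x :: "real^3"
    have "- c * (x \<bullet> x) = (\<Sum>b\<in>Basis. - c * (x \<bullet> b)\<^sup>2)"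
      by (subst euclidean_inner) (simp add: sum_distrib_left power2_eq_square)
    then show "ennreal (norm (exp (- c * (x \<bullet> x)))) = (\<Prod>b\<in>Basis. ennreal (exp (- c * (x \<bullet> b)\<^sup>2)))"
      by (simp add: exp_sum prod_ennreal abs_of_nonneg prod_nonneg)
  qed
  also have "\<dots> = (\<Prod>b\<in>(Basis :: (real^3) set). (\<integral>\<^sup>+y. ennreal (exp (- c * y\<^sup>2)) \<partial>lborel))"
    by (rule nn_integral_lborel_prod) auto
  also have "\<dots> < \<infinity>" using fin by (simp add: power_less_top_ennreal)
  finally show "(\<integral>\<^sup>+x. ennreal (norm (exp (- c * (x \<bullet> x)))) \<partial>(lborel :: (real^3) measure)) < \<infinity>" .
qed simp

text \<open>The common majorant, up to constants, of the approximate eigenfunctions and their first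
  two derivatives along \<open>x_3\<close>.\<close>

definition gs :: "real \<Rightarrow> real^3 \<Rightarrow> real" where "gs c x = (1 + x \<bullet> x) * exp (- c * (x \<bullet> x))"

lemma integrable_gs_squared:
  assumes c: "c > 0"
  shows "integrable lborel (\<lambda>x. (gs c x)\<^sup>2)"
proof -
  \<comment> \<open>Makes \<open>1 + s <= K exp (c s / 2)\<close>, so that half of the exponent
    absorbs the polynomial factor.\<close>
  define K where "K = max 1 (2 / c)"
  have le: "(gs c x)\<^sup>2 \<le> K\<^sup>2 * exp (- c * (x \<bullet> x))" for x
  proof -
    define s where "s = x \<bullet> x"
    have s: "s \<ge> 0" by (simp add: s_def)
    have "2 / c * (c * s / 2) \<le> K * (c * s / 2)" using c s by (intro mult_right_mono) (auto simp: K_def)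
    then have "s \<le> K * (c * s / 2)" using c by simp
    moreover have "1 \<le> K" by (simp add: K_def)
    ultimately have "1 + s \<le> K * (1 + c * s / 2)" by (simp add: distrib_left)
    also have "\<dots> \<le> K * exp (c * s / 2)" using exp_ge_add_one_self[of "c * s / 2"] by (intro mult_left_mono) (auto simp: K_def)
    finally have "(1 + s)\<^sup>2 \<le> (K * exp (c * s / 2))\<^sup>2" using s by (intro power_mono) auto
    also have "\<dots> = K\<^sup>2 * exp (c * s)" by (simp add: power_mult_distrib power2_eq_square flip: exp_add)
    finally have "(1 + s)\<^sup>2 * (exp (- c * s))\<^sup>2 \<le> K\<^sup>2 * exp (c * s) * (exp (- c * s))\<^sup>2" by (intro mult_right_mono) auto
    also have "\<dots> = K\<^sup>2 * exp (- c * s)" by (simp add: power2_eq_square mult.assoc flip: exp_add)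
    finally show ?thesis by (simp add: gs_def s_def power_mult_distrib)
  qed
  show ?thesis
  proof (rule Bochner_Integration.integrable_bound[of _ "\<lambda>x. K\<^sup>2 * exp (- c * (x \<bullet> x))"])
    show "integrable lborel (\<lambda>x::real^3. K\<^sup>2 * exp (- c * (x \<bullet> x)))"
      by (intro integrable_mult_right integrable_gaussian c)
    show "(\<lambda>x. (gs c x)\<^sup>2) \<in> borel_measurable lborel" unfolding gs_def by measurable
  qed (use le in \<open>auto intro!: AE_I2\<close>)
qed

lemma gs_L2: "c > 0 \<Longrightarrow> f \<in> borel_measurable borel \<Longrightarrow> (\<And>x. cmod (f x) \<le> K * gs c x) \<Longrightarrow> f \<in> L2"
proof (rule L2_bound[where g = "\<lambda>x. K\<^sup>2 * (gs c x)\<^sup>2"])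
  assume le: "\<And>x. cmod (f x) \<le> K * gs c x"
  have "(cmod (f x))\<^sup>2 \<le> (K * gs c x)\<^sup>2" for x using le by (intro power_mono) auto
  then show "AE x in lborel. (cmod (f x))\<^sup>2 \<le> K\<^sup>2 * (gs c x)\<^sup>2" by (simp add: power_mult_distrib)
qed (auto intro: integrable_gs_squared)

text \<open>The factor \<open>exp 1\<close> normalizes the value at the origin, and thereby the
  pointwise limit for growing radius, to 1.\<close>

definition cutoff :: "nat \<Rightarrow> real^3 \<Rightarrow> complex" where
  "cutoff n x = exp 1 * bump (real (Suc n)) x"

lemma flat_bounded: "\<exists>M\<ge>0. \<forall>t\<le>1. \<bar>flat p t\<bar> \<le> M"
proof -
  have "continuous_on {0..1} (flat p)"
    by (intro continuous_at_imp_continuous_on ballI DERIV_isCont[OF flat_derivative])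
  then have "compact (flat p ` {0..1})" by (intro compact_continuous_image compact_Icc)
  from compact_imp_bounded[OF this] obtain M where "\<forall>y\<in>flat p ` {0..1}. norm y \<le> M"
    unfolding bounded_iff by blast
  then have M: "\<bar>flat p t\<bar> \<le> M" if "t \<in> {0..1}" for t using that by auto
  have "\<bar>flat p t\<bar> \<le> max M 0" if "t \<le> 1" for t
  proof (cases "t > 0")
    case True
    then show ?thesis using M[of t] that by auto
  qed (simp add: flat_def)
  then show ?thesis by (intro exI[of _ "max M 0"]) auto
qed

lemma smooth_cutoff: "smooth (cutoff n)"
  unfolding cutoff_def[abs_def] by (intro smooth_cmult smooth_bump)

lemma cutoff_le: "cmod (cutoff n x) \<le> 1"
proof -
  have "flat 1 t \<le> exp (- 1)" "flat 1 t \<ge> 0" if "t \<le> 1" for t :: real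
    using that by (auto simp: flat_def)
  then have "\<bar>flat 1 (1 - (x \<bullet> x) / (real (Suc n))\<^sup>2)\<bar> \<le> exp (- 1)" by (simp add: abs_of_nonneg)
  then have "exp 1 * \<bar>flat 1 (1 - (x \<bullet> x) / (real (Suc n))\<^sup>2)\<bar> \<le> exp 1 * exp (- 1)" by (intro mult_left_mono) auto
  then show ?thesis by (simp add: cutoff_def bump_def norm_mult flip: exp_add)
qed

text \<open>Scaling: the derivative carries \<open>2 / R^2\<close> times a coordinate, and
  coordinates are at most \<open>R\<close> on the support.\<close>

lemma cutoff_partial:
  obtains M where "M \<ge> 0" "\<And>n j x. cmod (partial j (cutoff n) x) \<le> M / real (Suc n)"
proof -
  obtain M where M: "M \<ge> 0" "\<And>t. t \<le> 1 \<Longrightarrow> \<bar>flat ([:0, 1:] ^ 2 * (1 - pderiv 1)) t\<bar> \<le> M"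
    using flat_bounded by blast
  have "cmod (partial j (cutoff n) x) \<le> (2 * exp 1 * M) / real (Suc n)" for j n x
  proof -
    define R where "R = real (Suc n)"
    have R: "R > 0" by (simp add: R_def)
    define F where "F = flat ([:0, 1:] ^ 2 * (1 - pderiv 1)) (1 - (x \<bullet> x) / R\<^sup>2)"
    have "partial j (cutoff n) = (\<lambda>x. exp 1 * partial j (bump R) x)"
      unfolding cutoff_def[abs_def] R_def[symmetric]
      by (subst partial_mult) (auto simp: partial_const smooth_differentiable smooth_bump)
    then have "cmod (partial j (cutoff n) x) = exp 1 * (2 / R\<^sup>2 * \<bar>x $ j\<bar> * \<bar>F\<bar>)"
      unfolding bump_def[abs_def] partial_flat by (simp add: norm_mult norm_divide norm_power F_def)
    also have "\<dots> \<le> exp 1 * (2 / R * M)"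
    proof (intro mult_left_mono)
      show "2 / R\<^sup>2 * \<bar>x $ j\<bar> * \<bar>F\<bar> \<le> 2 / R * M"
      proof (cases "norm x \<le> R")
        case True
        have "2 / R\<^sup>2 * \<bar>x $ j\<bar> \<le> 2 / R\<^sup>2 * R"
          using True component_le_norm_cart[of x j] by (intro mult_left_mono) auto
        also have "\<dots> = 2 / R" using R by (simp add: power2_eq_square)
        finally show ?thesis using M R by (intro mult_mono) (auto simp: F_def)
      next
        case False
        then have "R\<^sup>2 < (norm x)\<^sup>2" using R by (intro power_strict_mono) auto
        then have "1 - (x \<bullet> x) / R\<^sup>2 < 0" using R by (simp add: power2_norm_eq_inner divide_simps)
        then have "F = 0" by (simp add: F_def flat_def)
        then show ?thesis using R M by simp
      qed
    qed auto
    finally show ?thesis by (simp add: R_def mult_ac)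
  qed
  then show ?thesis using that[of "2 * exp 1 * M"] M by auto
qed

lemma cutoff_tendsto: "(\<lambda>n. cutoff n x) \<longlonglongrightarrow> 1"
proof -
  have l: "(\<lambda>n. 1 - (x \<bullet> x) * (1 / (real (Suc n))\<^sup>2)) \<longlonglongrightarrow> 1 - (x \<bullet> x) * 0"
  proof (intro tendsto_intros)
    show "(\<lambda>n. 1 / (real (Suc n))\<^sup>2) \<longlonglongrightarrow> 0" by real_asymp
  qed
  have "(\<lambda>n. flat 1 (1 - (x \<bullet> x) * (1 / (real (Suc n))\<^sup>2))) \<longlonglongrightarrow> flat 1 1"
    by (rule isCont_tendsto_compose[OF DERIV_isCont[OF flat_derivative]]) (use l in simp)
  then have "(\<lambda>n. exp 1 * complex_of_real (flat 1 (1 - (x \<bullet> x) * (1 / (real (Suc n))\<^sup>2)))) \<longlonglongrightarrow> exp 1 * complex_of_real (flat 1 1)"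
    by (intro tendsto_intros)
  moreover have "exp 1 * complex_of_real (flat 1 1) = 1" by (simp add: flat_def exp_minus exp_of_real[symmetric])
  ultimately show ?thesis by (simp add: cutoff_def bump_def)
qed

lemma test_cutoff: "smooth V \<Longrightarrow> (\<lambda>x. cutoff n x * V x) \<in> test_functions"
proof -
  assume V: "smooth V"
  have "{x. cutoff n x * V x \<noteq> 0} \<subseteq> cball 0 (real (Suc n))"
  proof (intro subsetI, rule ccontr)
    fix x :: "real^3" assume x: "x \<in> {x. cutoff n x * V x \<noteq> 0}" "x \<notin> cball 0 (real (Suc n))"
    then have "(real (Suc n))\<^sup>2 < (norm x)\<^sup>2" by (intro power_strict_mono) auto
    then have "1 - (x \<bullet> x) / (real (Suc n))\<^sup>2 < 0" by (simp add: power2_norm_eq_inner divide_simps del: of_nat_Suc)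
    then have "cutoff n x = 0" by (simp add: cutoff_def bump_def flat_def)
    then show False using x by simp
  qed
  then show ?thesis using V by (auto simp: test_iff smooth_mult smooth_cutoff intro: bounded_subset[OF bounded_cball])
qed

lemma smooth_measurable: "smooth V \<Longrightarrow> V \<in> borel_measurable borel"
  by (intro borel_measurable_continuous_onI smooth_continuous)

lemma cutoff_limit:
  assumes V: "smooth V" and c: "c > 0" and le: "\<And>x. cmod (V x) \<le> K * gs c x" "\<And>x. cmod (partial j V x) \<le> K * gs c x"
  shows "(\<lambda>n. cls (\<lambda>x. cutoff n x * V x)) \<longlonglongrightarrow> cls V"
    and "(\<lambda>n. cls (partial j (\<lambda>x. cutoff n x * V x))) \<longlonglongrightarrow> cls (partial j V)"
proof -
  note [measurable] = smooth_measurable[OF V] smooth_measurable[OF smooth_cutoff]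
    smooth_measurable[OF smooth_partial[OF V]] smooth_measurable[OF smooth_partial[OF smooth_cutoff]]
  have int: "integrable lborel (\<lambda>x. (L * gs c x)\<^sup>2)" for L
    unfolding power_mult_distrib by (intro integrable_mult_right integrable_gs_squared c)
  show "(\<lambda>n. cls (\<lambda>x. cutoff n x * V x)) \<longlonglongrightarrow> cls V"
  proof (rule L2_dominated(3)[OF _ _ int[of K]])
    show "cmod (cutoff n x * V x) \<le> K * gs c x" for n x
    proof -
      have "cmod (cutoff n x) * cmod (V x) \<le> 1 * (K * gs c x)" by (intro mult_mono cutoff_le le) auto
      then show ?thesis by (simp add: norm_mult)
    qed
    have "(\<lambda>n. cutoff n x * V x) \<longlonglongrightarrow> 1 * V x" for x by (intro tendsto_intros cutoff_tendsto)
    then show "AE x in lborel. (\<lambda>n. cutoff n x * V x) \<longlonglongrightarrow> V x" by simp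
  qed auto
  obtain M where M: "M \<ge> 0" "\<And>n j x. cmod (partial j (cutoff n) x) \<le> M / real (Suc n)"
    using cutoff_partial by blast
  have M': "cmod (partial j (cutoff n) x) \<le> M" for n x
    using M(2)[of j n x] M(1) order_trans[of _ "M / real (Suc n)" M] by (simp add: divide_le_eq mult_le_cancel_left1 algebra_simps)
  have e: "partial j (\<lambda>x. cutoff n x * V x) = (\<lambda>x. cutoff n x * partial j V x + partial j (cutoff n) x * V x)" for n
    by (rule partial_mult) (auto simp: smooth_differentiable smooth_cutoff V)
  show "(\<lambda>n. cls (partial j (\<lambda>x. cutoff n x * V x))) \<longlonglongrightarrow> cls (partial j V)"
    unfolding e
  proof (rule L2_dominated(3)[OF _ _ int[of "K + M * K"]])
    fix n x
    have "cmod (cutoff n x * partial j V x + partial j (cutoff n) x * V x)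
        \<le> cmod (cutoff n x) * cmod (partial j V x) + cmod (partial j (cutoff n) x) * cmod (V x)"
      by (rule order_trans[OF norm_triangle_ineq]) (simp add: norm_mult)
    also have "\<dots> \<le> 1 * (K * gs c x) + M * (K * gs c x)"
      using M by (intro add_mono mult_mono cutoff_le le M') auto
    finally show "cmod (cutoff n x * partial j V x + partial j (cutoff n) x * V x) \<le> (K + M * K) * gs c x"
      by (simp add: algebra_simps)
  next
    have "(\<lambda>n. cutoff n x * partial j V x + partial j (cutoff n) x * V x) \<longlonglongrightarrow> 1 * partial j V x + 0 * V x" for x
    proof (intro tendsto_intros cutoff_tendsto)
      have "(\<lambda>n. M / real (Suc n)) \<longlonglongrightarrow> 0" by real_asymp
      then show "(\<lambda>n. partial j (cutoff n) x) \<longlonglongrightarrow> 0"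
        by (rule Lim_null_comparison[rotated]) (use M in auto)
    qed
    then show "AE x in lborel. (\<lambda>n. cutoff n x * partial j V x + partial j (cutoff n) x * V x) \<longlonglongrightarrow> partial j V x" by simp
  qed auto
qed

lemma cutoff_partial_limit:
  assumes V: "smooth V" and c: "c > 0" and le: "\<And>x. cmod (V x) \<le> K * gs c x"
  shows "(\<lambda>n. cls (\<lambda>x. partial j (cutoff n) x * V x)) \<longlonglongrightarrow> 0"
    and "(\<lambda>x. partial j (cutoff n) x * V x) \<in> L2"
proof -
  note [measurable] = smooth_measurable[OF V] smooth_measurable[OF smooth_partial[OF smooth_cutoff]]
  obtain M where M: "M \<ge> 0" "\<And>n j x. cmod (partial j (cutoff n) x) \<le> M / real (Suc n)"
    using cutoff_partial by blast
  have M': "cmod (partial j (cutoff n) x) \<le> M" for n x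
    using M(2)[of j n x] M(1) order_trans[of _ "M / real (Suc n)" M] by (simp add: divide_le_eq mult_le_cancel_left1 algebra_simps)
  have int: "integrable lborel (\<lambda>x. (M * K * gs c x)\<^sup>2)"
    unfolding power_mult_distrib by (intro integrable_mult_right integrable_gs_squared c)
  have a: "cmod (partial j (cutoff n) x * V x) \<le> M * K * gs c x" for n x
  proof -
    have "cmod (partial j (cutoff n) x) * cmod (V x) \<le> M * (K * gs c x)" using M(1) by (intro mult_mono M' le) auto
    then show ?thesis by (simp add: norm_mult mult.assoc)
  qed
  have "(\<lambda>n. partial j (cutoff n) x * V x) \<longlonglongrightarrow> 0 * V x" for x
  proof (intro tendsto_intros)
    have "(\<lambda>n. M / real (Suc n)) \<longlonglongrightarrow> 0" by real_asymp
    then show "(\<lambda>n. partial j (cutoff n) x) \<longlonglongrightarrow> 0"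
      by (rule Lim_null_comparison[rotated]) (use M in auto)
  qed
  then have b: "AE x in lborel. (\<lambda>n. partial j (cutoff n) x * V x) \<longlonglongrightarrow> 0" by simp
  show "(\<lambda>n. cls (\<lambda>x. partial j (cutoff n) x * V x)) \<longlonglongrightarrow> 0"
    using L2_dominated(3)[OF _ _ int a b] by (simp add: cls_zero)
  show "(\<lambda>x. partial j (cutoff n) x * V x) \<in> L2"
    using L2_dominated(1)[OF _ _ int a b] by simp
qed

text \<open>Rescaling \<open>x_3\<close> alone reduces Gaussians of all widths \<open>1 / s\<close>
  to one fixed profile.\<close>

lemma nn_integral_stretch3:
  fixes f :: "real^3 \<Rightarrow> ennreal"
  assumes s: "s > 0" and [measurable]: "f \<in> borel_measurable borel"
  shows "(\<integral>\<^sup>+x. f x \<partial>lborel) = ennreal (1 / s) * (\<integral>\<^sup>+x. f (\<chi> i. if i = 3 then x $ i / s else x $ i) \<partial>lborel)"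
proof -
  define c :: "real^3 \<Rightarrow> real" where "c = (\<lambda>j. if j = axis 3 1 then 1 / s else 1)"
  define T :: "real^3 \<Rightarrow> real^3" where "T = (\<lambda>x. 0 + (\<Sum>j\<in>Basis. (c j * (x \<bullet> j)) *\<^sub>R j))"
  have B: "(Basis :: (real^3) set) = (\<lambda>i. axis i 1) ` UNIV" by (auto simp: Basis_vec_def)
  have inj: "inj (\<lambda>i::3. axis i (1::real))" by (auto simp: inj_on_def axis_eq_axis)
  have cax: "c (axis j 1) = (if j = 3 then 1 / s else 1)" for j by (simp add: c_def axis_eq_axis)
  have T: "T x = (\<chi> i. if i = 3 then x $ i / s else x $ i)" for x
    by (simp add: T_def B sum.reindex[OF inj] inner_axis cax vec_eq_iff forall_3 sum_3) (simp add: axis_def)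
  have P: "(\<Prod>j\<in>Basis. \<bar>c j\<bar>) = 1 / s"
    using s by (simp add: B prod.reindex[OF inj] c_def axis_eq_axis)
  have [measurable]: "T \<in> borel_measurable borel" unfolding T_def by measurable
  have "(\<integral>\<^sup>+x. f x \<partial>lborel) = (\<integral>\<^sup>+x. f x \<partial>density (distr lborel borel T) (\<lambda>_. ennreal (1 / s)))"
    using lborel_affine_euclidean[of c 0] s unfolding P T_def by (simp add: c_def)
  also have "\<dots> = ennreal (1 / s) * (\<integral>\<^sup>+x. f (T x) \<partial>lborel)"
    by (simp add: nn_integral_density nn_integral_cmult nn_integral_distr)
  finally show ?thesis by (simp add: T)
qed

section \<open>Wave packets in the lowest Landau level\<close>

context magnetic
begin

text \<open>The Gaussian ground state in the plane times a plane wave of momentum \<kappa> along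
  \<open>x_3\<close>, under an envelope of width \<open>1 / s\<close>.\<close>

definition gauss :: "real \<Rightarrow> real \<Rightarrow> wavefn" where
  "gauss s \<kappa> x = exp (of_real (- b / 4) * (of_real (x $ 1) * of_real (x $ 1) + of_real (x $ 2) * of_real (x $ 2))
     + (of_real (- s\<^sup>2 / 2) * (of_real (x $ 3) * of_real (x $ 3)) + (\<i> * of_real \<kappa>) * of_real (x $ 3)))"

lemma smooth_gauss: "smooth (gauss s \<kappa>)"
  and partial_gauss: "partial 1 (gauss s \<kappa>) = (\<lambda>x. of_real (- b / 2 * x $ 1) * gauss s \<kappa> x)"
    "partial 2 (gauss s \<kappa>) = (\<lambda>x. of_real (- b / 2 * x $ 2) * gauss s \<kappa> x)"
    "partial 3 (gauss s \<kappa>) = (\<lambda>x. (\<i> * of_real \<kappa> - of_real (s\<^sup>2) * of_real (x $ 3)) * gauss s \<kappa> x)"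
proof -
  define p :: wavefn where "p = (\<lambda>x. of_real (- b / 4) * (of_real (x $ 1) * of_real (x $ 1) + of_real (x $ 2) * of_real (x $ 2))
     + (of_real (- s\<^sup>2 / 2) * (of_real (x $ 3) * of_real (x $ 3)) + (\<i> * of_real \<kappa>) * of_real (x $ 3)))"
  have g: "gauss s \<kappa> = (\<lambda>x. exp (p x))" by (simp add: gauss_def p_def fun_eq_iff)
  have p: "smooth p" unfolding p_def by (intro smooth_add smooth_mult smooth_const smooth_coord)
  show "smooth (gauss s \<kappa>)" unfolding g by (rule smooth_exp(1)[OF p])
  note sm = smooth_differentiable smooth_add smooth_mult smooth_const smooth_coord
  have "partial j p = (\<lambda>x. of_real (- b / 4) * ((if j = 1 then 2 else 0) * of_real (x $ 1) + (if j = 2 then 2 else 0) * of_real (x $ 2))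
     + (of_real (- s\<^sup>2 / 2) * ((if j = 3 then 2 else 0) * of_real (x $ 3)) + (\<i> * of_real \<kappa>) * (if j = 3 then 1 else 0)))" for j
  proof -
    have "partial j (\<lambda>x. A * (of_real (x $ 1) * of_real (x $ 1) + of_real (x $ 2) * of_real (x $ 2))
       + (B * (of_real (x $ 3) * of_real (x $ 3)) + C * of_real (x $ 3)))
      = (\<lambda>x. A * ((if j = 1 then 2 else 0) * of_real (x $ 1) + (if j = 2 then 2 else 0) * of_real (x $ 2))
       + (B * ((if j = 3 then 2 else 0) * of_real (x $ 3)) + C * (if j = 3 then 1 else 0)))" for A B C
      by (simp add: partial_add partial_mult partial_const partial_coord sm eq_commute[of _ j])
    then show ?thesis by (simp only: p_def)
  qed
  then show "partial 1 (gauss s \<kappa>) = (\<lambda>x. of_real (- b / 2 * x $ 1) * gauss s \<kappa> x)"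
    "partial 2 (gauss s \<kappa>) = (\<lambda>x. of_real (- b / 2 * x $ 2) * gauss s \<kappa> x)"
    "partial 3 (gauss s \<kappa>) = (\<lambda>x. (\<i> * of_real \<kappa> - of_real (s\<^sup>2) * of_real (x $ 3)) * gauss s \<kappa> x)"
    unfolding g smooth_exp(2)[OF p] by (simp_all add: fun_eq_iff)
qed

lemma partial_partial_gauss: "partial 3 (partial 3 (gauss s \<kappa>))
    = (\<lambda>x. ((\<i> * of_real \<kappa> - of_real (s\<^sup>2) * of_real (x $ 3))\<^sup>2 - of_real (s\<^sup>2)) * gauss s \<kappa> x)"
proof -
  have "smooth (\<lambda>x. \<i> * of_real \<kappa> + of_real (- s\<^sup>2) * of_real (x $ 3))"
    by (intro smooth_add smooth_mult smooth_const smooth_coord)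
  moreover have "partial 3 (\<lambda>x. \<i> * of_real \<kappa> + of_real (- s\<^sup>2) * of_real (x $ 3)) = (\<lambda>x. - of_real (s\<^sup>2))"
  proof -
    have "partial 3 (\<lambda>x. A + B * of_real (x $ 3)) = (\<lambda>x. B)" for A B
      by (simp add: partial_add partial_mult partial_const partial_coord smooth_differentiable smooth_const smooth_coord smooth_mult)
    then show ?thesis by (simp only: of_real_minus)
  qed
  ultimately show ?thesis
    using partial_mult[of "\<lambda>x::real^3. \<i> * of_real \<kappa> + of_real (- s\<^sup>2) * of_real (x $ 3)" "gauss s \<kappa>" 3]
    unfolding partial_gauss(3) by (simp add: smooth_differentiable smooth_gauss partial_gauss(3))
      (simp add: fun_eq_iff algebra_simps power2_eq_square)
qed

lemma cmod_gauss: "cmod (gauss s \<kappa> x) = exp (- b / 4 * ((x $ 1)\<^sup>2 + (x $ 2)\<^sup>2) - s\<^sup>2 / 2 * (x $ 3)\<^sup>2)"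
  by (simp add: gauss_def norm_exp_eq_Re power2_eq_square)

lemma gauss_le:
  fixes x :: "real^3"
  assumes c: "c \<le> b / 4" "c \<le> s\<^sup>2 / 2" and K: "cmod h \<le> K * (1 + (x $ 3)\<^sup>2)" "K \<ge> 0"
  shows "cmod (h * gauss s \<kappa> x) \<le> K * gs c x"
proof -
  have xx: "x \<bullet> x = (x $ 1)\<^sup>2 + (x $ 2)\<^sup>2 + (x $ 3)\<^sup>2" by (simp add: inner_vec_def sum_3 power2_eq_square)
  have "cmod h * cmod (gauss s \<kappa> x) \<le> (K * (1 + x \<bullet> x)) * exp (- c * (x \<bullet> x))"
  proof (rule mult_mono)
    have "K * (1 + (x $ 3)\<^sup>2) \<le> K * (1 + x \<bullet> x)" using K unfolding xx by (intro mult_left_mono) auto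
    then show "cmod h \<le> K * (1 + x \<bullet> x)" using K by linarith
    have "c * ((x $ 1)\<^sup>2 + (x $ 2)\<^sup>2) \<le> b / 4 * ((x $ 1)\<^sup>2 + (x $ 2)\<^sup>2)" "c * (x $ 3)\<^sup>2 \<le> s\<^sup>2 / 2 * (x $ 3)\<^sup>2"
      using c by (intro mult_right_mono; simp)+
    then show "cmod (gauss s \<kappa> x) \<le> exp (- c * (x \<bullet> x))" unfolding cmod_gauss xx by (simp add: algebra_simps)
  qed (use K in auto)
  then show ?thesis by (simp add: norm_mult gs_def mult.assoc)
qed

lemma gauss_bounds:
  assumes b: "b > 0" and s: "s > 0"
  obtains c K where "c > 0" "\<And>x. cmod (gauss s \<kappa> x) \<le> K * gs c x" "\<And>x. cmod (partial 3 (gauss s \<kappa>) x) \<le> K * gs c x"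
    "\<And>x. cmod (partial 3 (partial 3 (gauss s \<kappa>)) x) \<le> K * gs c x"
proof -
  define c where "c = min (b / 4) (s\<^sup>2 / 2)"
  define K where "K = 1 + \<bar>\<kappa>\<bar> + \<kappa>\<^sup>2 + s\<^sup>2 + (s\<^sup>2)\<^sup>2"
  have c: "c \<le> b / 4" "c \<le> s\<^sup>2 / 2" "c > 0" using b s by (auto simp: c_def)
  have K: "K \<ge> 0" by (simp add: K_def add_nonneg_nonneg)
  have sq: "\<bar>y\<bar> \<le> 1 + y\<^sup>2" for y :: real
    using zero_le_power2[of "\<bar>y\<bar> - 1/2"] by (simp add: power2_eq_square algebra_simps)
  have e: "(cmod (\<i> * of_real \<kappa> - of_real (s\<^sup>2) * of_real y))\<^sup>2 = \<kappa>\<^sup>2 + (s\<^sup>2)\<^sup>2 * y\<^sup>2" for y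
    by (simp add: cmod_power2 power_mult_distrib)
  have 1: "cmod (1::complex) \<le> K * (1 + y\<^sup>2)" for y
    using mult_mono[of 1 K 1 "1 + y\<^sup>2"] by (simp add: K_def)
  have 2: "cmod (\<i> * of_real \<kappa> - of_real (s\<^sup>2) * of_real y) \<le> K * (1 + y\<^sup>2)" for y
  proof -
    have "cmod (\<i> * of_real \<kappa> - of_real (s\<^sup>2) * of_real y) \<le> \<bar>\<kappa>\<bar> + s\<^sup>2 * \<bar>y\<bar>"
      by (rule order_trans[OF norm_triangle_ineq4]) (simp add: norm_mult norm_power)
    also have "\<dots> \<le> \<bar>\<kappa>\<bar> * (1 + y\<^sup>2) + s\<^sup>2 * (1 + y\<^sup>2)"
      using mult_left_mono[OF sq, of "s\<^sup>2" y] mult_left_mono[of 1 "1 + y\<^sup>2" "\<bar>\<kappa>\<bar>"] by simp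
    also have "\<dots> \<le> K * (1 + y\<^sup>2)" unfolding distrib_right[symmetric] K_def by (intro mult_right_mono) auto
    finally show ?thesis .
  qed
  have 3: "cmod ((\<i> * of_real \<kappa> - of_real (s\<^sup>2) * of_real y)\<^sup>2 - of_real (s\<^sup>2)) \<le> K * (1 + y\<^sup>2)" for y
  proof -
    have "cmod ((\<i> * of_real \<kappa> - of_real (s\<^sup>2) * of_real y)\<^sup>2 - of_real (s\<^sup>2)) \<le> \<kappa>\<^sup>2 + (s\<^sup>2)\<^sup>2 * y\<^sup>2 + s\<^sup>2"
      by (rule order_trans[OF norm_triangle_ineq4]) (simp only: norm_power e norm_of_real abs_power2 order_refl)
    also have "\<dots> \<le> (\<kappa>\<^sup>2 + (s\<^sup>2)\<^sup>2 + s\<^sup>2) * (1 + y\<^sup>2)" by (simp add: algebra_simps)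
    also have "\<dots> \<le> K * (1 + y\<^sup>2)" unfolding K_def by (intro mult_right_mono) auto
    finally show ?thesis .
  qed
  show ?thesis
  proof (rule that[OF c(3)])
    show "cmod (gauss s \<kappa> x) \<le> K * gs c x" for x using gauss_le[OF c(1,2) 1[of "x $ 3"] K] by simp
    show "cmod (partial 3 (gauss s \<kappa>) x) \<le> K * gs c x" for x unfolding partial_gauss by (rule gauss_le[OF c(1,2) 2 K])
    show "cmod (partial 3 (partial 3 (gauss s \<kappa>)) x) \<le> K * gs c x" for x
      unfolding partial_partial_gauss by (rule gauss_le[OF c(1,2) 3 K])
  qed
qed

text \<open>Only derivatives of the cutoff remain: \<open>gauss\<close> is in the lowest Landau level.\<close>

lemma a_cutoff_gauss:
  "a (\<lambda>x. cutoff n x * gauss s \<kappa> x)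
    = (\<lambda>x. - \<i> * (partial 1 (cutoff n) x * gauss s \<kappa> x) + partial 2 (cutoff n) x * gauss s \<kappa> x)"
  by (simp add: a_def D_def A_simps partial_mult smooth_differentiable smooth_cutoff smooth_gauss partial_gauss fun_eq_iff algebra_simps)

text \<open>The cutoff functions converge in the form sense, and their \<open>a\<close>-components
  tend to 0. The weak equation then reduces to integration by parts along \<open>x_3\<close>, which
  is done against test functions and extended to \<open>Gm\<close> by limits.\<close>

lemma gauss_H0:
  assumes b: "b > 0" and s: "s > 0"
  shows "(gauss s \<kappa>, \<lambda>x. - partial 3 (partial 3 (gauss s \<kappa>)) x) \<in> H0 b"
proof -
  let ?U = "gauss s \<kappa>" and ?U' = "partial 3 (gauss s \<kappa>)" and ?U'' = "partial 3 (partial 3 (gauss s \<kappa>))"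
  obtain c K where c: "c > 0" and le: "\<And>x. cmod (?U x) \<le> K * gs c x" "\<And>x. cmod (?U' x) \<le> K * gs c x" "\<And>x. cmod (?U'' x) \<le> K * gs c x"
    using gauss_bounds[OF b s] by blast
  have sm: "smooth ?U" "smooth ?U'" "smooth ?U''" by (intro smooth_gauss smooth_partial)+
  have L: "?U \<in> L2" "?U' \<in> L2" "?U'' \<in> L2"
    using gs_L2[OF c smooth_measurable] sm le by blast+
  have G: "(cls ?U, 0, cls ?U') \<in> Gm"
  proof (rule Gm_limit)
    show "(\<lambda>x. cutoff n x * ?U x) \<in> test_functions" for n by (rule test_cutoff[OF sm(1)])
    show "(\<lambda>n. cls (\<lambda>x. cutoff n x * ?U x)) \<longlonglongrightarrow> cls ?U" "(\<lambda>n. cls (partial 3 (\<lambda>x. cutoff n x * ?U x))) \<longlonglongrightarrow> cls ?U'"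
      using cutoff_limit[OF sm(1) c le(1,2)] by auto
    have e: "cls (a (\<lambda>x. cutoff n x * ?U x))
      = cscale (- \<i>) (cls (\<lambda>x. partial 1 (cutoff n) x * ?U x)) + cls (\<lambda>x. partial 2 (cutoff n) x * ?U x)" for n
      unfolding a_cutoff_gauss using cutoff_partial_limit(2)[OF sm(1) c le(1)]
      by (subst cls_cscale, simp, subst cls_add) (simp_all add: L2_scale L2_uminus)
    have "(\<lambda>n. cscale (- \<i>) (cls (\<lambda>x. partial 1 (cutoff n) x * ?U x)) + cls (\<lambda>x. partial 2 (cutoff n) x * ?U x)) \<longlonglongrightarrow> cscale (- \<i>) 0 + 0"
      by (intro tendsto_add bounded_linear.tendsto[OF bounded_linear_cscale] cutoff_partial_limit(1)[OF sm(1) c le(1)])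
    then show "(\<lambda>n. cls (a (\<lambda>x. cutoff n x * ?U x))) \<longlonglongrightarrow> 0"
      unfolding e by (simp add: bounded_bilinear.zero_right[OF bounded_bilinear_cscale])
  qed
  have ibp: "inner (cls ?U') (cls (partial 3 \<phi>)) = - inner (cls ?U'') (cls \<phi>)" if \<phi>: "\<phi> \<in> test_functions" for \<phi>
  proof (rule LIMSEQ_unique)
    show "(\<lambda>n. inner (cls (\<lambda>x. cutoff n x * ?U' x)) (cls (partial 3 \<phi>))) \<longlonglongrightarrow> inner (cls ?U') (cls (partial 3 \<phi>))"
      by (intro tendsto_inner tendsto_const cutoff_limit(1)[OF sm(2) c le(2,3)])
    have "inner (cls (\<lambda>x. cutoff n x * ?U' x)) (cls (partial 3 \<phi>)) = - inner (cls (partial 3 (\<lambda>x. cutoff n x * ?U' x))) (cls \<phi>)" for n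
      using integration_by_parts[OF test_cutoff[OF sm(2)] \<phi>] by simp
    then show "(\<lambda>n. inner (cls (\<lambda>x. cutoff n x * ?U' x)) (cls (partial 3 \<phi>))) \<longlonglongrightarrow> - inner (cls ?U'') (cls \<phi>)"
      by (simp only:) (intro tendsto_minus tendsto_inner tendsto_const cutoff_limit(2)[OF sm(2) c le(2,3)])
  qed
  have "inner 0 p' + inner (cls ?U') q' = inner (cls (\<lambda>x. - ?U'' x)) w" if wpq: "(w, p', q') \<in> Gm" for w p' q'
  proof -
    obtain t where t: "\<And>n. t n \<in> test_functions" "(\<lambda>n. cls (t n)) \<longlonglongrightarrow> w" "(\<lambda>n. cls (partial 3 (t n))) \<longlonglongrightarrow> q'"
      using Gm_sequence[OF wpq] by metis
    have "(\<lambda>n. inner (cls ?U') (cls (partial 3 (t n)))) \<longlonglongrightarrow> inner (cls ?U') q'" by (intro tendsto_inner tendsto_const t)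
    moreover have "(\<lambda>n. inner (cls ?U') (cls (partial 3 (t n)))) \<longlonglongrightarrow> - inner (cls ?U'') w"
      unfolding ibp[OF t(1)] by (intro tendsto_minus tendsto_inner tendsto_const t)
    ultimately have "inner (cls ?U') q' = - inner (cls ?U'') w" by (rule LIMSEQ_unique)
    then show ?thesis by (simp add: L flip: cls_uminus)
  qed
  then show ?thesis unfolding H0_iff using L G by (intro conjI exI[of _ 0] exI[of _ "cls ?U'"]) (auto simp: L2_uminus)
qed

lemma H0_shift3:
  assumes "(u, f) \<in> H0 b"
  shows "((\<lambda>x. u (x + t *\<^sub>R axis 3 1)), (\<lambda>x. f (x + t *\<^sub>R axis 3 1))) \<in> H0 b"
proof -
  obtain p q where u: "u \<in> L2" "f \<in> L2" "(cls u, p, q) \<in> Gm"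
    and eq: "\<And>w p' q'. (w, p', q') \<in> Gm \<Longrightarrow> inner p p' + inner q q' = inner (cls f) w"
    using assms unfolding H0_iff by fast
  have "inner (translate3 t p) p' + inner (translate3 t q) q' = inner (translate3 t (cls f)) w" if "(w, p', q') \<in> Gm" for w p' q'
    using eq[OF Gm_shift3[OF that, of "- t"]] by (simp add: inner_shift)
  then show ?thesis unfolding H0_iff
    using u Gm_shift3[OF u(3), of t]
    by (intro conjI exI[of _ "translate3 t p"] exI[of _ "translate3 t q"]) (auto simp: cls_shift L2_shift)
qed

text \<open>In the variable \<open>s x\<^sub>3\<close> the residual is of order \<open>s\<close> relative to the function itself.\<close>

lemma gauss_residual:
  assumes b: "b > 0" and e: "e > 0"
  obtains s where "s > 0" "norm (cls (gauss s \<kappa>)) > 0"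
    "norm (cls (\<lambda>x. - partial 3 (partial 3 (gauss s \<kappa>)) x - of_real (\<kappa>\<^sup>2) * gauss s \<kappa> x)) \<le> e * norm (cls (gauss s \<kappa>))"
proof -
  define G where "G x = exp (- b / 4 * ((x $ 1)\<^sup>2 + (x $ 2)\<^sup>2) - (x $ 3)\<^sup>2 / 2)" for x :: "real^3"
  define M0 M1 where "M0 = (\<integral>\<^sup>+x. ennreal ((G x)\<^sup>2) \<partial>lborel)" and "M1 = (\<integral>\<^sup>+x. ennreal (((1 + (x $ 3)\<^sup>2) * G x)\<^sup>2) \<partial>lborel)"
  have [measurable]: "G \<in> borel_measurable borel" unfolding G_def by measurable
  define N where "N = max 1 (1 + \<bar>\<kappa>\<bar>)"
  \<comment> \<open>The leading term \<open>\<kappa>^2\<close> cancels. Every remaining term carries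
    \<open>s^2\<close>, and after replacing \<open>x_3\<close> by \<open>x_3 / s\<close> at least
    one factor \<open>s\<close> survives.\<close>
  have res: "- partial 3 (partial 3 (gauss s \<kappa>)) x - of_real (\<kappa>\<^sup>2) * gauss s \<kappa> x
     = (of_real (s\<^sup>2 - (s\<^sup>2)\<^sup>2 * (x $ 3)\<^sup>2) + 2 * \<i> * of_real (\<kappa> * s\<^sup>2 * x $ 3)) * gauss s \<kappa> x" for s x
    unfolding partial_partial_gauss by (simp add: power2_eq_square algebra_simps)
  define R where "R s x = (of_real (s\<^sup>2 - (s\<^sup>2)\<^sup>2 * (x $ 3)\<^sup>2) + 2 * \<i> * of_real (\<kappa> * s\<^sup>2 * x $ 3)) * gauss s \<kappa> x" for s x
  note [measurable] = smooth_measurable[OF smooth_gauss]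
  have [measurable]: "R s \<in> borel_measurable borel" for s unfolding R_def by measurable
  have L: "gauss s \<kappa> \<in> L2" "R s \<in> L2" if s: "s > 0" for s
  proof -
    have H: "(gauss s \<kappa>, \<lambda>x. - partial 3 (partial 3 (gauss s \<kappa>)) x) \<in> H0 b" by (rule gauss_H0[OF b s])
    then show g: "gauss s \<kappa> \<in> L2" by (simp add: H0_iff)
    have "(\<lambda>x. - partial 3 (partial 3 (gauss s \<kappa>)) x) \<in> L2" using H by (simp add: H0_iff)
    from L2_diff[OF this L2_scale[OF g, of "of_real (\<kappa>\<^sup>2)"]] show "R s \<in> L2" unfolding res R_def[abs_def] .
  qed
  have st: "cmod (gauss s \<kappa> (\<chi> i. if i = 3 then x $ i / s else x $ i)) = G x" if "s > 0" for s x
    using that by (simp add: cmod_gauss G_def power_divide)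
  have n0: "ennreal ((norm (cls (gauss s \<kappa>)))\<^sup>2) = ennreal (1 / s) * M0" if s: "s > 0" for s
    unfolding norm_cls_nn[OF L(1)[OF s]] M0_def
    by (subst nn_integral_stretch3[OF s]) (simp_all add: st s)
  have n1: "ennreal ((norm (cls (R s)))\<^sup>2) \<le> ennreal (1 / s) * (ennreal ((s * N)\<^sup>2) * M1)" if s: "s > 0" "s \<le> 1" for s
  proof -
    have "cmod (R s (\<chi> i. if i = 3 then x $ i / s else x $ i)) \<le> s * N * ((1 + (x $ 3)\<^sup>2) * G x)" for x
    proof -
      define t where "t = x $ 3"
      have "cmod (of_real (s\<^sup>2 - s\<^sup>2 * t\<^sup>2) + 2 * \<i> * of_real (\<kappa> * s * t)) \<le> \<bar>s\<^sup>2 - s\<^sup>2 * t\<^sup>2\<bar> + 2 * \<bar>\<kappa> * s * t\<bar>"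
        by (rule order_trans[OF norm_triangle_ineq]) (simp add: norm_mult del: of_real_diff of_real_mult of_real_power)
      also have "\<dots> \<le> (s\<^sup>2 + s\<^sup>2 * t\<^sup>2) + s * \<bar>\<kappa>\<bar> * (2 * \<bar>t\<bar>)"
        using s by (intro add_mono) (auto simp: abs_mult intro: order_trans[OF abs_triangle_ineq4])
      also have "\<dots> \<le> s * (1 + t\<^sup>2) + s * \<bar>\<kappa>\<bar> * (1 + t\<^sup>2)"
      proof (intro add_mono mult_left_mono)
        have "s * s * (1 + t\<^sup>2) \<le> s * 1 * (1 + t\<^sup>2)" using s by (intro mult_right_mono mult_left_mono) auto
        then show "s\<^sup>2 + s\<^sup>2 * t\<^sup>2 \<le> s * (1 + t\<^sup>2)" by (simp add: power2_eq_square algebra_simps)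
        show "2 * \<bar>t\<bar> \<le> 1 + t\<^sup>2" using zero_le_power2[of "\<bar>t\<bar> - 1"] by (simp add: power2_eq_square algebra_simps)
      qed (use s in auto)
      also have "\<dots> = s * N * (1 + t\<^sup>2)" by (simp add: N_def algebra_simps)
      finally have "cmod (of_real (s\<^sup>2 - s\<^sup>2 * t\<^sup>2) + 2 * \<i> * of_real (\<kappa> * s * t)) * G x \<le> s * N * (1 + t\<^sup>2) * G x"
        by (intro mult_right_mono) (auto simp: G_def)
      moreover have "(s\<^sup>2)\<^sup>2 * (t / s)\<^sup>2 = s\<^sup>2 * t\<^sup>2" "\<kappa> * s\<^sup>2 * (t / s) = \<kappa> * s * t"
        using s by (simp_all add: power2_eq_square)
      ultimately show ?thesis using st[OF s(1), of x] unfolding R_def norm_mult by (simp add: t_def mult.assoc)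
    qed
    then have le: "(cmod (R s (\<chi> i. if i = 3 then x $ i / s else x $ i)))\<^sup>2 \<le> (s * N)\<^sup>2 * ((1 + (x $ 3)\<^sup>2) * G x)\<^sup>2" for x
      unfolding power_mult_distrib[symmetric] by (intro power_mono) auto
    have "ennreal ((norm (cls (R s)))\<^sup>2) = ennreal (1 / s) * (\<integral>\<^sup>+x. ennreal ((cmod (R s (\<chi> i. if i = 3 then x $ i / s else x $ i)))\<^sup>2) \<partial>lborel)"
      unfolding norm_cls_nn[OF L(2)[OF s(1)]] by (subst nn_integral_stretch3[OF s(1)]) simp_all
    also have "\<dots> \<le> ennreal (1 / s) * (\<integral>\<^sup>+x. ennreal ((s * N)\<^sup>2) * ennreal (((1 + (x $ 3)\<^sup>2) * G x)\<^sup>2) \<partial>lborel)"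
      using le by (intro mult_left_mono nn_integral_mono) (auto simp flip: ennreal_mult)
    also have "\<dots> = ennreal (1 / s) * (ennreal ((s * N)\<^sup>2) * M1)" unfolding M1_def by (subst nn_integral_cmult) auto
    finally show ?thesis .
  qed
  obtain m0 where m0: "M0 = ennreal m0" "m0 > 0"
  proof -
    have "M0 \<noteq> 0"
    proof
      assume "M0 = 0"
      then have "AE x in lborel. G x = 0" unfolding M0_def by (subst (asm) nn_integral_0_iff_AE) (auto elim!: eventually_mono)
      moreover have "G x \<noteq> 0" for x by (simp add: G_def)
      ultimately have "AE x in (lborel :: (real^3) measure). False" by (auto elim!: eventually_mono)
      then show False using emeasure_lborel_UNIV by (auto simp: AE_iff_null)
    qed
    moreover have "M0 = ennreal ((norm (cls (gauss 1 \<kappa>)))\<^sup>2)" using n0[of 1] by simp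
    ultimately show ?thesis using that[of "(norm (cls (gauss 1 \<kappa>)))\<^sup>2"] by auto
  qed
  obtain m1 where m1: "M1 = ennreal m1" "m1 \<ge> 0"
  proof -
    define c where "c = min (b / 4) (1 / 2)"
    have c: "c > 0" "c \<le> b / 4" "c \<le> 1\<^sup>2 / 2" using b by (auto simp: c_def)
    have "(1 + (x $ 3)\<^sup>2) * G x \<le> gs c x" for x
      using gauss_le[OF c(2,3), of "of_real (1 + (x $ 3)\<^sup>2)" 1 x 0] st[of 1 x]
      by (simp add: norm_mult cmod_gauss G_def del: of_real_add of_real_power)
    then have "M1 \<le> (\<integral>\<^sup>+x. ennreal ((gs c x)\<^sup>2) \<partial>lborel)"
      unfolding M1_def by (intro nn_integral_mono ennreal_leI power_mono) (auto simp: G_def)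
    also have "\<dots> < \<infinity>" by (subst nn_integral_eq_integral[OF integrable_gs_squared[OF c(1)]]) auto
    finally show ?thesis using that[of "enn2real M1"] by simp
  qed
  \<comment> \<open>Chosen for \<open>s N sqrt m1 <= e sqrt m0\<close>; the summand 1 keeps the
    denominator positive, and \<open>s <= 1\<close> is what the residual bound asks for.\<close>
  define s where "s = min 1 (e * sqrt m0 / (N * (1 + sqrt m1)))"
  have N: "N \<ge> 1" by (simp add: N_def)
  have s: "s > 0" "s \<le> 1" using e m0 m1 N by (auto simp: s_def intro!: divide_pos_pos mult_pos_pos add_pos_nonneg)
  have "s * N * sqrt m1 \<le> e * sqrt m0"
  proof -
    have "s * N * sqrt m1 \<le> s * N * (1 + sqrt m1)" using s N by (intro mult_left_mono) auto
    also have "\<dots> \<le> (e * sqrt m0 / (N * (1 + sqrt m1))) * N * (1 + sqrt m1)"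
      using N m1 by (intro mult_right_mono) (auto simp: s_def)
    also have "\<dots> = e * sqrt m0"
    proof -
      have "N \<noteq> 0" "1 + sqrt m1 \<noteq> 0" using N m1 real_sqrt_ge_zero[of m1] by linarith+
      then show ?thesis by simp
    qed
    finally show ?thesis .
  qed
  then have "(s * N * sqrt m1)\<^sup>2 \<le> (e * sqrt m0)\<^sup>2" using s N m1 by (intro power_mono) auto
  then have sN: "(s * N)\<^sup>2 * m1 \<le> e\<^sup>2 * m0" using m0 m1 by (simp add: power_mult_distrib)
  have 0: "(norm (cls (gauss s \<kappa>)))\<^sup>2 = 1 / s * m0"
    using n0[OF s(1)] s m0 by (simp flip: ennreal_mult)
  have "(norm (cls (R s)))\<^sup>2 \<le> 1 / s * ((s * N)\<^sup>2 * m1)"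
    using n1[OF s] s m1 by (simp flip: ennreal_mult)
  also have "\<dots> \<le> 1 / s * (e\<^sup>2 * m0)" using sN s by (intro mult_left_mono) auto
  also have "\<dots> = (e * norm (cls (gauss s \<kappa>)))\<^sup>2" by (simp add: power_mult_distrib 0)
  finally have 1: "norm (cls (R s)) \<le> e * norm (cls (gauss s \<kappa>))" by (rule power2_le_imp_le) (use e in auto)
  have "(norm (cls (gauss s \<kappa>)))\<^sup>2 > 0" unfolding 0 using s m0 by simp
  then have 2: "norm (cls (gauss s \<kappa>)) > 0" by simp
  show ?thesis using that[OF s(1) 2] 1 unfolding res R_def[abs_def] by blast
qed

end

section \<open>The half-line belongs to the spectrum\<close>

context perturbed
begin

text \<open>After undoing the translation, \<open>W\<close> is evaluated far out along
  \<open>x_3\<close>, where its decay makes it tend to 0; \<open>C1\<close> dominates it.\<close>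

lemma W_escapes:
  assumes u: "u \<in> L2"
  shows "(\<lambda>n. norm (cls (\<lambda>x. W x * u (x + real n *\<^sub>R axis 3 1)))) \<longlonglongrightarrow> 0"
proof -
  have [measurable]: "u \<in> borel_measurable borel" using u by auto
  define f where "f n x = (cmod (W (x + (- real n) *\<^sub>R axis 3 1)))\<^sup>2 * (cmod (u x))\<^sup>2" for n x
  have [measurable]: "f n \<in> borel_measurable borel" for n unfolding f_def by measurable
  have e: "(norm (cls (\<lambda>x. W x * u (x + real n *\<^sub>R axis 3 1))))\<^sup>2 = (LINT x|lborel. f n x)" for n
    using integral_lborel_shift[of "\<lambda>x. (cmod (W x * u (x + real n *\<^sub>R axis 3 1)))\<^sup>2" "(- real n) *\<^sub>R axis 3 1"]
    by (simp add: norm_cls_squared[OF WL2[OF L2_shift[OF u]]] f_def norm_mult power_mult_distrib)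
  have "(\<lambda>n. LINT x|lborel. f n x) \<longlonglongrightarrow> (LINT x|(lborel :: (real^3) measure). (0::real))"
  proof (rule integral_dominated_convergence[where w = "\<lambda>x. C1\<^sup>2 * (cmod (u x))\<^sup>2"])
    show "integrable lborel (\<lambda>x. C1\<^sup>2 * (cmod (u x))\<^sup>2)" using u by (simp add: L2_iff)
    show "AE x in lborel. norm (f n x) \<le> C1\<^sup>2 * (cmod (u x))\<^sup>2" for n
      using AE_lborel_shift[OF W_bounded, of "(- real n) *\<^sub>R axis 3 1"]
      by eventually_elim (auto simp: f_def intro!: mult_right_mono power_mono)
    have "AE x in lborel. \<forall>n. cmod (W (x + (- real n) *\<^sub>R axis 3 1)) \<le> C1 * (1 + ((x + (- real n) *\<^sub>R axis 3 1) $ 3)\<^sup>2) powr (- m / 2)"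
      unfolding AE_all_countable by (intro allI AE_lborel_shift[OF W_decay])
    then show "AE x in lborel. (\<lambda>n. f n x) \<longlonglongrightarrow> 0"
    proof eventually_elim
      case (elim x)
      have "filterlim (\<lambda>n. 1 + (x $ 3 - real n)\<^sup>2) at_top sequentially" by real_asymp
      then have "(\<lambda>n. C1 * (1 + (x $ 3 - real n)\<^sup>2) powr (- m / 2)) \<longlonglongrightarrow> C1 * 0"
        using m by (intro tendsto_mult tendsto_const tendsto_neg_powr) auto
      then have "(\<lambda>n. cmod (W (x + (- real n) *\<^sub>R axis 3 1))) \<longlonglongrightarrow> 0"
        unfolding mult_zero_right by (rule Lim_null_comparison[rotated]) (use elim in \<open>auto simp: axis_def\<close>)
      then have "(\<lambda>n. f n x) \<longlonglongrightarrow> 0\<^sup>2 * (cmod (u x))\<^sup>2" unfolding f_def by (intro tendsto_intros)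
      then show ?case by simp
    qed
  qed auto
  then have "(\<lambda>n. (norm (cls (\<lambda>x. W x * u (x + real n *\<^sub>R axis 3 1))))\<^sup>2) \<longlonglongrightarrow> 0" by (simp add: e)
  from tendsto_real_sqrt[OF this] show ?thesis by simp
qed

text \<open>A Weyl sequence: a wide packet of momentum \<open>sqrt l\<close> solves the free
  equation up to a small error, and translating it far along \<open>x_3\<close> makes the
  perturbation small without changing the free error.\<close>

lemma nonneg_in_spectrum:
  assumes b: "b > 0" and l: "l \<ge> 0"
  shows "of_real l \<in> spectrum H"
proof -
  have "of_real l \<notin> resolvent_set H"
  proof
    assume "of_real l \<in> resolvent_set H"
    then obtain C where "\<forall>(u, g)\<in>H. l2_norm u \<le> C * l2_norm (\<lambda>x. g x - of_real l * u x)"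
      unfolding resolvent_set_def by blast
    then have C: "l2_norm u \<le> max C 1 * l2_norm (\<lambda>x. g x - of_real l * u x)" if "(u, g) \<in> H" for u g
    proof -
      have "l2_norm u \<le> C * l2_norm (\<lambda>x. g x - of_real l * u x)"
        using \<open>\<forall>(u, g)\<in>H. _ u g\<close> that by auto
      also have "\<dots> \<le> max C 1 * l2_norm (\<lambda>x. g x - of_real l * u x)"
        by (intro mult_right_mono) (auto simp: l2_norm_def)
      finally show ?thesis .
    qed
    define C' where "C' = max C 1"
    have C': "C' \<ge> 1" by (simp add: C'_def)
    define \<kappa> where "\<kappa> = sqrt l"
    have \<kappa>: "\<kappa>\<^sup>2 = l" using l by (simp add: \<kappa>_def)
    \<comment> \<open>The free error and the perturbation contribute at most \<open>e\<close> times
      the norm each, so the supposed bound would give \<open>norm U <= norm U / 2\<close>.\<close>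
    define e where "e = 1 / (4 * C')"
    have e: "e > 0" "C' * e = 1 / 4" using C' by (auto simp: e_def)
    obtain s where s: "s > 0" and U0: "norm (cls (gauss s \<kappa>)) > 0"
      and r: "norm (cls (\<lambda>x. - partial 3 (partial 3 (gauss s \<kappa>)) x - of_real l * gauss s \<kappa> x)) \<le> e * norm (cls (gauss s \<kappa>))"
      using gauss_residual[OF b e(1), of \<kappa>] unfolding \<kappa> by blast
    define U f where "U = gauss s \<kappa>" and "f x = - partial 3 (partial 3 U) x" for x
    have H0: "(U, f) \<in> H0 b" using gauss_H0[OF b s] by (simp add: U_def f_def[abs_def])
    then have L: "U \<in> L2" "f \<in> L2" by (auto simp: H0_iff)
    define w where "w = axis (3::3) (1::real)"
    obtain n where n: "norm (cls (\<lambda>x. W x * U (x + real n *\<^sub>R w))) < e * norm (cls U) / \<epsilon>"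
    proof -
      have "e * norm (cls U) / \<epsilon> > 0" using e U0 \<epsilon> by (simp add: U_def)
      from order_tendstoD(2)[OF W_escapes[OF L(1)] this] show ?thesis
        using that by (auto simp: eventually_sequentially w_def)
    qed
    define y where "y = real n *\<^sub>R w"
    have Ly: "(\<lambda>x. U (x + y)) \<in> L2" "(\<lambda>x. f (x + y)) \<in> L2" using L by (auto intro: L2_shift)
    have "((\<lambda>x. U (x + y)), (\<lambda>x. f (x + y) + of_real \<epsilon> * W x * U (x + y))) \<in> H"
      unfolding H_iff using H0_shift3[OF H0, of "real n"] Ly by (simp add: y_def w_def)
    from C[OF this]
    have "norm (cls (\<lambda>x. U (x + y))) \<le> C' * l2_norm (\<lambda>x. f (x + y) + of_real \<epsilon> * W x * U (x + y) - of_real l * U (x + y))"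
      by (simp add: norm_cls Ly C'_def)
    also have "l2_norm (\<lambda>x. f (x + y) + of_real \<epsilon> * W x * U (x + y) - of_real l * U (x + y))
       = norm (cls (\<lambda>x. (f (x + y) - of_real l * U (x + y)) + of_real \<epsilon> * (W x * U (x + y))))"
      by (subst norm_cls) (auto simp: L2_add L2_diff L2_scale WL2 Ly algebra_simps)
    also have "\<dots> = norm (translate y (cls (\<lambda>x. f x - of_real l * U x)) + cscale (of_real \<epsilon>) (cls (\<lambda>x. W x * U (x + y))))"
      using L by (subst cls_shift, simp add: L2_diff L2_scale, subst cls_cscale, simp add: WL2 Ly, subst cls_add)
        (simp_all add: L2_diff L2_scale WL2 Ly)
    also have "\<dots> \<le> e * norm (cls U) + \<epsilon> * (e * norm (cls U) / \<epsilon>)"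
    proof (rule order_trans[OF norm_triangle_ineq], rule add_mono)
      show "norm (translate y (cls (\<lambda>x. f x - of_real l * U x))) \<le> e * norm (cls U)"
        using r by (simp add: U_def f_def)
      show "norm (cscale (of_real \<epsilon>) (cls (\<lambda>x. W x * U (x + y)))) \<le> \<epsilon> * (e * norm (cls U) / \<epsilon>)"
        unfolding norm_cscale using n \<epsilon> by (intro mult_mono) (auto simp: y_def)
    qed
    also have "norm (cls (\<lambda>x. U (x + y))) = norm (cls U)" using L by (simp flip: cls_shift)
    finally have "norm (cls U) \<le> C' * (2 * e * norm (cls U))" using C' \<epsilon> by simp
    also have "\<dots> = norm (cls U) / 2" using e by (simp add: algebra_simps)
    finally show False using U0 by (simp add: U_def)
  qed
  then show ?thesis by (simp add: spectrum_def)
qed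

end

section \<open>Absence of discrete spectrum\<close>

context perturbed
begin

theorem discrete_spectrum_empty:
  assumes b: "b > 0" and C: "C \<ge> 0"
    and est: "\<And>z v p q g \<psi> f. Im z \<noteq> 0 \<Longrightarrow> (v, p, q) \<in> Gm \<Longrightarrow>
      (\<forall>(w, p', q')\<in>Gm. inner p p' + inner q q' = inner (g + cscale z v) w) \<Longrightarrow> g = mulf (weight m) \<psi> + f \<Longrightarrow>
      - inner g v \<le> C * (norm \<psi>)\<^sup>2 + 2 / \<bar>Im z\<bar> * (2 * norm (mulf (weight m) \<psi>) * norm f + (norm f)\<^sup>2)"
    and small: "2 * \<epsilon> * C * C1 \<le> cos \<alpha>"
  shows "discrete_spectrum H = {}"
proof (rule equals0I)
  fix \<mu> assume "\<mu> \<in> discrete_spectrum H"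
  then obtain r where r: "r > 0" and iso: "spectrum H \<inter> cball \<mu> r = {\<mu>}" by (auto simp: discrete_spectrum_def)
  have \<mu>: "\<mu> \<notin> resolvent_set H" using iso by (auto simp: spectrum_def)
  have near: "z \<in> resolvent_set H" if "z \<noteq> \<mu>" "dist z \<mu> \<le> r" for z
  proof (rule ccontr)
    assume "z \<notin> resolvent_set H"
    then have "z \<in> spectrum H \<inter> cball \<mu> r" using that(2) by (simp add: spectrum_def dist_commute)
    then show False using that(1) unfolding iso by simp
  qed
  \<comment> \<open>A bound that is uniform on a disc carries solvability from the neighbouring
    points over to \<mu>, which would then not be spectral.\<close>
  have limit: False if \<rho>: "\<rho> > 0" and bd: "\<And>z u g. dist z \<mu> < \<rho> \<Longrightarrow> (u, g) \<in> H \<Longrightarrow> l2_norm u \<le> K * l2_norm (\<lambda>x. g x - z * u x)" for \<rho> K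
  proof -
    have "\<mu> \<in> resolvent_set H"
    proof (rule resolvent_set_limit[where r = "min r \<rho>" and C = K])
      show "u \<in> L2 \<and> g \<in> L2" if "(u, g) \<in> H" for u g using H_L2[OF that] .
      show "((\<lambda>x. u x - v x), (\<lambda>x. g x - h x)) \<in> H" if "(u, g) \<in> H" "(v, h) \<in> H" for u g v h
        using H_diff[OF that] .
      show "(u, h) \<in> H" if "(u, g) \<in> H" "h \<in> L2" "AE x in lborel. g x = h x" for u g h using H_ae[OF that] .
    qed (use near bd r \<rho> in auto)
    then show False using \<mu> by simp
  qed
  consider "Im \<mu> = 0" "Re \<mu> \<ge> 0" | "Re \<mu> < 0" | "Im \<mu> \<noteq> 0" by linarith
  then show False
  proof cases
    \<comment> \<open>The closed disc also contains \<open>Re \<mu> + r\<close>, another point of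
      the half-line and hence of the spectrum.\<close>
    case 1
    then have "\<mu> = of_real (Re \<mu>)" by (simp add: complex_eq_iff)
    then have "dist (of_real (Re \<mu> + r)) \<mu> = r" using r by (metis add_diff_cancel_left' dist_of_real dist_real_def abs_of_pos)
    then have "of_real (Re \<mu> + r) \<in> resolvent_set H" using r by (intro near) auto
    then show False using nonneg_in_spectrum[OF b, of "Re \<mu> + r"] 1 r by (simp add: spectrum_def)
  next
    case 2
    define c where "c = - Re \<mu> / 2"
    have c: "c > 0" using 2 by (simp add: c_def)
    show False
    proof (rule limit[OF c])
      fix z u g assume z: "dist z \<mu> < c" and H: "(u, g) \<in> H"
      have "Re z \<le> - c" using abs_Re_le_cmod[of "z - \<mu>"] z by (simp add: c_def dist_norm)
      then show "l2_norm u \<le> (1 / c) * l2_norm (\<lambda>x. g x - z * u x)" by (rule negative_bound[OF H _ c])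
    qed
  next
    case 3
    define c where "c = \<bar>Im \<mu>\<bar> / 2"
    have c: "c > 0" using 3 by (simp add: c_def)
    obtain K where K: "\<And>z u g. \<bar>Im z\<bar> \<ge> c \<Longrightarrow> (u, g) \<in> H \<Longrightarrow> l2_norm u \<le> K * l2_norm (\<lambda>x. g x - z * u x)"
    proof -
      have "\<exists>K. \<forall>z u g. \<bar>Im z\<bar> \<ge> c \<longrightarrow> (u, g) \<in> H \<longrightarrow> l2_norm u \<le> K * l2_norm (\<lambda>x. g x - z * u x)"
        by (rule nonreal_bound[OF C _ small c]) (rule est)
      then show ?thesis using that by blast
    qed
    show False
    proof (rule limit[OF c])
      fix z u g assume z: "dist z \<mu> < c" and H: "(u, g) \<in> H"
      have "\<bar>Im z\<bar> \<ge> c" using abs_Im_le_cmod[of "z - \<mu>"] z by (simp add: c_def dist_norm)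
      then show "l2_norm u \<le> K * l2_norm (\<lambda>x. g x - z * u x)" by (rule K[OF _ H])
    qed
  qed
qed

end

section \<open>From the assumption on W to decay in the third variable\<close>

text \<open>\<open>F\<close> is bounded almost everywhere in the plane, and the bound has to be
  pulled back to space. The map \<open>J\<close> carries the product of planar and linear Lebesgue
  measure to that of space, as boxes show, so a planar null set becomes a null cylinder.\<close>

lemma AE_perp:
  assumes AE: "AE y in lborel. P y" and [measurable]: "Measurable.pred borel P"
  shows "AE x in lborel. P (perp x)"
proof -
  define J :: "(real^2) \<times> real \<Rightarrow> real^3" where "J = (\<lambda>(y, t). vector [y $ 1, y $ 2, t])"
  have J: "J z $ 1 = fst z $ 1" "J z $ 2 = fst z $ 2" "J z $ 3 = snd z" for z
    by (simp_all add: J_def split: prod.split)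
  have [measurable]: "J \<in> borel_measurable borel"
  proof (intro borel_measurable_continuous_onI)
    have "J = (\<lambda>z. \<chi> i. if i = 1 then fst z $ 1 else if i = 2 then fst z $ 2 else snd z)"
      by (simp add: fun_eq_iff vec_eq_iff forall_3 J)
    moreover have "continuous_on UNIV (\<lambda>z. \<chi> i. if i = (1::3) then fst z $ (1::2) else if i = 2 then fst z $ 2 else (snd z :: real))"
    proof (rule continuous_on_vec_lambda)
      fix i :: 3
      show "continuous_on UNIV (\<lambda>z. if i = 1 then fst z $ (1::2) else if i = 2 then fst z $ 2 else (snd z :: real))"
        using exhaust_3[of i] by (auto intro!: continuous_intros)
    qed
    ultimately show "continuous_on UNIV J" by simp
  qed
  have Jm [measurable]: "J \<in> borel_measurable (lborel \<Otimes>\<^sub>M lborel)" by (simp add: lborel_prod)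
  have B3: "(Basis :: (real^3) set) = (\<lambda>i. axis i 1) ` UNIV" and B2: "(Basis :: (real^2) set) = (\<lambda>i. axis i 1) ` UNIV"
    by (auto simp: Basis_vec_def)
  have inj: "inj (\<lambda>i. axis i (1::real) :: real^3)" "inj (\<lambda>i. axis i (1::real) :: real^2)" by (auto simp: inj_on_def axis_eq_axis)
  have lb: "lborel = distr (lborel \<Otimes>\<^sub>M lborel) borel J"
  proof (rule lborel_eqI)
    fix l u :: "real^3" assume lu: "\<And>b. b \<in> Basis \<Longrightarrow> l \<bullet> b \<le> u \<bullet> b"
    have le: "l $ i \<le> u $ i" for i using lu[of "axis i 1"] by (simp add: B3 inner_axis)
    have "J -` box l u = box (perp l) (perp u) \<times> box (l $ 3) (u $ 3)"
      by (auto simp: box_def B3 B2 inner_axis forall_3 forall_2 J perp_def)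
    then have "emeasure (distr (lborel \<Otimes>\<^sub>M lborel) borel J) (box l u)
        = emeasure (lborel \<Otimes>\<^sub>M lborel) (box (perp l) (perp u) \<times> box (l $ 3) (u $ 3))"
      using Jm by (subst emeasure_distr) (auto simp: space_pair_measure)
    also have "\<dots> = emeasure lborel (box (perp l) (perp u)) * emeasure lborel (box (l $ 3) (u $ 3))"
      by (rule lborel.emeasure_pair_measure_Times) auto
    also have "\<dots> = ennreal (\<Prod>b\<in>Basis. (perp u - perp l) \<bullet> b) * ennreal (u $ 3 - l $ 3)"
    proof -
      have "perp l $ i \<le> perp u $ i" for i using le exhaust_2[of i] by (auto simp: perp_def)
      then show ?thesis using le by (subst emeasure_lborel_box) (auto simp: B2 inner_axis)
    qed
    also have "\<dots> = ennreal (\<Prod>b\<in>Basis. (u - l) \<bullet> b)"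
    proof -
      have "(\<Prod>b\<in>Basis. (perp u - perp l) \<bullet> b) = (u $ 1 - l $ 1) * (u $ 2 - l $ 2)"
        by (simp only: B2 prod.reindex[OF inj(2)] o_def inner_axis) (simp add: perp_def UNIV_2)
      moreover have "(\<Prod>b\<in>Basis. (u - l) \<bullet> b) = (u $ 1 - l $ 1) * (u $ 2 - l $ 2) * (u $ 3 - l $ 3)"
      proof -
        have "(\<Prod>i\<in>UNIV. f i) = f 1 * f 2 * f 3" for f :: "3 \<Rightarrow> real" unfolding UNIV_3 by (simp add: mult.assoc)
        then show ?thesis by (simp only: B3 prod.reindex[OF inj(1)] o_def inner_axis vector_minus_component inner_real_def mult_1_right)
      qed
      moreover have "(u $ 1 - l $ 1) * (u $ 2 - l $ 2) \<ge> 0" "u $ 3 - l $ 3 \<ge> 0"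
        by (rule mult_nonneg_nonneg; simp only: diff_ge_0_iff_ge le) (simp only: diff_ge_0_iff_ge le)
      ultimately show ?thesis by (metis ennreal_mult)
    qed
    finally show "emeasure (distr (lborel \<Otimes>\<^sub>M lborel) borel J) (box l u) = ennreal (\<Prod>b\<in>Basis. (u - l) \<bullet> b)" .
  qed simp
  have [measurable]: "perp \<in> borel_measurable borel"
  proof (intro borel_measurable_continuous_onI)
    have "perp = (\<lambda>x. \<chi> i. if i = 1 then x $ 1 else x $ 2)" by (simp add: perp_def fun_eq_iff vec_eq_iff forall_2)
    moreover have "continuous_on UNIV (\<lambda>x::real^3. \<chi> i. if i = (1::2) then x $ 1 else x $ 2)"
    proof (rule continuous_on_vec_lambda)
      fix i :: 2
      show "continuous_on UNIV (\<lambda>x::real^3. if i = 1 then x $ 1 else x $ 2)"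
        by (cases "i = 1") (auto intro!: continuous_intros)
    qed
    ultimately show "continuous_on UNIV perp" by (simp only:)
  qed
  have pJ: "perp (J (y, t)) = y" for y t by (simp add: perp_def vec_eq_iff forall_2 J)
  have "AE z in lborel \<Otimes>\<^sub>M lborel. P (perp (J z))"
  proof (rule lborel_pair.AE_pair_measure)
    show "{z \<in> space (lborel \<Otimes>\<^sub>M lborel). P (perp (J z))} \<in> sets (lborel \<Otimes>\<^sub>M lborel)" by measurable
    show "AE y in lborel. AE t in lborel. P (perp (J (y, t)))"
      using AE by eventually_elim (simp add: pJ)
  qed
  then show ?thesis by (subst lb) (simp add: AE_distr_iff)
qed

lemma Linf_AE_bound:
  assumes "f \<in> Linf"
  obtains M where "AE x in lborel. norm (f x) \<le> M" "M \<ge> 0"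
proof -
  have f: "f \<in> borel_measurable lborel" "Linf_norm f < \<infinity>" using assms by (auto simp: Linf_def)
  then obtain M where M: "Linf_norm f \<le> ereal M" by (cases "Linf_norm f") auto
  have "AE x in lborel. ereal (norm (f x)) \<le> Linf_norm f"
    unfolding Linf_norm_def using f(1) by (intro esssup_AE) measurable
  then have "AE x in lborel. norm (f x) \<le> max M 0"
    by eventually_elim (use M in \<open>auto dest: order_trans\<close>)
  then show ?thesis using that[of "max M 0"] by simp
qed

text \<open>\<open>F\<close> enters through its essential bound, pulled back by
  \<open>AE_perp\<close>, and the bracket to the power \<open>- m\<close> is
  \<open>(1 + x_3^2)^(- m / 2)\<close>.\<close>

lemma assumption_A1_decay:
  assumes "assumption_A1 W"
  obtains m C where "m > 3" "C > 0" "AE x in lborel. cmod (W x) \<le> C * (1 + (x $ 3)\<^sup>2) powr (- m / 2)"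
proof -
  obtain F :: "real^2 \<Rightarrow> real" and G :: "real \<Rightarrow> real" and m C0 C2 where F: "F \<in> Linf" "\<And>y. F y > 0" and m: "m > 3"
    and G: "\<And>t. G t > 0" "\<And>t. G t \<le> C0 * japanese_bracket t powr (- m)"
    and W: "AE x in lborel. cmod (W x) \<le> C2 * (F (perp x) * G (x$3))"
    using assms unfolding assumption_A1_def by blast
  obtain M where M: "AE y in lborel. norm (F y) \<le> M" "M \<ge> 0" using Linf_AE_bound[OF F(1)] .
  have [measurable]: "F \<in> borel_measurable borel" using F by (simp add: Linf_def)
  have FM: "AE x in lborel. F (perp x) \<le> M"
  proof (rule AE_perp)
    show "AE y in lborel. F y \<le> M" using M(1) by eventually_elim simp
  qed measurable
  have jb: "japanese_bracket t powr (- m) = (1 + t\<^sup>2) powr (- m / 2)" for t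
  proof -
    have "1 + t\<^sup>2 > 0" by (simp add: add_pos_nonneg)
    then show ?thesis by (simp add: japanese_bracket_def powr_half_sqrt[symmetric] powr_powr)
  qed
  \<comment> \<open>The absolute values cover constants of either sign; the summand 1 makes
    \<open>C\<close> strictly positive.\<close>
  define C where "C = \<bar>C2\<bar> * (M * \<bar>C0\<bar>) + 1"
  have "AE x in lborel. cmod (W x) \<le> C * (1 + (x $ 3)\<^sup>2) powr (- m / 2)"
    using W FM
  proof eventually_elim
    case (elim x)
    let ?w = "(1 + (x $ 3)\<^sup>2) powr (- m / 2)"
    have "G (x $ 3) \<le> \<bar>C0\<bar> * ?w"
      unfolding jb[symmetric] by (rule order_trans[OF G(2)]) (intro mult_right_mono; simp)
    then have "F (perp x) * G (x $ 3) \<le> M * (\<bar>C0\<bar> * ?w)"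
      using elim(2) M(2) G(1)[of "x $ 3"] by (intro mult_mono) auto
    then have "\<bar>C2\<bar> * (F (perp x) * G (x $ 3)) \<le> \<bar>C2\<bar> * (M * (\<bar>C0\<bar> * ?w))" by (intro mult_left_mono) auto
    moreover have "C2 * (F (perp x) * G (x $ 3)) \<le> \<bar>C2\<bar> * (F (perp x) * G (x $ 3))"
      using F(2)[of "perp x"] G(1)[of "x $ 3"] by (intro mult_right_mono) auto
    ultimately have "cmod (W x) \<le> \<bar>C2\<bar> * (M * (\<bar>C0\<bar> * ?w))" using elim(1) by linarith
    also have "\<dots> \<le> C * ?w" by (simp add: C_def algebra_simps)
    finally show ?case .
  qed
  then show ?thesis using that[OF m, of C] M(2) by (simp add: C_def add_nonneg_pos)
qed

theorem corollary2p1: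
  fixes b :: real
  assumes "b > 0"
  shows "\<exists>\<delta>>0. \<forall>(W :: real^3 \<Rightarrow> complex) (V :: real^3 \<Rightarrow> real) (\<alpha> :: real).
    assumption_A1 W \<longrightarrow>
    0 < Linf_norm W \<longrightarrow> Linf_norm W < ereal (2 * b) \<longrightarrow> Linf_norm W < ereal \<delta> \<longrightarrow>
    (\<forall>x. V x \<ge> 0) \<longrightarrow>
    (AE x in lborel. W x = exp (\<i> * of_real \<alpha>) * of_real (V x)) \<longrightarrow>
    \<alpha> \<in> {0<..<pi/2} \<union> {-pi/2<..<0} \<longrightarrow>
    (\<exists>\<epsilon>\<^sub>0>0. \<forall>\<epsilon>. 0 < \<epsilon> \<and> \<epsilon> \<le> \<epsilon>\<^sub>0 \<longrightarrow>
      (\<forall>q::nat. \<not> (of_real (2 * b * real q) islimpt discrete_spectrum (H_eps b W \<epsilon>))))"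
proof (rule exI[of _ 1], intro conjI allI impI)
  fix W :: wavefn and V :: "real^3 \<Rightarrow> real" and \<alpha> :: real
  assume A1: "assumption_A1 W" and V: "\<forall>x. V x \<ge> 0"
    and WV: "AE x in lborel. W x = exp (\<i> * of_real \<alpha>) * of_real (V x)"
    and \<alpha>: "\<alpha> \<in> {0<..<pi/2} \<union> {-pi/2<..<0}"
  interpret magnetic b .
  obtain m C1 where m: "m > 3" and C1: "C1 > 0"
    and decay: "AE x in lborel. cmod (W x) \<le> C1 * (1 + (x $ 3)\<^sup>2) powr (- m / 2)"
    using assumption_A1_decay[OF A1] .
  obtain C where C: "C \<ge> 0" and est: "\<And>z v p q g \<psi> f. Im z \<noteq> 0 \<Longrightarrow> (v, p, q) \<in> Gm \<Longrightarrow>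
      (\<forall>(w, p', q')\<in>Gm. inner p p' + inner q q' = inner (g + cscale z v) w) \<Longrightarrow> g = mulf (weight m) \<psi> + f \<Longrightarrow>
      - inner g v \<le> C * (norm \<psi>)\<^sup>2 + 2 / \<bar>Im z\<bar> * (2 * norm (mulf (weight m) \<psi>) * norm f + (norm f)\<^sup>2)"
    using weighted_resolvent_estimate[OF m] by blast
  have cos: "cos \<alpha> > 0" using \<alpha> by (intro cos_gt_zero_pi) auto
  have [measurable]: "W \<in> borel_measurable borel" using A1 by (simp add: assumption_A1_def Linf_def)
  \<comment> \<open>The phase factor has modulus 1, so the nonnegative \<open>V\<close> is the
    modulus of \<open>W\<close> almost everywhere.\<close>
  have phase: "AE x in lborel. W x = exp (\<i> * of_real \<alpha>) * of_real (cmod (W x))"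
    using WV by eventually_elim (use V in \<open>simp add: norm_mult\<close>)
  \<comment> \<open>Ensures \<open>2 \<epsilon> C C1 <= cos \<alpha>\<close>, the smallness that the
    absorption asks for; the summand 1 keeps the denominator positive even for
    \<open>C = 0\<close>.\<close>
  define \<epsilon>0 where "\<epsilon>0 = cos \<alpha> / (2 * C * C1 + 1)"
  have den: "2 * C * C1 + 1 > 0" using C C1 by (intro add_nonneg_pos) auto
  show "\<exists>\<epsilon>\<^sub>0>0. \<forall>\<epsilon>. 0 < \<epsilon> \<and> \<epsilon> \<le> \<epsilon>\<^sub>0 \<longrightarrow>
      (\<forall>q::nat. \<not> (of_real (2 * b * real q) islimpt discrete_spectrum (H_eps b W \<epsilon>)))"
  proof (intro exI[of _ \<epsilon>0] conjI allI impI)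
    show "\<epsilon>0 > 0" using cos den by (simp add: \<epsilon>0_def)
    fix \<epsilon> and q :: nat assume eps: "0 < \<epsilon> \<and> \<epsilon> \<le> \<epsilon>0"
    interpret perturbed b W \<alpha> m C1 \<epsilon> by unfold_locales (use phase decay m C1 cos eps in auto)
    have "2 * \<epsilon> * C * C1 \<le> \<epsilon> * (2 * C * C1 + 1)" using eps by (simp add: algebra_simps)
    also have "\<dots> \<le> \<epsilon>0 * (2 * C * C1 + 1)" using eps den by (intro mult_right_mono) auto
    also have "\<dots> = cos \<alpha>" using den by (simp add: \<epsilon>0_def)
    finally have "discrete_spectrum (H_eps b W \<epsilon>) = {}"
      by (intro discrete_spectrum_empty[OF assms C est])
    then show "\<not> (of_real (2 * b * real q) islimpt discrete_spectrum (H_eps b W \<epsilon>))" by simp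
  qed
qed simp

end
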